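(* Assume $[\overline B\cup\overline{B'}]\cap\partial D=\emptyset$ and $$T>\min_{x\in\partial D,\,y\in\partial B,\,y'\in\partial B'}\phi(x;y,y').$$ Then there exists $\tau_0>0$ such that for all $\tau\ge\tau_0$ $$I(\tau)=\int_{B}v_g\,dx-\int_{B'}w_f\,dx>0,$$ and $$\lim_{\tau\to\infty}\frac1\tau\log I(\tau)=-\min_{x\in\partial D,\,y\in\partial B,\,y'\in\partial B'}\phi(x;y,y').$$
   Context: Let $D\subset\mathbb R^3$ be a nonempty bounded open set with $C^2$ boundary such that $\mathbb R^3\setminus\overline D$ is connected. Fix $T\in(0,\infty)$. For $f\in L^2(\mathbb R^3)$ with $\mathrm{supp}\,f\cap\overline D=\emptyset$, let $u_f$ be the weak solution of $\partial_t^2u-\Delta u=0$ in $(\mathbb R^3\setminus\overline D)\times(0,T)$, $u(\cdot,0)=0$ and $\partial_tu(\cdot,0)=f$ in $\mathbb R^3\setminus\overline D$, $u=0$ on $\partial D\times(0,T)$ (sound-soft obstacle). For $\tau>0$ set $w_f(x,\tau)=\int_0^Te^{-\tau t}u_f(x,t)\,dt$, $x\in\mathbb R^3\setminus\overline D$. For $h\in L^2(\mathbb R^3)$, $v_h=v_h(\cdot,\tau)\in H^1(\mathbb R^3)$ is the weak solution of $(\Delta-\tau^2)v+h=0$ in $\mathbb R^3$, i.e. $v_h(x)=\frac1{4\pi}\int_{\mathbb R^3}\frac{e^{-\tau|x-y|}}{|x-y|}h(y)\,dy$. $B,B'$ are open balls with centers $p,p'$ and radii $\eta,\eta'$, with $\overline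 B\cap\overline D=\overline{B'}\cap\overline D=\emptyset$; $f=\chi_B$, $g=\chi_{B'}$ (characteristic functions). $\phi(x;y,y')=|y-x|+|x-y'|$. $[F]$ denotes the convex hull of $F\subset\mathbb R^3$. *)

theory Defs
  imports "HOL-Analysis.Analysis"
begin

definition C2_fun :: "('a::euclidean_space \<Rightarrow> real) \<Rightarrow> bool" where
  "C2_fun \<psi> \<longleftrightarrow> (\<exists>(\<psi>' :: 'a \<Rightarrow> ('a \<Rightarrow>\<^sub>L real)) (\<psi>'' :: 'a \<Rightarrow> ('a \<Rightarrow>\<^sub>L ('a \<Rightarrow>\<^sub>L real))).
      (\<forall>z. (\<psi> has_derivative blinfun_apply (\<psi>' z)) (at z)) \<and>
      (\<forall>z. (\<psi>' has_derivative blinfun_apply (\<psi>'' z)) (at z)) \<and>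
      continuous_on UNIV \<psi>'')"

definition C2_boundary :: "(real^3) set \<Rightarrow> bool" where
  "C2_boundary D \<longleftrightarrow> (\<forall>p \<in> frontier D. \<exists>r>0. \<exists>R :: real^3 \<Rightarrow> real^3. \<exists>\<psi> :: real^2 \<Rightarrow> real.
      orthogonal_transformation R \<and> C2_fun \<psi> \<and>
      (\<forall>x \<in> ball p r. x \<in> D \<longleftrightarrow>
          (R (x - p)) $ 3 < \<psi> (vector [(R (x - p)) $ 1, (R (x - p)) $ 2])))"

definition C1c_on :: "((real^3) \<times> real) set \<Rightarrow> ((real^3) \<times> real \<Rightarrow> real)
                        \<Rightarrow> ((real^3) \<times> real \<Rightarrow> (real^3) \<times> real) \<Rightarrow> bool" where
  "C1c_on U \<eta> \<eta>' \<longleftrightarrow> (\<forall>z. (\<eta> has_derivative (\<lambda>h. \<eta>' z \<bullet> h)) (at z)) \<and>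
      continuous_on UNIV \<eta>' \<and>
      compact (closure {z. \<eta> z \<noteq> 0}) \<and> closure {z. \<eta> z \<noteq> 0} \<subseteq> U"

definition H1_on :: "((real^3) \<times> real) set \<Rightarrow> ((real^3) \<times> real \<Rightarrow> real)
                      \<Rightarrow> ((real^3) \<times> real \<Rightarrow> (real^3) \<times> real) \<Rightarrow> bool" where
  "H1_on U u G \<longleftrightarrow> u \<in> borel_measurable lborel \<and> G \<in> borel_measurable lborel \<and>
      set_integrable lborel U (\<lambda>z. (u z)\<^sup>2) \<and>
      set_integrable lborel U (\<lambda>z. (norm (G z))\<^sup>2) \<and>
      (\<forall>\<phi> \<phi>'. C1c_on U \<phi> \<phi>' \<longrightarrow>
         (\<forall>h. (LINT z:U|lborel. u z * (\<phi>' z \<bullet> h)) = - (LINT z:U|lborel. (G z \<bullet> h) * \<phi> z)))"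

text \<open>Weak (generalized, in the sense of Ladyzhenskaya) solution u of
  u_tt - \<Delta>u = 0 in (R^3 \ closure D) x (0,T), u(.,0) = 0, u_t(.,0) = f, u = 0 on \<partial>D x (0,T).
  u is represented as a function on R^3 x R extended by zero for x in closure D and
  for t \<le> 0; the zero boundary condition on \<partial>D x (0,T) and the initial condition u(.,0)=0
  are encoded by requiring this extension to lie in H^1(R^3 x (-\<infinity>,T)).
  The integral identity is required for all C^1 test functions with compact support
  in (R^3 \ closure D) x (-\<infinity>,T) (i.e. vanishing near \<partial>D x [0,T] and near t = T).
  The gradient G z = (\<nabla>_x u, \<partial>_t u).\<close>
definition wave_weak_sol :: "(real^3) set \<Rightarrow> real \<Rightarrow> (real^3 \<Rightarrow> real)
                              \<Rightarrow> ((real^3) \<times> real \<Rightarrow> real) \<Rightarrow> bool" where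
  "wave_weak_sol D T f u \<longleftrightarrow>
     (\<forall>x t. (x \<in> closure D \<or> t \<le> 0) \<longrightarrow> u (x, t) = 0) \<and>
     (\<exists>G. H1_on (UNIV \<times> {..<T}) u G \<and>
        (\<forall>\<eta> \<eta>'. C1c_on ((- closure D) \<times> {..<T}) \<eta> \<eta>' \<longrightarrow>
           (LINT z:((- closure D) \<times> {0<..<T})|lborel.
                 - (snd (G z) * snd (\<eta>' z)) + fst (G z) \<bullet> fst (\<eta>' z))
           = (LINT x:(- closure D)|lborel. f x * \<eta> (x, 0))))"

definition wlap :: "real \<Rightarrow> ((real^3) \<times> real \<Rightarrow> real) \<Rightarrow> real^3 \<Rightarrow> real \<Rightarrow> real" where
  "wlap T u x \<tau> = (LINT t:{0..T}|lborel. exp (- \<tau> * t) * u (x, t))"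

definition vsol :: "(real^3 \<Rightarrow> real) \<Rightarrow> real^3 \<Rightarrow> real \<Rightarrow> real" where
  "vsol h x \<tau> = (1 / (4 * pi)) * (LINT y|lborel. exp (- \<tau> * dist x y) / dist x y * h y)"

definition Ifun :: "real \<Rightarrow> ((real^3) \<times> real \<Rightarrow> real) \<Rightarrow> real^3 \<Rightarrow> real \<Rightarrow> real^3 \<Rightarrow> real \<Rightarrow> real \<Rightarrow> real" where
  "Ifun T u p r p' r' \<tau> = (LINT x:ball p r|lborel. vsol (indicator (ball p' r')) x \<tau>)
                           - (LINT x:ball p' r'|lborel. wlap T u x \<tau>)"

end

theory Submission
  imports Defs "HOL-Real_Asymp.Real_Asymp"
begin

text \<open>
  Let \<open>W\<close> be the Laplace transform of \<open>u\<close>, cut off smoothly in time shortly before \<open>T\<close>. It solves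
  \<open>(\<tau>\<^sup>2 - \<Delta>) W = \<chi>\<^sub>B + F\<close> outside \<open>D\<close> with zero Dirichlet data, where \<open>F\<close> is of order \<open>exp (- \<tau> T1)\<close> for some
  \<open>T1\<close> between the minimal path length \<open>m\<close> and \<open>T\<close>, hence negligible. By symmetry of the Yukawa kernel,
  \<open>I(\<tau>)\<close> is the integral over \<open>B'\<close> of \<open>v - W\<close>, where \<open>v\<close> is the free solution with source \<open>\<chi>\<^sub>B\<close>, up to an error
  of the same order. The difference \<open>v - W\<close> is \<open>(\<tau>\<^sup>2 - \<Delta>)\<close>-harmonic outside \<open>D\<close> and equals \<open>v\<close> on the boundary,
  so it can be compared with barriers by the weak maximum principle. From below: one multiple of a Yukawa
  potential of slightly larger mass \<open>(1 + \<delta>) \<tau>\<close>, centred at a point of \<open>D\<close> near an optimal reflection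
  point. From above: a finite sum of Yukawa potentials centred at the points of a \<open>\<delta>\<close>-net of the
  closure of \<open>D\<close>. Both barriers give the exponent \<open>- m\<close> up to \<open>O(\<delta>)\<close>, which suffices for the logarithmic
  asymptotics.
\<close>

section \<open>Square integrable functions and translations\<close>

text \<open>The comparison has to be run in weak form: \<open>W\<close> is only an
  \<open>H^1\<close> function, and its Dirichlet condition is that it vanishes on the closure of
  \<open>D\<close>. This requires test functions supported off the obstacle that approximate
  \<open>W\<close> in \<open>H^1\<close>, and here the geometry of the boundary enters, as a cone
  condition. Singular kernels are replaced by potentials in the regularised distance
  \<open>sqrt (norm x ^ 2 + e ^ 2)\<close>: these are \<open>C^1\<close> everywhere, at the price
  that the point source is smeared over the whole space with positive density. For the upper barrier
  this sign is welcome. For the lower barrier it is the wrong one, and the larger mass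
  \<open>k\<close> repairs it: away from the centre, the surplus \<open>k^2 - \<tau>^2\<close> times
  the potential beats the smeared source once \<open>e\<close> is small, and the required
  \<open>e\<close> does not depend on \<open>\<tau>\<close>. The free solution is regularised as
  well, but there \<open>e\<close> tends to 0 with \<open>\<tau>\<close> fixed, so convergence
  without a rate is enough. Every loss in an exponent comes from a triangle inequality: both
  barriers replace the path from the source ball to \<open>x\<close> by a detour over their
  centre.\<close>

lemma nn_integral_affine:
  fixes f :: "'a::euclidean_space \<Rightarrow> ennreal"
  assumes [measurable]: "f \<in> borel_measurable borel" and c: "c \<noteq> 0"
  shows "(\<integral>\<^sup>+x. f x \<partial>lborel) = ennreal (\<bar>c\<bar> ^ DIM('a)) * (\<integral>\<^sup>+x. f (t + c *\<^sub>R x) \<partial>lborel)"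
  by (subst lborel_affine[OF c, of t])
     (simp add: nn_integral_density nn_integral_distr nn_integral_cmult)

lemma integrable_affine:
  fixes f :: "'a::euclidean_space \<Rightarrow> 'b::{banach, second_countable_topology}"
  assumes f: "integrable lborel f" and c: "c \<noteq> 0"
  shows "integrable lborel (\<lambda>x. f (t + c *\<^sub>R x))"
proof -
  have [measurable]: "f \<in> borel_measurable borel"
    using borel_measurable_integrable[OF f] by simp
  have "(\<integral>\<^sup>+x. norm (f x) \<partial>lborel) < \<infinity>"
    using f by (simp add: integrable_iff_bounded)
  then have "ennreal (\<bar>c\<bar> ^ DIM('a)) * (\<integral>\<^sup>+x. norm (f (t + c *\<^sub>R x)) \<partial>lborel) < \<infinity>"
    by (subst (asm) nn_integral_affine[OF _ c, of _ t]) auto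
  then show ?thesis
    using c by (auto simp: integrable_iff_bounded ennreal_mult_less_top)
qed

lemma integral_affine:
  fixes f :: "'a::euclidean_space \<Rightarrow> 'b::{banach, second_countable_topology}"
  assumes [measurable]: "f \<in> borel_measurable borel" and c: "c \<noteq> 0"
  shows "(LBINT x. f x) = (\<bar>c\<bar> ^ DIM('a)) *\<^sub>R (LBINT x. f (t + c *\<^sub>R x))"
  by (subst lborel_affine[OF c, of t])
     (simp add: integral_density integral_distr)

lemma integrable_translate:
  fixes f :: "'a::euclidean_space \<Rightarrow> 'b::{banach, second_countable_topology}"
  assumes "integrable lborel f"
  shows "integrable lborel (\<lambda>x. f (x - y))" "integrable lborel (\<lambda>x. f (x + y))"
    "integrable lborel (\<lambda>x. f (y - x))" "integrable lborel (\<lambda>x. f (y + x))"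
  using integrable_affine[OF assms, of 1 "-y"] integrable_affine[OF assms, of 1 "y"]
    integrable_affine[OF assms, of "-1" "y"]
  by (simp_all add: algebra_simps)

lemma nn_integral_translate:
  fixes f :: "'a::euclidean_space \<Rightarrow> ennreal"
  assumes "f \<in> borel_measurable borel"
  shows "(\<integral>\<^sup>+x. f (x - y) \<partial>lborel) = (\<integral>\<^sup>+x. f x \<partial>lborel)"
    "(\<integral>\<^sup>+x. f (y - x) \<partial>lborel) = (\<integral>\<^sup>+x. f x \<partial>lborel)"
  using nn_integral_affine[OF assms, of 1 "-y"] nn_integral_affine[OF assms, of "-1" "y"]
  by simp_all

lemma integral_translate:
  fixes f :: "'a::euclidean_space \<Rightarrow> 'b::{banach, second_countable_topology}"
  assumes "f \<in> borel_measurable borel"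
  shows "(LBINT x. f (x - y)) = (LBINT x. f x)"
    "(LBINT x. f (x + y)) = (LBINT x. f x)"
    "(LBINT x. f (y - x)) = (LBINT x. f x)"
  using integral_affine[OF assms, of 1 "-y"] integral_affine[OF assms, of 1 "y"]
    integral_affine[OF assms, of "-1" "y"]
  by (simp_all add: algebra_simps)

section \<open>Square integrable functions and squared L^2 norms\<close>

definition sq_integrable :: "('a::euclidean_space \<Rightarrow> 'b::euclidean_space) \<Rightarrow> bool" where
  "sq_integrable f \<longleftrightarrow> f \<in> borel_measurable borel \<and> integrable lborel (\<lambda>x. (norm (f x))\<^sup>2)"

text \<open>The norm is kept squared throughout: the triangle inequality then carries factors 2
  (\<open>sqn_add_le\<close>), but no roots appear in limits.\<close>

definition sqn :: "('a::euclidean_space \<Rightarrow> 'b::euclidean_space) \<Rightarrow> real" where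
  "sqn f = (LBINT x. (norm (f x))\<^sup>2)"

lemma sqn_nonneg [simp]: "0 \<le> sqn f"
  by (simp add: sqn_def)

lemma sq_integrable_measurable [measurable_dest]: "sq_integrable f \<Longrightarrow> f \<in> borel_measurable borel"
  by (simp add: sq_integrable_def)

lemma sq_integrableD: "sq_integrable f \<Longrightarrow> integrable lborel (\<lambda>x. (norm (f x))\<^sup>2)"
  by (simp add: sq_integrable_def)

lemma norm_add_sq_le: "(norm (a + b))\<^sup>2 \<le> 2 * (norm a)\<^sup>2 + 2 * (norm (b::'b::real_normed_vector))\<^sup>2"
proof -
  have "(norm (a + b))\<^sup>2 \<le> (norm a + norm b)\<^sup>2"
    by (intro power_mono norm_triangle_ineq) auto
  also have "\<dots> \<le> 2 * (norm a)\<^sup>2 + 2 * (norm b)\<^sup>2"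
    using sum_squares_bound[of "norm a" "norm b"] by (simp add: power2_sum)
  finally show ?thesis .
qed

lemma sq_integrable_bound:
  assumes "f \<in> borel_measurable borel" "integrable lborel g" "\<And>x. (norm (f x))\<^sup>2 \<le> g x"
  shows "sq_integrable f"
  unfolding sq_integrable_def
proof
  show "integrable lborel (\<lambda>x. (norm (f x))\<^sup>2)"
    using assms(1)
    by (intro Bochner_Integration.integrable_bound[OF assms(2)])
       (auto intro!: AE_I2 order_trans[OF assms(3)])
qed fact

lemma sq_integrable_add:
  assumes "sq_integrable f" "sq_integrable g"
  shows "sq_integrable (\<lambda>x. f x + g x)"
proof (rule sq_integrable_bound)
  show "integrable lborel (\<lambda>x. 2 * (norm (f x))\<^sup>2 + 2 * (norm (g x))\<^sup>2)"
    using assms[THEN sq_integrableD] by auto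
  show "(\<lambda>x. f x + g x) \<in> borel_measurable borel"
    using assms by (auto dest!: sq_integrable_measurable)
qed (rule norm_add_sq_le)

lemma sq_integrable_scale:
  assumes "sq_integrable f" "b \<in> borel_measurable borel" "\<And>x. \<bar>b x\<bar> \<le> M"
  shows "sq_integrable (\<lambda>x. b x *\<^sub>R f x)"
proof (rule sq_integrable_bound)
  show "integrable lborel (\<lambda>x. M\<^sup>2 * (norm (f x))\<^sup>2)"
    using assms(1) by (auto dest: sq_integrableD)
  show "(\<lambda>x. b x *\<^sub>R f x) \<in> borel_measurable borel"
    using assms(1,2) by (auto dest!: sq_integrable_measurable)
  fix x
  have "\<bar>b x\<bar>\<^sup>2 \<le> M\<^sup>2"
    using assms(3)[of x] by (intro power_mono) auto
  then show "(norm (b x *\<^sub>R f x))\<^sup>2 \<le> M\<^sup>2 * (norm (f x))\<^sup>2"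
    by (auto simp: power_mult_distrib intro!: mult_right_mono)
qed

lemma sq_integrable_cmult: "sq_integrable f \<Longrightarrow> sq_integrable (\<lambda>x. c *\<^sub>R f x)"
  by (rule sq_integrable_scale[of _ _ "\<bar>c\<bar>"]) auto

lemma sq_integrable_uminus: "sq_integrable f \<Longrightarrow> sq_integrable (\<lambda>x. - f x)"
  using sq_integrable_cmult[of f "-1"] by simp

lemma sq_integrable_diff:
  assumes "sq_integrable f" "sq_integrable g"
  shows "sq_integrable (\<lambda>x. f x - g x)"
  using sq_integrable_add[OF assms(1) sq_integrable_uminus[OF assms(2)]] by simp

lemma sq_integrable_sum:
  "(\<And>i. i \<in> I \<Longrightarrow> sq_integrable (f i)) \<Longrightarrow> sq_integrable (\<lambda>x. \<Sum>i\<in>I. f i x)"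
proof (induction I rule: infinite_finite_induct)
  case (insert i I)
  then show ?case by (auto intro!: sq_integrable_add)
qed (auto simp: sq_integrable_def)

lemma sq_integrable_bounded_support:
  assumes f: "f \<in> borel_measurable borel" and b: "\<And>x. norm (f x) \<le> M"
    and S: "bounded S" "\<And>x. x \<notin> S \<Longrightarrow> f x = 0"
  shows "sq_integrable f"
proof -
  obtain r where r: "S \<subseteq> cball 0 r"
    using S(1) by (metis bounded_iff mem_cball_0 subsetI)
  show ?thesis
  proof (rule sq_integrable_bound[OF f])
    show "integrable lborel (\<lambda>x. M\<^sup>2 * indicator (cball 0 r) x)"
      by (intro integrable_mult_right integrable_real_indicator) (auto simp: emeasure_lborel_cball_finite[unfolded infinity_ennreal_def])
    fix x
    show "(norm (f x))\<^sup>2 \<le> M\<^sup>2 * indicator (cball 0 r) x"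
      using b[of x] S(2)[of x] r by (cases "x \<in> S") (auto simp: indicator_def subset_iff intro!: power_mono)
  qed
qed

lemma integrable_inner:
  assumes "sq_integrable f" "sq_integrable g"
  shows "integrable lborel (\<lambda>x. f x \<bullet> g x)"
proof (rule Bochner_Integration.integrable_bound)
  show "integrable lborel (\<lambda>x. (norm (f x))\<^sup>2 + (norm (g x))\<^sup>2)"
    using assms by (auto dest: sq_integrableD)
  show "(\<lambda>x. f x \<bullet> g x) \<in> borel_measurable lborel"
    using assms by (auto dest!: sq_integrable_measurable)
  show "AE x in lborel. norm (f x \<bullet> g x) \<le> norm ((norm (f x))\<^sup>2 + (norm (g x))\<^sup>2)"
  proof (rule AE_I2)
    fix x
    have "\<bar>f x \<bullet> g x\<bar> \<le> norm (f x) * norm (g x)"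
      by (rule Cauchy_Schwarz_ineq2)
    also have "\<dots> \<le> (norm (f x))\<^sup>2 + (norm (g x))\<^sup>2"
      using sum_squares_bound[of "norm (f x)" "norm (g x)"] mult_nonneg_nonneg[of "norm (f x)" "norm (g x)"]
      by (simp del: mult_nonneg_nonneg)
    finally show "norm (f x \<bullet> g x) \<le> norm ((norm (f x))\<^sup>2 + (norm (g x))\<^sup>2)"
      by simp
  qed
qed

lemma integrable_mult_sq:
  fixes f g :: "'a::euclidean_space \<Rightarrow> real"
  assumes "sq_integrable f" "sq_integrable g"
  shows "integrable lborel (\<lambda>x. f x * g x)"
  using integrable_inner[OF assms] by simp

lemma integrable_scaleR_sq:
  fixes f :: "'a::euclidean_space \<Rightarrow> real" and g :: "'a \<Rightarrow> 'b::euclidean_space"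
  assumes "sq_integrable f" "sq_integrable g"
  shows "integrable lborel (\<lambda>x. f x *\<^sub>R g x)"
proof (rule Bochner_Integration.integrable_bound)
  show "integrable lborel (\<lambda>x. \<bar>f x\<bar> * norm (g x))"
    using assms by (intro integrable_mult_sq) (auto simp: sq_integrable_def)
  show "(\<lambda>x. f x *\<^sub>R g x) \<in> borel_measurable lborel"
    using assms by (auto dest!: sq_integrable_measurable)
qed auto

lemma sqn_add_le:
  assumes "sq_integrable f" "sq_integrable g"
  shows "sqn (\<lambda>x. f x + g x) \<le> 2 * sqn f + 2 * sqn g"
proof -
  have "sqn (\<lambda>x. f x + g x) \<le> (LBINT x. 2 * (norm (f x))\<^sup>2 + 2 * (norm (g x))\<^sup>2)"
    unfolding sqn_def
    using assms[THEN sq_integrableD] sq_integrable_add[OF assms, THEN sq_integrableD]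
    by (intro integral_mono norm_add_sq_le) auto
  also have "\<dots> = 2 * sqn f + 2 * sqn g"
    unfolding sqn_def using assms by (subst Bochner_Integration.integral_add) (auto dest: sq_integrableD)
  finally show ?thesis .
qed

lemma sqn_uminus [simp]: "sqn (\<lambda>x. - f x) = sqn f"
  by (simp add: sqn_def)

lemma sqn_cmult [simp]: "sqn (\<lambda>x. c *\<^sub>R f x) = c\<^sup>2 * sqn f"
  by (simp add: sqn_def power_mult_distrib)

lemma sqn_minus_commute: "sqn (\<lambda>x. f x - g x) = sqn (\<lambda>x. g x - f x)"
  by (simp add: sqn_def norm_minus_commute)

lemma sqn_diff_le:
  assumes "sq_integrable f" "sq_integrable g" "sq_integrable h"
  shows "sqn (\<lambda>x. f x - h x) \<le> 2 * sqn (\<lambda>x. f x - g x) + 2 * sqn (\<lambda>x. g x - h x)"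
  using sqn_add_le[OF sq_integrable_diff[OF assms(1,2)] sq_integrable_diff[OF assms(2,3)]] by simp

lemma ennreal_sqn: "sq_integrable f \<Longrightarrow> ennreal (sqn f) = (\<integral>\<^sup>+x. ennreal ((norm (f x))\<^sup>2) \<partial>lborel)"
  by (simp add: sqn_def nn_integral_eq_integral sq_integrableD)

lemma sq_integrable_translate:
  assumes "sq_integrable f"
  shows "sq_integrable (\<lambda>x. f (x - y))" "sq_integrable (\<lambda>x. f (y - x))"
  using assms integrable_translate[of "\<lambda>x. (norm (f x))\<^sup>2" y]
  by (auto simp: sq_integrable_def)

lemma sqn_translate:
  assumes "sq_integrable f" shows "sqn (\<lambda>x. f (x - y)) = sqn f"
  using assms unfolding sqn_def
  by (intro integral_translate(1)[of "\<lambda>x. (norm (f x))\<^sup>2"]) (auto dest!: sq_integrable_measurable)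

section \<open>The squared L^2 modulus of continuity under translations\<close>

definition tmod :: "('a::euclidean_space \<Rightarrow> 'b::euclidean_space) \<Rightarrow> 'a \<Rightarrow> real" where
  "tmod f y = sqn (\<lambda>x. f (x - y) - f x)"

lemma tmod_le: "sq_integrable f \<Longrightarrow> tmod f y \<le> 4 * sqn f"
  unfolding tmod_def
  using sqn_add_le[of "\<lambda>x. f (x - y)" "\<lambda>x. - f x"]
  by (simp add: sq_integrable_translate sq_integrable_uminus sqn_translate)

lemma tmod_nonneg [simp]: "0 \<le> tmod f y"
  by (simp add: tmod_def)

lemma tmod_add_le:
  assumes "sq_integrable f" "sq_integrable g"
  shows "tmod (\<lambda>x. f x + g x) y \<le> 2 * tmod f y + 2 * tmod g y"
proof -
  have eq: "(\<lambda>x. f (x - y) + g (x - y) - (f x + g x)) = (\<lambda>x. (f (x - y) - f x) + (g (x - y) - g x))"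
    by auto
  show ?thesis
    unfolding tmod_def eq using assms
    by (intro sqn_add_le sq_integrable_diff sq_integrable_translate)
qed

text \<open>Reduces continuity of translation to a dense class. The constant is 8 = 2 * 4, with 2
  from \<open>tmod_add_le\<close> and 4 from the trivial bound \<open>tmod_le\<close>.\<close>

lemma tmod_approx:
  assumes f: "sq_integrable f" and g: "sq_integrable g"
  shows "tmod f y \<le> 8 * sqn (\<lambda>x. f x - g x) + 2 * tmod g y"
proof -
  have "tmod f y = tmod (\<lambda>x. (f x - g x) + g x) y"
    by simp
  also have "\<dots> \<le> 2 * tmod (\<lambda>x. f x - g x) y + 2 * tmod g y"
    by (intro tmod_add_le sq_integrable_diff f g)
  finally show ?thesis
    using tmod_le[OF sq_integrable_diff[OF f g], of y] by simp
qed

text \<open>By regularity, \<open>A\<close> lies between a compact \<open>K\<close> and an open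
  \<open>U\<close> that differ by little measure. A shift smaller than the distance from
  \<open>K\<close> to the complement of \<open>U\<close> changes membership in \<open>A\<close> only
  near that thin difference.\<close>

lemma tmod_indicator_tendsto:
  fixes A :: "'a::euclidean_space set" and v :: "'b::euclidean_space"
  assumes A: "A \<in> sets borel" and fin: "emeasure lborel A < \<infinity>"
  shows "((\<lambda>y. tmod (\<lambda>x. indicator A x *\<^sub>R v) y) \<longlongrightarrow> 0) (at 0)"
proof (rule tendstoI)
  fix e :: real assume e: "e > 0"
  \<comment> \<open>The exceptional set \<open>E\<close> below has measure at most
    \<open>4 * d\<close>; the summand 1 covers \<open>v = 0\<close> and makes the final inequality
    strict.\<close>
  define d where "d = e / (4 * ((norm v)\<^sup>2 + 1))"
  have d: "d > 0" using e by (auto simp: d_def add_nonneg_pos intro!: divide_pos_pos)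
  obtain U where U: "open U" "A \<subseteq> U" "emeasure lborel (U - A) < d"
    using outer_regular_lborel[OF A d] by blast
  have AL: "A \<in> sets lebesgue" using A by (simp add: sets_completionI_sets)
  then obtain K0 where K0: "closed K0" "K0 \<subseteq> A" "emeasure lebesgue (A - K0) < ennreal (d/2)"
    using sets_lebesgue_inner_closed[of A "d/2"] half_gt_zero[OF d] by metis
  have K0b: "K0 \<in> sets borel" using K0 by auto
  have eK0: "emeasure lborel (A - K0) < ennreal (d/2)"
    using K0(3) A K0b by (simp add: emeasure_completion)
  \<comment> \<open>Inner regularity supplies only a closed set \<open>K0\<close>. Cutting it with a
    large ball makes it compact, and continuity from above makes the loss small.\<close>
  have "(\<lambda>n. measure lborel (K0 - cball 0 (real n))) \<longlonglongrightarrow> measure lborel (\<Inter>n. K0 - cball 0 (real n))"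
  proof (rule Lim_measure_decseq)
    show "range (\<lambda>n. K0 - cball 0 (real n)) \<subseteq> sets lborel" using K0b by auto
    show "decseq (\<lambda>n. K0 - cball 0 (real n))" by (auto simp: decseq_def)
    fix i
    have "emeasure lborel (K0 - cball 0 (real i)) \<le> emeasure lborel A"
      using K0 A by (intro emeasure_mono) auto
    then show "emeasure lborel (K0 - cball 0 (real i)) \<noteq> \<infinity>" using fin by (auto simp: less_top[symmetric] top_unique)
  qed
  moreover have "(\<Inter>n. K0 - cball 0 (real n)) = {}"
    using real_arch_simple by (auto simp: set_eq_iff)
  ultimately have "(\<lambda>n. measure lborel (K0 - cball 0 (real n))) \<longlonglongrightarrow> 0"
    by (metis measure_empty)
  then have "eventually (\<lambda>n. measure lborel (K0 - cball 0 (real n)) < d/2) sequentially"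
    using d by (intro order_tendstoD(2)) auto
  then obtain n where n: "measure lborel (K0 - cball 0 (real n)) < d/2"
    by (auto simp: eventually_sequentially)
  define K where "K = K0 \<inter> cball 0 (real n)"
  have K: "compact K" "K \<subseteq> A" using K0 by (auto simp: K_def intro: closed_Int_compact)
  have Kb: "K \<in> sets borel" using K by (auto intro: borel_compact)
  have finK0: "emeasure lborel (K0 - cball 0 (real n)) < \<infinity>"
  proof -
    have "emeasure lborel (K0 - cball 0 (real n)) \<le> emeasure lborel A"
      using K0 A by (intro emeasure_mono) auto
    then show ?thesis using fin by (rule le_less_trans)
  qed
  have eK: "emeasure lborel (A - K) \<le> d"
  proof -
    have "emeasure lborel (A - K) \<le> emeasure lborel ((A - K0) \<union> (K0 - cball 0 (real n)))"
      using A K0b by (intro emeasure_mono) (auto simp: K_def)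
    also have "\<dots> \<le> emeasure lborel (A - K0) + emeasure lborel (K0 - cball 0 (real n))"
      using A K0b by (intro emeasure_subadditive) auto
    also have "\<dots> \<le> ennreal (d/2) + ennreal (d/2)"
      using eK0 n finK0 by (intro add_mono) (auto simp: emeasure_eq_ennreal_measure ennreal_leI)
    also have "\<dots> = d" using d by (simp flip: ennreal_plus)
    finally show ?thesis .
  qed
  obtain \<delta> where \<delta>: "\<delta> > 0" "\<And>x. x \<in> K \<Longrightarrow> ball x \<delta> \<subseteq> U"
    using compact_subset_open_imp_ball_epsilon_subset[OF K(1) U(1)] K(2) U(2)
    by (metis UN_subset_iff order_trans)
  have "tmod (\<lambda>x. indicator A x *\<^sub>R v) y < e" if y: "norm y < \<delta>" for y
  proof -
    let ?f = "\<lambda>x. indicator A x *\<^sub>R v"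
    have sqi: "sq_integrable ?f"
      using A fin by (intro sq_integrable_bound[where g="\<lambda>x. (norm v)\<^sup>2 * indicator A x"]
          integrable_mult_right integrable_real_indicator) (auto simp: indicator_def)
    define N where "N = (U - A) \<union> (A - K)"
    have Nb [measurable]: "N \<in> sets borel" using A Kb U by (auto simp: N_def)
    have eN: "emeasure lborel N \<le> 2 * d"
    proof -
      have "emeasure lborel N \<le> emeasure lborel (U - A) + emeasure lborel (A - K)"
        unfolding N_def using A Kb U by (intro emeasure_subadditive) auto
      also have "\<dots> \<le> ennreal d + d"
        using U(3) eK by (intro add_mono) auto
      also have "\<dots> = 2 * d" using d by (simp flip: ennreal_plus)
      finally show ?thesis .
    qed
    \<comment> \<open>\<open>x\<close> and \<open>x - y\<close> can disagree about \<open>A\<close>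
      only on \<open>E\<close>: a point of \<open>K\<close> moved by less than
      \<open>\<delta>\<close> stays in \<open>U\<close>, so the other point lies in
      \<open>U - A\<close>.\<close>
    define E where "E = N \<union> {x. x - y \<in> N}"
    have tr: "{x. x - y \<in> N} \<in> sets borel"
      by measurable
    have eT: "emeasure lborel {x. x - y \<in> N} = emeasure lborel N"
    proof -
      have "emeasure lborel {x. x - y \<in> N} = (\<integral>\<^sup>+x. indicator N (x - y) \<partial>lborel)"
        using tr by (simp flip: nn_integral_indicator add: indicator_def)
      also have "\<dots> = emeasure lborel N"
        by (subst nn_integral_translate) auto
      finally show ?thesis .
    qed
    have eE: "emeasure lborel E \<le> 4 * d"
    proof -
      have "emeasure lborel E \<le> emeasure lborel N + emeasure lborel {x. x - y \<in> N}"
        unfolding E_def using Nb tr by (intro emeasure_subadditive) auto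
      also have "\<dots> \<le> ennreal (2 * d) + ennreal (2 * d)"
        using eN eT by (intro add_mono) auto
      also have "\<dots> = 4 * d" using d by (simp flip: ennreal_plus)
      finally show ?thesis .
    qed
    have Eb: "E \<in> sets borel" unfolding E_def using Nb tr by auto
    have "ennreal (tmod ?f y) = (\<integral>\<^sup>+x. ennreal ((norm (?f (x - y) - ?f x))\<^sup>2) \<partial>lborel)"
      unfolding tmod_def using sqi by (intro ennreal_sqn sq_integrable_diff sq_integrable_translate)
    also have "\<dots> \<le> (\<integral>\<^sup>+x. ennreal ((norm v)\<^sup>2) * indicator E x \<partial>lborel)"
    proof (rule nn_integral_mono)
      fix x
      have "x \<in> E" if "(x - y \<in> A) \<noteq> (x \<in> A)"
      proof (cases "x \<in> A")
        case True
        then have "x - y \<notin> A" using that by auto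
        show ?thesis
        proof (cases "x \<in> K")
          case True
          then have "x - y \<in> U" using \<delta>(2)[OF True] y by (auto simp: subset_iff dist_norm)
          then show ?thesis using \<open>x - y \<notin> A\<close> by (auto simp: E_def N_def)
        qed (use True in \<open>auto simp: E_def N_def\<close>)
      next
        case False
        then have "x - y \<in> A" using that by auto
        then show ?thesis
        proof (cases "x - y \<in> K")
          case True
          then have "x \<in> U" using \<delta>(2)[OF True] y by (auto simp: subset_iff dist_norm)
          then show ?thesis using False by (auto simp: E_def N_def)
        qed (auto simp: E_def N_def)
      qed
      then show "ennreal ((norm (?f (x - y) - ?f x))\<^sup>2) \<le> ennreal ((norm v)\<^sup>2) * indicator E x"
        by (auto simp: indicator_def)
    qed
    also have "\<dots> = ennreal ((norm v)\<^sup>2) * emeasure lborel E"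
      using Eb by (simp add: nn_integral_cmult_indicator)
    also have "\<dots> \<le> ennreal ((norm v)\<^sup>2) * ennreal (4 * d)"
      using eE by (intro mult_left_mono) auto
    also have "\<dots> = ennreal ((norm v)\<^sup>2 * (4 * d))"
      using d by (simp add: ennreal_mult)
    finally have "tmod ?f y \<le> (norm v)\<^sup>2 * (4 * d)"
      using d by (subst (asm) ennreal_le_iff) auto
    also have "\<dots> < e"
      using e by (simp add: d_def divide_simps add_nonneg_pos)
    finally show ?thesis .
  qed
  then show "\<forall>\<^sub>F y in at 0. dist (tmod (\<lambda>x. indicator A x *\<^sub>R v) y) 0 < e"
    using \<delta>(1) by (auto simp: eventually_at intro!: exI[of _ \<delta>])
qed

text \<open>A simple function is a finite combination of indicators of its level sets. Those of
  nonzero values have finite measure by Chebyshev's inequality, so the indicator case applies to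
  each.\<close>

lemma tmod_simple_tendsto:
  fixes f :: "'a::euclidean_space \<Rightarrow> 'b::euclidean_space"
  assumes s: "simple_function lborel f" and f: "sq_integrable f"
  shows "(tmod f \<longlongrightarrow> 0) (at 0)"
proof -
  define A where "A v = f -` {v}" for v
  have Ab [measurable]: "A v \<in> sets borel" for v
    using simple_functionD(2)[OF s, of "{v}"] by (simp add: A_def)
  have fin: "emeasure lborel (A v) < \<infinity>" if "v \<noteq> 0" for v
  proof -
    have "ennreal ((norm v)\<^sup>2) * emeasure lborel (A v) = (\<integral>\<^sup>+x. ennreal ((norm v)\<^sup>2) * indicator (A v) x \<partial>lborel)"
      by (simp add: nn_integral_cmult_indicator)
    also have "\<dots> \<le> (\<integral>\<^sup>+x. ennreal ((norm (f x))\<^sup>2) \<partial>lborel)"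
      by (intro nn_integral_mono) (auto simp: indicator_def A_def)
    also have "\<dots> < \<infinity>"
      using f by (simp flip: ennreal_sqn)
    finally show ?thesis
      using that by (auto simp: ennreal_mult_less_top)
  qed
  have finR: "finite (range f)"
    using simple_functionD(1)[OF s] by simp
  define I where "I = range f - {0}"
  have I: "finite I" using finR by (simp add: I_def)
  have feq: "f = (\<lambda>x. \<Sum>v\<in>I. indicator (A v) x *\<^sub>R v)"
  proof
    fix x
    have "(\<Sum>v\<in>I. indicator (A v) x *\<^sub>R v) = (\<Sum>v\<in>I. if v = f x then v else 0)"
      by (intro sum.cong) (auto simp: A_def indicator_def)
    also have "\<dots> = f x"
      using I by (auto simp: I_def)
    finally show "f x = (\<Sum>v\<in>I. indicator (A v) x *\<^sub>R v)" by simp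
  qed
  have sqA: "sq_integrable (\<lambda>x. indicator (A v) x *\<^sub>R v)" for v
  proof (cases "v = 0")
    case False
    then show ?thesis
      using fin[of v] by (intro sq_integrable_bound[where g="\<lambda>x. (norm v)\<^sup>2 * indicator (A v) x"]
          integrable_mult_right integrable_real_indicator) (auto simp: indicator_def)
  qed (auto simp: sq_integrable_def)
  have "(tmod (\<lambda>x. \<Sum>v\<in>J. indicator (A v) x *\<^sub>R v) \<longlongrightarrow> 0) (at 0)" if "finite J" "J \<subseteq> I" for J
    using that
  proof (induction J rule: finite_induct)
    case (insert v J)
    have v: "v \<noteq> 0" using insert by (auto simp: I_def)
    have "((\<lambda>y. 2 * tmod (\<lambda>x. indicator (A v) x *\<^sub>R v) y
        + 2 * tmod (\<lambda>x. \<Sum>v\<in>J. indicator (A v) x *\<^sub>R v) y) \<longlongrightarrow> 2 * 0 + 2 * 0) (at 0)"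
      using insert by (intro tendsto_intros tmod_indicator_tendsto fin v) auto
    then show ?case
    proof (rule Lim_null_comparison[rotated, OF tendsto_eq_rhs])
      show "\<forall>\<^sub>F y in at 0. norm (tmod (\<lambda>x. \<Sum>v\<in>insert v J. indicator (A v) x *\<^sub>R v) y)
         \<le> 2 * tmod (\<lambda>x. indicator (A v) x *\<^sub>R v) y
        + 2 * tmod (\<lambda>x. \<Sum>v\<in>J. indicator (A v) x *\<^sub>R v) y"
        unfolding sum.insert[OF insert.hyps] real_norm_def abs_of_nonneg[OF tmod_nonneg]
        by (intro always_eventually allI tmod_add_le sqA sq_integrable_sum)
    qed simp
  qed (simp add: tmod_def[abs_def] sqn_def)
  from this[OF I order_refl] show ?thesis
    by (subst feq)
qed

text \<open>Simple functions bounded by \<open>2 * norm (f x)\<close> converge to \<open>f\<close>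
  pointwise, hence in L^2 by dominated convergence; \<open>tmod_approx\<close> transfers the
  limit.\<close>

lemma tmod_tendsto:
  fixes f :: "'a::euclidean_space \<Rightarrow> 'b::euclidean_space"
  assumes f: "sq_integrable f"
  shows "(tmod f \<longlongrightarrow> 0) (at 0)"
proof (rule tendstoI)
  fix e :: real assume e: "e > 0"
  have fm [measurable]: "f \<in> borel_measurable lborel" using f by (auto dest: sq_integrable_measurable)
  obtain s where s: "\<And>i::nat. simple_function lborel (s i)" "\<And>x. (\<lambda>i. s i x) \<longlonglongrightarrow> f x"
      "\<And>i x. norm (s i x) \<le> 2 * norm (f x)"
    using borel_measurable_implies_sequence_metric[OF fm, of 0] by auto
  have sm [measurable]: "s i \<in> borel_measurable borel" for i
    using borel_measurable_simple_function[OF s(1)[of i]] by simp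
  have sq: "sq_integrable (s i)" for i
  proof (rule sq_integrable_bound)
    show "integrable lborel (\<lambda>x. 4 * (norm (f x))\<^sup>2)" using f by (auto dest: sq_integrableD)
    fix x show "(norm (s i x))\<^sup>2 \<le> 4 * (norm (f x))\<^sup>2"
      using power_mono[OF s(3)[of i x], of 2] by (simp add: power_mult_distrib)
  qed simp
  have "(\<lambda>i. sqn (\<lambda>x. f x - s i x)) \<longlonglongrightarrow> (\<integral>x. 0 \<partial>(lborel :: 'a measure))"
    unfolding sqn_def
  proof (rule integral_dominated_convergence)
    show "integrable lborel (\<lambda>x. 9 * (norm (f x))\<^sup>2)" using f by (auto dest: sq_integrableD)
    show "AE x in lborel. (\<lambda>i. (norm (f x - s i x))\<^sup>2) \<longlonglongrightarrow> 0"
    proof (rule AE_I2)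
      fix x
      have "(\<lambda>i. (norm (f x - s i x))\<^sup>2) \<longlonglongrightarrow> (norm (f x - f x))\<^sup>2"
        by (intro tendsto_intros s)
      then show "(\<lambda>i. (norm (f x - s i x))\<^sup>2) \<longlonglongrightarrow> 0" by simp
    qed
    fix i
    show "AE x in lborel. norm ((norm (f x - s i x))\<^sup>2) \<le> 9 * (norm (f x))\<^sup>2"
    proof (rule AE_I2)
      fix x
      have "norm (f x - s i x) \<le> 3 * norm (f x)"
        using norm_triangle_ineq4[of "f x" "s i x"] s(3)[of i x] by simp
      from power_mono[OF this, of 2] show "norm ((norm (f x - s i x))\<^sup>2) \<le> 9 * (norm (f x))\<^sup>2"
        by (simp add: power_mult_distrib)
    qed
  qed auto
  \<comment> \<open>The thresholds \<open>e / 16\<close> here and \<open>e / 4\<close> below match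
    \<open>tmod_approx\<close>: 8 / 16 + 2 / 4 = 1.\<close>
  then have "eventually (\<lambda>i. sqn (\<lambda>x. f x - s i x) < e / 16) sequentially"
    using e by (intro order_tendstoD(2)) auto
  then obtain i where i: "sqn (\<lambda>x. f x - s i x) < e / 16"
    by (auto simp: eventually_sequentially)
  have "eventually (\<lambda>y. tmod (s i) y < e / 4) (at 0)"
    using tmod_simple_tendsto[OF s(1) sq, of i] e by (intro order_tendstoD(2)) auto
  then show "\<forall>\<^sub>F y in at 0. dist (tmod f y) 0 < e"
  proof eventually_elim
    case (elim y)
    then show ?case using tmod_approx[OF f sq[of i], of y] i by simp
  qed
qed

lemma tmod_measurable:
  fixes f :: "'a::euclidean_space \<Rightarrow> 'b::euclidean_space"
  assumes f: "sq_integrable f"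
  shows "tmod f \<in> borel_measurable borel"
proof -
  have [measurable]: "f \<in> borel_measurable borel" using f by (rule sq_integrable_measurable)
  have "(\<lambda>y. tmod f y) = (\<lambda>y. LBINT x. (\<lambda>(y,x). (norm (f (x - y) - f x))\<^sup>2) (y, x))"
    by (simp add: tmod_def[abs_def] sqn_def)
  also have "\<dots> \<in> borel_measurable borel"
    by simp
  finally show ?thesis .
qed

text \<open>Cauchy-Schwarz for the weight \<open>k\<close>, then Tonelli. Only a bound on
  \<open>norm (g x)\<close> is assumed, so the estimate covers the mollification error as well as
  the Yukawa source, which carries an additional factor 1 / (4 pi).\<close>

lemma sqn_convolution_le:
  fixes f :: "'a::euclidean_space \<Rightarrow> 'b::euclidean_space" and k :: "'a \<Rightarrow> real"
  assumes f: "sq_integrable f" and k: "integrable lborel k" "\<And>y. 0 \<le> k y"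
    and g: "g \<in> borel_measurable borel"
    and gk: "\<And>x. norm (g x) \<le> norm (LBINT y. k y *\<^sub>R (f (x - y) - f x))"
  shows "sq_integrable g" "sqn g \<le> (LBINT y. k y) * (LBINT y. k y * tmod f y)"
proof -
  have [measurable]: "f \<in> borel_measurable borel" "k \<in> borel_measurable borel"
    "tmod f \<in> borel_measurable borel"
    using f k by (auto dest: sq_integrable_measurable borel_measurable_integrable intro: tmod_measurable)
  have ik: "integrable lborel (\<lambda>y. k y * tmod f y)"
  proof (rule Bochner_Integration.integrable_bound)
    show "integrable lborel (\<lambda>y. k y * (4 * sqn f))" using k by auto
  qed (auto intro!: AE_I2 mult_left_mono tmod_le[OF f] simp: k)
  have pt: "ennreal ((norm (g x))\<^sup>2) \<le> (\<integral>\<^sup>+y. ennreal (k y) \<partial>lborel) *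
      (\<integral>\<^sup>+y. ennreal (k y * (norm (f (x - y) - f x))\<^sup>2) \<partial>lborel)" for x
  proof -
    have "ennreal (norm (g x)) \<le> (\<integral>\<^sup>+y. ennreal (norm (k y *\<^sub>R (f (x - y) - f x))) \<partial>lborel)"
    proof (cases "integrable lborel (\<lambda>y. k y *\<^sub>R (f (x - y) - f x))")
      case True
      have "ennreal (norm (g x)) \<le> ennreal (norm (LBINT y. k y *\<^sub>R (f (x - y) - f x)))"
        by (intro ennreal_leI gk)
      also have "\<dots> \<le> (\<integral>\<^sup>+y. ennreal (norm (k y *\<^sub>R (f (x - y) - f x))) \<partial>lborel)"
        by (rule integral_norm_bound_ennreal[OF True])
      finally show ?thesis .
    next
      \<comment> \<open>A Bochner integral that does not exist is 0, so \<open>g x\<close>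
        vanishes.\<close>
      case False
      then show ?thesis using gk[of x] by (simp add: not_integrable_integral_eq)
    qed
    also have "\<dots> = (\<integral>\<^sup>+y. ennreal (sqrt (k y)) * ennreal (sqrt (k y) * norm (f (x - y) - f x)) \<partial>lborel)"
      by (intro nn_integral_cong) (simp add: k ennreal_mult[symmetric] mult.assoc[symmetric])
    finally have "(ennreal (norm (g x)))\<^sup>2 \<le> \<dots>\<^sup>2"
      by (intro power_mono) auto
    also have "\<dots> \<le> (\<integral>\<^sup>+y. (ennreal (sqrt (k y)))\<^sup>2 \<partial>lborel) *
        (\<integral>\<^sup>+y. (ennreal (sqrt (k y) * norm (f (x - y) - f x)))\<^sup>2 \<partial>lborel)"
      by (rule Cauchy_Schwarz_nn_integral) auto
    finally show ?thesis
      by (simp add: k ennreal_power power_mult_distrib)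
  qed
  have "(\<integral>\<^sup>+x. ennreal ((norm (g x))\<^sup>2) \<partial>lborel) \<le>
      (\<integral>\<^sup>+x. (\<integral>\<^sup>+y. ennreal (k y) \<partial>lborel) * (\<integral>\<^sup>+y. ennreal (k y * (norm (f (x - y) - f x))\<^sup>2) \<partial>lborel) \<partial>lborel)"
    by (intro nn_integral_mono pt)
  also have "\<dots> = (\<integral>\<^sup>+y. ennreal (k y) \<partial>lborel) * (\<integral>\<^sup>+x. \<integral>\<^sup>+y. ennreal (k y * (norm (f (x - y) - f x))\<^sup>2) \<partial>lborel \<partial>lborel)"
    by (rule nn_integral_cmult) measurable
  also have "(\<integral>\<^sup>+x. \<integral>\<^sup>+y. ennreal (k y * (norm (f (x - y) - f x))\<^sup>2) \<partial>lborel \<partial>lborel)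
      = (\<integral>\<^sup>+y. \<integral>\<^sup>+x. ennreal (k y * (norm (f (x - y) - f x))\<^sup>2) \<partial>lborel \<partial>lborel)"
    by (rule lborel_pair.Fubini'[symmetric]) measurable
  also have "\<dots> = (\<integral>\<^sup>+y. ennreal (k y * tmod f y) \<partial>lborel)"
  proof (intro nn_integral_cong)
    fix y
    have "(\<integral>\<^sup>+x. ennreal (k y * (norm (f (x - y) - f x))\<^sup>2) \<partial>lborel)
        = ennreal (k y) * (\<integral>\<^sup>+x. ennreal ((norm (f (x - y) - f x))\<^sup>2) \<partial>lborel)"
      by (subst nn_integral_cmult[symmetric]) (auto simp: ennreal_mult k)
    also have "\<dots> = ennreal (k y * tmod f y)"
      unfolding tmod_def using f
      by (subst ennreal_sqn[symmetric]) (auto simp: ennreal_mult k intro!: sq_integrable_diff sq_integrable_translate)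
    finally show "(\<integral>\<^sup>+x. ennreal (k y * (norm (f (x - y) - f x))\<^sup>2) \<partial>lborel) = ennreal (k y * tmod f y)" .
  qed
  also have "(\<integral>\<^sup>+y. ennreal (k y) \<partial>lborel) * \<dots> =
      ennreal ((LBINT y. k y) * (LBINT y. k y * tmod f y))"
    using k ik by (subst (1 2) nn_integral_eq_integral) (auto simp: ennreal_mult integral_nonneg_AE)
  finally have le: "(\<integral>\<^sup>+x. ennreal ((norm (g x))\<^sup>2) \<partial>lborel) \<le> ennreal ((LBINT y. k y) * (LBINT y. k y * tmod f y))" .
  show sq: "sq_integrable g"
    unfolding sq_integrable_def
  proof
    show "integrable lborel (\<lambda>x. (norm (g x))\<^sup>2)"
      using g le by (intro integrableI_nonneg) (auto simp: less_top[symmetric] top_unique)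
  qed fact
  show "sqn g \<le> (LBINT y. k y) * (LBINT y. k y * tmod f y)"
    using le k by (subst (asm) ennreal_sqn[OF sq, symmetric])
      (auto simp: ennreal_le_iff integral_nonneg_AE)
qed

section \<open>Continuously differentiable test functions\<close>

definition C1_grad :: "('a::euclidean_space \<Rightarrow> real) \<Rightarrow> ('a \<Rightarrow> 'a) \<Rightarrow> bool" where
  "C1_grad \<phi> \<phi>' \<longleftrightarrow> (\<forall>x. (\<phi> has_derivative (\<lambda>h. \<phi>' x \<bullet> h)) (at x)) \<and> continuous_on UNIV \<phi>'"

text \<open>Stated for every Euclidean space, so that it serves in space and, through
  \<open>C1c_on_eq\<close>, in space-time.\<close>

definition C1c :: "'a::euclidean_space set \<Rightarrow> ('a \<Rightarrow> real) \<Rightarrow> ('a \<Rightarrow> 'a) \<Rightarrow> bool" where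
  "C1c U \<phi> \<phi>' \<longleftrightarrow> C1_grad \<phi> \<phi>' \<and> compact (closure {x. \<phi> x \<noteq> 0}) \<and> closure {x. \<phi> x \<noteq> 0} \<subseteq> U"

lemma C1_grad_deriv: "C1_grad \<phi> \<phi>' \<Longrightarrow> (\<phi> has_derivative (\<lambda>h. \<phi>' x \<bullet> h)) (at x)"
  by (simp add: C1_grad_def)

lemma C1_grad_cont: "C1_grad \<phi> \<phi>' \<Longrightarrow> continuous_on UNIV \<phi>" "C1_grad \<phi> \<phi>' \<Longrightarrow> continuous_on UNIV \<phi>'"
  by (auto simp: C1_grad_def intro!: continuous_at_imp_continuous_on has_derivative_continuous)

lemma C1_grad_measurable:
  "C1_grad \<phi> \<phi>' \<Longrightarrow> \<phi> \<in> borel_measurable borel" "C1_grad \<phi> \<phi>' \<Longrightarrow> \<phi>' \<in> borel_measurable borel"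
  by (auto dest: C1_grad_cont intro: borel_measurable_continuous_onI)

lemma C1_grad_const: "C1_grad (\<lambda>x. c) (\<lambda>x. 0)"
  by (simp add: C1_grad_def)

lemma C1_grad_add:
  assumes "C1_grad \<phi> \<phi>'" "C1_grad \<psi> \<psi>'"
  shows "C1_grad (\<lambda>x. \<phi> x + \<psi> x) (\<lambda>x. \<phi>' x + \<psi>' x)"
  unfolding C1_grad_def
proof (intro conjI allI)
  show "((\<lambda>x. \<phi> x + \<psi> x) has_derivative (\<bullet>) (\<phi>' x + \<psi>' x)) (at x)" for x
    by (rule has_derivative_eq_rhs[OF has_derivative_add[OF C1_grad_deriv[OF assms(1)] C1_grad_deriv[OF assms(2)]]])
       (auto simp: inner_add_left)
qed (use assms in \<open>auto simp: C1_grad_def intro!: continuous_intros\<close>)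

lemma C1_grad_cmult:
  assumes "C1_grad \<phi> \<phi>'"
  shows "C1_grad (\<lambda>x. c * \<phi> x) (\<lambda>x. c *\<^sub>R \<phi>' x)"
  unfolding C1_grad_def
proof (intro conjI allI)
  show "((\<lambda>x. c * \<phi> x) has_derivative (\<bullet>) (c *\<^sub>R \<phi>' x)) (at x)" for x
    by (rule has_derivative_eq_rhs[OF has_derivative_mult_right[OF C1_grad_deriv[OF assms(1)]]])
       (auto simp: inner_scaleR_left)
qed (use assms in \<open>auto simp: C1_grad_def intro!: continuous_intros\<close>)

lemma C1_grad_diff:
  assumes "C1_grad \<phi> \<phi>'" "C1_grad \<psi> \<psi>'"
  shows "C1_grad (\<lambda>x. \<phi> x - \<psi> x) (\<lambda>x. \<phi>' x - \<psi>' x)"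
  using C1_grad_add[OF assms(1) C1_grad_cmult[OF assms(2), of "-1"]] by simp

lemma C1_grad_sum:
  "(\<And>i. i \<in> I \<Longrightarrow> C1_grad (\<phi> i) (\<phi>' i)) \<Longrightarrow> C1_grad (\<lambda>x. \<Sum>i\<in>I. \<phi> i x) (\<lambda>x. \<Sum>i\<in>I. \<phi>' i x)"
  by (induction I rule: infinite_finite_induct) (auto intro: C1_grad_add C1_grad_const)

lemma C1_grad_mult:
  assumes "C1_grad \<phi> \<phi>'" "C1_grad \<psi> \<psi>'"
  shows "C1_grad (\<lambda>x. \<phi> x * \<psi> x) (\<lambda>x. \<phi> x *\<^sub>R \<psi>' x + \<psi> x *\<^sub>R \<phi>' x)"
  unfolding C1_grad_def
proof (intro conjI allI)
  show "((\<lambda>x. \<phi> x * \<psi> x) has_derivative (\<bullet>) (\<phi> x *\<^sub>R \<psi>' x + \<psi> x *\<^sub>R \<phi>' x)) (at x)" for x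
    by (rule has_derivative_eq_rhs[OF has_derivative_mult[OF C1_grad_deriv[OF assms(1)] C1_grad_deriv[OF assms(2)]]])
       (auto simp: inner_add_left algebra_simps)
  show "continuous_on UNIV (\<lambda>x. \<phi> x *\<^sub>R \<psi>' x + \<psi> x *\<^sub>R \<phi>' x)"
    using assms by (auto intro!: continuous_intros dest: C1_grad_cont)
qed

lemma C1_grad_compose:
  assumes g: "\<And>x. (g has_real_derivative g' (\<phi> x)) (at (\<phi> x))" "continuous_on (range \<phi>) g'"
    and \<phi>: "C1_grad \<phi> \<phi>'"
  shows "C1_grad (\<lambda>x. g (\<phi> x)) (\<lambda>x. g' (\<phi> x) *\<^sub>R \<phi>' x)"
  unfolding C1_grad_def
proof (intro conjI allI)
  fix x
  have "(g has_derivative (*) (g' (\<phi> x))) (at (\<phi> x))"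
    using g(1) by (simp add: has_field_derivative_def)
  from has_derivative_compose[OF C1_grad_deriv[OF \<phi>] this]
  show "((\<lambda>x. g (\<phi> x)) has_derivative (\<bullet>) (g' (\<phi> x) *\<^sub>R \<phi>' x)) (at x)"
    by (rule has_derivative_eq_rhs) (auto simp: inner_scaleR_left)
  show "continuous_on UNIV (\<lambda>x. g' (\<phi> x) *\<^sub>R \<phi>' x)"
    using C1_grad_cont[OF \<phi>] by (auto intro!: continuous_intros continuous_on_compose2[OF g(2)])
qed

lemma C1_grad_affine:
  assumes "C1_grad \<phi> \<phi>'"
  shows "C1_grad (\<lambda>x. \<phi> (t + c *\<^sub>R x)) (\<lambda>x. c *\<^sub>R \<phi>' (t + c *\<^sub>R x))"
  unfolding C1_grad_def
proof (intro conjI allI)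
  fix x
  have "((\<lambda>x. t + c *\<^sub>R x) has_derivative (\<lambda>h. c *\<^sub>R h)) (at x)"
    by (auto intro!: derivative_eq_intros)
  from has_derivative_compose[OF this C1_grad_deriv[OF assms]]
  show "((\<lambda>x. \<phi> (t + c *\<^sub>R x)) has_derivative (\<bullet>) (c *\<^sub>R \<phi>' (t + c *\<^sub>R x))) (at x)"
    by (rule has_derivative_eq_rhs) (auto simp: inner_scaleR_left inner_scaleR_right)
  show "continuous_on UNIV (\<lambda>x. c *\<^sub>R \<phi>' (t + c *\<^sub>R x))"
    using C1_grad_cont(2)[OF assms] by (auto intro!: continuous_intros elim: continuous_on_compose2)
qed

lemma C1_grad_shift: "C1_grad \<phi> \<phi>' \<Longrightarrow> C1_grad (\<lambda>x. \<phi> (x - y)) (\<lambda>x. \<phi>' (x - y))"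
  using C1_grad_affine[of \<phi> \<phi>' "-y" 1] by simp

lemma C1_grad_reflect: "C1_grad \<phi> \<phi>' \<Longrightarrow> C1_grad (\<lambda>x. \<phi> (y - x)) (\<lambda>x. - \<phi>' (y - x))"
  using C1_grad_affine[of \<phi> \<phi>' "y" "-1"] by simp

lemma C1_grad_norm_sq: "C1_grad (\<lambda>x. (norm (x - p))\<^sup>2) (\<lambda>x. 2 *\<^sub>R (x - p))"
  unfolding C1_grad_def power2_norm_eq_inner
  by (auto intro!: derivative_eq_intros continuous_intros simp: inner_commute algebra_simps)

lemma C1_grad_lipschitz:
  assumes \<phi>: "C1_grad \<phi> \<phi>'" and M: "\<And>x. norm (\<phi>' x) \<le> M"
  shows "\<bar>\<phi> y - \<phi> x\<bar> \<le> M * norm (y - x)"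
proof -
  have "norm (\<phi> y - \<phi> x) \<le> M * norm (y - x)"
  proof (rule differentiable_bound[of UNIV])
    fix z
    show "(\<phi> has_derivative (\<lambda>h. \<phi>' z \<bullet> h)) (at z within UNIV)"
      using \<phi> by (simp add: C1_grad_deriv)
    show "onorm ((\<bullet>) (\<phi>' z)) \<le> M"
    proof (rule onorm_le)
      fix h
      have "norm (\<phi>' z \<bullet> h) \<le> norm (\<phi>' z) * norm h"
        by (simp add: Cauchy_Schwarz_ineq2)
      also have "\<dots> \<le> M * norm h" by (intro mult_right_mono M) auto
      finally show "norm (\<phi>' z \<bullet> h) \<le> M * norm h" .
    qed
  qed auto
  then show ?thesis by simp
qed

lemma C1c_C1: "C1c U \<phi> \<phi>' \<Longrightarrow> C1_grad \<phi> \<phi>'"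
  by (simp add: C1c_def)

lemma C1c_mono: "C1c U \<phi> \<phi>' \<Longrightarrow> U \<subseteq> V \<Longrightarrow> C1c V \<phi> \<phi>'"
  by (auto simp: C1c_def)

lemma C1c_I:
  assumes "C1_grad \<phi> \<phi>'" "compact S" "S \<subseteq> U" "\<And>x. x \<notin> S \<Longrightarrow> \<phi> x = 0"
  shows "C1c U \<phi> \<phi>'"
proof -
  have "closure {x. \<phi> x \<noteq> 0} \<subseteq> S"
    using assms(2,4) by (intro closure_minimal) (auto intro: compact_imp_closed)
  then show ?thesis
    using assms(1-3) unfolding C1c_def
    by (meson closed_closure closed_subset compact_eq_bounded_closed bounded_subset order_trans)
qed

lemma C1c_support:
  assumes "C1c U \<phi> \<phi>'"
  obtains S where "compact S" "S \<subseteq> U" "\<And>x. x \<notin> S \<Longrightarrow> \<phi> x = 0" "\<And>x. x \<notin> S \<Longrightarrow> \<phi>' x = 0"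
proof
  let ?S = "closure {x. \<phi> x \<noteq> 0}"
  show "compact ?S" "?S \<subseteq> U" using assms by (auto simp: C1c_def)
  show z: "\<phi> x = 0" if "x \<notin> ?S" for x
    using that closure_subset[of "{x. \<phi> x \<noteq> 0}"] by auto
  show "\<phi>' x = 0" if x: "x \<notin> ?S" for x
  proof -
    have op: "open (- ?S)" "x \<in> - ?S" using x by auto
    have "((\<lambda>_. 0) has_derivative (\<lambda>h. \<phi>' x \<bullet> h)) (at x)"
      by (rule has_derivative_transform_within_open[OF C1_grad_deriv[OF C1c_C1[OF assms], of x] op]) (blast intro: z)
    then have "(\<lambda>h. \<phi>' x \<bullet> h) = (\<lambda>h. 0)"
      by (rule has_derivative_unique[OF _ has_derivative_const])
    then have "\<phi>' x \<bullet> \<phi>' x = 0" by (rule fun_cong)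
    then show ?thesis by simp
  qed
qed

lemma C1c_bounded:
  assumes "C1c U \<phi> \<phi>'"
  obtains M where "M > 0" "\<And>x. \<bar>\<phi> x\<bar> \<le> M" "\<And>x. norm (\<phi>' x) \<le> M"
proof -
  obtain S where S: "compact S" "\<And>x. x \<notin> S \<Longrightarrow> \<phi> x = 0" "\<And>x. x \<notin> S \<Longrightarrow> \<phi>' x = 0"
    using C1c_support[OF assms] by metis
  have "compact (\<phi> ` S)" "compact (\<phi>' ` S)"
    using S(1) C1_grad_cont[OF C1c_C1[OF assms]]
    by (auto intro!: compact_continuous_image elim: continuous_on_subset)
  then have "bounded (\<phi> ` S)" "bounded (\<phi>' ` S)"
    by (auto intro: compact_imp_bounded)
  then obtain A B where A: "\<And>x. x \<in> S \<Longrightarrow> \<bar>\<phi> x\<bar> \<le> A" and B: "\<And>x. x \<in> S \<Longrightarrow> norm (\<phi>' x) \<le> B"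
    by (auto simp: bounded_iff)
  show ?thesis
  proof
    show "0 < \<bar>A\<bar> + \<bar>B\<bar> + 1" by simp
    fix x
    show "\<bar>\<phi> x\<bar> \<le> \<bar>A\<bar> + \<bar>B\<bar> + 1" using A[of x] S(2)[of x] by (cases "x \<in> S") auto
    show "norm (\<phi>' x) \<le> \<bar>A\<bar> + \<bar>B\<bar> + 1" using B[of x] S(3)[of x] by (cases "x \<in> S") auto
  qed
qed

lemma C1c_sq_integrable:
  assumes "C1c U \<phi> \<phi>'"
  shows "sq_integrable \<phi>" "sq_integrable \<phi>'"
proof -
  obtain M where M: "\<And>x. \<bar>\<phi> x\<bar> \<le> M" "\<And>x. norm (\<phi>' x) \<le> M"
    using C1c_bounded[OF assms] by metis
  obtain S where S: "compact S" "\<And>x. x \<notin> S \<Longrightarrow> \<phi> x = 0" "\<And>x. x \<notin> S \<Longrightarrow> \<phi>' x = 0"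
    using C1c_support[OF assms] by metis
  show "sq_integrable \<phi>" "sq_integrable \<phi>'"
    using M S C1_grad_measurable[OF C1c_C1[OF assms]] compact_imp_bounded[OF S(1)]
    by (auto intro!: sq_integrable_bounded_support[of _ M S])
qed

lemma integrable_bounded_support:
  fixes f :: "'a::euclidean_space \<Rightarrow> 'b::{banach, second_countable_topology}"
  assumes f: "f \<in> borel_measurable borel" and b: "\<And>x. norm (f x) \<le> M"
    and S: "bounded S" "\<And>x. x \<notin> S \<Longrightarrow> f x = 0"
  shows "integrable lborel f"
proof -
  obtain r where r: "S \<subseteq> cball 0 r"
    using S(1) by (metis bounded_iff mem_cball_0 subsetI)
  show ?thesis
  proof (rule Bochner_Integration.integrable_bound)
    show "integrable lborel (\<lambda>x. M * indicator (cball (0::'a) r) x)"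
      by (intro integrable_mult_right integrable_real_indicator)
         (auto simp: emeasure_lborel_cball_finite[unfolded infinity_ennreal_def])
    show "AE x in lborel. norm (f x) \<le> norm (M * indicator (cball 0 r) x)"
    proof (rule AE_I2)
      fix x
      show "norm (f x) \<le> norm (M * indicator (cball 0 r) x)"
        using b[of x] S(2)[of x] r by (cases "x \<in> S") (auto simp: indicator_def subset_iff)
    qed
  qed (use f in auto)
qed

lemma C1c_integrable:
  assumes "C1c U \<phi> \<phi>'"
  shows "integrable lborel \<phi>" "integrable lborel \<phi>'"
proof -
  obtain M where M: "\<And>x. \<bar>\<phi> x\<bar> \<le> M" "\<And>x. norm (\<phi>' x) \<le> M"
    using C1c_bounded[OF assms] by metis
  obtain S where S: "compact S" "\<And>x. x \<notin> S \<Longrightarrow> \<phi> x = 0" "\<And>x. x \<notin> S \<Longrightarrow> \<phi>' x = 0"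
    using C1c_support[OF assms] by metis
  show "integrable lborel \<phi>" "integrable lborel \<phi>'"
    using M S C1_grad_measurable[OF C1c_C1[OF assms]] compact_imp_bounded[OF S(1)]
    by (auto intro!: integrable_bounded_support[of _ M S])
qed

lemma C1c_mult:
  assumes "C1c U \<phi> \<phi>'" "C1_grad \<psi> \<psi>'"
  shows "C1c U (\<lambda>x. \<phi> x * \<psi> x) (\<lambda>x. \<phi> x *\<^sub>R \<psi>' x + \<psi> x *\<^sub>R \<phi>' x)"
proof -
  obtain S where "compact S" "S \<subseteq> U" "\<And>x. x \<notin> S \<Longrightarrow> \<phi> x = 0"
    using C1c_support[OF assms(1)] by metis
  then show ?thesis
    using C1_grad_mult[OF C1c_C1[OF assms(1)] assms(2)] by (intro C1c_I) auto
qed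

section \<open>Integration by parts and differentiation of convolutions\<close>

lemma C1_grad_directional:
  assumes "C1_grad \<phi> \<phi>'" and X: "X \<longlonglongrightarrow> 0" "\<And>n. X n \<noteq> 0"
  shows "(\<lambda>n. (\<phi> (x + X n *\<^sub>R h) - \<phi> x) / X n) \<longlonglongrightarrow> \<phi>' x \<bullet> h"
proof -
  have "((\<lambda>t. x + t *\<^sub>R h) has_derivative (\<lambda>t. t *\<^sub>R h)) (at 0)"
    by (auto intro!: derivative_eq_intros)
  from has_derivative_compose[OF this, of \<phi> "\<lambda>h. \<phi>' x \<bullet> h"] C1_grad_deriv[OF assms(1)]
  have "((\<lambda>t. \<phi> (x + t *\<^sub>R h)) has_derivative (\<lambda>t. \<phi>' x \<bullet> (t *\<^sub>R h))) (at 0)"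
    by simp
  then have "((\<lambda>t. \<phi> (x + t *\<^sub>R h)) has_real_derivative \<phi>' x \<bullet> h) (at 0)"
    unfolding has_field_derivative_def by (rule has_derivative_eq_rhs) (auto simp: mult.commute)
  then have "((\<lambda>t. (\<phi> (x + t *\<^sub>R h) - \<phi> x) / t) \<longlongrightarrow> \<phi>' x \<bullet> h) (at 0)"
    by (simp add: DERIV_def)
  then show ?thesis
    using X unfolding tendsto_at_iff_sequentially by (auto simp: comp_def)
qed

text \<open>Difference quotients integrate to 0 by translation invariance, and they converge to the
  directional derivative, dominated through the Lipschitz bound.\<close>

lemma integral_C1c_grad:
  assumes \<phi>: "C1c U \<phi> \<phi>'"
  shows "(LBINT x. \<phi>' x \<bullet> h) = 0"
proof -
  obtain M where M: "M > 0" "\<And>x. \<bar>\<phi> x\<bar> \<le> M" "\<And>x. norm (\<phi>' x) \<le> M"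
    using C1c_bounded[OF assms] by metis
  obtain S where S: "compact S" "\<And>x. x \<notin> S \<Longrightarrow> \<phi> x = 0" "\<And>x. x \<notin> S \<Longrightarrow> \<phi>' x = 0"
    using C1c_support[OF assms] by metis
  obtain r where r: "S \<subseteq> cball 0 r"
    using compact_imp_bounded[OF S(1)] by (metis bounded_iff mem_cball_0 subsetI)
  have [measurable]: "\<phi> \<in> borel_measurable borel" "\<phi>' \<in> borel_measurable borel"
    using C1_grad_measurable[OF C1c_C1[OF assms]] by auto
  define X where "X n = inverse (real (Suc n))" for n
  have X: "X \<longlonglongrightarrow> 0" "\<And>n. X n > 0" "\<And>n. X n \<le> 1"
    unfolding X_def by (rule LIMSEQ_inverse_real_of_nat) (auto simp: field_simps)
  have "(\<lambda>n. LBINT x. (\<phi> (x + X n *\<^sub>R h) - \<phi> x) / X n) \<longlonglongrightarrow> (LBINT x. \<phi>' x \<bullet> h)"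
  proof (rule integral_dominated_convergence)
    \<comment> \<open>The steps satisfy \<open>X n \<le> 1\<close>, so enlarging the support by
      \<open>norm h\<close> captures every shifted copy.\<close>
    show "integrable lborel (\<lambda>x. (M * norm h) * indicator (cball 0 (r + norm h)) x)"
      by (intro integrable_mult_right integrable_real_indicator)
         (auto simp: emeasure_lborel_cball_finite[unfolded infinity_ennreal_def])
    show "AE x in lborel. (\<lambda>n. (\<phi> (x + X n *\<^sub>R h) - \<phi> x) / X n) \<longlonglongrightarrow> \<phi>' x \<bullet> h"
      using X(2) by (intro AE_I2 C1_grad_directional[OF C1c_C1[OF \<phi>] X(1)]) (simp add: less_imp_neq[symmetric])
    fix n
    show "AE x in lborel. norm ((\<phi> (x + X n *\<^sub>R h) - \<phi> x) / X n) \<le> (M * norm h) * indicator (cball 0 (r + norm h)) x"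
    proof (rule AE_I2)
      fix x
      show "norm ((\<phi> (x + X n *\<^sub>R h) - \<phi> x) / X n) \<le> (M * norm h) * indicator (cball 0 (r + norm h)) x"
      proof (cases "x \<in> cball 0 (r + norm h)")
        case True
        have "\<bar>\<phi> (x + X n *\<^sub>R h) - \<phi> x\<bar> \<le> M * norm (X n *\<^sub>R h)"
          using C1_grad_lipschitz[OF C1c_C1[OF \<phi>] M(3), of "x + X n *\<^sub>R h" x] by simp
        then show ?thesis using True X(2)[of n] by (simp add: field_simps)
      next
        case False
        have "norm (X n *\<^sub>R h) \<le> norm h" using X(2,3)[of n] by (simp add: mult_left_le_one_le less_imp_le)
        then have "norm (x + X n *\<^sub>R h) > r"
          using False norm_triangle_ineq4[of "x + X n *\<^sub>R h" "X n *\<^sub>R h"] by auto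
        moreover have "norm x > r" using False norm_ge_zero[of h] by (auto simp: not_le simp del: norm_ge_zero)
        ultimately have "x + X n *\<^sub>R h \<notin> S" "x \<notin> S" using r by (auto simp: subset_iff)
        then show ?thesis using S(2) M(1) by simp
      qed
    qed
  qed auto
  moreover have "(LBINT x. (\<phi> (x + X n *\<^sub>R h) - \<phi> x) / X n) = 0" for n
    using C1c_integrable(1)[OF \<phi>] integrable_translate(2)[OF C1c_integrable(1)[OF \<phi>]]
      integral_translate(2)[of \<phi>]
    by simp
  ultimately show ?thesis
    by (simp only: LIMSEQ_const_iff)
qed

lemma integrable_continuous_compact_support:
  fixes f :: "'a::euclidean_space \<Rightarrow> real"
  assumes f: "continuous_on UNIV f" and S: "compact S" "\<And>x. x \<notin> S \<Longrightarrow> f x = 0"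
  shows "integrable lborel f"
proof -
  have "bounded (f ` S)"
    using S(1) f by (intro compact_imp_bounded compact_continuous_image) (auto elim: continuous_on_subset)
  then obtain M where M: "\<And>x. x \<in> S \<Longrightarrow> \<bar>f x\<bar> \<le> M" by (auto simp: bounded_iff)
  show ?thesis
  proof (rule integrable_bounded_support[of _ "\<bar>M\<bar>" S])
    fix x show "norm (f x) \<le> \<bar>M\<bar>" using M[of x] S(2)[of x] by (cases "x \<in> S") auto
  qed (use f S in \<open>auto intro: borel_measurable_continuous_onI compact_imp_bounded\<close>)
qed

text \<open>Apply \<open>integral_C1c_grad\<close> to the product of the two functions, which
  inherits the compact support of \<open>\<phi>\<close>.\<close>

lemma C1c_integral_by_parts:
  assumes \<phi>: "C1c U \<phi> \<phi>'" and \<psi>: "C1_grad \<psi> \<psi>'"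
  shows "(LBINT x. \<psi> x * (\<phi>' x \<bullet> h)) = - (LBINT x. (\<psi>' x \<bullet> h) * \<phi> x)"
proof -
  have "0 = (LBINT x. (\<phi> x *\<^sub>R \<psi>' x + \<psi> x *\<^sub>R \<phi>' x) \<bullet> h)"
    using integral_C1c_grad[OF C1c_mult[OF \<phi> \<psi>]] by simp
  also have "\<dots> = (LBINT x. (\<psi>' x \<bullet> h) * \<phi> x + \<psi> x * (\<phi>' x \<bullet> h))"
    by (simp add: inner_add_left mult.commute)
  also have "\<dots> = (LBINT x. (\<psi>' x \<bullet> h) * \<phi> x) + (LBINT x. \<psi> x * (\<phi>' x \<bullet> h))"
  proof (rule Bochner_Integration.integral_add)
    obtain S where S: "compact S" "\<And>x. x \<notin> S \<Longrightarrow> \<phi> x = 0" "\<And>x. x \<notin> S \<Longrightarrow> \<phi>' x = 0"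
      using C1c_support[OF \<phi>] by metis
    have c: "continuous_on UNIV (\<lambda>x. (\<psi>' x \<bullet> h) * \<phi> x)" "continuous_on UNIV (\<lambda>x. \<psi> x * (\<phi>' x \<bullet> h))"
      using C1_grad_cont[OF \<psi>] C1_grad_cont[OF C1c_C1[OF \<phi>]] by (auto intro!: continuous_intros)
    show "integrable lborel (\<lambda>x. (\<psi>' x \<bullet> h) * \<phi> x)" "integrable lborel (\<lambda>x. \<psi> x * (\<phi>' x \<bullet> h))"
      using S c by (auto intro!: integrable_continuous_compact_support[OF _ S(1)])
  qed
  finally show ?thesis by simp
qed

text \<open>The kernel only has to be bounded with bounded gradient, since it is used both for
  compactly supported mollifiers and for Yukawa kernels, whose support is the whole space.\<close>

lemma C1_grad_convolution:
  fixes W :: "'a::euclidean_space \<Rightarrow> real"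
  assumes W: "integrable lborel W" and \<gamma>: "C1_grad \<gamma> \<gamma>'"
    and M: "\<And>x. \<bar>\<gamma> x\<bar> \<le> M" "\<And>x. norm (\<gamma>' x) \<le> M"
  shows "C1_grad (\<lambda>x. LBINT z. W z * \<gamma> (x - z)) (\<lambda>x. LBINT z. W z *\<^sub>R \<gamma>' (x - z))"
proof -
  have [measurable]: "W \<in> borel_measurable borel" "\<gamma> \<in> borel_measurable borel" "\<gamma>' \<in> borel_measurable borel"
    using borel_measurable_integrable[OF W] C1_grad_measurable[OF \<gamma>] by auto
  have i1: "integrable lborel (\<lambda>z. W z * \<gamma> (x - z))" for x
    by (rule Bochner_Integration.integrable_bound[OF integrable_mult_right[OF W, of M]])
       (auto intro!: AE_I2 mult_mono order_trans[OF M(1)] simp: abs_mult mult.commute[of M])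
  have i2: "integrable lborel (\<lambda>z. W z *\<^sub>R \<gamma>' (x - z))" for x
    by (rule Bochner_Integration.integrable_bound[OF integrable_mult_right[OF W, of M]])
       (auto intro!: AE_I2 mult_mono order_trans[OF M(2)] simp: abs_mult mult.commute[of M])
  have i3: "integrable lborel (\<lambda>z. W z * (\<gamma>' (x - z) \<bullet> h))" for x h
    using integrable_inner_left[OF i2[of x], of h] by simp
  let ?F = "\<lambda>x. LBINT z. W z * \<gamma> (x - z)"
  let ?G = "\<lambda>x. LBINT z. W z *\<^sub>R \<gamma>' (x - z)"
  have M0: "0 \<le> M" using M(1)[of 0] by simp
  have "(?F has_derivative (\<lambda>h. ?G x \<bullet> h)) (at x)" for x
    unfolding has_derivative_iff_norm
  proof (intro conjI)
    show "bounded_linear (\<lambda>h. ?G x \<bullet> h)"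
      by (rule bounded_linear_inner_right)
    show "((\<lambda>y. norm (?F y - ?F x - ?G x \<bullet> (y - x)) / norm (y - x)) \<longlongrightarrow> 0) (at x)"
      unfolding tendsto_at_iff_sequentially
    proof (intro allI impI)
      fix X assume X: "\<forall>i. X i \<in> UNIV - {x}" "X \<longlonglongrightarrow> x"
      \<comment> \<open>Normalised Taylor remainder of the kernel: bounded by \<open>2 * M\<close>
        through the Lipschitz estimate and tending to 0 pointwise, so dominated convergence gives
        differentiability of the integral.\<close>
      define e where "e n z = \<bar>\<gamma> (X n - z) - \<gamma> (x - z) - \<gamma>' (x - z) \<bullet> (X n - x)\<bar> / norm (X n - x)" for n z
      have [measurable]: "e n \<in> borel_measurable borel" for n
        unfolding e_def by measurable
      have e2: "e n z \<le> 2 * M" for n z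
      proof -
        have "\<bar>\<gamma> (X n - z) - \<gamma> (x - z)\<bar> \<le> M * norm (X n - x)"
          using C1_grad_lipschitz[OF \<gamma> M(2), of "X n - z" "x - z"] by simp
        moreover have "\<bar>\<gamma>' (x - z) \<bullet> (X n - x)\<bar> \<le> M * norm (X n - x)"
          by (rule order_trans[OF Cauchy_Schwarz_ineq2]) (intro mult_right_mono M, simp)
        ultimately have "\<bar>\<gamma> (X n - z) - \<gamma> (x - z) - \<gamma>' (x - z) \<bullet> (X n - x)\<bar> \<le> 2 * M * norm (X n - x)"
          by linarith
        then show ?thesis using X(1) M0 by (auto simp: e_def divide_simps)
      qed
      have e0: "e n z \<ge> 0" for n z by (simp add: e_def)
      have elim: "(\<lambda>n. e n z) \<longlonglongrightarrow> 0" for z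
      proof -
        have "((\<lambda>y. norm (\<gamma> (y - z) - \<gamma> (x - z) - \<gamma>' (x - z) \<bullet> (y - x)) / norm (y - x)) \<longlongrightarrow> 0) (at x)"
          using C1_grad_deriv[OF C1_grad_shift[OF \<gamma>, of z], of x]
          unfolding has_derivative_iff_norm by auto
        then show ?thesis
          using X unfolding tendsto_at_iff_sequentially by (auto simp: e_def comp_def)
      qed
      have ie: "integrable lborel (\<lambda>z. \<bar>W z\<bar> * e n z)" for n
      proof (rule Bochner_Integration.integrable_bound)
        show "integrable lborel (\<lambda>z. \<bar>W z\<bar> * (2 * M))" using W by auto
      qed (use e0 e2 M0 in \<open>auto intro!: AE_I2 mult_left_mono\<close>)
      have lim: "(\<lambda>n. LBINT z. \<bar>W z\<bar> * e n z) \<longlonglongrightarrow> (\<integral>z. 0 \<partial>(lborel::'a measure))"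
      proof (rule integral_dominated_convergence)
        show "integrable lborel (\<lambda>z. \<bar>W z\<bar> * (2 * M))" using W by auto
        show "AE z in lborel. (\<lambda>n. \<bar>W z\<bar> * e n z) \<longlonglongrightarrow> 0"
          by (intro AE_I2 tendsto_mult_right_zero elim)
      qed (use e0 e2 in \<open>auto intro!: AE_I2 mult_left_mono\<close>)
      have bd: "norm (?F (X n) - ?F x - ?G x \<bullet> (X n - x)) / norm (X n - x) \<le> (LBINT z. \<bar>W z\<bar> * e n z)" for n
      proof -
        have eq: "?F (X n) - ?F x - ?G x \<bullet> (X n - x) =
            (LBINT z. W z * \<gamma> (X n - z) - W z * \<gamma> (x - z) - W z * (\<gamma>' (x - z) \<bullet> (X n - x)))"
        proof -
          have "?G x \<bullet> (X n - x) = (LBINT z. W z * (\<gamma>' (x - z) \<bullet> (X n - x)))"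
            by (subst integral_inner_left[symmetric, OF i2]) simp
          then show ?thesis
            by (simp only: Bochner_Integration.integral_diff[OF i1 i1]
                Bochner_Integration.integral_diff[OF Bochner_Integration.integrable_diff[OF i1 i1] i3])
        qed
        have "norm (?F (X n) - ?F x - ?G x \<bullet> (X n - x)) \<le> (LBINT z. norm (W z * \<gamma> (X n - z) - W z * \<gamma> (x - z) - W z * (\<gamma>' (x - z) \<bullet> (X n - x))))"
          unfolding eq by (rule integral_norm_bound)
        also have "\<dots> = (LBINT z. norm (X n - x) * (\<bar>W z\<bar> * e n z))"
        proof (intro Bochner_Integration.integral_cong refl)
          fix z
          have "W z * \<gamma> (X n - z) - W z * \<gamma> (x - z) - W z * (\<gamma>' (x - z) \<bullet> (X n - x))
            = W z * (\<gamma> (X n - z) - \<gamma> (x - z) - \<gamma>' (x - z) \<bullet> (X n - x))" by (simp add: algebra_simps)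
          then show "norm (W z * \<gamma> (X n - z) - W z * \<gamma> (x - z) - W z * (\<gamma>' (x - z) \<bullet> (X n - x))) = norm (X n - x) * (\<bar>W z\<bar> * e n z)"
            using X(1) by (simp add: e_def abs_mult)
        qed
        also have "\<dots> = norm (X n - x) * (LBINT z. \<bar>W z\<bar> * e n z)"
          by simp
        finally have "norm (?F (X n) - ?F x - ?G x \<bullet> (X n - x)) \<le> norm (X n - x) * (LBINT z. \<bar>W z\<bar> * e n z)" .
        moreover have "norm (X n - x) > 0" using X(1) by simp
        ultimately show ?thesis by (simp only: pos_divide_le_eq mult.commute)
      qed
      have lim0: "(\<lambda>n. LBINT z. \<bar>W z\<bar> * e n z) \<longlonglongrightarrow> 0"
        using lim by simp
      show "((\<lambda>y. norm (?F y - ?F x - ?G x \<bullet> (y - x)) / norm (y - x)) \<circ> X) \<longlonglongrightarrow> 0"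
        unfolding comp_def
      proof (rule Lim_null_comparison[OF _ lim0], intro always_eventually allI)
        fix n
        show "norm (norm (?F (X n) - ?F x - ?G x \<bullet> (X n - x)) / norm (X n - x)) \<le> (LBINT z. \<bar>W z\<bar> * e n z)"
          using bd[of n] by (simp only: real_norm_def abs_divide abs_norm_cancel abs_abs)
      qed
    qed
  qed
  moreover have "continuous_on UNIV ?G"
    unfolding continuous_on_sequentially
  proof (intro allI ballI impI)
    fix X :: "nat \<Rightarrow> 'a" and x assume "(\<forall>n. X n \<in> UNIV) \<and> X \<longlonglongrightarrow> x"
    then have X: "X \<longlonglongrightarrow> x" by simp
    have "(\<lambda>n. ?G (X n)) \<longlonglongrightarrow> ?G x"
    proof (rule integral_dominated_convergence)
      show "integrable lborel (\<lambda>z. \<bar>W z\<bar> * M)" using W by auto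
      show "AE z in lborel. (\<lambda>n. W z *\<^sub>R \<gamma>' (X n - z)) \<longlonglongrightarrow> W z *\<^sub>R \<gamma>' (x - z)"
      proof (intro AE_I2 tendsto_scaleR tendsto_const)
        fix z
        have "isCont \<gamma>' (x - z)"
          using C1_grad_cont(2)[OF \<gamma>] by (simp add: continuous_on_eq_continuous_at)
        then show "(\<lambda>n. \<gamma>' (X n - z)) \<longlonglongrightarrow> \<gamma>' (x - z)"
          using X by (auto intro!: isCont_tendsto_compose[of _ \<gamma>'] tendsto_intros)
      qed
    qed (auto intro!: AE_I2 mult_left_mono M)
    then show "(?G \<circ> X) \<longlonglongrightarrow> ?G x" by (simp add: comp_def)
  qed
  ultimately show ?thesis unfolding C1_grad_def by blast
qed

section \<open>A C^1 step function and radial cutoffs\<close>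

definition psq :: "real \<Rightarrow> real" where "psq t = (max 0 t)\<^sup>2"

lemma psq_deriv: "(psq has_real_derivative 2 * max 0 t) (at t)"
proof -
  consider "t > 0" | "t < 0" | "t = 0" by linarith
  then show ?thesis
  proof cases
    case 1
    have "((\<lambda>t. t\<^sup>2) has_real_derivative 2 * max 0 t) (at t)"
      using 1 by (auto intro!: derivative_eq_intros)
    then show ?thesis
      by (rule has_field_derivative_transform_within_open[of _ _ _ "{0<..}"]) (use 1 in \<open>auto simp: psq_def\<close>)
  next
    case 2
    have "((\<lambda>t. 0) has_real_derivative 2 * max 0 t) (at t)"
      using 2 by (auto intro!: derivative_eq_intros)
    then show ?thesis
      by (rule has_field_derivative_transform_within_open[of _ _ _ "{..<0}"]) (use 2 in \<open>auto simp: psq_def\<close>)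
  next
    case 3
    have "((\<lambda>h. psq h / h) \<longlongrightarrow> 0) (at 0)"
    proof (rule Lim_null_comparison)
      show "\<forall>\<^sub>F h in at 0. norm (psq h / h) \<le> \<bar>h\<bar>"
        by (auto intro!: always_eventually simp: psq_def max_def power2_eq_square abs_mult)
    qed (auto intro!: tendsto_eq_intros)
    then show ?thesis
      using 3 by (simp add: DERIV_def psq_def)
  qed
qed

lemma psq_nonneg [simp]: "0 \<le> psq t"
  by (simp add: psq_def)

text \<open>Two nested squared positive parts give a C^1 descent from 1 at \<open>t = 1\<close> to 0
  at \<open>t = 2\<close>; the outer one flattens the left end, the inner one the right end.\<close>

definition sstep :: "real \<Rightarrow> real" where "sstep t = 1 - psq (1 - psq (2 - t))"
definition sstep' :: "real \<Rightarrow> real" where "sstep' t = - 4 * max 0 (1 - psq (2 - t)) * max 0 (2 - t)"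

lemma sstep_deriv: "(sstep has_real_derivative sstep' t) (at t)"
  unfolding sstep_def[abs_def] sstep'_def
  by (auto intro!: derivative_eq_intros DERIV_chain2[OF psq_deriv])

lemma continuous_sstep': "continuous_on UNIV sstep'"
  unfolding sstep'_def[abs_def] psq_def by (auto intro!: continuous_intros)

lemma sstep_le1: "t \<le> 1 \<Longrightarrow> sstep t = 1"
proof -
  assume "t \<le> 1"
  then have "1 \<le> psq (2 - t)" unfolding psq_def by (intro one_le_power) auto
  then show ?thesis by (simp add: sstep_def psq_def[of "1 - _"])
qed

lemma sstep_ge2: "2 \<le> t \<Longrightarrow> sstep t = 0"
  by (simp add: sstep_def psq_def)

lemma sstep_bounds: "0 \<le> sstep t" "sstep t \<le> 1"
proof -
  have "psq (1 - psq (2 - t)) \<le> 1"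
    unfolding psq_def[of "1 - _"] by (intro power_le_one) (auto simp: max_def)
  then show "0 \<le> sstep t" by (simp add: sstep_def)
qed (simp add: sstep_def)

lemma sstep'_bound: "\<bar>sstep' t\<bar> \<le> 4"
proof (cases "psq (2 - t) \<le> 1")
  case True
  then have "max 0 (2 - t) \<le> 1"
    unfolding psq_def using power2_le_imp_le[of "max 0 (2 - t)" 1] by simp
  moreover have "max 0 (1 - psq (2 - t)) \<le> 1" by simp
  ultimately have "max 0 (1 - psq (2 - t)) * max 0 (2 - t) \<le> 1 * 1"
    by (intro mult_mono) auto
  then show ?thesis by (simp add: sstep'_def abs_mult)
qed (simp add: sstep'_def max_def)

lemma sstep'_ge2: "2 \<le> t \<Longrightarrow> sstep' t = 0"
  by (simp add: sstep'_def)

lemma sstep'_le1: "t \<le> 1 \<Longrightarrow> sstep' t = 0"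
proof -
  assume "t \<le> 1"
  then have "1 \<le> psq (2 - t)" unfolding psq_def by (intro one_le_power) auto
  then show ?thesis by (simp add: sstep'_def)
qed

text \<open>The squared norm keeps the function differentiable at the centre. The cutoff vanishes
  already beyond \<open>sqrt 2 * r\<close>; the radius \<open>2 * r\<close> used later is a rounded
  value.\<close>

definition bmp :: "'a::euclidean_space \<Rightarrow> real \<Rightarrow> 'a \<Rightarrow> real" where
  "bmp p r x = sstep (inverse (r\<^sup>2) * (norm (x - p))\<^sup>2)"

definition bmp' :: "'a::euclidean_space \<Rightarrow> real \<Rightarrow> 'a \<Rightarrow> 'a" where
  "bmp' p r x = sstep' (inverse (r\<^sup>2) * (norm (x - p))\<^sup>2) *\<^sub>R inverse (r\<^sup>2) *\<^sub>R 2 *\<^sub>R (x - p)"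

lemma bmp_C1: "C1_grad (bmp p r) (bmp' p r)"
  unfolding bmp_def[abs_def] bmp'_def[abs_def]
  by (rule C1_grad_compose[OF sstep_deriv continuous_on_subset[OF continuous_sstep'] C1_grad_cmult[OF C1_grad_norm_sq]]) simp

lemma bmp_bounds: "0 \<le> bmp p r x" "bmp p r x \<le> 1"
  by (simp_all add: bmp_def sstep_bounds)

lemma bmp_eq_1: "r > 0 \<Longrightarrow> norm (x - p) \<le> r \<Longrightarrow> bmp p r x = 1"
  unfolding bmp_def by (rule sstep_le1) (auto simp: field_simps intro!: power_mono)

lemma norm_ratio_ge: "r > 0 \<Longrightarrow> 2 * r \<le> norm (x - p) \<Longrightarrow> 2 \<le> inverse (r\<^sup>2) * (norm (x - p))\<^sup>2"
proof -
  assume r: "r > 0" "2 * r \<le> norm (x - p)"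
  then have "(2 * r)\<^sup>2 \<le> (norm (x - p))\<^sup>2" by (intro power_mono) auto
  moreover have "2 * r\<^sup>2 \<le> (2 * r)\<^sup>2" by (simp add: power_mult_distrib)
  ultimately have "2 * r\<^sup>2 \<le> (norm (x - p))\<^sup>2" by linarith
  then show ?thesis using r by (simp add: field_simps)
qed

lemma bmp_eq_0: "r > 0 \<Longrightarrow> 2 * r \<le> norm (x - p) \<Longrightarrow> bmp p r x = 0"
  unfolding bmp_def by (rule sstep_ge2) (rule norm_ratio_ge)

lemma bmp'_bound:
  assumes r: "r > 0" shows "norm (bmp' p r x) \<le> 16 / r"
proof (cases "2 * r \<le> norm (x - p)")
  case True
  then show ?thesis using r norm_ratio_ge[OF r True] by (simp add: bmp'_def sstep'_ge2)
next
  case False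
  have "norm (bmp' p r x) = \<bar>sstep' (inverse (r\<^sup>2) * (norm (x - p))\<^sup>2)\<bar> * (inverse (r\<^sup>2) * (2 * norm (x - p)))"
    by (simp add: bmp'_def abs_mult)
  also have "\<dots> \<le> 4 * (inverse (r\<^sup>2) * (2 * (2 * r)))"
    using False by (intro mult_mono sstep'_bound) auto
  also have "\<dots> = 16 / r" using r by (simp add: field_simps power2_eq_square)
  finally show ?thesis .
qed

lemma bmp_C1c: "r > 0 \<Longrightarrow> C1c UNIV (bmp p r) (bmp' p r)"
proof (rule C1c_I[OF bmp_C1])
  assume "r > 0"
  then show "x \<notin> cball p (2 * r) \<Longrightarrow> bmp p r x = 0" for x
    by (intro bmp_eq_0) (auto simp: dist_norm norm_minus_commute)
qed auto

section \<open>Density of test functions supported off the obstacle\<close>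

text \<open>Membership in \<open>H^1\<close> of the whole space. For a function vanishing on the
  closure of \<open>D\<close>, this is how zero boundary values are expressed without
  traces.\<close>

definition weak_grad :: "('a::euclidean_space \<Rightarrow> real) \<Rightarrow> ('a \<Rightarrow> 'a) \<Rightarrow> bool" where
  "weak_grad W H \<longleftrightarrow> sq_integrable W \<and> sq_integrable H \<and>
     (\<forall>\<phi> \<phi>'. C1c UNIV \<phi> \<phi>' \<longrightarrow>
        (\<forall>h. (LBINT x. W x * (\<phi>' x \<bullet> h)) = - (LBINT x. (H x \<bullet> h) * \<phi> x)))"

text \<open>Membership in \<open>H^1_0\<close> of \<open>U\<close>, i.e. the \<open>H^1\<close>
  closure of the test functions.\<close>

definition C1c_approx :: "'a::euclidean_space set \<Rightarrow> ('a \<Rightarrow> real) \<Rightarrow> ('a \<Rightarrow> 'a) \<Rightarrow> bool" where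
  "C1c_approx U W H \<longleftrightarrow>
     (\<forall>e>0. \<exists>\<phi> \<phi>'. C1c U \<phi> \<phi>' \<and> sqn (\<lambda>x. W x - \<phi> x) < e \<and> sqn (\<lambda>x. H x - \<phi>' x) < e)"

text \<open>The product rule follows by testing the weak gradient of \<open>W\<close> with
  \<open>\<phi> * \<zeta>\<close>, again a test function; the bound \<open>M\<close> keeps the
  result square integrable.\<close>

lemma weak_grad_mult:
  fixes W :: "'a::euclidean_space \<Rightarrow> real"
  assumes w: "weak_grad W H" and z: "C1_grad \<zeta> \<zeta>'"
    and M: "\<And>x. \<bar>\<zeta> x\<bar> \<le> M" "\<And>x. norm (\<zeta>' x) \<le> M"
  shows "weak_grad (\<lambda>x. \<zeta> x * W x) (\<lambda>x. \<zeta> x *\<^sub>R H x + W x *\<^sub>R \<zeta>' x)"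
  unfolding weak_grad_def
proof (intro conjI allI impI)
  have W: "sq_integrable W" and H: "sq_integrable H" using w by (auto simp: weak_grad_def)
  have [measurable]: "W \<in> borel_measurable borel" "H \<in> borel_measurable borel"
     "\<zeta> \<in> borel_measurable borel" "\<zeta>' \<in> borel_measurable borel"
    using W H C1_grad_measurable[OF z] by (auto dest: sq_integrable_measurable)
  show "sq_integrable (\<lambda>x. \<zeta> x * W x)"
    using sq_integrable_scale[OF W _ M(1)] by simp
  have zH: "sq_integrable (\<lambda>x. \<zeta> x *\<^sub>R H x)"
    using sq_integrable_scale[OF H _ M(1)] by simp
  have Wz: "sq_integrable (\<lambda>x. W x *\<^sub>R \<zeta>' x)"
  proof (rule sq_integrable_bound)
    show "integrable lborel (\<lambda>x. M\<^sup>2 * (norm (W x))\<^sup>2)" using sq_integrableD[OF W] by simp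
    show "(norm (W x *\<^sub>R \<zeta>' x))\<^sup>2 \<le> M\<^sup>2 * (norm (W x))\<^sup>2" for x
      using power_mono[OF M(2)[of x], of 2] by (auto simp: power_mult_distrib mult.commute[of "M\<^sup>2"] intro!: mult_left_mono)
  qed simp
  show "sq_integrable (\<lambda>x. \<zeta> x *\<^sub>R H x + W x *\<^sub>R \<zeta>' x)"
    by (rule sq_integrable_add[OF zH Wz])
  fix \<phi> :: "'a \<Rightarrow> real" and \<phi>' h assume p: "C1c UNIV \<phi> \<phi>'"
  have eq: "(LBINT x. W x * ((\<phi> x *\<^sub>R \<zeta>' x + \<zeta> x *\<^sub>R \<phi>' x) \<bullet> h)) = - (LBINT x. (H x \<bullet> h) * (\<phi> x * \<zeta> x))"
    using w C1c_mult[OF p z] unfolding weak_grad_def by blast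
  have i1: "integrable lborel (\<lambda>x. (\<zeta> x * W x) * (\<phi>' x \<bullet> h))"
    using integrable_inner_left[OF integrable_scaleR_sq[OF sq_integrable_scale[OF W _ M(1)] C1c_sq_integrable(2)[OF p]], of h]
    by simp
  have i2: "integrable lborel (\<lambda>x. ((W x *\<^sub>R \<zeta>' x) \<bullet> h) * \<phi> x)"
    using integrable_inner_left[OF integrable_scaleR_sq[OF C1c_sq_integrable(1)[OF p] Wz], of h]
    by (simp add: mult_ac)
  have i3: "integrable lborel (\<lambda>x. ((\<zeta> x *\<^sub>R H x) \<bullet> h) * \<phi> x)"
    using integrable_inner_left[OF integrable_scaleR_sq[OF C1c_sq_integrable(1)[OF p] zH], of h]
    by (simp add: mult_ac)
  have "(LBINT x. W x * ((\<phi> x *\<^sub>R \<zeta>' x + \<zeta> x *\<^sub>R \<phi>' x) \<bullet> h))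
      = (LBINT x. ((W x *\<^sub>R \<zeta>' x) \<bullet> h) * \<phi> x + (\<zeta> x * W x) * (\<phi>' x \<bullet> h))"
    by (intro Bochner_Integration.integral_cong) (auto simp: inner_add_left algebra_simps)
  also have "\<dots> = (LBINT x. ((W x *\<^sub>R \<zeta>' x) \<bullet> h) * \<phi> x) + (LBINT x. (\<zeta> x * W x) * (\<phi>' x \<bullet> h))"
    by (rule Bochner_Integration.integral_add[OF i2 i1])
  finally have 1: "(LBINT x. (\<zeta> x * W x) * (\<phi>' x \<bullet> h)) =
      - (LBINT x. (H x \<bullet> h) * (\<phi> x * \<zeta> x)) - (LBINT x. ((W x *\<^sub>R \<zeta>' x) \<bullet> h) * \<phi> x)"
    using eq by linarith
  have "(LBINT x. ((\<zeta> x *\<^sub>R H x + W x *\<^sub>R \<zeta>' x) \<bullet> h) * \<phi> x) =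
      (LBINT x. ((\<zeta> x *\<^sub>R H x) \<bullet> h) * \<phi> x + ((W x *\<^sub>R \<zeta>' x) \<bullet> h) * \<phi> x)"
    by (intro Bochner_Integration.integral_cong) (auto simp: inner_add_left algebra_simps)
  also have "\<dots> = (LBINT x. ((\<zeta> x *\<^sub>R H x) \<bullet> h) * \<phi> x) + (LBINT x. ((W x *\<^sub>R \<zeta>' x) \<bullet> h) * \<phi> x)"
    by (rule Bochner_Integration.integral_add[OF i3 i2])
  also have "(LBINT x. ((\<zeta> x *\<^sub>R H x) \<bullet> h) * \<phi> x) = (LBINT x. (H x \<bullet> h) * (\<phi> x * \<zeta> x))"
    by (intro Bochner_Integration.integral_cong) (auto simp: algebra_simps)
  finally show "(LBINT x. (\<zeta> x * W x) * (\<phi>' x \<bullet> h)) =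
      - (LBINT x. ((\<zeta> x *\<^sub>R H x + W x *\<^sub>R \<zeta>' x) \<bullet> h) * \<phi> x)"
    using 1 by linarith
qed

text \<open>\<open>H^1_0\<close> is closed. It serves to reduce density to functions of bounded
  support.\<close>

lemma C1c_approx_limit:
  assumes W: "sq_integrable W" "sq_integrable H"
    and *: "\<And>e. e > 0 \<Longrightarrow> \<exists>V K. sq_integrable V \<and> sq_integrable K \<and> C1c_approx U V K \<and>
        sqn (\<lambda>x. W x - V x) < e \<and> sqn (\<lambda>x. H x - K x) < e"
  shows "C1c_approx U W H"
  unfolding C1c_approx_def
proof (intro allI impI)
  fix e :: real assume e: "e > 0"
  then obtain V K where V: "sq_integrable V" "sq_integrable K" "C1c_approx U V K"
      "sqn (\<lambda>x. W x - V x) < e/4" "sqn (\<lambda>x. H x - K x) < e/4"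
    using *[of "e/4"] by auto
  obtain \<phi> \<phi>' where p: "C1c U \<phi> \<phi>'" "sqn (\<lambda>x. V x - \<phi> x) < e/4" "sqn (\<lambda>x. K x - \<phi>' x) < e/4"
    using V(3) e unfolding C1c_approx_def by (metis zero_less_divide_iff zero_less_numeral)
  have "sqn (\<lambda>x. W x - \<phi> x) < e" "sqn (\<lambda>x. H x - \<phi>' x) < e"
    using sqn_diff_le[OF W(1) V(1) C1c_sq_integrable(1)[OF p(1)]] V p
      sqn_diff_le[OF W(2) V(2) C1c_sq_integrable(2)[OF p(1)]] by linarith+
  then show "\<exists>\<phi> \<phi>'. C1c U \<phi> \<phi>' \<and> sqn (\<lambda>x. W x - \<phi> x) < e \<and> sqn (\<lambda>x. H x - \<phi>' x) < e"
    using p(1) by blast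
qed

lemma C1c_add:
  assumes "C1c U \<phi> \<phi>'" "C1c U \<psi> \<psi>'"
  shows "C1c U (\<lambda>x. \<phi> x + \<psi> x) (\<lambda>x. \<phi>' x + \<psi>' x)"
proof -
  obtain S where S: "compact S" "S \<subseteq> U" "\<And>x. x \<notin> S \<Longrightarrow> \<phi> x = 0"
    using C1c_support[OF assms(1)] by metis
  obtain S' where S': "compact S'" "S' \<subseteq> U" "\<And>x. x \<notin> S' \<Longrightarrow> \<psi> x = 0"
    using C1c_support[OF assms(2)] by metis
  show ?thesis
    using C1_grad_add[OF assms[THEN C1c_C1]] S S' by (intro C1c_I[of _ _ "S \<union> S'"]) auto
qed

lemma C1c_approx_add:
  assumes V: "sq_integrable V" "sq_integrable K" "C1c_approx U V K"
    and V': "sq_integrable V'" "sq_integrable K'" "C1c_approx U V' K'"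
  shows "C1c_approx U (\<lambda>x. V x + V' x) (\<lambda>x. K x + K' x)"
  unfolding C1c_approx_def
proof (intro allI impI)
  fix e :: real assume e: "e > 0"
  then have e4: "e/4 > 0" by simp
  obtain \<phi> \<phi>' where p: "C1c U \<phi> \<phi>'" "sqn (\<lambda>x. V x - \<phi> x) < e/4" "sqn (\<lambda>x. K x - \<phi>' x) < e/4"
    using V(3) e4 unfolding C1c_approx_def by metis
  obtain \<psi> \<psi>' where q: "C1c U \<psi> \<psi>'" "sqn (\<lambda>x. V' x - \<psi> x) < e/4" "sqn (\<lambda>x. K' x - \<psi>' x) < e/4"
    using V'(3) e4 unfolding C1c_approx_def by metis
  have "sqn (\<lambda>x. (V x - \<phi> x) + (V' x - \<psi> x)) < e"
    using sqn_add_le[OF sq_integrable_diff[OF V(1) C1c_sq_integrable(1)[OF p(1)]]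
        sq_integrable_diff[OF V'(1) C1c_sq_integrable(1)[OF q(1)]]] p q by linarith
  moreover have "sqn (\<lambda>x. (K x - \<phi>' x) + (K' x - \<psi>' x)) < e"
    using sqn_add_le[OF sq_integrable_diff[OF V(2) C1c_sq_integrable(2)[OF p(1)]]
        sq_integrable_diff[OF V'(2) C1c_sq_integrable(2)[OF q(1)]]] p q by linarith
  ultimately show "\<exists>\<phi> \<phi>'. C1c U \<phi> \<phi>' \<and> sqn (\<lambda>x. V x + V' x - \<phi> x) < e \<and> sqn (\<lambda>x. K x + K' x - \<phi>' x) < e"
    by (intro exI[of _ "\<lambda>x. \<phi> x + \<psi> x"] exI[of _ "\<lambda>x. \<phi>' x + \<psi>' x"] conjI C1c_add[OF p(1) q(1)])
       (simp_all add: add_diff_add)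
qed

lemma sq_integrable_imp_integrable:
  fixes V :: "'a::euclidean_space \<Rightarrow> real"
  assumes V: "sq_integrable V" and S: "bounded S" "\<And>x. x \<notin> S \<Longrightarrow> V x = 0"
  shows "integrable lborel V"
proof -
  obtain r where r: "S \<subseteq> cball 0 r"
    using S(1) by (metis bounded_iff mem_cball_0 subsetI)
  have "sq_integrable (indicator (cball 0 r) :: 'a \<Rightarrow> real)"
    by (rule sq_integrable_bounded_support[of _ 1 "cball 0 r"]) (auto simp: indicator_le_1 borel_measurable_indicator)
  from integrable_mult_sq[OF V this]
  show ?thesis
  proof (rule back_subst[where P="integrable lborel"], intro ext)
    show "V x * indicat_real (cball 0 r) x = V x" for x
      using S(2)[of x] r by (auto simp: indicator_def subset_iff)
  qed
qed

section \<open>Mollification with a shifted kernel\<close>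

lemma mollifier_exists:
  fixes b :: "'a::euclidean_space"
  assumes s: "s > 0"
  obtains \<gamma> \<gamma>' where "C1c UNIV \<gamma> \<gamma>'" "\<And>x. 0 \<le> \<gamma> x" "(LBINT x. \<gamma> x) = 1"
    "\<And>x. x \<notin> cball (s *\<^sub>R b) s \<Longrightarrow> \<gamma> x = 0"
proof -
  \<comment> \<open>Half the radius, because \<open>bmp\<close> vanishes only at twice its
    parameter.\<close>
  let ?f = "bmp (s *\<^sub>R b) (s/2)"
  have s2: "s/2 > 0" using s by simp
  have f: "C1c UNIV ?f (bmp' (s *\<^sub>R b) (s/2))"
    by (rule bmp_C1c[OF s2])
  define I where "I = (LBINT x. ?f x)"
  have "0 < measure lborel (cball (s *\<^sub>R b) (s/2))"
    using s by (simp add: content_cball)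
  also have "\<dots> = (LBINT x. indicator (cball (s *\<^sub>R b) (s/2)) x)"
    by simp
  also have "\<dots> \<le> I"
    unfolding I_def
  proof (rule integral_mono)
    show "integrable lborel (indicat_real (cball (s *\<^sub>R b) (s / 2)))"
      by (intro integrable_real_indicator) (auto simp: emeasure_lborel_cball_finite[unfolded infinity_ennreal_def])
    show "integrable lborel ?f" using C1c_integrable(1)[OF f] .
    show "indicat_real (cball (s *\<^sub>R b) (s / 2)) x \<le> ?f x" for x
      using bmp_eq_1[OF s2, of x "s *\<^sub>R b"] by (auto simp: indicator_def dist_norm norm_minus_commute bmp_bounds)
  qed
  finally have I: "I > 0" .
  show ?thesis
  proof
    show "C1c UNIV (\<lambda>x. (1/I) * ?f x) (\<lambda>x. (1/I) *\<^sub>R bmp' (s *\<^sub>R b) (s/2) x)"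
    proof (rule C1c_I)
      show "C1_grad (\<lambda>x. (1/I) * ?f x) (\<lambda>x. (1/I) *\<^sub>R bmp' (s *\<^sub>R b) (s/2) x)"
        by (rule C1_grad_cmult[OF bmp_C1])
      show "compact (cball (s *\<^sub>R b) s)" by simp
    qed (use bmp_eq_0[OF s2, of "s *\<^sub>R b"] bmp_eq_0[OF s2, of _ "s *\<^sub>R b"] in \<open>auto simp: dist_norm norm_minus_commute not_le less_imp_le\<close>)
    show "0 \<le> (1/I) * ?f x" for x using I bmp_bounds[of "s *\<^sub>R b"] by simp
    show "(LBINT x. (1/I) * ?f x) = 1" using I by (simp add: I_def)
    show "x \<notin> cball (s *\<^sub>R b) s \<Longrightarrow> (1/I) * ?f x = 0" for x
      using bmp_eq_0[OF s2, of x "s *\<^sub>R b"] by (auto simp: dist_norm norm_minus_commute not_le)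
  qed
qed

text \<open>The mollifying kernel is supported in a small ball around \<open>s *\<^sub>R b\<close> instead of the origin: it shifts the
  support off \<open>D\<close> while smoothing.\<close>

lemma C1c_approx_mollify:
  fixes D :: "'a::euclidean_space set"
  assumes w: "weak_grad V K" and S: "compact S" "\<And>x. x \<notin> S \<Longrightarrow> V x = 0"
    and s0: "s0 > 0"
    and cone: "\<And>x y s. x \<in> S \<Longrightarrow> y \<in> cball b 2 \<Longrightarrow> 0 < s \<Longrightarrow> s < s0 \<Longrightarrow> x + s *\<^sub>R y \<notin> D"
  shows "C1c_approx (- closure D) V K"
  unfolding C1c_approx_def
proof (intro allI impI)
  fix e :: real assume e: "e > 0"
  have V: "sq_integrable V" and K: "sq_integrable K" using w by (auto simp: weak_grad_def)
  have [measurable]: "V \<in> borel_measurable borel" "K \<in> borel_measurable borel"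
    using V K by (auto dest: sq_integrable_measurable)
  have iV: "integrable lborel V"
    using S by (intro sq_integrable_imp_integrable[OF V, of S]) (auto intro: compact_imp_bounded)
  have "eventually (\<lambda>y. tmod V y < e/2) (at 0)" "eventually (\<lambda>y. tmod K y < e/2) (at 0)"
    using e by (intro order_tendstoD(2)[OF tmod_tendsto[OF V]] order_tendstoD(2)[OF tmod_tendsto[OF K]]; simp)+
  then have "eventually (\<lambda>y. tmod V y < e/2 \<and> tmod K y < e/2) (at 0)"
    by (rule eventually_conj)
  then obtain d where d: "d > 0" "\<And>y. y \<noteq> 0 \<Longrightarrow> norm y < d \<Longrightarrow> tmod V y < e/2 \<and> tmod K y < e/2"
    by (auto simp: eventually_at)
  have t0: "tmod f 0 = 0" for f :: "'a \<Rightarrow> 'b::euclidean_space" by (simp add: tmod_def sqn_def)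
  have tm: "tmod V y \<le> e/2" "tmod K y \<le> e/2" if "norm y < d" for y
    using d(2)[OF _ that] e t0[of V] t0[of K] by (cases "y = 0"; force)+
  \<comment> \<open>The first bound keeps the shift inside the range of the cone condition; the
    second makes the whole support of the kernel, of size at most \<open>s * (norm b + 1)\<close>,
    lie where both moduli are at most \<open>e/2\<close>.\<close>
  define s where "s = min (s0/2) (d / (2 * (norm b + 1)))"
  have s: "s > 0" "s < s0" "s * (norm b + 1) < d"
  proof -
    have nb: "norm b + 1 > 0" by (simp add: add_nonneg_pos)
    show "s > 0" "s < s0" using s0 d nb by (auto simp: s_def min_less_iff_disj)
    have "s * (norm b + 1) \<le> d / (2 * (norm b + 1)) * (norm b + 1)"
      using nb by (intro mult_right_mono) (auto simp: s_def)
    also have "\<dots> = d / 2" using nb by (simp add: field_simps)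
    also have "\<dots> < d" using d by simp
    finally show "s * (norm b + 1) < d" .
  qed
  obtain \<gamma> \<gamma>' where g: "C1c UNIV \<gamma> \<gamma>'" "\<And>x. 0 \<le> \<gamma> x" "(LBINT x. \<gamma> x) = 1"
    "\<And>x. x \<notin> cball (s *\<^sub>R b) s \<Longrightarrow> \<gamma> x = 0"
    using mollifier_exists[OF s(1), of b] by metis
  obtain M where M: "\<And>x. \<bar>\<gamma> x\<bar> \<le> M" "\<And>x. norm (\<gamma>' x) \<le> M"
    using C1c_bounded[OF g(1)] by metis
  have ig: "integrable lborel \<gamma>" using C1c_integrable(1)[OF g(1)] .
  have [measurable]: "\<gamma> \<in> borel_measurable borel" "\<gamma>' \<in> borel_measurable borel"
    using C1_grad_measurable[OF C1c_C1[OF g(1)]] by auto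
  define \<phi> where "\<phi> x = (LBINT z. V z * \<gamma> (x - z))" for x
  define \<phi>' where "\<phi>' x = (LBINT z. V z *\<^sub>R \<gamma>' (x - z))" for x
  have C1: "C1_grad \<phi> \<phi>'"
    unfolding \<phi>_def[abs_def] \<phi>'_def[abs_def] by (rule C1_grad_convolution[OF iV C1c_C1[OF g(1)] M])
  have [measurable]: "\<phi> \<in> borel_measurable borel" "\<phi>' \<in> borel_measurable borel"
    using C1_grad_measurable[OF C1] by auto
  \<comment> \<open>The reflected kernel is an admissible test function in the definition of
    \<open>weak_grad\<close>; hence the gradient of the mollified \<open>V\<close> is the mollified
    \<open>K\<close>.\<close>
  have rg: "C1c UNIV (\<lambda>z. \<gamma> (x - z)) (\<lambda>z. - \<gamma>' (x - z))" for x
  proof (rule C1c_I[OF C1_grad_reflect[OF C1c_C1[OF g(1)]]])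
    show "compact (cball (x - s *\<^sub>R b) s)" by simp
    show "\<gamma> (x - z) = 0" if "z \<notin> cball (x - s *\<^sub>R b) s" for z
      using that by (intro g(4)) (auto simp: dist_norm norm_minus_commute algebra_simps)
  qed auto
  have iK: "integrable lborel (\<lambda>z. \<gamma> (x - z) *\<^sub>R K z)" for x
    by (rule integrable_scaleR_sq[OF C1c_sq_integrable(1)[OF rg] K])
  have iV': "integrable lborel (\<lambda>z. V z *\<^sub>R \<gamma>' (x - z))" for x
    using integrable_scaleR_sq[OF V sq_integrable_uminus[OF C1c_sq_integrable(2)[OF rg[of x]]]] by simp
  have \<phi>'_eq: "\<phi>' x = (LBINT z. \<gamma> (x - z) *\<^sub>R K z)" for x
  proof (rule euclidean_eqI)
    fix h :: 'a assume "h \<in> Basis"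
    have "(LBINT z. V z * ((- \<gamma>' (x - z)) \<bullet> h)) = - (LBINT z. (K z \<bullet> h) * \<gamma> (x - z))"
      using w rg[of x] unfolding weak_grad_def by blast
    then have "(LBINT z. V z * (\<gamma>' (x - z) \<bullet> h)) = (LBINT z. (K z \<bullet> h) * \<gamma> (x - z))"
      by simp
    moreover have "\<phi>' x \<bullet> h = (LBINT z. V z * (\<gamma>' (x - z) \<bullet> h))"
      unfolding \<phi>'_def by (subst integral_inner_left[OF iV', symmetric]) simp
    moreover have "(LBINT z. \<gamma> (x - z) *\<^sub>R K z) \<bullet> h = (LBINT z. (K z \<bullet> h) * \<gamma> (x - z))"
      by (subst integral_inner_left[OF iK, symmetric]) (simp add: mult.commute)
    ultimately show "\<phi>' x \<bullet> h = (LBINT z. \<gamma> (x - z) *\<^sub>R K z) \<bullet> h" by simp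
  qed
  \<comment> \<open>Unit mass of the kernel turns the mollification error into an average of
    translation differences, the form required by \<open>sqn_convolution_le\<close>.\<close>
  have conv: "(LBINT z. \<gamma> (x - z) *\<^sub>R f z) - f x = (LBINT y. \<gamma> y *\<^sub>R (f (x - y) - f x))"
    if f: "sq_integrable f" for f :: "'a \<Rightarrow> 'b::euclidean_space" and x
  proof -
    have [measurable]: "f \<in> borel_measurable borel" using f by (rule sq_integrable_measurable)
    have i: "integrable lborel (\<lambda>y. \<gamma> y *\<^sub>R f (x - y))"
      by (rule integrable_scaleR_sq[OF C1c_sq_integrable(1)[OF g(1)] sq_integrable_translate(2)[OF f]])
    have "(LBINT z. \<gamma> (x - z) *\<^sub>R f z) = (LBINT y. \<gamma> y *\<^sub>R f (x - y))"
      by (subst integral_translate(3)[symmetric, where y=x]) auto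
    moreover have "f x = (LBINT y. \<gamma> y *\<^sub>R f x)"
      using g(3) ig by simp
    moreover have "(LBINT y. \<gamma> y *\<^sub>R (f (x - y) - f x)) = (LBINT y. \<gamma> y *\<^sub>R f (x - y)) - (LBINT y. \<gamma> y *\<^sub>R f x)"
      unfolding scaleR_diff_right using i ig by (intro Bochner_Integration.integral_diff) auto
    ultimately show ?thesis by simp
  qed
  have est: "(LBINT y. \<gamma> y * tmod f y) \<le> e/2"
    if f: "sq_integrable f" and tm: "\<And>y. norm y < d \<Longrightarrow> tmod f y \<le> e/2" for f :: "'a \<Rightarrow> 'b::euclidean_space"
  proof -
    have [measurable]: "tmod f \<in> borel_measurable borel" using f by (rule tmod_measurable)
    have le: "\<gamma> y * tmod f y \<le> \<gamma> y * (e/2)" for y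
    proof (cases "y \<in> cball (s *\<^sub>R b) s")
      case True
      then have "norm y \<le> norm (s *\<^sub>R b) + s"
        using norm_triangle_ineq[of "s *\<^sub>R b" "y - s *\<^sub>R b"] by (simp add: dist_norm norm_minus_commute)
      also have "\<dots> < d" using s by (simp add: algebra_simps)
      finally show ?thesis using tm g(2) by (intro mult_left_mono) auto
    qed (simp add: g(4))
    have "(LBINT y. \<gamma> y * tmod f y) \<le> (LBINT y. \<gamma> y * (e/2))"
    proof (rule integral_mono[OF _ _ le])
      show "integrable lborel (\<lambda>y. \<gamma> y * tmod f y)"
        using le g(2) by (intro Bochner_Integration.integrable_bound[OF integrable_mult_left[OF ig, of "e/2"]])
          (auto intro!: AE_I2 order_trans[OF le order_trans[OF _ abs_ge_self]] simp: abs_mult g(2) e less_imp_le)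
    qed (use ig in auto)
    also have "\<dots> = e/2" using g(3) by simp
    finally show ?thesis .
  qed
  have "sqn (\<lambda>x. \<phi> x - V x) \<le> (LBINT y. \<gamma> y) * (LBINT y. \<gamma> y * tmod V y)"
  proof (rule sqn_convolution_le(2)[OF V ig g(2)])
    show "norm (\<phi> x - V x) \<le> norm (LBINT y. \<gamma> y *\<^sub>R (V (x - y) - V x))" for x
      unfolding conv[OF V, symmetric] by (simp add: \<phi>_def mult.commute)
  qed simp
  then have s1: "sqn (\<lambda>x. V x - \<phi> x) < e"
    using est[OF V tm(1)] g(3) e by (subst sqn_minus_commute) simp
  have "sqn (\<lambda>x. \<phi>' x - K x) \<le> (LBINT y. \<gamma> y) * (LBINT y. \<gamma> y * tmod K y)"
  proof (rule sqn_convolution_le(2)[OF K ig g(2)])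
    show "norm (\<phi>' x - K x) \<le> norm (LBINT y. \<gamma> y *\<^sub>R (K (x - y) - K x))" for x
      unfolding conv[OF K, symmetric] by (simp add: \<phi>'_eq)
  qed simp
  then have s2: "sqn (\<lambda>x. K x - \<phi>' x) < e"
    using est[OF K tm(2)] g(3) e by (subst sqn_minus_commute) simp
  have "C1c (- closure D) \<phi> \<phi>'"
  proof (rule C1c_I[OF C1])
    let ?S = "{x + y | x y. x \<in> S \<and> y \<in> cball (s *\<^sub>R b) s}"
    show "compact ?S" by (rule compact_sums[OF S(1) compact_cball])
    \<comment> \<open>A point \<open>z\<close> of \<open>D\<close> near the shifted support would be
      \<open>x + s *\<^sub>R y'\<close> with \<open>norm (y' - b) \<le> 2\<close>: one unit for the
      kernel's radius, one for approximating a point of the closure. This explains the radius 2 in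
      the cone condition.\<close>
    show "?S \<subseteq> - closure D"
    proof clarify
      fix x y assume x: "x \<in> S" and y: "y \<in> cball (s *\<^sub>R b) s" and cl: "x + y \<in> closure D"
      obtain z where z: "z \<in> D" "dist z (x + y) < s"
        using cl s(1) unfolding closure_approachable by blast
      define y' where "y' = (1/s) *\<^sub>R (z - x)"
      have "s * norm (y' - b) = norm (s *\<^sub>R (y' - b))" using s by simp
      also have "s *\<^sub>R (y' - b) = (z - (x + y)) + (y - s *\<^sub>R b)"
        using s by (simp add: y'_def algebra_simps)
      also have "norm \<dots> \<le> s + s"
        using z(2) y by (intro norm_triangle_le add_mono) (auto simp: dist_norm norm_minus_commute)
      finally have "norm (y' - b) \<le> 2" using s by (simp add: field_simps)
      then have "x + s *\<^sub>R y' \<notin> D" using s x by (intro cone) (auto simp: dist_norm norm_minus_commute)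
      then show False using z(1) s by (simp add: y'_def)
    qed
    show "\<phi> x = 0" if "x \<notin> ?S" for x
    proof -
      have "V z * \<gamma> (x - z) = 0" for z
      proof (cases "z \<in> S")
        case True
        then have "x - z \<notin> cball (s *\<^sub>R b) s" using that by (force simp: algebra_simps)
        then show ?thesis using g(4) by simp
      qed (simp add: S(2))
      then show ?thesis by (simp only: \<phi>_def Bochner_Integration.integral_zero)
    qed
  qed
  then show "\<exists>\<phi> \<phi>'. C1c (- closure D) \<phi> \<phi>' \<and> sqn (\<lambda>x. V x - \<phi> x) < e \<and> sqn (\<lambda>x. K x - \<phi>' x) < e"
    using s1 s2 by blast
qed

text \<open>A bounded derivative makes the graph function Lipschitz near \<open>p\<close>. A
  sufficiently steep direction then rises at least as fast as the graph can, so a point on or above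
  the graph stays there when moved along it.\<close>

lemma C2_boundary_cone:
  assumes "C2_boundary D" "p \<in> frontier D"
  shows "\<exists>r>0. \<exists>b. \<exists>s0>0. \<forall>x\<in>cball p r - D. \<forall>y\<in>cball b 2. \<forall>s. 0 < s \<longrightarrow> s < s0 \<longrightarrow> x + s *\<^sub>R y \<notin> D"
proof -
  obtain r and R :: "real^3 \<Rightarrow> real^3" and \<psi> :: "real^2 \<Rightarrow> real" where r: "r > 0" and R: "orthogonal_transformation R" and psi: "C2_fun \<psi>"
    and gr: "\<And>x. x \<in> ball p r \<Longrightarrow> x \<in> D \<longleftrightarrow> (R (x - p)) $ 3 < \<psi> (vector [(R (x - p)) $ 1, (R (x - p)) $ 2])"
    using assms unfolding C2_boundary_def by blast
  define P :: "real^3 \<Rightarrow> real^2" where "P w = vector [w $ 1, w $ 2]" for w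
  have P_add: "P (v + s *\<^sub>R w) = P v + s *\<^sub>R P w" for v w s
    by (simp add: P_def vec_eq_iff forall_2)
  have P_norm: "norm (P w) \<le> \<bar>w $ 1\<bar> + \<bar>w $ 2\<bar>" for w
    using norm_le_l1_cart[of "P w"] by (simp add: P_def sum_2)
  have linR: "linear R" using R by (simp add: orthogonal_transformation_linear)
  have normR: "norm (R w) = norm w" for w using R by (simp add: orthogonal_transformation_norm)
  obtain \<psi>' \<psi>'' where d1: "\<And>z. (\<psi> has_derivative blinfun_apply (\<psi>' z)) (at z)"
    and d2: "\<And>z. (\<psi>' has_derivative blinfun_apply (\<psi>'' z)) (at z)"
    using psi unfolding C2_fun_def by blast
  \<comment> \<open>The radius doubles because the projection \<open>P\<close> is only estimated by
    \<open>norm (P u) \<le> 2 * norm u\<close>.\<close>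
  have "continuous_on (cball 0 (2 * r)) \<psi>'"
    using d2 by (auto intro!: continuous_at_imp_continuous_on has_derivative_continuous)
  then have "bounded (\<psi>' ` cball 0 (2 * r))"
    by (intro compact_imp_bounded compact_continuous_image) auto
  then obtain B where B: "\<And>z. z \<in> cball 0 (2 * r) \<Longrightarrow> norm (\<psi>' z) \<le> B"
    unfolding bounded_iff by blast
  have lip: "\<bar>\<psi> y - \<psi> z\<bar> \<le> B * norm (y - z)" if "y \<in> cball 0 (2 * r)" "z \<in> cball 0 (2 * r)" for y z
  proof -
    have "norm (\<psi> y - \<psi> z) \<le> B * norm (y - z)"
      using that d1 B
      by (intro differentiable_bound[of "cball 0 (2 * r)" \<psi> "\<lambda>z. blinfun_apply (\<psi>' z)"])
         (auto intro: has_derivative_at_withinI simp: norm_blinfun.rep_eq[symmetric])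
    then show ?thesis by simp
  qed
  have B0: "0 \<le> B" using B[of 0] r by (smt (verit) norm_ge_zero mem_cball dist_self)
  obtain b0 where b0: "R b0 = axis 3 1"
    using orthogonal_transformation_surj[OF R] by (metis surjD)
  \<comment> \<open>For \<open>y\<close> within 2 of \<open>b\<close>, the vertical component is at
    least \<open>4 * B\<close>, while the horizontal part has norm at most 4; the graph thus rises
    by at most \<open>4 * B * s\<close> along \<open>s *\<^sub>R y\<close>.\<close>
  define b where "b = (4 * B + 2) *\<^sub>R b0"
  have Rb: "R b = (4 * B + 2) *\<^sub>R axis 3 1" using linR b0 by (simp add: b_def linear_cmul)
  \<comment> \<open>Starting within \<open>r/2\<close> of \<open>p\<close>, the moved point remains
    in the ball of radius \<open>r\<close> where the graph description holds.\<close>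
  define s0 where "s0 = r / (2 * (norm b + 2))"
  have nb: "norm b + 2 > 0" by (simp add: add_nonneg_pos)
  have s0: "s0 > 0" using r nb by (simp add: s0_def)
  have "x + s *\<^sub>R y \<notin> D" if x: "x \<in> cball p (r/2)" "x \<notin> D" and y: "y \<in> cball b 2" and s: "0 < s" "s < s0" for x y s
  proof -
    have ny: "norm y \<le> norm b + 2"
      using y norm_triangle_ineq[of b "y - b"] by (simp add: dist_norm norm_minus_commute)
    have "norm (s *\<^sub>R y) \<le> s * (norm b + 2)" using s ny by (simp add: mult_left_mono)
    also have "\<dots> < s0 * (norm b + 2)" using s nb by (intro mult_strict_right_mono)
    also have "\<dots> = r / 2" using nb by (simp add: s0_def field_simps)
    finally have nsy: "norm (s *\<^sub>R y) < r/2" .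
    have nx: "norm (x - p) \<le> r/2" using x by (simp add: dist_norm norm_minus_commute)
    have nxs: "norm (x + s *\<^sub>R y - p) < r"
      using norm_triangle_ineq[of "x - p" "s *\<^sub>R y"] nx nsy by (simp add: algebra_simps)
    define v where "v = R (x - p)"
    define w where "w = R y"
    have eq: "R (x + s *\<^sub>R y - p) = v + s *\<^sub>R w"
      using linR by (simp add: v_def w_def linear_diff linear_add linear_cmul algebra_simps)
    have wb: "norm (w - R b) \<le> 2"
      using y normR[of "y - b"] linR by (simp add: w_def linear_diff dist_norm norm_minus_commute)
    have c: "\<bar>(w - R b) $ i\<bar> \<le> 2" for i
      using component_le_norm_cart[of "w - R b" i] wb by linarith
    have w12: "\<bar>w $ 1\<bar> \<le> 2" "\<bar>w $ 2\<bar> \<le> 2" and w3: "w $ 3 \<ge> 4 * B"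
      using c[of 1] c[of 2] c[of 3] by (auto simp: Rb axis_def)
    have Pw: "norm (P w) \<le> 4" using P_norm[of w] w12 by simp
    have PP: "norm (P u) \<le> 2 * norm u" for u
      using P_norm[of u] component_le_norm_cart[of u 1] component_le_norm_cart[of u 2] by simp
    have xr: "x \<in> ball p r" "x + s *\<^sub>R y \<in> ball p r"
      using nx nxs r by (auto simp: dist_norm norm_minus_commute)
    have "norm v = norm (x - p)" "norm (v + s *\<^sub>R w) = norm (x + s *\<^sub>R y - p)"
      using normR[of "x - p"] normR[of "x + s *\<^sub>R y - p"] eq by (simp_all add: v_def)
    then have "norm v \<le> r" "norm (v + s *\<^sub>R w) \<le> r"
      using nx nxs r by simp_all
    then have "P v \<in> cball 0 (2 * r)" "P (v + s *\<^sub>R w) \<in> cball 0 (2 * r)"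
      using PP[of v] PP[of "v + s *\<^sub>R w"] by auto
    from lip[OF this(2,1)] have "\<psi> (P (v + s *\<^sub>R w)) \<le> \<psi> (P v) + B * norm (s *\<^sub>R P w)"
      by (simp add: P_add)
    also have "B * norm (s *\<^sub>R P w) \<le> B * (s * 4)"
      using s Pw B0 by (intro mult_left_mono) auto
    also have "\<dots> \<le> s * w $ 3" using w3 s by (simp add: mult.commute[of s] mult.left_commute)
    finally have "\<psi> (P (v + s *\<^sub>R w)) \<le> \<psi> (P v) + s * w $ 3" by simp
    moreover have "\<psi> (P v) \<le> v $ 3"
      using gr[OF xr(1)] x(2) by (auto simp: v_def P_def)
    ultimately have "\<psi> (P (v + s *\<^sub>R w)) \<le> (v + s *\<^sub>R w) $ 3" by simp
    then show ?thesis
      using gr[OF xr(2)] by (simp add: eq P_def)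
  qed
  then show ?thesis using r s0 by (intro exI[of _ "r/2"] conjI exI[of _ b] exI[of _ s0]) auto
qed

text \<open>The direction that leaves \<open>D\<close> varies along the boundary, so
  \<open>W\<close> has to be split. \<open>J\<close> lists the boundary balls still to be treated;
  each step of the induction peels off one piece and mollifies it with its own shift. What remains
  at the end stays away from the boundary.\<close>

lemma weak_grad_C1c_approx:
  fixes D :: "'a::euclidean_space set"
  assumes D: "open D" "bounded D"
    and cone: "\<And>p. p \<in> frontier D \<Longrightarrow> \<exists>r>0. \<exists>b. \<exists>s0>0. \<forall>x\<in>cball p r - D. \<forall>y\<in>cball b 2.
        \<forall>s. 0 < s \<longrightarrow> s < s0 \<longrightarrow> x + s *\<^sub>R y \<notin> D"
    and w: "weak_grad W H" and W0: "\<And>x. x \<in> closure D \<Longrightarrow> W x = 0"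
  shows "C1c_approx (- closure D) W H"
proof -
  obtain r b s0 where r: "\<And>p. p \<in> frontier D \<Longrightarrow> r p > 0" and s0: "\<And>p. p \<in> frontier D \<Longrightarrow> s0 p > 0"
    and cone': "\<And>p x y s. p \<in> frontier D \<Longrightarrow> x \<in> cball p (r p) - D \<Longrightarrow> y \<in> cball (b p) 2 \<Longrightarrow>
        0 < s \<Longrightarrow> s < s0 p \<Longrightarrow> x + s *\<^sub>R y \<notin> D"
    using cone by metis
  have cF: "compact (frontier D)" using D(2) by (rule compact_frontier_bounded)
  obtain P where P: "P \<subseteq> frontier D" "finite P" "frontier D \<subseteq> (\<Union>p\<in>P. ball p (r p / 2))"
  proof (rule compactE_image[OF cF])
    show "open (ball p (r p / 2))" for p by simp
    show "frontier D \<subseteq> (\<Union>p\<in>frontier D. ball p (r p / 2))" using r by force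
  qed (use that in blast)
  have clD: "closure D = D \<union> frontier D"
    using D(1) by (simp add: frontier_def interior_open closure_subset Un_Diff_cancel2 Un_absorb1 sup_commute)
  have step: "C1c_approx (- closure D) V K"
    if J: "finite J" "J \<subseteq> P" and V: "weak_grad V K" "\<And>x. x \<in> closure D \<Longrightarrow> V x = 0"
      "\<And>x. x \<notin> cball 0 \<rho> \<Longrightarrow> V x = 0" "\<And>p x. p \<in> P - J \<Longrightarrow> x \<in> cball p (r p / 2) \<Longrightarrow> V x = 0"
    for J V K \<rho>
    using J V
  proof (induction J arbitrary: V K rule: finite_induct)
    case empty
    \<comment> \<open>All boundary balls have been removed, so \<open>S\<close> has positive
      distance from the closure of \<open>D\<close> and the unshifted kernel (\<open>b = 0\<close>)
      works.\<close>
    define S where "S = cball 0 \<rho> - (D \<union> (\<Union>p\<in>P. ball p (r p / 2)))"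
    have S: "compact S"
      unfolding S_def using D(1) by (intro compact_diff) auto
    have "S \<inter> closure D = {}" using P(3) by (auto simp: S_def clD)
    then obtain d where d: "d > 0" "\<And>x y. x \<in> S \<Longrightarrow> y \<in> closure D \<Longrightarrow> d \<le> dist x y"
      using separate_compact_closed[OF S closed_closure, of D] by metis
    show ?case
    proof (rule C1c_approx_mollify[OF empty.prems(2) S, of "d/2" 0])
      show "V x = 0" if "x \<notin> S" for x
        using that empty.prems(3)[of x] empty.prems(4)[of x] empty.prems(5)[of _ x] closure_subset[of D]
        by (fastforce simp: S_def)
      show "x + s *\<^sub>R y \<notin> D" if "x \<in> S" "y \<in> cball 0 2" "0 < s" "s < d/2" for x y s
      proof
        assume "x + s *\<^sub>R y \<in> D"
        then have "d \<le> dist x (x + s *\<^sub>R y)" using d(2) that(1) closure_subset by blast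
        also have "\<dots> = s * norm y" using that by (simp add: dist_norm)
        also have "\<dots> \<le> s * 2" using that by (intro mult_left_mono) auto
        also have "\<dots> < d" using that by simp
        finally show False by simp
      qed
    qed (use d in auto)
  next
    case (insert p J)
    have pF: "p \<in> frontier D" using insert.prems P by auto
    have rp: "r p / 2 > 0" using r[OF pF] by simp
    \<comment> \<open>Equal to 1 on the half ball, so that \<open>1 - ?z\<close> removes it, and 0
      beyond \<open>r p\<close>, where the cone condition stops.\<close>
    let ?z = "bmp p (r p / 2)" and ?z' = "bmp' p (r p / 2)"
    let ?M = "16 / (r p / 2) + 1"
    have M0: "0 < 16 / (r p / 2)" using rp by (rule divide_pos_pos[rotated]) simp
    have M: "\<bar>?z x\<bar> \<le> ?M" "norm (?z' x) \<le> ?M" for x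
      using bmp_bounds[of p "r p / 2" x] bmp'_bound[OF rp, of p x] M0 by linarith+
    have M': "\<bar>1 - ?z x\<bar> \<le> ?M" "norm (0 - ?z' x) \<le> ?M" for x
      using bmp_bounds[of p "r p / 2" x] bmp'_bound[OF rp, of p x] M0 unfolding diff_0 norm_minus_cancel by linarith+
    have w1: "weak_grad (\<lambda>x. ?z x * V x) (\<lambda>x. ?z x *\<^sub>R K x + V x *\<^sub>R ?z' x)"
      by (rule weak_grad_mult[OF insert.prems(2) bmp_C1 M])
    have w2: "weak_grad (\<lambda>x. (1 - ?z x) * V x) (\<lambda>x. (1 - ?z x) *\<^sub>R K x + V x *\<^sub>R (0 - ?z' x))"
      by (rule weak_grad_mult[OF insert.prems(2) C1_grad_diff[OF C1_grad_const bmp_C1] M'])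
    have a1: "C1c_approx (- closure D) (\<lambda>x. ?z x * V x) (\<lambda>x. ?z x *\<^sub>R K x + V x *\<^sub>R ?z' x)"
    proof (rule C1c_approx_mollify[OF w1, of "cball p (r p) - D" "s0 p" "b p"])
      show "compact (cball p (r p) - D)" using D(1) by (intro compact_diff) auto
      show "?z x * V x = 0" if "x \<notin> cball p (r p) - D" for x
        using that insert.prems(3)[of x] closure_subset[of D] bmp_eq_0[OF rp, of x p]
        by (auto simp: dist_norm norm_minus_commute not_le)
    qed (use s0 pF cone' in auto)
    \<comment> \<open>The remainder vanishes on the half ball of \<open>p\<close> and still on those
      treated before, which is the induction invariant for \<open>J\<close>.\<close>
    have a2: "C1c_approx (- closure D) (\<lambda>x. (1 - ?z x) * V x) (\<lambda>x. (1 - ?z x) *\<^sub>R K x + V x *\<^sub>R (0 - ?z' x))"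
    proof (rule insert.IH[OF _ w2])
      show "J \<subseteq> P" using insert.prems by auto
      show "(1 - ?z x) * V x = 0" if "q \<in> P - J" "x \<in> cball q (r q / 2)" for q x
        using that insert.prems(5)[of q x] bmp_eq_1[OF rp, of x p]
        by (cases "q = p") (auto simp: dist_norm norm_minus_commute)
    qed (use insert.prems in auto)
    have "C1c_approx (- closure D) (\<lambda>x. ?z x * V x + (1 - ?z x) * V x)
        (\<lambda>x. (?z x *\<^sub>R K x + V x *\<^sub>R ?z' x) + ((1 - ?z x) *\<^sub>R K x + V x *\<^sub>R (0 - ?z' x)))"
      using w1 w2 by (intro C1c_approx_add[OF _ _ a1 _ _ a2]) (auto simp: weak_grad_def)
    then show ?case
      by (simp add: algebra_simps)
  qed
  have Wsq: "sq_integrable W" and Hsq: "sq_integrable H" using w by (auto simp: weak_grad_def)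
  have [measurable]: "W \<in> borel_measurable borel" "H \<in> borel_measurable borel"
    using Wsq Hsq by (auto dest: sq_integrable_measurable)
  \<comment> \<open>Cutoffs at radius \<open>n + 1\<close>: their gradients are of order
    \<open>1 / n\<close>, so the extra term \<open>W x *\<^sub>R z' n x\<close> disappears in the
    limit.\<close>
  define z where "z n = bmp (0::'a) (real (Suc n))" for n
  define z' where "z' n = bmp' (0::'a) (real (Suc n))" for n
  have zC: "C1_grad (z n) (z' n)" for n unfolding z_def z'_def by (rule bmp_C1)
  have [measurable]: "z n \<in> borel_measurable borel" "z' n \<in> borel_measurable borel" for n
    using C1_grad_measurable[OF zC] by auto
  have zb: "0 \<le> z n x" "z n x \<le> 1" for n x by (auto simp: z_def bmp_bounds)
  have z'b: "norm (z' n x) \<le> 16 / real (Suc n)" for n x unfolding z'_def by (rule bmp'_bound) simp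
  have z'b16: "norm (z' n x) \<le> 16" for n x
    by (rule order_trans[OF z'b]) (simp add: field_simps)
  have wz: "weak_grad (\<lambda>x. z n x * W x) (\<lambda>x. z n x *\<^sub>R H x + W x *\<^sub>R z' n x)" for n
    using zb[of n] z'b16[of n] by (intro weak_grad_mult[OF w zC, of _ 16]) (auto intro: order_trans[of _ 1])
  have zlim: "(\<lambda>n. z n x) \<longlonglongrightarrow> 1" for x
  proof (rule tendsto_eventually)
    obtain N where N: "norm x \<le> real N" using real_arch_simple by blast
    show "\<forall>\<^sub>F n in sequentially. z n x = 1"
      using eventually_ge_at_top[of N]
    proof eventually_elim
      case (elim n)
      then show ?case unfolding z_def using N by (intro bmp_eq_1) auto
    qed
  qed
  have z'lim: "(\<lambda>n. z' n x) \<longlonglongrightarrow> 0" for x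
  proof (rule Lim_null_comparison)
    show "\<forall>\<^sub>F n in sequentially. norm (z' n x) \<le> 16 / real (Suc n)" using z'b by simp
    show "(\<lambda>n. 16 / real (Suc n)) \<longlonglongrightarrow> 0"
      using tendsto_mult_right_zero[OF LIMSEQ_inverse_real_of_nat, of 16] by (simp add: divide_inverse)
  qed
  have l1: "(\<lambda>n. sqn (\<lambda>x. W x - z n x * W x)) \<longlonglongrightarrow> (\<integral>x. 0 \<partial>(lborel :: 'a measure))"
    unfolding sqn_def
  proof (rule integral_dominated_convergence)
    show "integrable lborel (\<lambda>x. (norm (W x))\<^sup>2)" using Wsq by (rule sq_integrableD)
    show "AE x in lborel. (\<lambda>n. (norm (W x - z n x * W x))\<^sup>2) \<longlonglongrightarrow> 0"
    proof (rule AE_I2)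
      fix x
      have "(\<lambda>n. (norm (W x - z n x * W x))\<^sup>2) \<longlonglongrightarrow> (norm (W x - 1 * W x))\<^sup>2"
        by (intro tendsto_intros zlim)
      then show "(\<lambda>n. (norm (W x - z n x * W x))\<^sup>2) \<longlonglongrightarrow> 0" by simp
    qed
    show "AE x in lborel. norm ((norm (W x - z n x * W x))\<^sup>2) \<le> (norm (W x))\<^sup>2" for n
    proof (rule AE_I2)
      fix x
      have "\<bar>W x - z n x * W x\<bar> = \<bar>1 - z n x\<bar> * \<bar>W x\<bar>" by (simp add: abs_mult[symmetric] algebra_simps)
      also have "\<dots> \<le> 1 * \<bar>W x\<bar>" using zb[of n x] by (intro mult_right_mono) auto
      finally have "\<bar>W x - z n x * W x\<bar> \<le> \<bar>W x\<bar>" by simp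
      from power_mono[OF this, of 2] show "norm ((norm (W x - z n x * W x))\<^sup>2) \<le> (norm (W x))\<^sup>2"
        by simp
    qed
  qed auto
  have l2: "(\<lambda>n. sqn (\<lambda>x. H x - (z n x *\<^sub>R H x + W x *\<^sub>R z' n x))) \<longlonglongrightarrow> (\<integral>x. 0 \<partial>(lborel :: 'a measure))"
    unfolding sqn_def
  proof (rule integral_dominated_convergence)
    \<comment> \<open>512 = 2 * 16^2, with 16 the uniform bound on the gradients of the
      cutoffs.\<close>
    show "integrable lborel (\<lambda>x. 2 * (norm (H x))\<^sup>2 + 512 * (norm (W x))\<^sup>2)"
      using Wsq[THEN sq_integrableD] Hsq[THEN sq_integrableD] by auto
    show "AE x in lborel. (\<lambda>n. (norm (H x - (z n x *\<^sub>R H x + W x *\<^sub>R z' n x)))\<^sup>2) \<longlonglongrightarrow> 0"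
    proof (rule AE_I2)
      fix x
      have "(\<lambda>n. (norm (H x - (z n x *\<^sub>R H x + W x *\<^sub>R z' n x)))\<^sup>2) \<longlonglongrightarrow> (norm (H x - (1 *\<^sub>R H x + W x *\<^sub>R 0)))\<^sup>2"
        by (intro tendsto_intros zlim z'lim)
      then show "(\<lambda>n. (norm (H x - (z n x *\<^sub>R H x + W x *\<^sub>R z' n x)))\<^sup>2) \<longlonglongrightarrow> 0" by simp
    qed
    show "AE x in lborel. norm ((norm (H x - (z n x *\<^sub>R H x + W x *\<^sub>R z' n x)))\<^sup>2) \<le> 2 * (norm (H x))\<^sup>2 + 512 * (norm (W x))\<^sup>2" for n
    proof (rule AE_I2)
      fix x
      have "H x - (z n x *\<^sub>R H x + W x *\<^sub>R z' n x) = (1 - z n x) *\<^sub>R H x + (- (W x *\<^sub>R z' n x))"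
        by (simp add: algebra_simps)
      then have "(norm (H x - (z n x *\<^sub>R H x + W x *\<^sub>R z' n x)))\<^sup>2 \<le> 2 * (norm ((1 - z n x) *\<^sub>R H x))\<^sup>2 + 2 * (norm (- (W x *\<^sub>R z' n x)))\<^sup>2"
        using norm_add_sq_le by metis
      moreover have "norm ((1 - z n x) *\<^sub>R H x) \<le> norm (H x)"
        using zb[of n x] by (auto intro!: mult_left_le_one_le)
      then have "(norm ((1 - z n x) *\<^sub>R H x))\<^sup>2 \<le> (norm (H x))\<^sup>2" by (intro power_mono) auto
      moreover have "norm (- (W x *\<^sub>R z' n x)) \<le> norm (W x) * 16"
        using z'b16[of n x] by (auto intro!: mult_left_mono)
      then have "(norm (- (W x *\<^sub>R z' n x)))\<^sup>2 \<le> (norm (W x) * 16)\<^sup>2" by (intro power_mono) auto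
      ultimately show "norm ((norm (H x - (z n x *\<^sub>R H x + W x *\<^sub>R z' n x)))\<^sup>2) \<le> 2 * (norm (H x))\<^sup>2 + 512 * (norm (W x))\<^sup>2"
        by (simp add: power_mult_distrib)
    qed
  qed auto
  show ?thesis
  proof (rule C1c_approx_limit[OF Wsq Hsq])
    fix e :: real assume e: "e > 0"
    have "eventually (\<lambda>n. sqn (\<lambda>x. W x - z n x * W x) < e \<and> sqn (\<lambda>x. H x - (z n x *\<^sub>R H x + W x *\<^sub>R z' n x)) < e) sequentially"
      using l1 l2 e by (intro eventually_conj order_tendstoD(2)) auto
    then obtain n where n: "sqn (\<lambda>x. W x - z n x * W x) < e" "sqn (\<lambda>x. H x - (z n x *\<^sub>R H x + W x *\<^sub>R z' n x)) < e"
      by (auto simp: eventually_sequentially)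
    have "C1c_approx (- closure D) (\<lambda>x. z n x * W x) (\<lambda>x. z n x *\<^sub>R H x + W x *\<^sub>R z' n x)"
    proof (rule step[OF P(2) order_refl wz])
      show "z n x * W x = 0" if "x \<notin> cball 0 (2 * real (Suc n))" for x
        using that bmp_eq_0[of "real (Suc n)" x 0] by (auto simp: z_def)
    qed (use W0 in auto)
    then show "\<exists>V K. sq_integrable V \<and> sq_integrable K \<and> C1c_approx (- closure D) V K \<and>
        sqn (\<lambda>x. W x - V x) < e \<and> sqn (\<lambda>x. H x - K x) < e"
      using n wz[of n] unfolding weak_grad_def by blast
  qed
qed

section \<open>The weak maximum principle\<close>

text \<open>A C^1 substitute for the positive part: zero for \<open>t \<le> 0\<close>, within
  \<open>a\<close> of the positive part, and with slope between 0 and 1.\<close>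

definition pth :: "real \<Rightarrow> real \<Rightarrow> real" where "pth a t = sqrt (a\<^sup>2 + psq t) - a"

lemma pth_deriv:
  assumes "a > 0"
  shows "(pth a has_real_derivative max 0 t / sqrt (a\<^sup>2 + psq t)) (at t)"
proof -
  have "a\<^sup>2 + psq t > 0" using assms by (simp add: add_pos_nonneg)
  then show ?thesis
    unfolding pth_def[abs_def]
    by (auto intro!: derivative_eq_intros DERIV_chain2[OF DERIV_real_sqrt] psq_deriv simp: field_simps)
qed

lemma pth_nonneg: "a > 0 \<Longrightarrow> 0 \<le> pth a t"
  unfolding pth_def using real_sqrt_le_mono[of "a\<^sup>2" "a\<^sup>2 + psq t"] by simp

lemma pth_nonpos: "a > 0 \<Longrightarrow> t \<le> 0 \<Longrightarrow> pth a t = 0"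
  by (simp add: pth_def psq_def)

lemma pth_le: "a > 0 \<Longrightarrow> 0 \<le> t \<Longrightarrow> pth a t \<le> t"
  unfolding pth_def psq_def using sqrt_sum_squares_le_sum[of a t] by simp

lemma le_pth: "a > 0 \<Longrightarrow> t \<le> a + pth a t"
proof (cases "t \<ge> 0")
  case True
  then show ?thesis
    unfolding pth_def psq_def using real_sqrt_le_mono[of "t\<^sup>2" "a\<^sup>2 + t\<^sup>2"] by simp
next
  case False
  assume "a > 0"
  then show ?thesis using pth_nonneg[of a t] False by simp
qed

lemma pth_deriv_bounds:
  assumes "a > 0"
  shows "0 \<le> max 0 t / sqrt (a\<^sup>2 + psq t)" "max 0 t / sqrt (a\<^sup>2 + psq t) \<le> 1"
proof -
  have p: "0 < sqrt (a\<^sup>2 + psq t)" using assms by (simp add: add_pos_nonneg)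
  then show "0 \<le> max 0 t / sqrt (a\<^sup>2 + psq t)" by simp
  have "max 0 t = sqrt (psq t)" by (simp add: psq_def)
  also have "\<dots> \<le> sqrt (a\<^sup>2 + psq t)" by simp
  finally show "max 0 t / sqrt (a\<^sup>2 + psq t) \<le> 1" using p by simp
qed

text \<open>Replaces the identity \<open>t * max 0 t = (max 0 t)\<^sup>2\<close> of the
  unregularised energy argument.\<close>

lemma pth_square_le: "a > 0 \<Longrightarrow> (pth a t)\<^sup>2 \<le> t * pth a t"
  using pth_nonneg[of a t] pth_le[of a t] pth_nonpos[of a t]
  by (cases "t \<ge> 0") (auto simp: power2_eq_square intro!: mult_right_mono)

lemma integrable_indicator_sq:
  fixes g :: "'a::euclidean_space \<Rightarrow> real"
  assumes g: "sq_integrable g" and M: "M \<in> sets borel" "emeasure lborel M < \<infinity>"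
  shows "integrable lborel (\<lambda>x. indicator M x * g x)"
proof (rule integrable_mult_sq[OF _ g])
  show "sq_integrable (indicat_real M)"
    by (rule sq_integrable_bound[of _ "indicator M"])
       (use M in \<open>auto simp: indicator_def intro!: integrable_real_indicator\<close>)
qed

text \<open>Young's inequality with a free weight \<open>c\<close> in place of Cauchy-Schwarz. Later
  \<open>c\<close> is taken of the exponentially small size of the error, which balances the two
  terms.\<close>

lemma indicator_integral_le_sqn:
  fixes g :: "'a::euclidean_space \<Rightarrow> real"
  assumes g: "sq_integrable g" and M: "M \<in> sets borel" "emeasure lborel M < \<infinity>" and c: "c > 0"
  shows "(LBINT x. indicator M x * g x) \<le> sqn g / (2 * c) + c * measure lborel M / 2"
proof -
  have "(LBINT x. indicator M x * g x) \<le> (LBINT x. (1 / (2 * c)) * (norm (g x))\<^sup>2 + (c / 2) * indicator M x)"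
  proof (rule integral_mono[OF integrable_indicator_sq[OF g M]])
    show "integrable lborel (\<lambda>x. (1 / (2 * c)) * (norm (g x))\<^sup>2 + (c / 2) * indicator M x)"
      using g[THEN sq_integrableD] M by (intro Bochner_Integration.integrable_add integrable_mult_right integrable_real_indicator) auto
    fix x
    have "0 \<le> (g x - c)\<^sup>2" by simp
    then have "2 * c * g x \<le> (g x)\<^sup>2 + c\<^sup>2" by (simp add: power2_diff algebra_simps)
    then have "g x \<le> ((g x)\<^sup>2 + c\<^sup>2) / (2 * c)" using c by (simp add: field_simps)
    also have "\<dots> = (1 / (2 * c)) * (norm (g x))\<^sup>2 + c / 2" using c by (simp add: field_simps power2_eq_square)
    finally show "indicator M x * g x \<le> (1 / (2 * c)) * (norm (g x))\<^sup>2 + (c / 2) * indicator M x"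
      using c by (auto simp: indicator_def)
  qed
  also have "\<dots> = sqn g / (2 * c) + c * measure lborel M / 2"
    using g[THEN sq_integrableD] M
    by (subst Bochner_Integration.integral_add) (auto simp: sqn_def intro!: integrable_real_indicator)
  finally show ?thesis .
qed

text \<open>The test function is \<open>pth a (w - q - a)\<close>, a \<open>C\<^sup>1\<close> regularisation of the positive part of \<open>W - q\<close>, with \<open>w\<close> an
  approximation of \<open>W\<close>; the shift by \<open>a\<close> makes its support compact and disjoint from the complement of \<open>U\<close>.\<close>

lemma weak_comparison:
  fixes W :: "'a::euclidean_space \<Rightarrow> real"
  assumes \<tau>: "\<tau> > 0" and W: "sq_integrable W" "sq_integrable H" "C1c_approx U W H"
    and P: "sq_integrable P" and Q: "sq_integrable Q"
    and sol: "\<And>\<phi> \<phi>'. C1c U \<phi> \<phi>' \<Longrightarrow>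
      (LBINT x. H x \<bullet> \<phi>' x + \<tau>\<^sup>2 * W x * \<phi> x) = (LBINT x. P x * \<phi> x)"
    and q: "C1_grad q q'" "\<And>x. x \<notin> U \<Longrightarrow> 0 \<le> q x" "\<And>a. a > 0 \<Longrightarrow> bounded {x. q x \<le> - a}"
    and super: "\<And>\<phi> \<phi>'. C1c U \<phi> \<phi>' \<Longrightarrow> (\<And>x. 0 \<le> \<phi> x) \<Longrightarrow>
      (LBINT x. Q x * \<phi> x) \<le> (LBINT x. q' x \<bullet> \<phi>' x + \<tau>\<^sup>2 * q x * \<phi> x)"
    and M: "M \<in> sets borel" "emeasure lborel M < \<infinity>" "integrable lborel (\<lambda>x. indicator M x * q x)"
    and c: "c > 0"
  shows "(LBINT x. indicator M x * W x) - (LBINT x. indicator M x * q x)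
      \<le> c * measure lborel M + 2 * sqn (\<lambda>x. P x - Q x) / (c * \<tau>^4)"
proof -
  have main: "(LBINT x. indicator M x * W x) - (LBINT x. indicator M x * q x)
      \<le> c * measure lborel M + 2 * sqn (\<lambda>x. P x - Q x) / (c * \<tau>^4) +
        (a\<^sup>2 + a\<^sup>2 * (1 / \<tau>\<^sup>2 + 2)) / (2 * c) + 2 * a * measure lborel M" if a: "a > 0" for a
  proof -
    have "a\<^sup>2 > 0" using a by simp
    then obtain w w' where w: "C1c U w w'" "sqn (\<lambda>x. W x - w x) < a\<^sup>2" "sqn (\<lambda>x. H x - w' x) < a\<^sup>2"
      using W(3) unfolding C1c_approx_def by blast
    define Z where "Z x = w x - q x - a" for x
    define t where "t x = max 0 (Z x) / sqrt (a\<^sup>2 + psq (Z x))" for x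
    define \<phi> where "\<phi> x = pth a (Z x)" for x
    define \<phi>' where "\<phi>' x = t x *\<^sub>R (w' x - q' x)" for x
    have Z1: "C1_grad Z (\<lambda>x. w' x - q' x - 0)"
      unfolding Z_def[abs_def] by (intro C1_grad_diff C1_grad_const C1c_C1[OF w(1)] q(1))
    have C1: "C1_grad \<phi> \<phi>'"
    proof -
      have "continuous_on (range Z) (\<lambda>t. max 0 t / sqrt (a\<^sup>2 + psq t))"
        unfolding psq_def using a
        by (auto intro!: continuous_intros simp: add_pos_nonneg real_sqrt_eq_zero_cancel_iff dest!: less_imp_neq
            intro: less_imp_neq[symmetric])
      from C1_grad_compose[OF pth_deriv[OF a] this Z1]
      show ?thesis by (simp add: \<phi>_def[abs_def] \<phi>'_def[abs_def] t_def)
    qed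
    obtain S0 where S0: "compact S0" "S0 \<subseteq> U" "\<And>x. x \<notin> S0 \<Longrightarrow> w x = 0"
      using C1c_support[OF w(1)] by metis
    have "closed {x. q x \<le> - a}"
      using C1_grad_cont(1)[OF q(1)] by (intro closed_Collect_le) auto
    then have cq: "compact {x. q x \<le> - a}"
      using q(3)[OF a] by (simp add: compact_eq_bounded_closed)
    \<comment> \<open>Off \<open>S0\<close> one has \<open>w x = 0\<close>, so
      \<open>\<phi> x\<close> can be nonzero only where \<open>q x < - a\<close>; this set is
      bounded by assumption and contained in \<open>U\<close> because \<open>q\<close> is
      nonnegative off \<open>U\<close>.\<close>
    have \<phi>: "C1c U \<phi> \<phi>'"
    proof (rule C1c_I[OF C1])
      show "compact (S0 \<union> {x. q x \<le> - a})" using S0 cq by auto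
      show "S0 \<union> {x. q x \<le> - a} \<subseteq> U" using S0(2) q(2) a by force
      show "\<phi> x = 0" if "x \<notin> S0 \<union> {x. q x \<le> - a}" for x
        using that S0(3)[of x] a unfolding \<phi>_def by (intro pth_nonpos) (auto simp: Z_def)
    qed
    have \<phi>0: "0 \<le> \<phi> x" for x unfolding \<phi>_def by (rule pth_nonneg[OF a])
    have t01: "0 \<le> t x" "t x \<le> 1" for x unfolding t_def by (auto intro: pth_deriv_bounds[OF a])
    obtain S where S: "compact S" "\<And>x. x \<notin> S \<Longrightarrow> \<phi> x = 0" "\<And>x. x \<notin> S \<Longrightarrow> \<phi>' x = 0"
      using C1c_support[OF \<phi>] by metis
    have sqw: "sq_integrable w" "sq_integrable w'" and sq\<phi>: "sq_integrable \<phi>" "sq_integrable \<phi>'"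
      using C1c_sq_integrable[OF w(1)] C1c_sq_integrable[OF \<phi>] by auto
    have i1: "integrable lborel (\<lambda>x. H x \<bullet> \<phi>' x + \<tau>\<^sup>2 * W x * \<phi> x)"
      using integrable_inner[OF W(2) sq\<phi>(2)] integrable_mult_sq[OF W(1) sq\<phi>(1)]
      by (simp add: mult.assoc)
    have i2: "integrable lborel (\<lambda>x. q' x \<bullet> \<phi>' x + \<tau>\<^sup>2 * q x * \<phi> x)"
      using C1_grad_cont[OF q(1)] C1_grad_cont[OF C1] S
      by (intro integrable_continuous_compact_support[of _ S]) (auto intro!: continuous_intros)
    have i3: "integrable lborel (\<lambda>x. P x * \<phi> x)" "integrable lborel (\<lambda>x. Q x * \<phi> x)"
      using integrable_mult_sq[OF P sq\<phi>(1)] integrable_mult_sq[OF Q sq\<phi>(1)] by auto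
    have sqPQ: "sq_integrable (\<lambda>x. P x - Q x)" by (rule sq_integrable_diff[OF P Q])
    have sqWw: "sq_integrable (\<lambda>x. W x - w x)" by (rule sq_integrable_diff[OF W(1) sqw(1)])
    have sqHw: "sq_integrable (\<lambda>x. H x - w' x)" by (rule sq_integrable_diff[OF W(2) sqw(2)])
    \<comment> \<open>The gap between the weak equation for \<open>W\<close> and the supersolution
      inequality for \<open>q\<close>; its integral is nonnegative because \<open>\<phi>\<close> is
      an admissible nonnegative test function for both.\<close>
    define R where "R x = (P x * \<phi> x - Q x * \<phi> x) -
        ((H x \<bullet> \<phi>' x + \<tau>\<^sup>2 * W x * \<phi> x) - (q' x \<bullet> \<phi>' x + \<tau>\<^sup>2 * q x * \<phi> x))" for x
    have R: "0 \<le> (LBINT x. R x)" "integrable lborel R"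
      unfolding R_def[abs_def] using i1 i2 i3 sol[OF \<phi>] super[OF \<phi> \<phi>0] by auto
    \<comment> \<open>The energy estimate, done pointwise. Of
      \<open>\<tau>\<^sup>2 * (\<phi> x)\<^sup>2\<close>, one half is spent on \<open>W - w\<close>
      and a quarter on \<open>P - Q\<close>; a quarter survives on the left.\<close>
    have pt: "\<tau>\<^sup>2 / 4 * (norm (\<phi> x))\<^sup>2 + R x \<le> (1 / \<tau>\<^sup>2) * (norm (P x - Q x))\<^sup>2 + (1/4) * (norm (H x - w' x))\<^sup>2
        + \<tau>\<^sup>2 / 2 * (norm (W x - w x))\<^sup>2" for x
    proof -
      define X where "X = w' x - q' x"
      define Y where "Y = H x - w' x"
      have "H x \<bullet> \<phi>' x - q' x \<bullet> \<phi>' x = t x * ((X + Y) \<bullet> X)"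
        by (simp add: \<phi>'_def X_def Y_def inner_diff_left algebra_simps)
      \<comment> \<open>Completing the square: only the approximation error \<open>Y\<close> of the
        gradient can make this term negative.\<close>
      moreover have "(X + Y) \<bullet> X \<ge> - (1/4) * (norm Y)\<^sup>2"
      proof -
        have "0 \<le> (norm (X + (1/2) *\<^sub>R Y))\<^sup>2" by simp
        also have "\<dots> = (X + Y) \<bullet> X + (1/4) * (norm Y)\<^sup>2"
          unfolding power2_norm_eq_inner by (simp add: inner_add_left inner_add_right inner_commute algebra_simps)
        finally show ?thesis by simp
      qed
      then have "t x * ((X + Y) \<bullet> X) \<ge> t x * (- (1/4) * (norm Y)\<^sup>2)"
        using t01 by (intro mult_left_mono) auto
      moreover have "t x * ((1/4) * (norm Y)\<^sup>2) \<le> 1 * ((1/4) * (norm Y)\<^sup>2)"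
        using t01 by (intro mult_right_mono) auto
      ultimately have A: "H x \<bullet> \<phi>' x - q' x \<bullet> \<phi>' x \<ge> - (1/4) * (norm Y)\<^sup>2" by simp
      have "(W x - q x) * \<phi> x = Z x * \<phi> x + a * \<phi> x + (W x - w x) * \<phi> x"
        by (simp add: Z_def algebra_simps)
      moreover have "Z x * \<phi> x \<ge> (\<phi> x)\<^sup>2" unfolding \<phi>_def by (rule pth_square_le[OF a])
      moreover have "a * \<phi> x \<ge> 0" using a \<phi>0 by simp
      moreover have "(W x - w x) * \<phi> x \<ge> - (1/2) * (\<phi> x)\<^sup>2 - (1/2) * (W x - w x)\<^sup>2"
      proof -
        have "0 \<le> (\<phi> x + (W x - w x))\<^sup>2" by simp
        also have "\<dots> = (\<phi> x)\<^sup>2 + (W x - w x)\<^sup>2 + 2 * ((W x - w x) * \<phi> x)"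
          unfolding power2_sum by (simp add: mult_ac)
        finally show ?thesis by simp
      qed
      ultimately have "(W x - q x) * \<phi> x \<ge> (1/2) * (\<phi> x)\<^sup>2 - (1/2) * (W x - w x)\<^sup>2" by linarith
      then have B: "\<tau>\<^sup>2 * ((W x - q x) * \<phi> x) \<ge> \<tau>\<^sup>2 * ((1/2) * (\<phi> x)\<^sup>2 - (1/2) * (W x - w x)\<^sup>2)"
        by (intro mult_left_mono) auto
      have C: "(P x - Q x) * \<phi> x \<le> (1 / \<tau>\<^sup>2) * (P x - Q x)\<^sup>2 + \<tau>\<^sup>2 / 4 * (\<phi> x)\<^sup>2"
      proof -
        have sq: "((1 / \<tau>) * d - (\<tau> / 2) * y)\<^sup>2 = (1 / \<tau>\<^sup>2) * d\<^sup>2 + \<tau>\<^sup>2 / 4 * y\<^sup>2 - d * y" for d y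
          using \<tau> by (simp add: power2_eq_square field_simps)
        have "0 \<le> ((1 / \<tau>) * (P x - Q x) - (\<tau> / 2) * \<phi> x)\<^sup>2" by simp
        also have "\<dots> = (1 / \<tau>\<^sup>2) * (P x - Q x)\<^sup>2 + \<tau>\<^sup>2 / 4 * (\<phi> x)\<^sup>2 - (P x - Q x) * \<phi> x"
          by (rule sq)
        finally show ?thesis by simp
      qed
      have "R x = (P x - Q x) * \<phi> x - (H x \<bullet> \<phi>' x - q' x \<bullet> \<phi>' x) - \<tau>\<^sup>2 * ((W x - q x) * \<phi> x)"
        by (simp add: R_def algebra_simps)
      then have "\<tau>\<^sup>2 / 4 * (\<phi> x)\<^sup>2 + R x \<le> (1 / \<tau>\<^sup>2) * (P x - Q x)\<^sup>2 + (1/4) * (norm Y)\<^sup>2 + \<tau>\<^sup>2 / 2 * (W x - w x)\<^sup>2"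
        using A B C by (simp add: algebra_simps)
      then show ?thesis by (simp add: Y_def)
    qed
    have "\<tau>\<^sup>2 / 4 * sqn \<phi> \<le> \<tau>\<^sup>2 / 4 * sqn \<phi> + (LBINT x. R x)" using R by simp
    also have "\<dots> = (LBINT x. \<tau>\<^sup>2 / 4 * (norm (\<phi> x))\<^sup>2 + R x)"
      using sq\<phi>(1)[THEN sq_integrableD] R by (simp add: sqn_def)
    also have "\<dots> \<le> (LBINT x. (1 / \<tau>\<^sup>2) * (norm (P x - Q x))\<^sup>2 + (1/4) * (norm (H x - w' x))\<^sup>2
        + \<tau>\<^sup>2 / 2 * (norm (W x - w x))\<^sup>2)"
      using sq\<phi>(1)[THEN sq_integrableD] R sqPQ[THEN sq_integrableD] sqWw[THEN sq_integrableD] sqHw[THEN sq_integrableD]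
      by (intro integral_mono pt) auto
    also have "\<dots> = (1 / \<tau>\<^sup>2) * sqn (\<lambda>x. P x - Q x) + (1/4) * sqn (\<lambda>x. H x - w' x) + \<tau>\<^sup>2 / 2 * sqn (\<lambda>x. W x - w x)"
      using sqPQ[THEN sq_integrableD] sqWw[THEN sq_integrableD] sqHw[THEN sq_integrableD]
      by (simp add: sqn_def)
    also have "\<dots> \<le> (1 / \<tau>\<^sup>2) * sqn (\<lambda>x. P x - Q x) + (1/4) * a\<^sup>2 + \<tau>\<^sup>2 / 2 * a\<^sup>2"
      using w(2,3) by (intro add_mono mult_left_mono) auto
    finally have "\<tau>\<^sup>2 / 4 * sqn \<phi> \<le> (1 / \<tau>\<^sup>2) * sqn (\<lambda>x. P x - Q x) + (1/4) * a\<^sup>2 + \<tau>\<^sup>2 / 2 * a\<^sup>2" .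
    then have "4 / \<tau>\<^sup>2 * (\<tau>\<^sup>2 / 4 * sqn \<phi>) \<le> 4 / \<tau>\<^sup>2 * ((1 / \<tau>\<^sup>2) * sqn (\<lambda>x. P x - Q x) + (1/4) * a\<^sup>2 + \<tau>\<^sup>2 / 2 * a\<^sup>2)"
      by (intro mult_left_mono) auto
    then have nphi: "sqn \<phi> \<le> 4 * sqn (\<lambda>x. P x - Q x) / \<tau>^4 + a\<^sup>2 * (1 / \<tau>\<^sup>2 + 2)"
    proof -
      have "4 / \<tau>\<^sup>2 * (\<tau>\<^sup>2 / 4 * y) = y" "4 / \<tau>\<^sup>2 * ((1 / \<tau>\<^sup>2) * y + (1/4) * z + \<tau>\<^sup>2 / 2 * z) = 4 * y / \<tau>^4 + z * (1 / \<tau>\<^sup>2 + 2)" for y z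
        using \<tau> by (simp_all add: field_simps power4_eq_xxxx power2_eq_square)
      then show ?thesis
        using \<open>4 / \<tau>\<^sup>2 * (\<tau>\<^sup>2 / 4 * sqn \<phi>) \<le> _\<close> by (simp only:)
    qed
    have iM: "integrable lborel (\<lambda>x. indicator M x * (W x - w x))" "integrable lborel (\<lambda>x. indicator M x * \<phi> x)"
      "integrable lborel (\<lambda>x. indicator M x * W x)"
      using integrable_indicator_sq[OF _ M(1,2)] sqWw sq\<phi>(1) W(1) by auto
    have iMM: "integrable lborel (\<lambda>x. 2 * a * indicator M x)"
      using M by (intro integrable_mult_right integrable_real_indicator) auto
    have "(LBINT x. indicator M x * W x) - (LBINT x. indicator M x * q x)
        = (LBINT x. indicator M x * W x - indicator M x * q x)"
      using iM(3) M(3) by simp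
    also have "\<dots> \<le> (LBINT x. indicator M x * (W x - w x) + indicator M x * \<phi> x + 2 * a * indicator M x)"
    proof (rule integral_mono)
      fix x
      have "w x - q x \<le> 2 * a + \<phi> x" using le_pth[OF a, of "Z x"] by (simp add: \<phi>_def Z_def)
      then show "indicator M x * W x - indicator M x * q x \<le> indicator M x * (W x - w x) + indicator M x * \<phi> x + 2 * a * indicator M x"
        by (auto simp: indicator_def)
    qed (use iM iMM M(3) in auto)
    also have "\<dots> = (LBINT x. indicator M x * (W x - w x)) + (LBINT x. indicator M x * \<phi> x) + 2 * a * measure lborel M"
      using iM iMM M by simp
    also have "\<dots> \<le> (sqn (\<lambda>x. W x - w x) / (2 * c) + c * measure lborel M / 2) + (sqn \<phi> / (2 * c) + c * measure lborel M / 2)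
        + 2 * a * measure lborel M"
      by (intro add_mono indicator_integral_le_sqn sqWw sq\<phi>(1) M(1,2) c order_refl)
    also have "\<dots> \<le> (a\<^sup>2 / (2 * c) + c * measure lborel M / 2) +
        ((4 * sqn (\<lambda>x. P x - Q x) / \<tau>^4 + a\<^sup>2 * (1 / \<tau>\<^sup>2 + 2)) / (2 * c) + c * measure lborel M / 2)
        + 2 * a * measure lborel M"
      using w(2) nphi c by (intro add_mono divide_right_mono order_refl) auto
    also have "\<dots> = c * measure lborel M + 2 * sqn (\<lambda>x. P x - Q x) / (c * \<tau>^4) +
        (a\<^sup>2 + a\<^sup>2 * (1 / \<tau>\<^sup>2 + 2)) / (2 * c) + 2 * a * measure lborel M"
      using c by (simp add: add_divide_distrib)
    finally show ?thesis .
  qed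
  \<comment> \<open>The approximation parameter \<open>a\<close> occurs only on the right-hand side,
    so it may tend to 0.\<close>
  let ?r = "\<lambda>a. c * measure lborel M + 2 * sqn (\<lambda>x. P x - Q x) / (c * \<tau>^4) +
        (a\<^sup>2 + a\<^sup>2 * (1 / \<tau>\<^sup>2 + 2)) / (2 * c) + 2 * a * measure lborel M"
  have "(?r \<longlongrightarrow> ?r 0) (at_right 0)"
    using c by (intro tendsto_intros) auto
  then have "(?r \<longlongrightarrow> c * measure lborel M + 2 * sqn (\<lambda>x. P x - Q x) / (c * \<tau>^4)) (at_right 0)"
    by simp
  then show ?thesis
    by (rule tendsto_lowerbound) (auto intro!: eventually_at_rightI[of 0 1] main)
qed

section \<open>Regularised Yukawa potentials\<close>

lemma distr_neg_norm:
  "distr lborel borel (\<lambda>x::real^3. - norm x) = density lborel (\<lambda>r. ennreal (4 * pi * r\<^sup>2) * indicator {..0} r)"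
proof (rule measure_eqI_lessThan)
  \<comment> \<open>The sign is reversed because the uniqueness criterion tests half-lines
    \<open>{a<..}\<close> of finite measure: their preimages under the negative norm are balls,
    under the norm they would be complements of balls.\<close>
  have eq: "emeasure (distr lborel borel (\<lambda>x::real^3. - norm x)) {a<..} = ennreal (if a < 0 then 4 / 3 * pi * (- a)^3 else 0)" for a
  proof -
    have "emeasure (distr lborel borel (\<lambda>x::real^3. - norm x)) {a<..} = emeasure lborel {x::real^3. a < - norm x}"
      by (subst emeasure_distr) (auto simp: vimage_def)
    also have "{x::real^3. a < - norm x} = (if a < 0 then ball 0 (- a) else {})"
      using norm_ge_zero by (auto simp: not_less) (smt (verit) norm_ge_zero)
    finally show ?thesis
      by (auto simp: emeasure_ball unit_ball_vol_3)
  qed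
  show "emeasure (distr lborel borel (\<lambda>x::real^3. - norm x)) {a<..} < \<infinity>" for a
    unfolding eq by simp
  show "emeasure (distr lborel borel (\<lambda>x::real^3. - norm x)) {a<..} =
      emeasure (density lborel (\<lambda>r. ennreal (4 * pi * r\<^sup>2) * indicator {..0} r)) {a<..}" for a
  proof -
    have "emeasure (density lborel (\<lambda>r. ennreal (4 * pi * r\<^sup>2) * indicator {..0} r)) {a<..} =
        (\<integral>\<^sup>+r. ennreal (4 * pi * r\<^sup>2) * indicator {..0} r * indicator {a<..} r \<partial>lborel)"
      by (subst emeasure_density) auto
    also have "\<dots> = ennreal (if a < 0 then 4 / 3 * pi * (- a)^3 else 0)"
    proof (cases "a < 0")
      case True
      have "(\<integral>\<^sup>+r. ennreal (4 * pi * r\<^sup>2) * indicator {..0} r * indicator {a<..} r \<partial>lborel)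
          = (\<integral>\<^sup>+r. ennreal (4 * pi * r\<^sup>2) * indicator {a..0} r \<partial>lborel)"
        using AE_lborel_singleton[of a] by (intro nn_integral_cong_AE) (auto simp: indicator_def elim: eventually_mono)
      also have "\<dots> = ennreal (4 / 3 * pi * 0^3 - 4 / 3 * pi * a^3)"
        by (rule nn_integral_FTC_Icc) (use True in \<open>auto intro!: derivative_eq_intros\<close>)
      also have "4 / 3 * pi * 0^3 - 4 / 3 * pi * a^3 = 4 / 3 * pi * (- a)^3"
        by (simp add: power3_eq_cube)
      finally show ?thesis using True by simp
    next
      case False
      have "(\<lambda>r. ennreal (4 * pi * r\<^sup>2) * indicator {..0} r * indicator {a<..} r) = (\<lambda>r. 0)"
        using False by (auto simp: indicator_def fun_eq_iff)
      then show ?thesis using False by simp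
    qed
    finally show ?thesis unfolding eq by simp
  qed
qed auto

lemma nn_integral_radial:
  fixes f :: "real \<Rightarrow> ennreal"
  assumes [measurable]: "f \<in> borel_measurable borel"
  shows "(\<integral>\<^sup>+x. f (norm (x::real^3)) \<partial>lborel) = (\<integral>\<^sup>+r. ennreal (4 * pi * r\<^sup>2) * f r * indicator {0..} r \<partial>lborel)"
proof -
  have "(\<integral>\<^sup>+x. f (norm (x::real^3)) \<partial>lborel) = (\<integral>\<^sup>+r. f (- r) \<partial>distr lborel borel (\<lambda>x::real^3. - norm x))"
    by (subst nn_integral_distr) auto
  also have "\<dots> = (\<integral>\<^sup>+r. ennreal (4 * pi * r\<^sup>2) * indicator {..0} r * f (- r) \<partial>lborel)"
    unfolding distr_neg_norm by (subst nn_integral_density) auto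
  also have "\<dots> = (\<integral>\<^sup>+r. ennreal (4 * pi * r\<^sup>2) * f r * indicator {0..} r \<partial>lborel)"
    by (subst nn_integral_real_affine[of _ "-1" 0])
       (auto simp: indicator_def mult_ac intro!: nn_integral_cong)
  finally show ?thesis .
qed

text \<open>A smooth substitute for \<open>norm x\<close>, bounded below by \<open>e\<close>. It
  makes the kernels C^1 and bounded, so no neighbourhood of a singularity has to be excised.\<close>

definition sreg :: "real \<Rightarrow> real^3 \<Rightarrow> real" where
  "sreg e x = sqrt ((norm x)\<^sup>2 + e\<^sup>2)"

text \<open>\<open>yuk'\<close> is the gradient of \<open>yuk\<close>, and \<open>ksrc = (k\<^sup>2 - \<Delta>) yuk\<close>; as \<open>e \<rightarrow> 0\<close>, \<open>ksrc\<close> tends to \<open>4 \<pi>\<close> times the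
  Dirac measure at the origin.\<close>

definition yuk :: "real \<Rightarrow> real \<Rightarrow> real^3 \<Rightarrow> real" where
  "yuk k e x = exp (- k * sreg e x) / sreg e x"

definition yuk1 :: "real \<Rightarrow> real \<Rightarrow> real^3 \<Rightarrow> real" where
  "yuk1 k e x = exp (- k * sreg e x) * (k / (sreg e x)\<^sup>2 + 1 / (sreg e x)^3)"

definition yuk' :: "real \<Rightarrow> real \<Rightarrow> real^3 \<Rightarrow> real^3" where
  "yuk' k e x = (- yuk1 k e x) *\<^sub>R x"

definition ksrc :: "real \<Rightarrow> real \<Rightarrow> real^3 \<Rightarrow> real" where
  "ksrc k e x = e\<^sup>2 * exp (- k * sreg e x) * (k\<^sup>2 / (sreg e x)^3 + 3 * k / (sreg e x)^4 + 3 / (sreg e x)^5)"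

lemma sreg_pos: "e > 0 \<Longrightarrow> sreg e x > 0"
  by (simp add: sreg_def add_nonneg_pos)

lemma sreg_ge: "e > 0 \<Longrightarrow> e \<le> sreg e x" "norm x \<le> sreg e x"
  unfolding sreg_def by (auto intro!: real_le_rsqrt)

lemma sreg_le: "e > 0 \<Longrightarrow> sreg e x \<le> norm x + e"
  unfolding sreg_def by (rule sqrt_sum_squares_le_sum) auto

lemma sreg_sq: "(sreg e x)\<^sup>2 = (norm x)\<^sup>2 + e\<^sup>2"
  by (simp add: sreg_def)

lemma sreg_C1:
  assumes e: "e > 0" shows "C1_grad (sreg e) (\<lambda>x. (1 / sreg e x) *\<^sub>R x)"
proof -
  have g: "((\<lambda>t. sqrt (t + e\<^sup>2)) has_real_derivative inverse (2 * sqrt ((norm (x - 0))\<^sup>2 + e\<^sup>2))) (at ((norm (x - 0))\<^sup>2))" for x :: "real^3"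
  proof -
    have "0 < (norm x)\<^sup>2 + e\<^sup>2" using e by (simp add: add_nonneg_pos)
    then show ?thesis
      by (auto intro!: derivative_eq_intros simp: field_simps)
  qed
  have "C1_grad (\<lambda>x::real^3. sqrt ((norm (x - 0))\<^sup>2 + e\<^sup>2)) (\<lambda>x. inverse (2 * sqrt ((norm (x - 0))\<^sup>2 + e\<^sup>2)) *\<^sub>R 2 *\<^sub>R (x - 0))"
  proof (rule C1_grad_compose[OF g _ C1_grad_norm_sq])
    show "continuous_on (range (\<lambda>x::real^3. (norm (x - 0))\<^sup>2)) (\<lambda>t. inverse (2 * sqrt (t + e\<^sup>2)))"
      using e by (intro continuous_intros) (auto simp: add_nonneg_eq_0_iff)
  qed
  moreover have "(\<lambda>x::real^3. sqrt ((norm (x - 0))\<^sup>2 + e\<^sup>2)) = sreg e"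
    by (simp add: sreg_def fun_eq_iff)
  moreover have "(\<lambda>x::real^3. inverse (2 * sqrt ((norm (x - 0))\<^sup>2 + e\<^sup>2)) *\<^sub>R 2 *\<^sub>R (x - 0)) = (\<lambda>x. (1 / sreg e x) *\<^sub>R x)"
    by (simp add: sreg_def fun_eq_iff field_simps)
  ultimately show ?thesis by simp
qed

lemma yuk_C1:
  assumes e: "e > 0" shows "C1_grad (yuk k e) (yuk' k e)"
proof -
  define g' where "g' s = - exp (- k * s) * (k / s + 1 / s\<^sup>2)" for s :: real
  have g: "((\<lambda>s. exp (- k * s) / s) has_real_derivative g' (sreg e x)) (at (sreg e x))" for x
    unfolding g'_def using sreg_pos[OF e, of x]
    by (auto intro!: derivative_eq_intros simp: field_simps power2_eq_square)
  have "C1_grad (\<lambda>x. exp (- k * sreg e x) / sreg e x) (\<lambda>x. g' (sreg e x) *\<^sub>R (1 / sreg e x) *\<^sub>R x)"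
  proof (rule C1_grad_compose[OF g _ sreg_C1[OF e]])
    have "sreg e x \<noteq> 0" for x using sreg_pos[OF e, of x] by simp
    then show "continuous_on (range (sreg e)) g'"
      unfolding g'_def by (intro continuous_intros) auto
  qed
  moreover have "g' (sreg e x) *\<^sub>R (1 / sreg e x) *\<^sub>R x = yuk' k e x" for x
  proof -
    have "g' (sreg e x) * (1 / sreg e x) = - yuk1 k e x"
      using sreg_pos[OF e, of x] by (simp add: g'_def yuk1_def field_simps power2_eq_square power3_eq_cube)
    then show ?thesis unfolding scaleR_scaleR yuk'_def by (simp only:)
  qed
  ultimately show ?thesis by (simp add: yuk_def[abs_def] fun_eq_iff)
qed

text \<open>Second derivatives of \<open>yuk\<close> in the form
  \<open>C1c_integral_by_parts\<close> asks for: each component of the gradient is C^1.\<close>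

lemma yuk'_comp_C1:
  assumes e: "e > 0"
  shows "C1_grad (\<lambda>x. yuk' k e x \<bullet> b) (\<lambda>x. (exp (- k * sreg e x) * (k\<^sup>2 / (sreg e x)^3 + 3 * k / (sreg e x)^4 + 3 / (sreg e x)^5) * (x \<bullet> b)) *\<^sub>R x
      - yuk1 k e x *\<^sub>R b)"
proof -
  define g' where "g' s = - exp (- k * s) * (k\<^sup>2 / s\<^sup>2 + 3 * k / s^3 + 3 / s^4)" for s :: real
  have g: "((\<lambda>s. exp (- k * s) * (k / s\<^sup>2 + 1 / s^3)) has_real_derivative g' (sreg e x)) (at (sreg e x))" for x
    unfolding g'_def using sreg_pos[OF e, of x]
    by (auto intro!: derivative_eq_intros simp: field_simps power2_eq_square power3_eq_cube power4_eq_xxxx)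
  have c1: "C1_grad (yuk1 k e) (\<lambda>x. g' (sreg e x) *\<^sub>R (1 / sreg e x) *\<^sub>R x)"
    unfolding yuk1_def[abs_def]
  proof (rule C1_grad_compose[OF g _ sreg_C1[OF e]])
    have "sreg e x \<noteq> 0" for x using sreg_pos[OF e, of x] by simp
    then show "continuous_on (range (sreg e)) g'"
      unfolding g'_def by (intro continuous_intros) auto
  qed
  have c2: "C1_grad (\<lambda>x::real^3. x \<bullet> b) (\<lambda>x. b)"
    unfolding C1_grad_def by (auto intro!: derivative_eq_intros simp: inner_commute)
  from C1_grad_cmult[OF C1_grad_mult[OF c1 c2], of "-1"]
  have "C1_grad (\<lambda>x. - 1 * (yuk1 k e x * (x \<bullet> b)))
     (\<lambda>x. - 1 *\<^sub>R (yuk1 k e x *\<^sub>R b + (x \<bullet> b) *\<^sub>R g' (sreg e x) *\<^sub>R (1 / sreg e x) *\<^sub>R x))" .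
  moreover have "- 1 * (yuk1 k e x * (x \<bullet> b)) = yuk' k e x \<bullet> b" for x
    by (simp add: yuk'_def)
  moreover have "- 1 *\<^sub>R (yuk1 k e x *\<^sub>R b + (x \<bullet> b) *\<^sub>R g' (sreg e x) *\<^sub>R (1 / sreg e x) *\<^sub>R x)
     = (exp (- k * sreg e x) * (k\<^sup>2 / (sreg e x)^3 + 3 * k / (sreg e x)^4 + 3 / (sreg e x)^5) * (x \<bullet> b)) *\<^sub>R x
      - yuk1 k e x *\<^sub>R b" for x
  proof -
    define c where "c = exp (- k * sreg e x) * (k\<^sup>2 / (sreg e x)^3 + 3 * k / (sreg e x)^4 + 3 / (sreg e x)^5)"
    have "g' (sreg e x) * (1 / sreg e x) = - c"
      using sreg_pos[OF e, of x] by (simp add: c_def g'_def field_simps eval_nat_numeral)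
    then have c: "g' (sreg e x) *\<^sub>R (1 / sreg e x) *\<^sub>R x = (- c) *\<^sub>R x"
      unfolding scaleR_scaleR by (simp only:)
    show ?thesis
      unfolding c c_def[symmetric] by (simp add: algebra_simps)
  qed
  ultimately show ?thesis by (simp only:)
qed

text \<open>One integration by parts in each coordinate moves the derivative onto
  \<open>yuk'\<close>, and the trace of its derivative is the Laplacian computed in
  \<open>lap\<close>.\<close>

lemma yuk_weak:
  assumes e: "e > 0" and \<phi>: "C1c U \<phi> \<phi>'"
  shows "(LBINT x. yuk' k e (x - p) \<bullet> \<phi>' x + k\<^sup>2 * yuk k e (x - p) * \<phi> x) = (LBINT x. ksrc k e (x - p) * \<phi> x)"
proof -
  define E where "E x = exp (- k * sreg e x) * (k\<^sup>2 / (sreg e x)^3 + 3 * k / (sreg e x)^4 + 3 / (sreg e x)^5)" for x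
  define gb where "gb b x = (E x * (x \<bullet> b)) *\<^sub>R x - yuk1 k e x *\<^sub>R b" for b x
  have gC: "C1_grad (\<lambda>x. yuk' k e (x - p) \<bullet> b) (\<lambda>x. gb b (x - p))" for b
    unfolding gb_def E_def by (rule C1_grad_shift[OF yuk'_comp_C1[OF e]])
  obtain S where S: "compact S" "\<And>x. x \<notin> S \<Longrightarrow> \<phi> x = 0" "\<And>x. x \<notin> S \<Longrightarrow> \<phi>' x = 0"
    using C1c_support[OF \<phi>] by metis
  note cont = C1_grad_cont[OF gC] C1_grad_cont[OF C1c_C1[OF \<phi>]] C1_grad_cont[OF C1_grad_shift[OF yuk_C1[OF e]]]
  have i1: "integrable lborel (\<lambda>x. (yuk' k e (x - p) \<bullet> b) * (\<phi>' x \<bullet> b))" for b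
    by (rule integrable_continuous_compact_support[OF _ S(1)]) (auto intro!: continuous_intros cont simp: S)
  have i2: "integrable lborel (\<lambda>x. (gb b (x - p) \<bullet> b) * \<phi> x)" for b
    by (rule integrable_continuous_compact_support[OF _ S(1)]) (auto intro!: continuous_intros cont simp: S)
  have i3: "integrable lborel (\<lambda>x. k\<^sup>2 * yuk k e (x - p) * \<phi> x)"
    by (rule integrable_continuous_compact_support[OF _ S(1)]) (auto intro!: continuous_intros cont simp: S)
  \<comment> \<open>Replacing \<open>(norm x)\<^sup>2\<close> by
    \<open>(sreg e x)\<^sup>2 - e\<^sup>2\<close> isolates the effect of the regularisation: the
    \<open>sreg\<close> part is exactly \<open>k\<^sup>2 * yuk k e x\<close>, the
    \<open>e\<^sup>2\<close> part is the source.\<close>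
  have lap: "(\<Sum>b\<in>Basis. gb b x \<bullet> b) = k\<^sup>2 * yuk k e x - ksrc k e x" for x
  proof -
    have s: "sreg e x > 0" by (rule sreg_pos[OF e])
    have "(\<Sum>b\<in>Basis. gb b x \<bullet> b) = (\<Sum>b\<in>Basis. E x * ((x \<bullet> b) * (x \<bullet> b)) - yuk1 k e x)"
      by (intro sum.cong) (auto simp: gb_def inner_diff_left)
    also have "\<dots> = E x * (norm x)\<^sup>2 - 3 * yuk1 k e x"
      by (simp add: sum_subtractf flip: sum_distrib_left euclidean_inner power2_norm_eq_inner)
    also have "(norm x)\<^sup>2 = (sreg e x)\<^sup>2 - e\<^sup>2" by (simp add: sreg_sq)
    also have "E x * ((sreg e x)\<^sup>2 - e\<^sup>2) - 3 * yuk1 k e x = k\<^sup>2 * yuk k e x - ksrc k e x"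
      using s by (simp add: E_def yuk1_def yuk_def ksrc_def field_simps eval_nat_numeral)
    finally show ?thesis .
  qed
  have "(LBINT x. yuk' k e (x - p) \<bullet> \<phi>' x) = (LBINT x. (\<Sum>b\<in>Basis. (yuk' k e (x - p) \<bullet> b) * (\<phi>' x \<bullet> b)))"
    by (intro Bochner_Integration.integral_cong refl) (rule euclidean_inner)
  also have "\<dots> = (\<Sum>b\<in>Basis. LBINT x. (yuk' k e (x - p) \<bullet> b) * (\<phi>' x \<bullet> b))"
    using i1 by (rule Bochner_Integration.integral_sum)
  also have "\<dots> = (\<Sum>b\<in>Basis. - (LBINT x. (gb b (x - p) \<bullet> b) * \<phi> x))"
    by (intro sum.cong refl C1c_integral_by_parts[OF \<phi> gC])
  also have "\<dots> = - (LBINT x. (\<Sum>b\<in>Basis. (gb b (x - p) \<bullet> b) * \<phi> x))"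
    using i2 by (simp add: sum_negf Bochner_Integration.integral_sum)
  also have "\<dots> = - (LBINT x. (k\<^sup>2 * yuk k e (x - p) - ksrc k e (x - p)) * \<phi> x)"
    by (simp flip: sum_distrib_right add: lap)
  finally have 1: "(LBINT x. yuk' k e (x - p) \<bullet> \<phi>' x) = - (LBINT x. (k\<^sup>2 * yuk k e (x - p) - ksrc k e (x - p)) * \<phi> x)" .
  have i4: "integrable lborel (\<lambda>x. yuk' k e (x - p) \<bullet> \<phi>' x)"
    by (rule integrable_continuous_compact_support[OF _ S(1)]) (auto intro!: continuous_intros cont simp: S)
  have i5: "integrable lborel (\<lambda>x. (k\<^sup>2 * yuk k e (x - p) - ksrc k e (x - p)) * \<phi> x)"
    using i2 by (simp flip: lap add: sum_distrib_right)
  have i6: "integrable lborel (\<lambda>x. ksrc k e (x - p) * \<phi> x)"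
    using Bochner_Integration.integrable_diff[OF i3 i5] by (simp add: algebra_simps)
  have "(LBINT x. (k\<^sup>2 * yuk k e (x - p) - ksrc k e (x - p)) * \<phi> x) =
    (LBINT x. k\<^sup>2 * yuk k e (x - p) * \<phi> x) - (LBINT x. ksrc k e (x - p) * \<phi> x)"
    using i3 i6 by (simp add: left_diff_distrib)
  then show ?thesis
    using 1 i3 i4 by simp
qed

lemma yuk_pos: "e > 0 \<Longrightarrow> yuk k e x > 0"
  using sreg_pos[of e x] by (simp add: yuk_def)

lemma yuk_le:
  assumes "e > 0" "k \<ge> 0" "a \<le> norm x" "0 < b" "b \<le> norm x"
  shows "yuk k e x \<le> exp (- k * a) / b"
  unfolding yuk_def using assms sreg_ge(2)[of x e]
  by (intro frac_le) (auto intro: mult_left_mono)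

lemma yuk_le':
  assumes "e > 0" "k \<ge> 0" "d \<le> norm x"
  shows "yuk k e x \<le> exp (- k * d) / e"
  unfolding yuk_def using assms sreg_ge(1)[of e x] sreg_ge(2)[of x e]
  by (intro frac_le) (auto intro: mult_left_mono)

lemma yuk_ge:
  assumes "e > 0" "k \<ge> 0" "norm x + e \<le> a" "norm x + e \<le> b"
  shows "exp (- k * a) / b \<le> yuk k e x"
proof -
  have "sreg e x \<le> a" "sreg e x \<le> b" using sreg_le[OF assms(1), of x] assms(3,4) by auto
  then show ?thesis unfolding yuk_def using assms sreg_pos[OF assms(1), of x]
    by (intro frac_le) (auto intro: mult_left_mono)
qed

lemma yuk_bounded: 
  assumes "e > 0" "k \<ge> 0"
  shows "\<bar>yuk k e x\<bar> \<le> 1 / e + k / e + 1 / e\<^sup>2" "norm (yuk' k e x) \<le> 1 / e + k / e + 1 / e\<^sup>2"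
proof -
  let ?s = "sreg e x"
  have s: "0 < ?s" "e \<le> ?s" "norm x \<le> ?s" using sreg_pos[OF assms(1)] sreg_ge(1)[OF assms(1), of x] sreg_ge(2)[of x e] by auto
  have "\<bar>yuk k e x\<bar> \<le> exp (- k * 0) / e"
    using yuk_le'[OF assms, of 0 x] yuk_pos[OF assms(1), of k x] by simp
  then show "\<bar>yuk k e x\<bar> \<le> 1 / e + k / e + 1 / e\<^sup>2" using assms by (simp add: add_increasing2)
  have y0: "yuk1 k e x \<ge> 0" using s assms by (simp add: yuk1_def)
  have "norm (yuk' k e x) = yuk1 k e x * norm x" using y0 by (simp add: yuk'_def)
  also have "\<dots> \<le> yuk1 k e x * ?s" using y0 s by (intro mult_left_mono) auto
  also have "\<dots> = exp (- k * ?s) * (k / ?s + 1 / ?s\<^sup>2)"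
    using s by (simp add: yuk1_def field_simps power2_eq_square power3_eq_cube)
  also have "\<dots> \<le> 1 * (k / e + 1 / e\<^sup>2)"
    using s assms by (intro mult_mono add_mono divide_left_mono power_mono) auto
  finally have "norm (yuk' k e x) \<le> k / e + 1 / e\<^sup>2" by simp
  moreover have "0 \<le> 1 / e" using assms by simp
  ultimately show "norm (yuk' k e x) \<le> 1 / e + k / e + 1 / e\<^sup>2" by linarith
qed

lemma ksrc_nonneg: "e > 0 \<Longrightarrow> k \<ge> 0 \<Longrightarrow> 0 \<le> ksrc k e x"
  using sreg_pos[of e x] by (simp add: ksrc_def)

lemma ksrc_measurable [measurable]: "ksrc k e \<in> borel_measurable borel"
  unfolding ksrc_def[abs_def] sreg_def by measurable

text \<open>At scale \<open>e\<close>, the source depends on \<open>e\<close> only through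
  \<open>y = k * e * sreg 1 z\<close>, in the profile
  \<open>exp (- y) * (y\<^sup>2 + 3 * y + 3)\<close>. So it concentrates at the origin like an
  approximate identity.\<close>

lemma ksrc_scaled:
  assumes e: "e > 0"
  shows "e^3 * ksrc k e (e *\<^sub>R z) = exp (- (k * e * sreg 1 z)) * ((k * e * sreg 1 z)\<^sup>2 + 3 * (k * e * sreg 1 z) + 3) / (sreg 1 z)^5"
proof -
  have s: "sreg e (e *\<^sub>R z) = e * sreg 1 z"
  proof -
    have "(norm (e *\<^sub>R z))\<^sup>2 + e\<^sup>2 = e\<^sup>2 * ((norm z)\<^sup>2 + 1\<^sup>2)"
      by (simp add: power_mult_distrib algebra_simps)
    then show ?thesis unfolding sreg_def using e by (simp add: real_sqrt_mult)
  qed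
  have "sreg 1 z > 0" by (rule sreg_pos) simp
  then show ?thesis
    unfolding ksrc_def s using e by (simp add: field_simps eval_nat_numeral)
qed

text \<open>The quadratic Taylor bound for the exponential makes the profile at most 3, a dominating
  function independent of \<open>e\<close> and \<open>k\<close>.\<close>

lemma ksrc_scaled_le:
  assumes "e > 0" "k \<ge> 0"
  shows "e^3 * ksrc k e (e *\<^sub>R z) \<le> 3 / (sreg 1 z)^5"
proof -
  define y where "y = k * e * sreg 1 z"
  have s: "sreg 1 z > 0" by (rule sreg_pos) simp
  have y: "y \<ge> 0" using assms s by (simp add: y_def)
  have "y\<^sup>2 + 3 * y + 3 \<le> 3 * (1 + y + y\<^sup>2 / 2)" using zero_le_power2[of y] by (simp add: algebra_simps del: zero_le_power2)
  also have "\<dots> \<le> 3 * exp y" using exp_lower_Taylor_quadratic[OF y] by simp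
  finally have "exp (- y) * (y\<^sup>2 + 3 * y + 3) \<le> exp (- y) * (3 * exp y)" by (intro mult_left_mono) auto
  also have "\<dots> = 3" by (simp add: exp_minus)
  finally show ?thesis
    unfolding ksrc_scaled[OF assms(1)] y_def[symmetric] using s by (intro divide_right_mono) auto
qed

text \<open>The derivative of \<open>r / sqrt (r\<^sup>2 + 1)\<close> is
  \<open>1 / sqrt (r\<^sup>2 + 1) ^ 3\<close>, so \<open>4 * pi\<close> times its cube is an
  antiderivative of the radial density.\<close>

lemma ksrc_mass:
  "integrable lborel (\<lambda>z. 3 / (sreg 1 z)^5)" "(LBINT z. 3 / (sreg 1 z)^5) = 4 * pi"
proof -
  let ?g = "\<lambda>r. ennreal (3 / (sqrt (r\<^sup>2 + 1))^5)"
  have "(\<integral>\<^sup>+z. ennreal (3 / (sreg 1 z)^5) \<partial>lborel) = (\<integral>\<^sup>+z. ?g (norm (z::real^3)) \<partial>lborel)"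
    by (simp add: sreg_def)
  also have "\<dots> = (\<integral>\<^sup>+r. ennreal (4 * pi * r\<^sup>2) * ?g r * indicator {0..} r \<partial>lborel)"
    by (rule nn_integral_radial) simp
  also have "\<dots> = (\<integral>\<^sup>+r. ennreal (4 * pi * (3 * r\<^sup>2 / (sqrt (r\<^sup>2 + 1))^5)) * indicator {0..} r \<partial>lborel)"
    by (intro nn_integral_cong) (simp flip: ennreal_mult add: field_simps)
  also have "\<dots> = ennreal (4 * pi - 4 * pi * (0 / sqrt (0\<^sup>2 + 1))^3)"
  proof (rule nn_integral_FTC_atLeast)
    fix r :: real assume "0 \<le> r"
    define s where "s = sqrt (r\<^sup>2 + 1)"
    have s: "s > 0" "s\<^sup>2 = r\<^sup>2 + 1" by (auto simp: s_def add_nonneg_pos)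
    have ds: "((\<lambda>r. sqrt (r\<^sup>2 + 1)) has_real_derivative r / s) (at r)"
    proof -
      have "0 < r\<^sup>2 + 1" by (simp add: add_nonneg_pos)
      then show ?thesis unfolding s_def by (auto intro!: derivative_eq_intros simp: field_simps)
    qed
    have "((\<lambda>r. r / sqrt (r\<^sup>2 + 1)) has_real_derivative (1 * s - r * (r / s)) / (s * s)) (at r)"
      unfolding s_def[symmetric] using DERIV_divide[OF DERIV_ident ds] s by (simp add: s_def)
    moreover have "(1 * s - r * (r / s)) / (s * s) = 1 / s^3"
    proof -
      have "1 * s - r * (r / s) = (s\<^sup>2 - r\<^sup>2) / s" using s(1) by (simp add: field_simps power2_eq_square)
      also have "\<dots> = 1 / s" using s(2) by simp
      finally show ?thesis by (simp add: power3_eq_cube)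
    qed
    ultimately have d: "((\<lambda>r. r / sqrt (r\<^sup>2 + 1)) has_real_derivative 1 / s^3) (at r)" by simp
    have "((\<lambda>r. 4 * pi * (r / sqrt (r\<^sup>2 + 1))^3) has_real_derivative 4 * pi * (3 * (r / s)\<^sup>2 * (1 / s^3))) (at r)"
      using DERIV_cmult[OF DERIV_power[OF d, of 3], of "4 * pi"] by (simp add: s_def mult_ac)
    moreover have "3 * (r / s)\<^sup>2 * (1 / s^3) = 3 * r\<^sup>2 / s^5"
      using s(1) by (simp add: field_simps eval_nat_numeral)
    ultimately show "((\<lambda>r. 4 * pi * (r / sqrt (r\<^sup>2 + 1))^3) has_real_derivative 4 * pi * (3 * r\<^sup>2 / (sqrt (r\<^sup>2 + 1))^5)) (at r)"
      unfolding s_def[symmetric] by (simp only:)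
  next
    have "((\<lambda>r::real. r / sqrt (r\<^sup>2 + 1)) \<longlongrightarrow> 1) at_top"
      by real_asymp
    from tendsto_mult[OF tendsto_const tendsto_power[OF this, of 3], of "4 * pi"]
    show "((\<lambda>r. 4 * pi * (r / sqrt (r\<^sup>2 + 1))^3) \<longlongrightarrow> 4 * pi) at_top" by simp
  qed auto
  finally have nn: "(\<integral>\<^sup>+z. ennreal (3 / (sreg 1 z)^5) \<partial>lborel) = ennreal (4 * pi)" by simp
  have pos: "0 \<le> 3 / (sreg 1 z)^5" for z using sreg_pos[of 1 z] by simp
  have m: "(\<lambda>z. 3 / (sreg 1 z)^5) \<in> borel_measurable lborel" unfolding sreg_def by measurable
  show "integrable lborel (\<lambda>z. 3 / (sreg 1 z)^5)"
    by (rule integrableI_nonneg[OF m AE_I2[OF pos]]) (simp add: nn)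
  show "(LBINT z. 3 / (sreg 1 z)^5) = 4 * pi"
    using integral_eq_nn_integral[OF m AE_I2[OF pos]] nn by simp
qed

text \<open>The factor \<open>r\<^sup>2\<close> of polar coordinates cancels the singularity, and
  \<open>r * exp (- k * r)\<close> has an explicit antiderivative.\<close>

lemma yukawa_integrable:
  assumes k: "k > 0"
  shows "integrable lborel (\<lambda>x::real^3. exp (- k * norm x) / norm x)"
proof -
  have "(\<integral>\<^sup>+x. ennreal (exp (- k * norm (x::real^3)) / norm x) \<partial>lborel)
      = (\<integral>\<^sup>+r. ennreal (4 * pi * r\<^sup>2) * ennreal (exp (- k * r) / r) * indicator {0..} r \<partial>lborel)"
    by (rule nn_integral_radial) simp
  also have "\<dots> = (\<integral>\<^sup>+r. ennreal (4 * pi * (r * exp (- k * r))) * indicator {0..} r \<partial>lborel)"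
    by (intro nn_integral_cong) (auto simp flip: ennreal_mult simp: indicator_def power2_eq_square field_simps)
  also have "\<dots> = ennreal (0 - 4 * pi * (- (0 / k + 1 / k\<^sup>2) * exp (- k * 0)))"
  proof (rule nn_integral_FTC_atLeast)
    show "((\<lambda>r. 4 * pi * (- (r / k + 1 / k\<^sup>2) * exp (- k * r))) has_real_derivative 4 * pi * (r * exp (- k * r))) (at r)" for r
      using k by (auto intro!: derivative_eq_intros simp: field_simps power2_eq_square)
    show "((\<lambda>r. 4 * pi * (- (r / k + 1 / k\<^sup>2) * exp (- k * r))) \<longlongrightarrow> 0) at_top"
      using k by real_asymp
  qed auto
  finally have "(\<integral>\<^sup>+x. ennreal (exp (- k * norm (x::real^3)) / norm x) \<partial>lborel) < \<infinity>" by simp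
  then show ?thesis by (intro integrableI_nonneg) auto
qed

section \<open>Regularised potentials of bounded source sets and their limits\<close>

definition yconv :: "real \<Rightarrow> real \<Rightarrow> (real^3) set \<Rightarrow> real^3 \<Rightarrow> real" where
  "yconv k e B x = (1 / (4 * pi)) * (LBINT z. indicator B z * yuk k e (x - z))"

definition yconv' :: "real \<Rightarrow> real \<Rightarrow> (real^3) set \<Rightarrow> real^3 \<Rightarrow> real^3" where
  "yconv' k e B x = (1 / (4 * pi)) *\<^sub>R (LBINT z. indicator B z *\<^sub>R yuk' k e (x - z))"

definition ysrc :: "real \<Rightarrow> real \<Rightarrow> (real^3) set \<Rightarrow> real^3 \<Rightarrow> real" where
  "ysrc k e B x = (1 / (4 * pi)) * (LBINT z. indicator B z * ksrc k e (x - z))"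

lemma integrable_indicator_bounded:
  fixes B :: "'a::euclidean_space set"
  assumes B: "B \<in> sets borel" "bounded B"
  shows "integrable lborel (indicat_real B)"
  by (rule integrable_bounded_support[of _ 1 B]) (use B in \<open>auto simp: indicator_def\<close>)

lemma yconv_C1:
  assumes e: "e > 0" and k: "k \<ge> 0" and B: "B \<in> sets borel" "bounded B"
  shows "C1_grad (yconv k e B) (yconv' k e B)"
  unfolding yconv_def[abs_def] yconv'_def[abs_def]
  by (rule C1_grad_cmult[OF C1_grad_convolution[OF integrable_indicator_bounded[OF B] yuk_C1[OF e] yuk_bounded[OF e k]]])

text \<open>\<open>yuk_weak\<close> integrated over the source point. Both double integrands are
  bounded with bounded support, which justifies the two exchanges of integration.\<close>

lemma yconv_weak:
  assumes e: "e > 0" and k: "k \<ge> 0" and B: "B \<in> sets borel" "bounded B" and \<phi>: "C1c U \<phi> \<phi>'"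
  shows "(LBINT x. yconv' k e B x \<bullet> \<phi>' x + k\<^sup>2 * yconv k e B x * \<phi> x) = (LBINT x. ysrc k e B x * \<phi> x)"
proof -
  obtain S where S: "compact S" "\<And>x. x \<notin> S \<Longrightarrow> \<phi> x = 0" "\<And>x. x \<notin> S \<Longrightarrow> \<phi>' x = 0"
    using C1c_support[OF \<phi>] by metis
  obtain M where M: "M > 0" "\<And>x. \<bar>\<phi> x\<bar> \<le> M" "\<And>x. norm (\<phi>' x) \<le> M"
    using C1c_bounded[OF \<phi>] by metis
  define N where "N = 1 / e + k / e + 1 / e\<^sup>2"
  have N: "\<bar>yuk k e x\<bar> \<le> N" "norm (yuk' k e x) \<le> N" for x unfolding N_def by (auto intro: yuk_bounded[OF e k])
  have N0: "0 \<le> N" using N(1)[of 0] by (meson abs_ge_zero order_trans)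
  have [measurable]: "\<phi> \<in> borel_measurable borel" "\<phi>' \<in> borel_measurable borel"
      "yuk k e \<in> borel_measurable borel" "yuk' k e \<in> borel_measurable borel" "B \<in> sets borel"
    using C1_grad_measurable[OF C1c_C1[OF \<phi>]] C1_grad_measurable[OF yuk_C1[OF e]] B by auto
  have iy: "integrable lborel (\<lambda>z. indicator B z * yuk k e (x - z))" for x
    by (rule integrable_bounded_support[OF _ _ B(2), of _ N]) (use N N0 in \<open>auto simp: indicator_def\<close>)
  have iy': "integrable lborel (\<lambda>z. indicat_real B z *\<^sub>R yuk' k e (x - z))" for x
    by (rule integrable_bounded_support[OF _ _ B(2), of _ N]) (use N N0 in \<open>auto simp: indicator_def\<close>)
  define f where "f z x = indicator B z * (yuk' k e (x - z) \<bullet> \<phi>' x + k\<^sup>2 * yuk k e (x - z) * \<phi> x)" for z x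
  define N' where "N' = N * M + k\<^sup>2 * N * M"
  have N'0: "0 \<le> N'" using N0 M(1) by (simp add: N'_def)
  have fb: "\<bar>f z x\<bar> \<le> N'" for z x
  proof -
    have "\<bar>yuk' k e (x - z) \<bullet> \<phi>' x\<bar> \<le> N * M"
      by (rule order_trans[OF Cauchy_Schwarz_ineq2]) (intro mult_mono N M; simp add: N0)
    moreover have "\<bar>k\<^sup>2 * yuk k e (x - z) * \<phi> x\<bar> \<le> k\<^sup>2 * N * M"
      unfolding abs_mult using N(1)[of "x - z"] M(2)[of x] N0 by (intro mult_mono) auto
    ultimately have "\<bar>yuk' k e (x - z) \<bullet> \<phi>' x + k\<^sup>2 * yuk k e (x - z) * \<phi> x\<bar> \<le> N'"
      unfolding N'_def by linarith
    then show ?thesis using N'0 by (simp add: f_def indicator_def)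
  qed
  have fz: "f z x = 0" if "(z, x) \<notin> B \<times> S" for z x
    using that S(2,3)[of x] by (auto simp: f_def indicator_def)
  have fi: "integrable (lborel \<Otimes>\<^sub>M lborel) (\<lambda>(z, x). f z x)"
    unfolding lborel_prod
  proof (rule integrable_bounded_support[of _ N' "B \<times> S"])
    show "(\<lambda>(z, x). f z x) \<in> borel_measurable borel"
      unfolding f_def borel_prod[symmetric] by measurable
    show "bounded (B \<times> S)" using B S by (auto intro: bounded_Times compact_imp_bounded)
  qed (use fb fz in auto)
  have i: "integrable lborel (f z)" for z
  proof (rule integrable_bounded_support[of _ N' S])
    show "f z \<in> borel_measurable borel" unfolding f_def by measurable
  qed (use fb S in \<open>auto simp: f_def compact_imp_bounded\<close>)
  define g where "g z x = indicator B z * (ksrc k e (x - z) * \<phi> x)" for z x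
  \<comment> \<open>Since \<open>sreg e x \<ge> e\<close>, every term of \<open>ksrc\<close> is
    bounded by its value at the origin.\<close>
  obtain Kb where Kb: "\<And>x. \<bar>ksrc k e x\<bar> \<le> Kb"
  proof (rule that)
    fix x
    let ?s = "sreg e x"
    have s: "0 < ?s" "e \<le> ?s" using sreg_pos[OF e] sreg_ge(1)[OF e, of x] by auto
    have "\<bar>ksrc k e x\<bar> = ksrc k e x" using ksrc_nonneg[OF e k] by simp
    also have "\<dots> \<le> e\<^sup>2 * 1 * (k\<^sup>2 / e^3 + 3 * k / e^4 + 3 / e^5)"
      unfolding ksrc_def using s e k
      by (intro mult_mono add_mono divide_left_mono power_mono mult_nonneg_nonneg add_nonneg_nonneg divide_nonneg_nonneg mult_pos_pos zero_less_power) auto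
    finally show "\<bar>ksrc k e x\<bar> \<le> e\<^sup>2 * 1 * (k\<^sup>2 / e^3 + 3 * k / e^4 + 3 / e^5)" .
  qed
  have Kb0: "0 \<le> Kb" using Kb[of 0] by (meson abs_ge_zero order_trans)
  have gi: "integrable (lborel \<Otimes>\<^sub>M lborel) (\<lambda>(z, x). g z x)"
    unfolding lborel_prod
  proof (rule integrable_bounded_support[of _ "Kb * M" "B \<times> S"])
    show "(\<lambda>(z, x). g z x) \<in> borel_measurable borel"
      unfolding g_def borel_prod[symmetric] by measurable
    show "bounded (B \<times> S)" using B S by (auto intro: bounded_Times compact_imp_bounded)
    fix y :: "(real^3) \<times> (real^3)"
    show "norm (case y of (z, x) \<Rightarrow> g z x) \<le> Kb * M"
      using Kb0 M Kb by (auto simp: g_def indicator_def abs_mult split_beta intro!: mult_mono)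
    show "y \<notin> B \<times> S \<Longrightarrow> (case y of (z, x) \<Rightarrow> g z x) = 0"
      using S(2) by (cases y) (auto simp: g_def indicator_def)
  qed
  have ik: "integrable lborel (\<lambda>z. indicator B z * ksrc k e (x - z))" for x
    by (rule integrable_bounded_support[OF _ _ B(2), of _ Kb]) (use Kb Kb0 in \<open>auto simp: indicator_def\<close>)
  have "(LBINT x. yconv' k e B x \<bullet> \<phi>' x + k\<^sup>2 * yconv k e B x * \<phi> x) = (LBINT x. (1 / (4 * pi)) * (LBINT z. f z x))"
  proof (intro Bochner_Integration.integral_cong refl)
    fix x
    have "(LBINT z. indicat_real B z *\<^sub>R yuk' k e (x - z)) \<bullet> \<phi>' x = (LBINT z. (indicat_real B z *\<^sub>R yuk' k e (x - z)) \<bullet> \<phi>' x)"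
      by (rule integral_inner_left[OF iy', symmetric])
    moreover have "(LBINT z. f z x) = (LBINT z. (indicat_real B z *\<^sub>R yuk' k e (x - z)) \<bullet> \<phi>' x + k\<^sup>2 * \<phi> x * (indicator B z * yuk k e (x - z)))"
      by (intro Bochner_Integration.integral_cong refl) (simp add: f_def algebra_simps)
    moreover have "\<dots> = (LBINT z. (indicat_real B z *\<^sub>R yuk' k e (x - z)) \<bullet> \<phi>' x) + k\<^sup>2 * \<phi> x * (LBINT z. indicator B z * yuk k e (x - z))"
      using iy[of x] integrable_inner_left[OF iy'[of x], of "\<phi>' x"]
      by (subst Bochner_Integration.integral_add) auto
    ultimately show "yconv' k e B x \<bullet> \<phi>' x + k\<^sup>2 * yconv k e B x * \<phi> x = (1 / (4 * pi)) * (LBINT z. f z x)"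
      by (simp add: yconv_def yconv'_def algebra_simps)
  qed
  also have "\<dots> = (1 / (4 * pi)) * (LBINT x. LBINT z. f z x)" by simp
  also have "(LBINT x. LBINT z. f z x) = (LBINT z. LBINT x. f z x)"
    by (rule lborel_pair.Fubini_integral[OF fi])
  also have "\<dots> = (LBINT z. LBINT x. g z x)"
  proof (rule Bochner_Integration.integral_cong[OF refl])
    fix z
    show "(LBINT x. f z x) = (LBINT x. g z x)"
      using yuk_weak[OF e \<phi>, of k z] by (simp add: f_def g_def)
  qed
  also have "\<dots> = (LBINT x. LBINT z. g z x)"
    by (rule lborel_pair.Fubini_integral[OF gi, symmetric])
  also have "(1 / (4 * pi)) * \<dots> = (LBINT x. (1 / (4 * pi)) * (LBINT z. g z x))"
    by simp
  also have "\<dots> = (LBINT x. ysrc k e B x * \<phi> x)"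
  proof (intro Bochner_Integration.integral_cong refl)
    fix x
    have "(LBINT z. g z x) = (LBINT z. indicator B z * ksrc k e (x - z) * \<phi> x)"
      by (intro Bochner_Integration.integral_cong refl) (simp add: g_def)
    also have "\<dots> = (LBINT z. indicator B z * ksrc k e (x - z)) * \<phi> x"
      using ik by simp
    finally show "(1 / (4 * pi)) * (LBINT z. g z x) = ysrc k e B x * \<phi> x"
      by (simp add: ysrc_def)
  qed
  finally show ?thesis .
qed

lemma ksrc_integrable:
  assumes e: "e > 0" and k: "k \<ge> 0"
  shows "integrable lborel (ksrc k e)"
proof -
  have "integrable lborel (\<lambda>z. e^3 * ksrc k e (e *\<^sub>R z))"
  proof (rule Bochner_Integration.integrable_bound[OF ksrc_mass(1)])
    show "AE z in lborel. norm (e^3 * ksrc k e (e *\<^sub>R z)) \<le> norm (3 / (sreg 1 z)^5)"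
    proof (rule AE_I2)
      fix z
      have "norm (e^3 * ksrc k e (e *\<^sub>R z)) = e^3 * ksrc k e (e *\<^sub>R z)"
        using e ksrc_nonneg[OF e k, of "e *\<^sub>R z"] by simp
      also have "\<dots> \<le> norm (3 / (sreg 1 z)^5)"
        unfolding real_norm_def by (rule order_trans[OF ksrc_scaled_le[OF e k] abs_ge_self])
      finally show "norm (e^3 * ksrc k e (e *\<^sub>R z)) \<le> norm (3 / (sreg 1 z)^5)" .
    qed
  qed measurable
  then have "integrable lborel (\<lambda>z. ksrc k e (0 + e *\<^sub>R z))" using e by simp
  from integrable_affine[OF this, of "1/e" 0] e show ?thesis by simp
qed

lemma ksrc_integral_scaled:
  assumes e: "e > 0" and g: "g \<in> borel_measurable borel"
  shows "(LBINT y. ksrc k e y * g y) = (LBINT z. (e^3 * ksrc k e (e *\<^sub>R z)) * g (e *\<^sub>R z))"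
  using g by (subst integral_affine[of _ e 0]) (use e in \<open>auto simp: mult.assoc\<close>)

lemma ksrc_scaled_tendsto:
  assumes X: "X \<longlonglongrightarrow> 0" "\<And>n. X n > 0"
  shows "(\<lambda>n. (X n)^3 * ksrc k (X n) (X n *\<^sub>R z)) \<longlonglongrightarrow> 3 / (sreg 1 z)^5"
proof -
  have s: "sreg 1 z \<noteq> 0" using sreg_pos[of 1 z] by simp
  have "(\<lambda>n. exp (- (k * X n * sreg 1 z)) * ((k * X n * sreg 1 z)\<^sup>2 + 3 * (k * X n * sreg 1 z) + 3) / (sreg 1 z)^5)
    \<longlonglongrightarrow> exp (- (k * 0 * sreg 1 z)) * ((k * 0 * sreg 1 z)\<^sup>2 + 3 * (k * 0 * sreg 1 z) + 3) / (sreg 1 z)^5"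
    by (intro tendsto_intros X) (use s in auto)
  then show ?thesis using X(2) by (simp add: ksrc_scaled)
qed

text \<open>\<open>ksrc / (4 * pi)\<close> is an approximate identity, but for positive
  \<open>k\<close> its mass \<open>m n\<close> only tends to 1. Hence the split into a pure
  translation error \<open>r n\<close> and a multiple of the indicator.\<close>

lemma ysrc_tendsto:
  assumes k: "k \<ge> 0" and B: "B \<in> sets borel" "bounded B" and X: "X \<longlonglongrightarrow> 0" "\<And>n. X n > 0"
  shows "\<And>n. sq_integrable (ysrc k (X n) B)" "(\<lambda>n. sqn (\<lambda>x. ysrc k (X n) B x - indicator B x)) \<longlonglongrightarrow> 0"
proof -
  let ?f = "indicat_real B"
  have f: "sq_integrable ?f"
    by (rule sq_integrable_bounded_support[of _ 1 B]) (use B in \<open>auto simp: indicator_def\<close>)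
  have fm [measurable]: "?f \<in> borel_measurable borel" using B by simp
  have tm [measurable]: "tmod ?f \<in> borel_measurable borel" by (rule tmod_measurable[OF f])
  define m where "m n = (LBINT y. ksrc k (X n) y) / (4 * pi)" for n
  define r where "r n x = ysrc k (X n) B x - m n * ?f x" for n x
  have kn: "0 \<le> ksrc k (X n) y" for n y by (rule ksrc_nonneg[OF X(2) k])
  have ki: "integrable lborel (ksrc k (X n))" for n by (rule ksrc_integrable[OF X(2) k])
  have ym [measurable]: "ysrc k (X n) B \<in> borel_measurable borel" for n
    unfolding ysrc_def[abs_def] by measurable
  have rm [measurable]: "r n \<in> borel_measurable borel" for n
    unfolding r_def[abs_def] by measurable
  have req: "r n x = (1 / (4 * pi)) * (LBINT y. ksrc k (X n) y *\<^sub>R (?f (x - y) - ?f x))" for n x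
  proof -
    have "(LBINT z. ?f z * ksrc k (X n) (x - z)) = (LBINT y. ?f (x - y) * ksrc k (X n) y)"
      by (subst integral_translate(3)[symmetric, where y=x]) auto
    moreover have "integrable lborel (\<lambda>y. ?f (x - y) * ksrc k (X n) y)"
      by (rule Bochner_Integration.integrable_bound[OF ki[of n]], measurable) (auto simp: indicator_def intro!: AE_I2)
    moreover have "(LBINT y. ksrc k (X n) y *\<^sub>R (?f (x - y) - ?f x)) = (LBINT y. ?f (x - y) * ksrc k (X n) y - ksrc k (X n) y * ?f x)"
      by (intro Bochner_Integration.integral_cong refl) (simp add: algebra_simps)
    ultimately show ?thesis
      using ki[of n] by (simp add: r_def ysrc_def m_def algebra_simps)
  qed
  have rb: "norm (r n x) \<le> norm (LBINT y. ksrc k (X n) y *\<^sub>R (?f (x - y) - ?f x))" for n x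
  proof -
    have "1 / (4 * pi) \<le> 1" using pi_ge_two by simp
    then have "(1 / (4 * pi)) * \<bar>y\<bar> \<le> \<bar>y\<bar>" for y :: real by (intro mult_left_le_one_le) auto
    then show ?thesis unfolding req real_norm_def abs_mult by simp
  qed
  have rs: "sq_integrable (r n)" "sqn (r n) \<le> (LBINT y. ksrc k (X n) y) * (LBINT y. ksrc k (X n) y * tmod ?f y)" for n
    using sqn_convolution_le[OF f ki kn rm rb] by auto
  have mf: "sq_integrable (\<lambda>x. c * ?f x)" for c using sq_integrable_cmult[OF f, of c] by simp
  have yr: "ysrc k (X n) B = (\<lambda>x. r n x + m n * ?f x)" for n by (simp add: r_def fun_eq_iff)
  show "sq_integrable (ysrc k (X n) B)" for n
    unfolding yr by (rule sq_integrable_add[OF rs(1) mf])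
  \<comment> \<open>The substitution \<open>y = X n *\<^sub>R z\<close> fixes the dominating
    function. It is applied to the constant 1, for the mass, and to \<open>tmod\<close>, for the
    translation error.\<close>
  have lim: "(\<lambda>n. LBINT y. ksrc k (X n) y * g y) \<longlonglongrightarrow> (LBINT z. 3 / (sreg 1 z)^5 * L)"
    if g: "g \<in> borel_measurable borel" "\<And>y. \<bar>g y\<bar> \<le> C" "\<And>z. (\<lambda>n. g (X n *\<^sub>R z)) \<longlonglongrightarrow> L" for g C L
    unfolding ksrc_integral_scaled[OF X(2) g(1)]
  proof (rule integral_dominated_convergence)
    note [measurable] = g(1)
    show "integrable lborel (\<lambda>z. 3 / (sreg 1 z)^5 * C)" using ksrc_mass(1) by (rule integrable_mult_left)
    show "AE z in lborel. (\<lambda>n. (X n)^3 * ksrc k (X n) (X n *\<^sub>R z) * g (X n *\<^sub>R z)) \<longlonglongrightarrow> 3 / (sreg 1 z)^5 * L"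
      by (intro AE_I2 tendsto_mult ksrc_scaled_tendsto X g(3))
    show "(\<lambda>z. 3 / (sreg 1 z)^5 * L) \<in> borel_measurable lborel" unfolding sreg_def by measurable
    show "(\<lambda>z. (X n)^3 * ksrc k (X n) (X n *\<^sub>R z) * g (X n *\<^sub>R z)) \<in> borel_measurable lborel" for n by measurable
    show "AE z in lborel. norm ((X n)^3 * ksrc k (X n) (X n *\<^sub>R z) * g (X n *\<^sub>R z)) \<le> 3 / (sreg 1 z)^5 * C" for n
    proof (rule AE_I2)
      fix z
      have "norm ((X n)^3 * ksrc k (X n) (X n *\<^sub>R z) * g (X n *\<^sub>R z)) = ((X n)^3 * ksrc k (X n) (X n *\<^sub>R z)) * \<bar>g (X n *\<^sub>R z)\<bar>"
        using kn X(2)[of n] by (simp add: abs_mult less_imp_le)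
      also have "\<dots> \<le> 3 / (sreg 1 z)^5 * C"
        using ksrc_scaled_le[OF X(2) k] g(2) sreg_pos[of 1 z] by (intro mult_mono) auto
      finally show "norm ((X n)^3 * ksrc k (X n) (X n *\<^sub>R z) * g (X n *\<^sub>R z)) \<le> 3 / (sreg 1 z)^5 * C" .
    qed
  qed
  have l1: "(\<lambda>n. LBINT y. ksrc k (X n) y) \<longlonglongrightarrow> 4 * pi"
    using lim[of "\<lambda>_. 1" 1 1] ksrc_mass(2) by simp
  have l2: "(\<lambda>n. LBINT y. ksrc k (X n) y * tmod ?f y) \<longlonglongrightarrow> 0"
  proof -
    have t: "(\<lambda>n. tmod ?f (X n *\<^sub>R z)) \<longlonglongrightarrow> 0" for z
    proof (cases "z = 0")
      case True
      then show ?thesis by (simp add: tmod_def sqn_def)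
    next
      case False
      have "(\<lambda>n. X n *\<^sub>R z) \<longlonglongrightarrow> 0 *\<^sub>R z" by (intro tendsto_intros X)
      moreover have "X n *\<^sub>R z \<noteq> 0" for n using X(2)[of n] False by simp
      ultimately show ?thesis
        using tmod_tendsto[OF f] unfolding tendsto_at_iff_sequentially by (auto simp: comp_def)
    qed
    have "(\<lambda>n. LBINT y. ksrc k (X n) y * tmod ?f y) \<longlonglongrightarrow> (LBINT z. 3 / (sreg 1 z)^5 * 0)"
      by (rule lim[OF tm _ t, of "4 * sqn ?f"]) (simp add: tmod_le[OF f])
    then show ?thesis by simp
  qed
  have l3: "(\<lambda>n. sqn (r n)) \<longlonglongrightarrow> 0"
  proof (rule Lim_null_comparison)
    show "\<forall>\<^sub>F n in sequentially. norm (sqn (r n)) \<le> (LBINT y. ksrc k (X n) y) * (LBINT y. ksrc k (X n) y * tmod ?f y)"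
      using rs(2) by simp
    show "(\<lambda>n. (LBINT y. ksrc k (X n) y) * (LBINT y. ksrc k (X n) y * tmod ?f y)) \<longlonglongrightarrow> 0"
      using tendsto_mult[OF l1 l2] by simp
  qed
  have l4: "m \<longlonglongrightarrow> 1"
    unfolding m_def[abs_def] using tendsto_divide[OF l1 tendsto_const, of "4 * pi"] by simp
  show "(\<lambda>n. sqn (\<lambda>x. ysrc k (X n) B x - ?f x)) \<longlonglongrightarrow> 0"
  proof (rule Lim_null_comparison)
    show "\<forall>\<^sub>F n in sequentially. norm (sqn (\<lambda>x. ysrc k (X n) B x - ?f x)) \<le> 2 * sqn (r n) + 2 * ((m n - 1)\<^sup>2 * sqn ?f)"
    proof (intro always_eventually allI)
      fix n
      have "(\<lambda>x. ysrc k (X n) B x - ?f x) = (\<lambda>x. r n x + (m n - 1) * ?f x)"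
        by (simp add: r_def fun_eq_iff algebra_simps)
      then have "sqn (\<lambda>x. ysrc k (X n) B x - ?f x) \<le> 2 * sqn (r n) + 2 * sqn (\<lambda>x. (m n - 1) * ?f x)"
        using sqn_add_le[OF rs(1) mf] by metis
      also have "sqn (\<lambda>x. (m n - 1) * ?f x) = (m n - 1)\<^sup>2 * sqn ?f"
        using sqn_cmult[of "m n - 1" ?f] by simp
      finally show "norm (sqn (\<lambda>x. ysrc k (X n) B x - ?f x)) \<le> 2 * sqn (r n) + 2 * ((m n - 1)\<^sup>2 * sqn ?f)" by simp
    qed
    have "(\<lambda>n. 2 * sqn (r n) + 2 * ((m n - 1)\<^sup>2 * sqn ?f)) \<longlonglongrightarrow> 2 * 0 + 2 * ((1 - 1)\<^sup>2 * sqn ?f)"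
      by (intro tendsto_intros l3 l4)
    then show "(\<lambda>n. 2 * sqn (r n) + 2 * ((m n - 1)\<^sup>2 * sqn ?f)) \<longlonglongrightarrow> 0" by simp
  qed
qed

text \<open>For fixed \<open>x\<close> the inner integral is at most that of the whole kernel, which
  does not depend on \<open>x\<close>; boundedness of \<open>A\<close> does the rest.\<close>

lemma yukawa_pair_integrable:
  fixes A B :: "(real^3) set"
  assumes k: "k > 0" and A: "A \<in> sets borel" "bounded A" and B: "B \<in> sets borel" "bounded B"
  shows "integrable (lborel \<Otimes>\<^sub>M lborel) (\<lambda>(x, y). indicator A x * indicator B y * (exp (- k * norm (x - y)) / norm (x - y)))"
proof (rule lborel_pair.Fubini_integrable)
  let ?G = "\<lambda>x::real^3. exp (- k * norm x) / norm x"
  have [measurable]: "A \<in> sets borel" "B \<in> sets borel" using A B by auto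
  show m: "(\<lambda>(x, y). indicator A x * indicator B y * ?G (x - y)) \<in> borel_measurable (lborel \<Otimes>\<^sub>M lborel)"
    by measurable
  have iG: "integrable lborel (\<lambda>y. ?G (x - y))" for x
    using integrable_translate(3)[OF yukawa_integrable[OF k], of x] by simp
  have iGB: "integrable lborel (\<lambda>y. indicator A x * indicator B y * ?G (x - y))" for x
    by (rule Bochner_Integration.integrable_bound[OF iG[of x]]) (auto simp: indicator_def intro!: AE_I2)
  then show "AE x in lborel. integrable lborel (\<lambda>y. case (x, y) of (x, y) \<Rightarrow> indicator A x * indicator B y * ?G (x - y))"
    by (intro AE_I2) simp
  show "integrable lborel (\<lambda>x. LBINT y. norm (case (x, y) of (x, y) \<Rightarrow> indicator A x * indicator B y * ?G (x - y)))"
  proof (rule integrable_bounded_support[of _ "LBINT y. ?G y" A])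
    show "(\<lambda>x. LBINT y. norm (case (x, y) of (x, y) \<Rightarrow> indicator A x * indicator B y * ?G (x - y))) \<in> borel_measurable borel"
      by measurable
    fix x
    have "(LBINT y. norm (indicator A x * indicator B y * ?G (x - y))) \<le> (LBINT y. ?G (x - y))"
      using iGB[of x] iG[of x] by (intro integral_mono) (auto simp: indicator_def)
    also have "\<dots> = (LBINT y. ?G y)"
      by (rule integral_translate(3)[of ?G]) simp
    finally show "norm (LBINT y. norm (case (x, y) of (x, y) \<Rightarrow> indicator A x * indicator B y * ?G (x - y))) \<le> (LBINT y. ?G y)"
      by simp
    show "x \<notin> A \<Longrightarrow> (LBINT y. norm (case (x, y) of (x, y) \<Rightarrow> indicator A x * indicator B y * ?G (x - y))) = 0"
      by simp
  qed (use A in auto)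
qed

lemma yuk_le_yukawa: "e > 0 \<Longrightarrow> k \<ge> 0 \<Longrightarrow> x \<noteq> 0 \<Longrightarrow> yuk k e x \<le> exp (- k * norm x) / norm x"
  by (rule yuk_le) auto

lemma yuk_tendsto:
  assumes X: "X \<longlonglongrightarrow> 0" and x: "x \<noteq> 0"
  shows "(\<lambda>n. yuk k (X n) x) \<longlonglongrightarrow> exp (- k * norm x) / norm x"
proof -
  have "(\<lambda>n. exp (- k * sqrt ((norm x)\<^sup>2 + (X n)\<^sup>2)) / sqrt ((norm x)\<^sup>2 + (X n)\<^sup>2))
      \<longlonglongrightarrow> exp (- k * sqrt ((norm x)\<^sup>2 + 0\<^sup>2)) / sqrt ((norm x)\<^sup>2 + 0\<^sup>2)"
    by (intro tendsto_intros X) (use x in auto)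
  then show ?thesis by (simp add: yuk_def sreg_def)
qed

text \<open>The symmetry of the Yukawa kernel enters here: the regularised integral is iterated with
  \<open>x\<close> outside, its limit with \<open>y\<close> outside, so the potential of
  \<open>B\<close> over \<open>A\<close> turns into the potential of \<open>A\<close> over
  \<open>B\<close>.\<close>

lemma integral_yconv_tendsto:
  fixes A B :: "(real^3) set"
  assumes k: "k > 0" and A: "A \<in> sets borel" "bounded A" and B: "B \<in> sets borel" "bounded B"
    and X: "X \<longlonglongrightarrow> 0" "\<And>n. X n > 0"
  shows "(\<lambda>n. LBINT x. indicator A x * yconv k (X n) B x) \<longlonglongrightarrow> (LBINT y. indicator B y * vsol (indicator A) y k)"
proof -
  have [measurable]: "A \<in> sets borel" "B \<in> sets borel" using A B by auto
  let ?G = "\<lambda>x::real^3. exp (- k * norm x) / norm x"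
  have ym [measurable]: "yuk k (X n) \<in> borel_measurable borel" for n
    using C1_grad_measurable[OF yuk_C1[OF X(2)]] by auto
  have "AE y in (lborel :: (real^3) measure). x - y \<noteq> 0" for x
    using AE_lborel_singleton[of x] by eventually_elim auto
  \<comment> \<open>Off the diagonal, a null set, the regularised kernels converge to the singular
    one and are dominated by it.\<close>
  then have ne: "AE p in (lborel \<Otimes>\<^sub>M lborel). fst p - snd p \<noteq> (0::real^3)"
  proof (intro lborel_pair.AE_pair_measure)
    have "open {p::(real^3)\<times>(real^3). fst p - snd p \<noteq> 0}"
      by (intro open_Collect_neq continuous_intros)
    then show "{p \<in> space (lborel \<Otimes>\<^sub>M lborel). fst p - snd p \<noteq> (0::real^3)} \<in> sets (lborel \<Otimes>\<^sub>M lborel)"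
      unfolding lborel_prod by simp
  qed simp
  have lim: "(\<lambda>n. \<integral>p. indicator A (fst p) * indicator B (snd p) * yuk k (X n) (fst p - snd p) \<partial>(lborel \<Otimes>\<^sub>M lborel))
      \<longlonglongrightarrow> (\<integral>p. indicator A (fst p) * indicator B (snd p) * ?G (fst p - snd p) \<partial>(lborel \<Otimes>\<^sub>M lborel))"
  proof (rule integral_dominated_convergence)
    show "integrable (lborel \<Otimes>\<^sub>M lborel) (\<lambda>p. indicator A (fst p) * indicator B (snd p) * ?G (fst p - snd p))"
      using yukawa_pair_integrable[OF k A B] unfolding case_prod_unfold .
    show "AE p in lborel \<Otimes>\<^sub>M lborel. (\<lambda>n. indicator A (fst p) * indicator B (snd p) * yuk k (X n) (fst p - snd p)) \<longlonglongrightarrow>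
        indicator A (fst p) * indicator B (snd p) * ?G (fst p - snd p)"
      using ne by eventually_elim (intro tendsto_intros yuk_tendsto X)
    show "AE p in lborel \<Otimes>\<^sub>M lborel. norm (indicator A (fst p) * indicator B (snd p) * yuk k (X n) (fst p - snd p))
        \<le> indicator A (fst p) * indicator B (snd p) * ?G (fst p - snd p)" for n
      using ne
    proof eventually_elim
      case (elim p)
      then show ?case
        using yuk_le_yukawa[OF X(2)[of n] less_imp_le[OF k], of "fst p - snd p"] yuk_pos[OF X(2)[of n], of k "fst p - snd p"]
        by (auto simp: indicator_def)
    qed
  qed measurable
  have 1: "(\<integral>p. indicator A (fst p) * indicator B (snd p) * yuk k (X n) (fst p - snd p) \<partial>(lborel \<Otimes>\<^sub>M lborel))
      = 4 * pi * (LBINT x. indicator A x * yconv k (X n) B x)" for n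
  proof -
    have "integrable (lborel \<Otimes>\<^sub>M lborel) (\<lambda>p. indicator A (fst p) * indicator B (snd p) * yuk k (X n) (fst p - snd p))"
    proof (rule Bochner_Integration.integrable_bound)
      show "integrable (lborel \<Otimes>\<^sub>M lborel) (\<lambda>p. indicator A (fst p) * indicator B (snd p) * ?G (fst p - snd p))"
        using yukawa_pair_integrable[OF k A B] unfolding case_prod_unfold .
      show "AE p in lborel \<Otimes>\<^sub>M lborel. norm (indicator A (fst p) * indicator B (snd p) * yuk k (X n) (fst p - snd p))
        \<le> norm (indicator A (fst p) * indicator B (snd p) * ?G (fst p - snd p))"
        using ne
      proof eventually_elim
        case (elim p)
        then show ?case
          using yuk_le_yukawa[OF X(2)[of n] less_imp_le[OF k], of "fst p - snd p"] yuk_pos[OF X(2)[of n], of k "fst p - snd p"]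
          by (auto simp: indicator_def)
      qed
    qed measurable
    from lborel_pair.integral_fst'[OF this]
    have "(\<integral>p. indicator A (fst p) * indicator B (snd p) * yuk k (X n) (fst p - snd p) \<partial>(lborel \<Otimes>\<^sub>M lborel))
        = (LBINT x. LBINT y. indicator A x * (indicator B y * yuk k (X n) (x - y)))"
      by (simp add: mult.assoc)
    also have "\<dots> = (LBINT x. 4 * pi * (indicator A x * yconv k (X n) B x))"
      by (intro Bochner_Integration.integral_cong refl) (simp add: yconv_def)
    finally show ?thesis by simp
  qed
  have 2: "(\<integral>p. indicator A (fst p) * indicator B (snd p) * ?G (fst p - snd p) \<partial>(lborel \<Otimes>\<^sub>M lborel))
      = 4 * pi * (LBINT y. indicator B y * vsol (indicator A) y k)"
  proof -
    have "(\<integral>p. indicator A (fst p) * indicator B (snd p) * ?G (fst p - snd p) \<partial>(lborel \<Otimes>\<^sub>M lborel))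
        = (LBINT y. LBINT x. indicator A x * indicator B y * ?G (x - y))"
      using lborel_pair.integral_snd[OF yukawa_pair_integrable[OF k A B]] unfolding case_prod_unfold by simp
    also have "\<dots> = (LBINT y. 4 * pi * (indicator B y * vsol (indicator A) y k))"
    proof (intro Bochner_Integration.integral_cong refl)
      fix y :: "real^3"
      have "(LBINT x. indicator A x * indicator B y * ?G (x - y)) = indicator B y * (LBINT x. exp (- k * dist y x) / dist y x * indicator A x)"
        by (subst integral_mult_right_zero[symmetric], intro Bochner_Integration.integral_cong refl)
           (simp add: dist_norm norm_minus_commute)
      then show "(LBINT x. indicator A x * indicator B y * ?G (x - y)) = 4 * pi * (indicator B y * vsol (indicator A) y k)"
        by (simp add: vsol_def)
    qed
    finally show ?thesis by simp
  qed
  from tendsto_mult[OF tendsto_const lim[unfolded 1 2], of "1 / (4 * pi)"] show ?thesis by simp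
qed

section \<open>From the wave equation to an elliptic problem\<close>

lemma C1c_on_eq: "C1c_on U \<phi> \<phi>' \<longleftrightarrow> C1c U \<phi> \<phi>'"
  by (auto simp: C1c_on_def C1c_def C1_grad_def)

lemma C1_grad_product:
  fixes \<phi> :: "'a::euclidean_space \<Rightarrow> real" and g :: "real \<Rightarrow> real"
  assumes \<phi>: "C1_grad \<phi> \<phi>'" and g: "\<And>t. (g has_real_derivative g' t) (at t)" "continuous_on UNIV g'"
  shows "C1_grad (\<lambda>z. \<phi> (fst z) * g (snd z)) (\<lambda>z. (g (snd z) *\<^sub>R \<phi>' (fst z), \<phi> (fst z) * g' (snd z)))"
  unfolding C1_grad_def
proof (intro conjI allI)
  fix z :: "'a \<times> real"
  have "((\<lambda>z. \<phi> (fst z)) has_derivative (\<lambda>h. \<phi>' (fst z) \<bullet> fst h)) (at z)"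
    by (rule has_derivative_compose[OF has_derivative_fst[OF has_derivative_ident] C1_grad_deriv[OF \<phi>]])
  moreover have "((\<lambda>z. g (snd z)) has_derivative (\<lambda>h. g' (snd z) * snd h)) (at z)"
    using g(1)[of "snd z"] unfolding has_field_derivative_def
    by (rule has_derivative_compose[OF has_derivative_snd[OF has_derivative_ident]])
  ultimately show "((\<lambda>z. \<phi> (fst z) * g (snd z)) has_derivative (\<bullet>) (g (snd z) *\<^sub>R \<phi>' (fst z), \<phi> (fst z) * g' (snd z))) (at z)"
    by (rule has_derivative_eq_rhs[OF has_derivative_mult]) (auto simp: inner_prod_def algebra_simps)
  have gc: "continuous_on UNIV g"
    using g(1) by (auto intro!: continuous_at_imp_continuous_on DERIV_isCont)
  show "continuous_on UNIV (\<lambda>z::'a\<times>real. (g (snd z) *\<^sub>R \<phi>' (fst z), \<phi> (fst z) * g' (snd z)))"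
    by (intro continuous_intros continuous_on_compose2[OF gc] continuous_on_compose2[OF g(2)]
        continuous_on_compose2[OF C1_grad_cont(1)[OF \<phi>]] continuous_on_compose2[OF C1_grad_cont(2)[OF \<phi>]]) auto
qed

section \<open>Weighted time integrals of space-time functions\<close>

lemma le_one_plus_square: "r \<le> 1 + (r::real)\<^sup>2"
proof -
  have "0 \<le> (r - 1/2)\<^sup>2" by simp
  then show ?thesis unfolding power2_diff by (simp add: power2_eq_square)
qed

text \<open>\<open>W\<close>, its gradient \<open>H\<close> and the error \<open>F\<close> are all
  of this form, with different weights \<open>c\<close>.\<close>

definition slc :: "(real \<Rightarrow> real) \<Rightarrow> ('a::euclidean_space \<times> real \<Rightarrow> 'b::euclidean_space) \<Rightarrow> 'a \<Rightarrow> 'b" where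
  "slc c g x = (LBINT t. c t *\<^sub>R g (x, t))"

text \<open>Cauchy-Schwarz in time over \<open>{0<..<T}\<close> gives the norm bound; Fubini turns a
  pairing in space into one in space-time, where the weak formulations live.\<close>

lemma slc_props:
  fixes g :: "'a::euclidean_space \<times> real \<Rightarrow> 'b::euclidean_space"
  assumes g: "g \<in> borel_measurable borel" "integrable lborel (\<lambda>z. indicator {0<..<T} (snd z) * (norm (g z))\<^sup>2)"
    and c: "c \<in> borel_measurable borel" "\<And>t. \<bar>c t\<bar> \<le> C" "\<forall>t. t \<notin> {0<..<T} \<longrightarrow> c t = 0" and T: "T > 0"
  shows "sq_integrable (slc c g)"
    and "sqn (slc c g) \<le> T * C\<^sup>2 * (LBINT z. indicator {0<..<T} (snd z) * (norm (g z))\<^sup>2)"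
    and "\<And>\<psi>. sq_integrable \<psi> \<Longrightarrow> integrable lborel (\<lambda>z. \<psi> (fst z) \<bullet> (c (snd z) *\<^sub>R g z))"
    and "\<And>\<psi>. sq_integrable \<psi> \<Longrightarrow> (LBINT x. \<psi> x \<bullet> slc c g x) = (LBINT z. \<psi> (fst z) \<bullet> (c (snd z) *\<^sub>R g z))"
proof -
  have [measurable]: "g \<in> borel_measurable borel" "c \<in> borel_measurable borel" using g c by auto
  have gp [measurable]: "g \<in> borel_measurable (borel \<Otimes>\<^sub>M borel)" using g(1) by (simp add: borel_prod)
  have C0: "0 \<le> C" using c(2)[of 0] by (meson abs_ge_zero order_trans)
  have slm [measurable]: "slc c g \<in> borel_measurable borel"
    unfolding slc_def[abs_def] by measurable
  let ?j = "indicat_real {0<..<T}"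
  have cj: "\<bar>c t\<bar> \<le> C * ?j t" for t using c(2)[of t] c(3)[rule_format, of t] by (auto simp: indicator_def)
  define q where "q z = ?j (snd z) * (norm (g z))\<^sup>2" for z
  have q0: "0 \<le> q z" for z by (simp add: q_def)
  have qi: "integrable (lborel \<Otimes>\<^sub>M lborel) q" using g(2) unfolding q_def[abs_def] by (simp add: lborel_prod)
  have [measurable]: "q \<in> borel_measurable (borel \<Otimes>\<^sub>M borel)" unfolding q_def[abs_def] by measurable
  have ji: "integrable lborel ?j" using T by (intro integrable_real_indicator) (auto simp: emeasure_lborel_Ioo)
  have pt: "ennreal ((norm (slc c g x))\<^sup>2) \<le> ennreal (C\<^sup>2 * T) * (\<integral>\<^sup>+t. ennreal (q (x, t)) \<partial>lborel)" for x
  proof -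
    have "ennreal (norm (slc c g x)) \<le> (\<integral>\<^sup>+t. ennreal (norm (c t *\<^sub>R g (x, t))) \<partial>lborel)"
    proof (cases "integrable lborel (\<lambda>t. c t *\<^sub>R g (x, t))")
      case True
      then show ?thesis unfolding slc_def by (rule integral_norm_bound_ennreal)
    next
      case False
      then show ?thesis by (simp add: slc_def not_integrable_integral_eq)
    qed
    also have "\<dots> \<le> (\<integral>\<^sup>+t. ennreal (C * ?j t) * ennreal (?j t * norm (g (x, t))) \<partial>lborel)"
    proof (intro nn_integral_mono)
      fix t
      have "norm (c t *\<^sub>R g (x, t)) \<le> (C * ?j t) * norm (g (x, t))"
        using cj[of t] by (simp add: mult_right_mono)
      also have "\<dots> = (C * ?j t) * (?j t * norm (g (x, t)))" by (simp add: indicator_def)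
      finally show "ennreal (norm (c t *\<^sub>R g (x, t))) \<le> ennreal (C * ?j t) * ennreal (?j t * norm (g (x, t)))"
        using C0 by (simp add: ennreal_mult[symmetric] ennreal_leI)
    qed
    finally have "(ennreal (norm (slc c g x)))\<^sup>2 \<le> (\<integral>\<^sup>+t. ennreal (C * ?j t) * ennreal (?j t * norm (g (x, t))) \<partial>lborel)\<^sup>2"
      by (intro power_mono) auto
    also have "\<dots> \<le> (\<integral>\<^sup>+t. (ennreal (C * ?j t))\<^sup>2 \<partial>lborel) * (\<integral>\<^sup>+t. (ennreal (?j t * norm (g (x, t))))\<^sup>2 \<partial>lborel)"
      by (rule Cauchy_Schwarz_nn_integral) auto
    also have "(\<integral>\<^sup>+t. (ennreal (C * ?j t))\<^sup>2 \<partial>lborel) = (\<integral>\<^sup>+t. ennreal (C\<^sup>2) * indicator {0<..<T} t \<partial>lborel)"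
      using C0 by (intro nn_integral_cong) (auto simp: ennreal_power indicator_def power_mult_distrib)
    also have "\<dots> = ennreal (C\<^sup>2 * T)" using T by (simp add: nn_integral_cmult_indicator ennreal_mult)
    also have "(\<integral>\<^sup>+t. (ennreal (?j t * norm (g (x, t))))\<^sup>2 \<partial>lborel) = (\<integral>\<^sup>+t. ennreal (q (x, t)) \<partial>lborel)"
      by (intro nn_integral_cong) (auto simp: ennreal_power indicator_def q_def)
    finally show ?thesis by (simp add: ennreal_power)
  qed
  have le: "(\<integral>\<^sup>+x. ennreal ((norm (slc c g x))\<^sup>2) \<partial>lborel) \<le> ennreal (T * C\<^sup>2 * (LBINT z. q z))"
  proof -
    have "(\<integral>\<^sup>+x. ennreal ((norm (slc c g x))\<^sup>2) \<partial>lborel) \<le> (\<integral>\<^sup>+x. ennreal (C\<^sup>2 * T) * (\<integral>\<^sup>+t. ennreal (q (x, t)) \<partial>lborel) \<partial>lborel)"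
      by (intro nn_integral_mono pt)
    also have "\<dots> = ennreal (C\<^sup>2 * T) * (\<integral>\<^sup>+x. \<integral>\<^sup>+t. ennreal (q (x, t)) \<partial>lborel \<partial>lborel)"
      by (rule nn_integral_cmult) measurable
    also have "(\<integral>\<^sup>+x. \<integral>\<^sup>+t. ennreal (q (x, t)) \<partial>lborel \<partial>lborel) = (\<integral>\<^sup>+z. ennreal (q z) \<partial>(lborel \<Otimes>\<^sub>M lborel))"
      by (rule lborel.nn_integral_fst) measurable
    also have "\<dots> = ennreal (\<integral>z. q z \<partial>(lborel \<Otimes>\<^sub>M lborel))"
      using qi q0 by (intro nn_integral_eq_integral) auto
    finally show ?thesis using T q0 by (simp add: ennreal_mult lborel_prod mult_ac)
  qed
  show sq: "sq_integrable (slc c g)"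
    unfolding sq_integrable_def
  proof
    show "integrable lborel (\<lambda>x. (norm (slc c g x))\<^sup>2)"
      using le by (intro integrableI_nonneg) (auto simp: less_top[symmetric] top_unique)
  qed measurable
  show "sqn (slc c g) \<le> T * C\<^sup>2 * (LBINT z. indicator {0<..<T} (snd z) * (norm (g z))\<^sup>2)"
    using le T q0 by (subst (asm) ennreal_sqn[OF sq, symmetric]) (auto simp: ennreal_le_iff q_def[abs_def])
  fix \<psi> :: "'a \<Rightarrow> 'b" assume \<psi>: "sq_integrable \<psi>"
  have [measurable]: "\<psi> \<in> borel_measurable borel" using \<psi> by (rule sq_integrable_measurable)
  have dom: "integrable (lborel \<Otimes>\<^sub>M lborel) (\<lambda>z. (norm (\<psi> (fst z)))\<^sup>2 * ?j (snd z) + C\<^sup>2 * q z)"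
  proof (intro Bochner_Integration.integrable_add integrable_mult_right qi)
    show "integrable (lborel \<Otimes>\<^sub>M lborel) (\<lambda>z. (norm (\<psi> (fst z)))\<^sup>2 * ?j (snd z))"
    proof (rule lborel_pair.Fubini_integrable)
      show "integrable lborel (\<lambda>x. LBINT t. norm ((norm (\<psi> (fst (x, t))))\<^sup>2 * ?j (snd (x, t))))"
        using sq_integrableD[OF \<psi>] by (simp add: abs_mult)
      show "AE x in lborel. integrable lborel (\<lambda>t. (norm (\<psi> (fst (x, t))))\<^sup>2 * ?j (snd (x, t)))"
        using ji by simp
    qed measurable
  qed
  have bd: "\<bar>\<psi> x \<bullet> (c t *\<^sub>R g (x, t))\<bar> \<le> (norm (\<psi> x))\<^sup>2 * ?j t + C\<^sup>2 * q (x, t)" for x t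
  proof -
    have "\<bar>\<psi> x \<bullet> (c t *\<^sub>R g (x, t))\<bar> \<le> norm (\<psi> x) * norm (c t *\<^sub>R g (x, t))" by (rule Cauchy_Schwarz_ineq2)
    also have "\<dots> \<le> norm (\<psi> x) * (C * ?j t * norm (g (x, t)))"
      using cj[of t] by (intro mult_left_mono) (auto intro!: mult_right_mono)
    also have "\<dots> = ?j t * (norm (\<psi> x) * (C * norm (g (x, t))))" by simp
    also have "\<dots> \<le> ?j t * ((norm (\<psi> x))\<^sup>2 + (C * norm (g (x, t)))\<^sup>2)"
    proof (intro mult_left_mono)
      have "0 \<le> norm (\<psi> x) * (C * norm (g (x, t)))" using C0 by simp
      then show "norm (\<psi> x) * (C * norm (g (x, t))) \<le> (norm (\<psi> x))\<^sup>2 + (C * norm (g (x, t)))\<^sup>2"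
        using sum_squares_bound[of "norm (\<psi> x)" "C * norm (g (x, t))"] by linarith
    qed simp
    finally show ?thesis by (simp add: q_def algebra_simps power_mult_distrib)
  qed
  have i: "integrable (lborel \<Otimes>\<^sub>M lborel) (\<lambda>z. \<psi> (fst z) \<bullet> (c (snd z) *\<^sub>R g z))"
  proof (rule Bochner_Integration.integrable_bound[OF dom])
    show "AE z in lborel \<Otimes>\<^sub>M lborel. norm (\<psi> (fst z) \<bullet> (c (snd z) *\<^sub>R g z)) \<le> norm ((norm (\<psi> (fst z)))\<^sup>2 * ?j (snd z) + C\<^sup>2 * q z)"
    proof (rule AE_I2)
      fix z show "norm (\<psi> (fst z) \<bullet> (c (snd z) *\<^sub>R g z)) \<le> norm ((norm (\<psi> (fst z)))\<^sup>2 * ?j (snd z) + C\<^sup>2 * q z)"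
        using bd[of "fst z" "snd z"] by simp
    qed
  qed measurable
  then show "integrable lborel (\<lambda>z. \<psi> (fst z) \<bullet> (c (snd z) *\<^sub>R g z))" by (simp add: lborel_prod)
  \<comment> \<open>For almost every \<open>x\<close> the time integral is a genuine one, so the
    inner product with \<open>\<psi> x\<close> may be moved inside it; the remaining
    \<open>x\<close> form a null set.\<close>
  have ae: "AE x in lborel. integrable lborel (\<lambda>t. c t *\<^sub>R g (x, t))"
    using lborel_pair.AE_integrable_fst'[OF qi]
  proof eventually_elim
    case (elim x)
    show ?case
    proof (rule Bochner_Integration.integrable_bound)
      show "integrable lborel (\<lambda>t. C * (?j t + q (x, t)))" using elim ji by auto
      show "AE t in lborel. norm (c t *\<^sub>R g (x, t)) \<le> norm (C * (?j t + q (x, t)))"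
      proof (rule AE_I2)
        fix t
        have "norm (c t *\<^sub>R g (x, t)) \<le> (C * ?j t) * norm (g (x, t))"
          using cj[of t] by (simp add: mult_right_mono)
        also have "\<dots> = C * (?j t * norm (g (x, t)))" by simp
        also have "\<dots> \<le> C * (?j t * (1 + (norm (g (x, t)))\<^sup>2))"
        proof (intro mult_left_mono C0)
          show "norm (g (x, t)) \<le> 1 + (norm (g (x, t)))\<^sup>2" by (rule le_one_plus_square)
        qed simp
        also have "\<dots> = C * (?j t + q (x, t))" by (simp add: q_def algebra_simps)
        finally show "norm (c t *\<^sub>R g (x, t)) \<le> norm (C * (?j t + q (x, t)))" by simp
      qed
    qed measurable
  qed
  have "(LBINT x. \<psi> x \<bullet> slc c g x) = (LBINT x. LBINT t. \<psi> x \<bullet> (c t *\<^sub>R g (x, t)))"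
  proof (rule integral_cong_AE)
    show "AE x in lborel. \<psi> x \<bullet> slc c g x = (LBINT t. \<psi> x \<bullet> (c t *\<^sub>R g (x, t)))"
      using ae by eventually_elim (simp only: slc_def integral_inner_right)
  qed measurable
  also have "\<dots> = (\<integral>z. \<psi> (fst z) \<bullet> (c (snd z) *\<^sub>R g z) \<partial>(lborel \<Otimes>\<^sub>M lborel))"
    using lborel_pair.integral_fst'[OF i] by simp
  finally show "(LBINT x. \<psi> x \<bullet> slc c g x) = (LBINT z. \<psi> (fst z) \<bullet> (c (snd z) *\<^sub>R g z))"
    by (simp add: lborel_prod)
qed

lemma AE_snd_neq: "AE z in (lborel :: ('a::euclidean_space \<times> real) measure). snd z \<noteq> t"
proof -
  have "AE z in (lborel \<Otimes>\<^sub>M lborel :: ('a \<times> real) measure). snd z \<noteq> t"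
  proof (intro lborel_pair.AE_pair_measure)
    have "open {z::'a\<times>real. snd z \<noteq> t}"
      by (intro open_Collect_neq continuous_intros)
    then show "{z \<in> space (lborel \<Otimes>\<^sub>M lborel). snd z \<noteq> t} \<in> sets (lborel \<Otimes>\<^sub>M lborel :: ('a \<times> real) measure)"
      unfolding lborel_prod by simp
  qed (simp add: AE_lborel_singleton)
  then show ?thesis unfolding lborel_prod .
qed

text \<open>The weight \<open>a\<close> need not vanish for \<open>t \<le> 0\<close>, so
  \<open>\<phi> (fst z) * a (snd z)\<close> lacks compact support. Steep ramps \<open>l n\<close>
  just below \<open>t = 0\<close> repair this: they leave the side with \<open>u\<close> unchanged,
  and on the other side only a slab of vanishing width is affected.\<close>

lemma H1_on_time_cutoff:
  fixes u :: "(real^3) \<times> real \<Rightarrow> real"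
  assumes H1: "H1_on (UNIV \<times> {..<T}) u G" and u0: "\<And>x t. t \<le> 0 \<Longrightarrow> u (x, t) = 0"
    and T: "0 < T'" "T' < T"
    and a: "\<And>t. (a has_real_derivative a' t) (at t)" "continuous_on UNIV a'" "\<And>t. T' \<le> t \<Longrightarrow> a t = 0"
    and \<phi>: "C1c UNIV \<phi> \<phi>'"
  shows "(LBINT z. indicator {0<..<T} (snd z) * u z * (a (snd z) * (\<phi>' (fst z) \<bullet> h1) + \<phi> (fst z) * a' (snd z) * h2))
    = - (LBINT z. indicator {0<..<T} (snd z) * (fst (G z) \<bullet> h1 + snd (G z) * h2) * (\<phi> (fst z) * a (snd z)))"
proof -
  let ?U = "UNIV \<times> {..<T} :: ((real^3) \<times> real) set"
  let ?h = "(h1, h2)"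
  have um [measurable]: "u \<in> borel_measurable borel" and Gm [measurable]: "G \<in> borel_measurable borel"
    and Gi: "set_integrable lborel ?U (\<lambda>z. (norm (G z))\<^sup>2)"
    and ibp: "\<And>\<psi> \<psi>' h. C1c ?U \<psi> \<psi>' \<Longrightarrow>
         (LINT z:?U|lborel. u z * (\<psi>' z \<bullet> h)) = - (LINT z:?U|lborel. (G z \<bullet> h) * \<psi> z)"
    using H1 unfolding H1_on_def C1c_on_eq by auto
  have Gp [measurable]: "G \<in> borel_measurable (borel \<Otimes>\<^sub>M borel)" by (simp add: borel_prod)
  have [measurable]: "(\<lambda>z. fst (G z)) \<in> borel_measurable (borel \<Otimes>\<^sub>M borel)"
    by (rule borel_measurable_continuous_on[OF continuous_on_fst[OF continuous_on_id] Gp])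
  have [measurable]: "(\<lambda>z. snd (G z)) \<in> borel_measurable (borel \<Otimes>\<^sub>M borel)"
    by (rule borel_measurable_continuous_on[OF continuous_on_snd[OF continuous_on_id] Gp])
  obtain S where S: "compact S" "\<And>x. x \<notin> S \<Longrightarrow> \<phi> x = 0" "\<And>x. x \<notin> S \<Longrightarrow> \<phi>' x = 0"
    using C1c_support[OF \<phi>] by metis
  obtain M where M: "M > 0" "\<And>x. \<bar>\<phi> x\<bar> \<le> M" "\<And>x. norm (\<phi>' x) \<le> M"
    using C1c_bounded[OF \<phi>] by metis
  have ac: "continuous_on UNIV a"
    using a(1) by (auto intro!: continuous_at_imp_continuous_on DERIV_isCont)
  have "bounded (a ` {-1..T})"
    by (intro compact_imp_bounded compact_continuous_image continuous_on_subset[OF ac]) auto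
  then obtain A where A: "\<And>t. t \<in> {-1..T} \<Longrightarrow> \<bar>a t\<bar> \<le> A" unfolding bounded_iff real_norm_def by blast
  have A0: "0 \<le> A" using A[of 0] T by (auto intro: order_trans[OF abs_ge_zero])
  have [measurable]: "\<phi> \<in> borel_measurable borel" "\<phi>' \<in> borel_measurable borel"
     "a \<in> borel_measurable borel" "a' \<in> borel_measurable borel"
    using C1_grad_measurable[OF C1c_C1[OF \<phi>]] ac a(2) by (auto intro: borel_measurable_continuous_onI)
  \<comment> \<open>Equal to 1 for \<open>t \<ge> 0\<close> and to 0 for
    \<open>t \<le> -1 / (n + 1)\<close>.\<close>
  define l where "l n t = sstep (1 - real (Suc n) * t)" for n t
  define l' where "l' n t = sstep' (1 - real (Suc n) * t) * (- real (Suc n))" for n t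
  have ld: "(l n has_real_derivative l' n t) (at t)" for n t
    unfolding l_def[abs_def] l'_def
    by (auto intro!: derivative_eq_intros DERIV_chain2[OF sstep_deriv])
  have lc: "continuous_on UNIV (l' n)" for n
    unfolding l'_def[abs_def] by (intro continuous_intros continuous_on_compose2[OF continuous_sstep']) auto
  have l1: "l n t = 1" "l' n t = 0" if "t \<ge> 0" for n t
    using that by (auto simp: l_def l'_def sstep_le1 sstep'_le1)
  have l0: "l n t = 0" if "t \<le> -1 / real (Suc n)" for n t
    unfolding l_def using that by (intro sstep_ge2) (simp add: field_simps)
  have lb: "0 \<le> l n t" "l n t \<le> 1" for n t by (auto simp: l_def sstep_bounds)
  have [measurable]: "l n \<in> borel_measurable borel" for n
    using ld[of n] by (intro borel_measurable_continuous_onI continuous_at_imp_continuous_on) (auto intro: DERIV_isCont)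
  define g where "g n t = a t * l n t" for n t
  define g' where "g' n t = a t * l' n t + a' t * l n t" for n t
  have gd: "(g n has_real_derivative g' n t) (at t)" for n t
    unfolding g_def[abs_def] g'_def using DERIV_mult[OF a(1) ld] by (simp add: algebra_simps)
  have lcc: "continuous_on UNIV (l n)" for n
    using ld[of n] by (auto intro!: continuous_at_imp_continuous_on DERIV_isCont)
  have gc: "continuous_on UNIV (g' n)" for n
    unfolding g'_def[abs_def] by (intro continuous_intros ac a(2) lc lcc)
  have gz: "g n t = 0" if "t \<notin> {-1..T'}" for n t
  proof (cases "t < -1")
    case True
    have "1 / real (Suc n) \<le> 1" by simp
    then have "t \<le> -1 / real (Suc n)" using True unfolding minus_divide_left[symmetric] by linarith
    then show ?thesis using l0 by (simp add: g_def)
  next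
    case False
    then show ?thesis using that a(3)[of t] by (simp add: g_def)
  qed
  define \<psi> where "\<psi> n z = \<phi> (fst z) * g n (snd z)" for n z
  define \<psi>' where "\<psi>' n z = (g n (snd z) *\<^sub>R \<phi>' (fst z), \<phi> (fst z) * g' n (snd z))" for n z
  have C: "C1c ?U (\<psi> n) (\<psi>' n)" for n
  proof (rule C1c_I)
    show "C1_grad (\<psi> n) (\<psi>' n)"
      unfolding \<psi>_def[abs_def] \<psi>'_def[abs_def] by (rule C1_grad_product[OF C1c_C1[OF \<phi>] gd gc])
    show "compact (S \<times> {-1..T'})" using S(1) by (intro compact_Times) auto
    show "S \<times> {-1..T'} \<subseteq> ?U" using T by auto
    show "\<psi> n z = 0" if "z \<notin> S \<times> {-1..T'}" for z
      using that S(2)[of "fst z"] gz[of "snd z" n] by (cases z) (auto simp: \<psi>_def)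
  qed
  \<comment> \<open>Exact for every \<open>n\<close>, because \<open>u\<close> vanishes for
    \<open>t \<le> 0\<close>; the large derivative of the ramp is multiplied by 0 and never has to
    be estimated.\<close>
  have L: "(LINT z:?U|lborel. u z * (\<psi>' n z \<bullet> ?h)) =
      (LBINT z. indicator {0<..<T} (snd z) * u z * (a (snd z) * (\<phi>' (fst z) \<bullet> h1) + \<phi> (fst z) * a' (snd z) * h2))" for n
    unfolding set_lebesgue_integral_def
  proof (intro Bochner_Integration.integral_cong refl)
    fix z :: "(real^3) \<times> real"
    obtain x t where z: "z = (x, t)" by (cases z)
    show "indicat_real ?U z *\<^sub>R (u z * (\<psi>' n z \<bullet> ?h)) =
        indicator {0<..<T} (snd z) * u z * (a (snd z) * (\<phi>' (fst z) \<bullet> h1) + \<phi> (fst z) * a' (snd z) * h2)"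
      using u0[of t x] l1[of t n]
      by (cases "t \<le> 0") (auto simp: z indicator_def \<psi>'_def g_def g'_def inner_prod_def)
  qed
  have nG: "\<bar>G z \<bullet> ?h\<bar> \<le> norm (G z) * norm ?h" for z by (rule Cauchy_Schwarz_ineq2)
  define dom where "dom z = (M * A * norm ?h) * (indicator (S \<times> {-1..T}) z + indicator ?U z * (norm (G z))\<^sup>2)" for z
  have domi: "integrable lborel dom"
    unfolding dom_def[abs_def]
  proof (intro integrable_mult_right Bochner_Integration.integrable_add)
    have "compact (S \<times> {-1..T})" using S(1) by (intro compact_Times) auto
    then show "integrable lborel (indicat_real (S \<times> {- 1..T}))"
      by (intro integrable_indicator_bounded borel_compact compact_imp_bounded)
    show "integrable lborel (\<lambda>z. indicat_real ?U z * (norm (G z))\<^sup>2)"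
      using Gi by (simp add: set_integrable_def)
  qed
  have lim: "(\<lambda>n. LINT z:?U|lborel. (G z \<bullet> ?h) * \<psi> n z) \<longlonglongrightarrow>
      (LBINT z. indicator {0<..<T} (snd z) * (fst (G z) \<bullet> h1 + snd (G z) * h2) * (\<phi> (fst z) * a (snd z)))"
    unfolding set_lebesgue_integral_def
  proof (rule integral_dominated_convergence[OF _ _ domi])
    have *: "indicat_real ?U z = indicat_real {..<T} (snd z)" for z by (cases z) (simp add: indicator_def)
    show "(\<lambda>z. indicat_real ?U z *\<^sub>R ((G z \<bullet> ?h) * \<psi> n z)) \<in> borel_measurable lborel" for n
      unfolding * \<psi>_def g_def measurable_lborel2 borel_prod[symmetric] by measurable
    show "(\<lambda>z. indicat_real {0<..<T} (snd z) * (fst (G z) \<bullet> h1 + snd (G z) * h2) * (\<phi> (fst z) * a (snd z))) \<in> borel_measurable lborel"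
      unfolding measurable_lborel2 borel_prod[symmetric] by measurable
    show "AE z in lborel. (\<lambda>n. indicat_real ?U z *\<^sub>R ((G z \<bullet> ?h) * \<psi> n z)) \<longlonglongrightarrow>
        indicator {0<..<T} (snd z) * (fst (G z) \<bullet> h1 + snd (G z) * h2) * (\<phi> (fst z) * a (snd z))"
      using AE_snd_neq[of 0]
    proof eventually_elim
      case (elim z)
      obtain x t where z: "z = (x, t)" by (cases z)
      show ?case
      proof (rule tendsto_eventually)
        have t0: "t \<noteq> 0" using elim by (simp add: z)
        show "\<forall>\<^sub>F n in sequentially. indicat_real ?U z *\<^sub>R ((G z \<bullet> ?h) * \<psi> n z) =
            indicator {0<..<T} (snd z) * (fst (G z) \<bullet> h1 + snd (G z) * h2) * (\<phi> (fst z) * a (snd z))"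
        proof (cases "t > 0")
          case True
          then show ?thesis
            using l1(1)[of t] by (intro always_eventually) (auto simp: z indicator_def \<psi>_def g_def inner_prod_def)
        next
          \<comment> \<open>At a fixed negative time the ramp has reached 0 from some
            \<open>n\<close> on.\<close>
          case False
          then have "- t > 0" using t0 by simp
          then obtain N where N: "inverse (real (Suc N)) < - t" using reals_Archimedean by blast
          show ?thesis
            using eventually_ge_at_top[of N]
          proof eventually_elim
            case (elim n)
            have "1 / real (Suc n) \<le> 1 / real (Suc N)" using elim by (intro divide_left_mono) auto
            then have "t \<le> -1 / real (Suc n)" using N by (simp add: inverse_eq_divide)
            then show ?case using l0[of t n] False by (simp add: z \<psi>_def g_def indicator_def)
          qed
        qed
      qed
    qed
    show "AE z in lborel. norm (indicat_real ?U z *\<^sub>R ((G z \<bullet> ?h) * \<psi> n z)) \<le> dom z" for n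
    proof (rule AE_I2)
      fix z :: "(real^3) \<times> real"
      obtain x t where z: "z = (x, t)" by (cases z)
      show "norm (indicat_real ?U z *\<^sub>R ((G z \<bullet> ?h) * \<psi> n z)) \<le> dom z"
      proof (cases "z \<in> ?U \<and> \<psi> n z \<noteq> 0")
        case True
        then have xS: "x \<in> S" "t \<in> {-1..T'}" "t < T"
          using S(2)[of x] gz[of t n] by (auto simp: z \<psi>_def)
        have "\<bar>\<psi> n z\<bar> \<le> M * (A * 1)"
          unfolding \<psi>_def g_def abs_mult z fst_conv snd_conv using M(2)[of x] A[of t] xS T lb[of n t] M(1) A0
          by (intro mult_mono) auto
        then have "\<bar>G z \<bullet> ?h\<bar> * \<bar>\<psi> n z\<bar> \<le> (norm (G z) * norm ?h) * (M * A)"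
          using nG[of z] by (intro mult_mono) auto
        also have "\<dots> = (M * A * norm ?h) * norm (G z)" by simp
        also have "\<dots> \<le> (M * A * norm ?h) * (1 + (norm (G z))\<^sup>2)"
        proof (intro mult_left_mono)
          show "norm (G z) \<le> 1 + (norm (G z))\<^sup>2" by (rule le_one_plus_square)
        qed (use M A0 in auto)
        also have "\<dots> = dom z" using xS T by (auto simp: dom_def z indicator_def)
        finally show ?thesis using True by (simp add: abs_mult)
      next
        case False
        have "0 \<le> dom z" using M A0 by (simp add: dom_def)
        then show ?thesis using False by auto
      qed
    qed
  qed
  define R where "R = (LBINT z. indicator {0<..<T} (snd z) * u z * (a (snd z) * (\<phi>' (fst z) \<bullet> h1) + \<phi> (fst z) * a' (snd z) * h2))"
  have "(LINT z:?U|lborel. (G z \<bullet> ?h) * \<psi> n z) = - R" for n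
    using ibp[OF C[of n], of ?h] unfolding L[of n] R_def by linarith
  then have "(\<lambda>n. LINT z:?U|lborel. (G z \<bullet> ?h) * \<psi> n z) \<longlonglongrightarrow> - R"
    by simp
  from LIMSEQ_unique[OF this lim] show ?thesis unfolding R_def by linarith
qed

text \<open>\<open>W\<close> is the Laplace transform of \<open>u\<close> with a smooth cutoff in time between \<open>T1\<close> and \<open>T\<close>:
  no trace of \<open>u\<close> or \<open>\<partial>u/\<partial>t\<close> at time \<open>T\<close> is needed, and the cutoff only costs the error terms below.\<close>

definition Laplace_sol ::
  "(real^3) set \<Rightarrow> real \<Rightarrow> real \<Rightarrow> (real^3 \<Rightarrow> real) \<Rightarrow> ((real^3) \<times> real \<Rightarrow> real) \<Rightarrow> real \<Rightarrow> real \<Rightarrow>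
   (real^3 \<Rightarrow> real) \<Rightarrow> (real^3 \<Rightarrow> real^3) \<Rightarrow> (real^3 \<Rightarrow> real) \<Rightarrow> bool" where
  "Laplace_sol D T T1 f u C \<tau> W H F \<longleftrightarrow> weak_grad W H \<and> (\<forall>x\<in>closure D. W x = 0) \<and>
     sq_integrable F \<and> sqn F \<le> C * \<tau>\<^sup>2 * exp (- 2 * \<tau> * T1) \<and>
     (\<forall>\<phi> \<phi>'. C1c (- closure D) \<phi> \<phi>' \<longrightarrow>
        (LBINT x. H x \<bullet> \<phi>' x + \<tau>\<^sup>2 * W x * \<phi> x) = (LBINT x. (f x + F x) * \<phi> x)) \<and>
     (\<forall>M. M \<in> sets borel \<longrightarrow> bounded M \<longrightarrow>
        \<bar>(LBINT x. indicator M x * wlap T u x \<tau>) - (LBINT x. indicator M x * W x)\<bar>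
          \<le> C * (1 + measure lborel M) * exp (- \<tau> * T1))"

text \<open>With \<open>a' = b - \<tau> * a\<close>, the wave equation and the definition of the
  weak time derivative are both tested with \<open>\<phi>\<close> times \<open>a\<close>. Combining
  them yields the term \<open>\<tau>\<^sup>2 * W\<close>; everything multiplied by \<open>b\<close>
  goes into \<open>F\<close> and is small because \<open>b\<close> lives on
  \<open>t \<ge> T1\<close>.\<close>

lemma wave_weak_sol_Laplace:
  fixes u :: "(real^3) \<times> real \<Rightarrow> real"
  assumes sol: "wave_weak_sol D T f u" and f: "sq_integrable f" and T: "0 < T1" "T1 < T"
  obtains C where "C > 0" "\<And>\<tau>. \<tau> \<ge> 1 \<Longrightarrow> \<exists>W H F. Laplace_sol D T T1 f u C \<tau> W H F"
proof -
  have T0: "T > 0" using T by simp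
  have u0: "\<And>x t. x \<in> closure D \<Longrightarrow> u (x, t) = 0" "\<And>x t. t \<le> 0 \<Longrightarrow> u (x, t) = 0"
    using sol unfolding wave_weak_sol_def by auto
  obtain G where H1: "H1_on (UNIV \<times> {..<T}) u G"
    and weak: "\<And>\<eta> \<eta>'. C1c ((- closure D) \<times> {..<T}) \<eta> \<eta>' \<Longrightarrow>
           (LINT z:((- closure D) \<times> {0<..<T})|lborel.
                 - (snd (G z) * snd (\<eta>' z)) + fst (G z) \<bullet> fst (\<eta>' z))
           = (LINT x:(- closure D)|lborel. f x * \<eta> (x, 0))"
    using sol unfolding wave_weak_sol_def C1c_on_eq by auto
  have um [measurable]: "u \<in> borel_measurable borel" and Gm [measurable]: "G \<in> borel_measurable borel"
    and ui: "set_integrable lborel (UNIV \<times> {..<T}) (\<lambda>z. (u z)\<^sup>2)"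
    and Gi: "set_integrable lborel (UNIV \<times> {..<T}) (\<lambda>z. (norm (G z))\<^sup>2)"
    using H1 unfolding H1_on_def by auto
  let ?j = "indicat_real {0<..<T}"
  define g1 where "g1 z = fst (G z)" for z
  define g2 where "g2 z = snd (G z)" for z
  have m1 [measurable]: "g1 \<in> borel_measurable borel"
    unfolding g1_def[abs_def] by (rule borel_measurable_continuous_on[OF continuous_on_fst[OF continuous_on_id] Gm])
  have m2 [measurable]: "g2 \<in> borel_measurable borel"
    unfolding g2_def[abs_def] by (rule borel_measurable_continuous_on[OF continuous_on_snd[OF continuous_on_id] Gm])
  have jm [measurable]: "(\<lambda>z::(real^3)\<times>real. ?j (snd z)) \<in> borel_measurable borel"
    unfolding borel_prod[symmetric] by measurable
  have restr: "integrable lborel (\<lambda>z. ?j (snd z) * (norm (g z))\<^sup>2)"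
    if "g \<in> borel_measurable borel" "integrable lborel (\<lambda>z. indicator (UNIV \<times> {..<T}) z * q z)" "\<And>z. (norm (g z))\<^sup>2 \<le> q z"
    for g :: "(real^3) \<times> real \<Rightarrow> 'b::euclidean_space" and q :: "(real^3) \<times> real \<Rightarrow> real"
  proof (rule Bochner_Integration.integrable_bound[OF that(2)])
    show "(\<lambda>z. ?j (snd z) * (norm (g z))\<^sup>2) \<in> borel_measurable lborel" using that(1) by simp
    show "AE z in lborel. norm (?j (snd z) * (norm (g z))\<^sup>2) \<le> norm (indicator (UNIV \<times> {..<T}) z * q z)"
    proof (rule AE_I2)
      fix z show "norm (?j (snd z) * (norm (g z))\<^sup>2) \<le> norm (indicator (UNIV \<times> {..<T}) z * q z)"
        using that(3)[of z] by (cases z) (auto simp: indicator_def)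
    qed
  qed
  have iu: "integrable lborel (\<lambda>z. ?j (snd z) * (norm (u z))\<^sup>2)"
    using ui by (intro restr[of u "\<lambda>z. (u z)\<^sup>2"]) (auto simp: set_integrable_def)
  have iG: "integrable lborel (\<lambda>z. indicator (UNIV \<times> {..<T}) z * (norm (G z))\<^sup>2)"
    using Gi by (simp add: set_integrable_def)
  have i1: "integrable lborel (\<lambda>z. ?j (snd z) * (norm (g1 z))\<^sup>2)"
  proof (rule restr[OF m1 iG])
    fix z show "(norm (g1 z))\<^sup>2 \<le> (norm (G z))\<^sup>2"
      unfolding g1_def using norm_fst_le[of "fst (G z)" "snd (G z)"] by (intro power_mono) auto
  qed
  have i2: "integrable lborel (\<lambda>z. ?j (snd z) * (norm (g2 z))\<^sup>2)"
  proof (rule restr[OF m2 iG])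
    fix z show "(norm (g2 z))\<^sup>2 \<le> (norm (G z))\<^sup>2"
      unfolding g2_def using norm_snd_le[of "snd (G z)" "fst (G z)"] by (intro power_mono) auto
  qed
  define Iu where "Iu = (LBINT z. ?j (snd z) * (norm (u z))\<^sup>2)"
  define I2 where "I2 = (LBINT z. ?j (snd z) * (norm (g2 z))\<^sup>2)"
  have I0: "0 \<le> Iu" "0 \<le> I2" by (auto simp: Iu_def I2_def)
  \<comment> \<open>The cutoff descends over half of the gap and vanishes from
    \<open>T' = (T1 + T) / 2\<close> on, strictly before \<open>T\<close>, as the test functions
    require.\<close>
  define \<delta> where "\<delta> = (T - T1) / 2"
  have \<delta>: "\<delta> > 0" using T by (simp add: \<delta>_def)
  define ct where "ct t = sstep ((t - T1) / \<delta> + 1)" for t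
  define ct' where "ct' t = sstep' ((t - T1) / \<delta> + 1) / \<delta>" for t
  have ctd: "(ct has_real_derivative ct' t) (at t)" for t
  proof -
    have "((\<lambda>t. (t - T1) / \<delta> + 1) has_real_derivative 1 / \<delta>) (at t)"
      using \<delta> by (auto intro!: derivative_eq_intros)
    from DERIV_chain2[OF sstep_deriv this] show ?thesis
      by (simp add: ct_def[abs_def] ct'_def)
  qed
  have ct'c: "continuous_on UNIV ct'"
    unfolding ct'_def[abs_def] using \<delta> by (intro continuous_intros continuous_on_compose2[OF continuous_sstep']) auto
  have ctc: "continuous_on UNIV ct"
    using ctd by (auto intro!: continuous_at_imp_continuous_on DERIV_isCont)
  have ctb: "0 \<le> ct t" "ct t \<le> 1" for t by (auto simp: ct_def sstep_bounds)
  have ct1: "ct t = 1" "ct' t = 0" if "t \<le> T1" for t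
  proof -
    have "(t - T1) / \<delta> + 1 \<le> 1" using that \<delta> by (simp add: divide_le_0_iff)
    then show "ct t = 1" "ct' t = 0" by (auto simp: ct_def ct'_def sstep_le1 sstep'_le1)
  qed
  define T' where "T' = T1 + \<delta>"
  have T': "0 < T'" "T' < T" using T by (auto simp: T'_def \<delta>_def field_simps)
  have ct0: "ct t = 0" if "T' \<le> t" for t
    unfolding ct_def using that \<delta> by (intro sstep_ge2) (simp add: T'_def field_simps)
  have ct'b: "\<bar>ct' t\<bar> \<le> 4 / \<delta>" for t
    using sstep'_bound[of "(t - T1) / \<delta> + 1"] \<delta> by (simp add: ct'_def divide_right_mono)
  have [measurable]: "ct \<in> borel_measurable borel" "ct' \<in> borel_measurable borel"
    using ctc ct'c by (auto intro: borel_measurable_continuous_onI)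
  define C where "C = 1 + T * (4 / \<delta>)\<^sup>2 * (2 * Iu + 2 * I2) + T * Iu"
  have C: "C > 0" "T * (4 / \<delta>)\<^sup>2 * (2 * Iu + 2 * I2) \<le> C" "1 \<le> C" "T * Iu \<le> C"
    using I0 T0 unfolding C_def by (auto simp: add_pos_nonneg)
  show ?thesis
  proof (rule that[OF C(1)])
    fix \<tau> :: real assume \<tau>: "\<tau> \<ge> 1"
    define a where "a t = exp (- \<tau> * t) * ct t" for t
    define b where "b t = exp (- \<tau> * t) * ct' t" for t
    define a' where "a' t = b t - \<tau> * a t" for t
    have ad: "(a has_real_derivative a' t) (at t)" for t
      unfolding a_def[abs_def] a'_def b_def
      by (auto intro!: derivative_eq_intros ctd simp: algebra_simps)
    have a'c: "continuous_on UNIV a'"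
      unfolding a'_def[abs_def] a_def b_def by (intro continuous_intros ctc ct'c)
    have a0: "a t = 0" if "T' \<le> t" for t using ct0[OF that] by (simp add: a_def)
    have [measurable]: "a \<in> borel_measurable borel" "b \<in> borel_measurable borel"
      unfolding a_def[abs_def] b_def[abs_def] by measurable
    define ca where "ca t = ?j t * a t" for t
    define cb where "cb t = ?j t * b t" for t
    define cw where "cw t = ?j t * exp (- \<tau> * t)" for t
    \<comment> \<open>The difference of the weights for \<open>wlap\<close> and for
      \<open>W\<close>. It lives on times beyond \<open>T1\<close>, which makes their discrepancy
      exponentially small.\<close>
    define cr where "cr t = ?j t * (exp (- \<tau> * t) * (1 - ct t))" for t
    have cm [measurable]: "ca \<in> borel_measurable borel" "cb \<in> borel_measurable borel"
      "cw \<in> borel_measurable borel" "cr \<in> borel_measurable borel"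
      unfolding ca_def[abs_def] cb_def[abs_def] cw_def[abs_def] cr_def[abs_def] by measurable
    have e1: "exp (- \<tau> * t) \<le> 1" if "0 < t" for t using that \<tau> by simp
    have cab: "\<bar>ca t\<bar> \<le> 1" for t
      using e1[of t] ctb[of t] by (auto simp: ca_def a_def indicator_def abs_mult intro!: mult_le_one)
    have cwb: "\<bar>cw t\<bar> \<le> 1" for t
      using e1[of t] by (auto simp: cw_def indicator_def)
    have eT: "exp (- \<tau> * t) \<le> exp (- \<tau> * T1)" if "T1 \<le> t" for t using that \<tau> by simp
    have cbb: "\<bar>cb t\<bar> \<le> exp (- \<tau> * T1) * (4 / \<delta>)" for t
    proof (cases "T1 \<le> t")
      case True
      have "\<bar>b t\<bar> \<le> exp (- \<tau> * T1) * (4 / \<delta>)"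
        unfolding b_def abs_mult using eT[OF True] ct'b[of t] by (intro mult_mono) auto
      moreover have "0 \<le> exp (- \<tau> * T1) * (4 / \<delta>)" using \<delta> by simp
      ultimately show ?thesis by (auto simp: cb_def indicator_def)
    next
      case False
      then show ?thesis using ct1(2)[of t] \<delta> by (simp add: cb_def b_def)
    qed
    have crb: "\<bar>cr t\<bar> \<le> exp (- \<tau> * T1)" for t
    proof (cases "T1 \<le> t")
      case True
      have "exp (- \<tau> * t) * (1 - ct t) \<le> exp (- \<tau> * T1) * 1"
        using eT[OF True] ctb[of t] by (intro mult_mono) auto
      then show ?thesis using ctb[of t] by (auto simp: cr_def indicator_def abs_mult)
    next
      case False
      then show ?thesis using ct1(1)[of t] by (simp add: cr_def)
    qed
    have cz: "\<forall>t. t \<notin> {0<..<T} \<longrightarrow> ca t = 0" "\<forall>t. t \<notin> {0<..<T} \<longrightarrow> cb t = 0"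
      "\<forall>t. t \<notin> {0<..<T} \<longrightarrow> cw t = 0" "\<forall>t. t \<notin> {0<..<T} \<longrightarrow> cr t = 0"
      by (auto simp: ca_def cb_def cw_def cr_def)
    \<comment> \<open>Coefficient of \<open>b\<close> in the error: \<open>\<tau> * u\<close> from
      the weak time derivative and \<open>g2\<close>, the time derivative of \<open>u\<close>, from
      the wave equation.\<close>
    define g3 where "g3 z = \<tau> * u z + g2 z" for z
    have m3 [measurable]: "g3 \<in> borel_measurable borel" unfolding g3_def[abs_def] by measurable
    have g3le: "(norm (g3 z))\<^sup>2 \<le> 2 * \<tau>\<^sup>2 * (norm (u z))\<^sup>2 + 2 * (norm (g2 z))\<^sup>2" for z
      using norm_add_sq_le[of "\<tau> * u z" "g2 z"] by (simp add: g3_def power_mult_distrib)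
    have iu2: "integrable lborel (\<lambda>z. 2 * \<tau>\<^sup>2 * (?j (snd z) * (norm (u z))\<^sup>2) + 2 * (?j (snd z) * (norm (g2 z))\<^sup>2))"
      using iu i2 by (intro Bochner_Integration.integrable_add integrable_mult_right)
    have jg3: "?j (snd z) * (norm (g3 z))\<^sup>2 \<le> 2 * \<tau>\<^sup>2 * (?j (snd z) * (norm (u z))\<^sup>2) + 2 * (?j (snd z) * (norm (g2 z))\<^sup>2)" for z
      using g3le[of z] by (auto simp: indicator_def)
    have i3: "integrable lborel (\<lambda>z. ?j (snd z) * (norm (g3 z))\<^sup>2)"
    proof (rule Bochner_Integration.integrable_bound[OF iu2])
      show "AE z in lborel. norm (?j (snd z) * (norm (g3 z))\<^sup>2) \<le> norm (2 * \<tau>\<^sup>2 * (?j (snd z) * (norm (u z))\<^sup>2) + 2 * (?j (snd z) * (norm (g2 z))\<^sup>2))"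
      proof (rule AE_I2)
        fix z
        have "norm (?j (snd z) * (norm (g3 z))\<^sup>2) = ?j (snd z) * (norm (g3 z))\<^sup>2" by simp
        also have "\<dots> \<le> norm (2 * \<tau>\<^sup>2 * (?j (snd z) * (norm (u z))\<^sup>2) + 2 * (?j (snd z) * (norm (g2 z))\<^sup>2))"
          unfolding real_norm_def by (rule order_trans[OF jg3[unfolded real_norm_def] abs_ge_self])
        finally show "norm (?j (snd z) * (norm (g3 z))\<^sup>2) \<le> norm (2 * \<tau>\<^sup>2 * (?j (snd z) * (norm (u z))\<^sup>2) + 2 * (?j (snd z) * (norm (g2 z))\<^sup>2))" .
      qed
    qed simp
    \<comment> \<open>Since \<open>\<tau> \<ge> 1\<close>, the factor \<open>\<tau>\<^sup>2\<close>
      can be put in front of the \<open>I2\<close> term as well.\<close>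
    have I3: "(LBINT z. ?j (snd z) * (norm (g3 z))\<^sup>2) \<le> \<tau>\<^sup>2 * (2 * Iu + 2 * I2)"
    proof -
      have "(LBINT z. ?j (snd z) * (norm (g3 z))\<^sup>2) \<le>
          (LBINT z. 2 * \<tau>\<^sup>2 * (?j (snd z) * (norm (u z))\<^sup>2) + 2 * (?j (snd z) * (norm (g2 z))\<^sup>2))"
        by (rule integral_mono[OF i3 iu2 jg3])
      also have "\<dots> = 2 * \<tau>\<^sup>2 * Iu + 2 * I2"
        unfolding Iu_def I2_def using iu i2
        by (subst Bochner_Integration.integral_add) (auto intro!: integrable_mult_right)
      also have "\<dots> \<le> \<tau>\<^sup>2 * (2 * Iu + 2 * I2)"
      proof -
        have "1 * I2 \<le> \<tau>\<^sup>2 * I2" using \<tau> I0 by (intro mult_right_mono one_le_power) auto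
        then show ?thesis by (simp add: algebra_simps)
      qed
      finally show ?thesis .
    qed
    define W where "W = slc ca u"
    define H where "H = slc ca g1"
    define F where "F = slc cb g3"
    note Wp = slc_props[OF um iu cm(1) cab cz(1) T0, folded W_def]
    note Hp = slc_props[OF m1 i1 cm(1) cab cz(1) T0, folded H_def]
    note Fp = slc_props[OF m3 i3 cm(2) cbb cz(2) T0, folded F_def]
    note wp = slc_props[OF um iu cm(3) cwb cz(3) T0]
    note rp = slc_props[OF um iu cm(4) crb cz(4) T0]
    have cut: "(LBINT z. ?j (snd z) * u z * (a (snd z) * (\<phi>' (fst z) \<bullet> h1) + \<phi> (fst z) * a' (snd z) * h2))
      = - (LBINT z. ?j (snd z) * (fst (G z) \<bullet> h1 + snd (G z) * h2) * (\<phi> (fst z) * a (snd z)))"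
      if "C1c UNIV \<phi> \<phi>'" for \<phi> \<phi>' h1 h2
      by (rule H1_on_time_cutoff[OF H1 u0(2) T' ad a'c a0 that])
    have wg: "weak_grad W H"
      unfolding weak_grad_def
    proof (intro conjI allI impI)
      show "sq_integrable W" "sq_integrable H" using Wp(1) Hp(1) by auto
      fix \<phi> :: "real^3 \<Rightarrow> real" and \<phi>' h assume \<phi>: "C1c UNIV \<phi> \<phi>'"
      have s1: "sq_integrable (\<lambda>x. \<phi>' x \<bullet> h)"
      proof (rule sq_integrable_bound)
        show "integrable lborel (\<lambda>x. (norm h)\<^sup>2 * (norm (\<phi>' x))\<^sup>2)"
          using C1c_sq_integrable(2)[OF \<phi>] by (intro integrable_mult_right sq_integrableD)
        show "(\<lambda>x. \<phi>' x \<bullet> h) \<in> borel_measurable borel"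
          using C1_grad_measurable(2)[OF C1c_C1[OF \<phi>]] by measurable
        show "(norm (\<phi>' x \<bullet> h))\<^sup>2 \<le> (norm h)\<^sup>2 * (norm (\<phi>' x))\<^sup>2" for x
          using power_mono[OF Cauchy_Schwarz_ineq2[of "\<phi>' x" h], of 2] by (simp add: power_mult_distrib mult.commute)
      qed
      have s2: "sq_integrable (\<lambda>x. \<phi> x *\<^sub>R h)"
      proof (rule sq_integrable_bound)
        show "integrable lborel (\<lambda>x. (norm h)\<^sup>2 * (norm (\<phi> x))\<^sup>2)"
          using C1c_sq_integrable(1)[OF \<phi>] by (intro integrable_mult_right sq_integrableD)
        show "(\<lambda>x. \<phi> x *\<^sub>R h) \<in> borel_measurable borel"
          using C1_grad_measurable(1)[OF C1c_C1[OF \<phi>]] by measurable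
      qed (simp add: power_mult_distrib mult.commute)
      have "(LBINT x. W x * (\<phi>' x \<bullet> h)) = (LBINT x. (\<phi>' x \<bullet> h) \<bullet> W x)"
        by (simp add: mult.commute)
      also have "\<dots> = (LBINT z. ?j (snd z) * u z * (a (snd z) * (\<phi>' (fst z) \<bullet> h) + \<phi> (fst z) * a' (snd z) * 0))"
        unfolding Wp(4)[OF s1] by (intro Bochner_Integration.integral_cong refl) (simp add: ca_def)
      also have "\<dots> = - (LBINT z. ?j (snd z) * (fst (G z) \<bullet> h + snd (G z) * 0) * (\<phi> (fst z) * a (snd z)))"
        by (rule cut[OF \<phi>])
      also have "(LBINT z. ?j (snd z) * (fst (G z) \<bullet> h + snd (G z) * 0) * (\<phi> (fst z) * a (snd z)))
          = (LBINT x. (\<phi> x *\<^sub>R h) \<bullet> H x)"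
        unfolding Hp(4)[OF s2] by (intro Bochner_Integration.integral_cong refl) (simp add: ca_def g1_def inner_commute)
      also have "\<dots> = (LBINT x. (H x \<bullet> h) * \<phi> x)"
        by (simp add: inner_commute mult.commute)
      finally show "(LBINT x. W x * (\<phi>' x \<bullet> h)) = - (LBINT x. (H x \<bullet> h) * \<phi> x)" .
    qed
    have W0: "W x = 0" if "x \<in> closure D" for x
      using u0(1)[OF that] by (simp add: W_def slc_def)
    have Fb: "sqn F \<le> C * \<tau>\<^sup>2 * exp (- 2 * \<tau> * T1)"
    proof -
      have "sqn F \<le> T * (exp (- \<tau> * T1) * (4 / \<delta>))\<^sup>2 * (LBINT z. ?j (snd z) * (norm (g3 z))\<^sup>2)" by (rule Fp(2))
      also have "\<dots> \<le> T * (exp (- \<tau> * T1) * (4 / \<delta>))\<^sup>2 * (\<tau>\<^sup>2 * (2 * Iu + 2 * I2))"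
        using T0 by (intro mult_left_mono I3) auto
      also have "\<dots> = (T * (4 / \<delta>)\<^sup>2 * (2 * Iu + 2 * I2)) * (\<tau>\<^sup>2 * (exp (- \<tau> * T1))\<^sup>2)"
        unfolding power_mult_distrib[of "exp (- \<tau> * T1)"] by (simp only: mult_ac)
      also have "\<dots> \<le> C * (\<tau>\<^sup>2 * (exp (- \<tau> * T1))\<^sup>2)"
        using C(2) by (intro mult_right_mono) auto
      also have "(exp (- \<tau> * T1))\<^sup>2 = exp (- 2 * \<tau> * T1)"
        by (simp add: power2_eq_square flip: exp_add)
      finally show ?thesis by (simp add: mult.assoc)
    qed
    have eqn: "(LBINT x. H x \<bullet> \<phi>' x + \<tau>\<^sup>2 * W x * \<phi> x) = (LBINT x. (f x + F x) * \<phi> x)"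
      if \<phi>: "C1c (- closure D) \<phi> \<phi>'" for \<phi> \<phi>'
    proof -
      have \<phi>U: "C1c UNIV \<phi> \<phi>'" by (rule C1c_mono[OF \<phi>]) simp
      have s\<phi>: "sq_integrable \<phi>" "sq_integrable \<phi>'" using C1c_sq_integrable[OF \<phi>] by auto
      obtain S where S: "compact S" "S \<subseteq> - closure D" "\<And>x. x \<notin> S \<Longrightarrow> \<phi> x = 0" "\<And>x. x \<notin> S \<Longrightarrow> \<phi>' x = 0"
        using C1c_support[OF \<phi>] by metis
      have outz: "\<phi> x = 0" "\<phi>' x = 0" if "x \<in> closure D" for x using S that by auto
      \<comment> \<open>Makes the support compact in time. It equals 1 for \<open>t \<ge> 0\<close>,
        so neither the space-time integral nor the initial value
        \<open>\<eta> (x, 0) = \<phi> x\<close> changes.\<close>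
      define l where "l t = sstep (1 - t)" for t :: real
      define l' where "l' t = - sstep' (1 - t)" for t :: real
      have ld: "(l has_real_derivative l' t) (at t)" for t
      proof -
        have "((\<lambda>t. 1 - t) has_real_derivative - 1) (at t)" by (auto intro!: derivative_eq_intros)
        from DERIV_chain2[OF sstep_deriv this] show ?thesis by (simp add: l_def[abs_def] l'_def)
      qed
      have lc: "continuous_on UNIV l'"
        unfolding l'_def[abs_def] by (intro continuous_intros continuous_on_compose2[OF continuous_sstep']) auto
      have lc': "continuous_on UNIV l"
        using ld by (auto intro!: continuous_at_imp_continuous_on DERIV_isCont)
      have l1: "l t = 1" "l' t = 0" if "t \<ge> 0" for t using that by (auto simp: l_def l'_def sstep_le1 sstep'_le1)
      have l0: "l t = 0" if "t \<le> -1" for t unfolding l_def using that by (intro sstep_ge2) simp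
      define \<eta> where "\<eta> z = \<phi> (fst z) * (a (snd z) * l (snd z))" for z
      define \<eta>' where "\<eta>' z = ((a (snd z) * l (snd z)) *\<^sub>R \<phi>' (fst z), \<phi> (fst z) * (a (snd z) * l' (snd z) + a' (snd z) * l (snd z)))" for z
      have ac: "continuous_on UNIV a"
        using ad by (auto intro!: continuous_at_imp_continuous_on DERIV_isCont)
      have \<eta>C: "C1c ((- closure D) \<times> {..<T}) \<eta> \<eta>'"
      proof (rule C1c_I)
        show "C1_grad \<eta> \<eta>'"
          unfolding \<eta>_def[abs_def] \<eta>'_def[abs_def]
        proof (rule C1_grad_product[OF C1c_C1[OF \<phi>]])
          show "((\<lambda>t. a t * l t) has_real_derivative a t * l' t + a' t * l t) (at t)" for t
            using DERIV_mult[OF ad ld] by (simp add: algebra_simps)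
          show "continuous_on UNIV (\<lambda>t. a t * l' t + a' t * l t)"
            by (intro continuous_intros ac a'c lc lc')
        qed
        show "compact (S \<times> {-1..T'})" using S(1) by (intro compact_Times) auto
        show "S \<times> {-1..T'} \<subseteq> (- closure D) \<times> {..<T}" using S(2) T' by auto
        show "\<eta> z = 0" if "z \<notin> S \<times> {-1..T'}" for z
          using that S(3)[of "fst z"] a0[of "snd z"] l0[of "snd z"] by (cases z) (fastforce simp: \<eta>_def not_le)
      qed
      have "(LINT x:(- closure D)|lborel. f x * \<eta> (x, 0)) = (LBINT x. f x * \<phi> x)"
        unfolding set_lebesgue_integral_def
        using outz(1) ct1(1)[of 0] l1(1)[of 0] T
        by (intro Bochner_Integration.integral_cong refl) (auto simp: \<eta>_def a_def indicator_def)
      moreover have "(LINT z:((- closure D) \<times> {0<..<T})|lborel. - (snd (G z) * snd (\<eta>' z)) + fst (G z) \<bullet> fst (\<eta>' z))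
        = (LBINT z. \<phi>' (fst z) \<bullet> (ca (snd z) *\<^sub>R g1 z) - ?j (snd z) * a' (snd z) * g2 z * \<phi> (fst z))"
        unfolding set_lebesgue_integral_def
      proof (intro Bochner_Integration.integral_cong refl)
        fix z :: "(real^3) \<times> real"
        obtain x t where z: "z = (x, t)" by (cases z)
        show "indicat_real ((- closure D) \<times> {0<..<T}) z *\<^sub>R (- (snd (G z) * snd (\<eta>' z)) + fst (G z) \<bullet> fst (\<eta>' z)) =
          \<phi>' (fst z) \<bullet> (ca (snd z) *\<^sub>R g1 z) - ?j (snd z) * a' (snd z) * g2 z * \<phi> (fst z)"
          using outz[of x] l1[of t]
          by (cases "x \<in> closure D"; cases "t \<in> {0<..<T}")
             (auto simp: z indicator_def \<eta>'_def ca_def g1_def g2_def inner_commute)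
      qed
      ultimately have E1: "(LBINT z. \<phi>' (fst z) \<bullet> (ca (snd z) *\<^sub>R g1 z) - ?j (snd z) * a' (snd z) * g2 z * \<phi> (fst z))
          = (LBINT x. f x * \<phi> x)"
        using weak[OF \<eta>C] by simp
      note k1 = Hp(3)[OF s\<phi>(2)]
      note k2 = slc_props(3)[OF m2 i2 cm(1) cab cz(1) T0 s\<phi>(1)]
      note k3 = slc_props(3)[OF m2 i2 cm(2) cbb cz(2) T0 s\<phi>(1)]
      note k4 = Wp(3)[OF s\<phi>(1)]
      note k5 = slc_props(3)[OF um iu cm(2) cbb cz(2) T0 s\<phi>(1)]
      let ?A2 = "LBINT z. \<phi> (fst z) \<bullet> (ca (snd z) *\<^sub>R g2 z)"
      let ?B2 = "LBINT z. \<phi> (fst z) \<bullet> (cb (snd z) *\<^sub>R g2 z)"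
      let ?Au = "LBINT z. \<phi> (fst z) \<bullet> (ca (snd z) *\<^sub>R u z)"
      let ?Bu = "LBINT z. \<phi> (fst z) \<bullet> (cb (snd z) *\<^sub>R u z)"
      let ?A1 = "LBINT z. \<phi>' (fst z) \<bullet> (ca (snd z) *\<^sub>R g1 z)"
      have "(LBINT z. \<phi>' (fst z) \<bullet> (ca (snd z) *\<^sub>R g1 z) - ?j (snd z) * a' (snd z) * g2 z * \<phi> (fst z))
        = (LBINT z. \<phi>' (fst z) \<bullet> (ca (snd z) *\<^sub>R g1 z) - (\<phi> (fst z) \<bullet> (cb (snd z) *\<^sub>R g2 z) - \<tau> * (\<phi> (fst z) \<bullet> (ca (snd z) *\<^sub>R g2 z))))"
        by (intro Bochner_Integration.integral_cong refl) (simp add: ca_def cb_def a'_def algebra_simps)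
      also have "\<dots> = ?A1 - (?B2 - \<tau> * ?A2)"
        using k1 k2 k3 by (simp add: Bochner_Integration.integral_diff)
      finally have E2: "?A1 - ?B2 + \<tau> * ?A2 = (LBINT x. f x * \<phi> x)" using E1 by simp
      \<comment> \<open>Pure time direction \<open>(0, 1)\<close>: trades the pairing with the time
        derivative of \<open>u\<close> for one with \<open>u\<close> itself and supplies the second
        factor \<open>\<tau>\<close>.\<close>
      have "(LBINT z. ?j (snd z) * u z * (a (snd z) * (\<phi>' (fst z) \<bullet> 0) + \<phi> (fst z) * a' (snd z) * 1))
        = (LBINT z. \<phi> (fst z) \<bullet> (cb (snd z) *\<^sub>R u z) - \<tau> * (\<phi> (fst z) \<bullet> (ca (snd z) *\<^sub>R u z)))"
        by (intro Bochner_Integration.integral_cong refl) (simp add: ca_def cb_def a'_def algebra_simps)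
      also have "\<dots> = ?Bu - \<tau> * ?Au"
        using k4 k5 by (simp add: Bochner_Integration.integral_diff)
      finally have "?Bu - \<tau> * ?Au = - (LBINT z. ?j (snd z) * (fst (G z) \<bullet> 0 + snd (G z) * 1) * (\<phi> (fst z) * a (snd z)))"
        using cut[OF \<phi>U, of 0 1] by simp
      also have "(LBINT z. ?j (snd z) * (fst (G z) \<bullet> 0 + snd (G z) * 1) * (\<phi> (fst z) * a (snd z))) = ?A2"
        by (intro Bochner_Integration.integral_cong refl) (simp add: ca_def g2_def)
      finally have E3: "?A2 = \<tau> * ?Au - ?Bu" by simp
      \<comment> \<open>Eliminating \<open>?A2\<close> between E2 and E3 leaves exactly the terms
        \<open>\<tau> * ?Bu + ?B2\<close>, which define \<open>F\<close>.\<close>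
      have "(LBINT x. F x * \<phi> x) = (LBINT x. \<phi> x \<bullet> F x)" by (simp add: mult.commute)
      also have "\<dots> = (LBINT z. \<tau> * (\<phi> (fst z) \<bullet> (cb (snd z) *\<^sub>R u z)) + \<phi> (fst z) \<bullet> (cb (snd z) *\<^sub>R g2 z))"
        unfolding Fp(4)[OF s\<phi>(1)] by (intro Bochner_Integration.integral_cong refl) (simp add: g3_def algebra_simps)
      also have "\<dots> = \<tau> * ?Bu + ?B2"
        using k3 k5 by (simp add: Bochner_Integration.integral_add)
      finally have E4: "(LBINT x. F x * \<phi> x) = \<tau> * ?Bu + ?B2" .
      have E5: "(LBINT x. H x \<bullet> \<phi>' x) = ?A1"
        unfolding Hp(4)[OF s\<phi>(2), symmetric] by (simp add: inner_commute)
      have E6: "(LBINT x. W x * \<phi> x) = ?Au"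
        unfolding Wp(4)[OF s\<phi>(1), symmetric] by (simp add: mult.commute)
      have "(LBINT x. H x \<bullet> \<phi>' x + \<tau>\<^sup>2 * W x * \<phi> x) = (LBINT x. H x \<bullet> \<phi>' x + \<tau>\<^sup>2 * (W x * \<phi> x))"
        by (simp add: mult.assoc)
      also have "\<dots> = ?A1 + \<tau>\<^sup>2 * ?Au"
        using integrable_inner[OF Hp(1) s\<phi>(2)] integrable_mult_sq[OF Wp(1) s\<phi>(1)]
        by (subst Bochner_Integration.integral_add) (auto simp: E5 E6)
      also have "\<dots> = (LBINT x. f x * \<phi> x) + (LBINT x. F x * \<phi> x)"
      proof -
        have "\<tau> * ?A2 = \<tau>\<^sup>2 * ?Au - \<tau> * ?Bu"
          unfolding E3 right_diff_distrib power2_eq_square by (simp only: mult.assoc)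
        then show ?thesis using E2 E4 by linarith
      qed
      also have "\<dots> = (LBINT x. (f x + F x) * \<phi> x)"
        using integrable_mult_sq[OF f s\<phi>(1)] integrable_mult_sq[OF Fp(1) s\<phi>(1)]
        by (simp add: distrib_right)
      finally show ?thesis .
    qed
    \<comment> \<open>The closed interval of \<open>wlap\<close> and the open one of the weights
      differ at 0, where \<open>u\<close> vanishes, and at the null set
      \<open>t = T\<close>.\<close>
    have wl: "wlap T u x \<tau> = slc cw u x" for x
      unfolding wlap_def slc_def set_lebesgue_integral_def
    proof (rule integral_cong_AE)
      have up [measurable]: "u \<in> borel_measurable (borel \<Otimes>\<^sub>M borel)" by (simp add: borel_prod)
      show "(\<lambda>t. indicat_real {0..T} t *\<^sub>R (exp (- \<tau> * t) * u (x, t))) \<in> borel_measurable lborel" by measurable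
      show "(\<lambda>t. cw t *\<^sub>R u (x, t)) \<in> borel_measurable lborel" by measurable
      show "AE t in lborel. indicat_real {0..T} t *\<^sub>R (exp (- \<tau> * t) * u (x, t)) = cw t *\<^sub>R u (x, t)"
        using AE_lborel_singleton[of T]
      proof eventually_elim
        case (elim t)
        then show ?case using u0(2)[of t x] by (cases "t \<le> 0") (auto simp: cw_def indicator_def)
      qed
    qed
    have rest: "\<bar>(LBINT x. indicator M x * wlap T u x \<tau>) - (LBINT x. indicator M x * W x)\<bar>
           \<le> C * (1 + measure lborel M) * exp (- \<tau> * T1)" if M: "M \<in> sets borel" "bounded M" for M
    proof -
      have fin: "emeasure lborel M < \<infinity>" by (rule emeasure_bounded_finite[OF M(2)])
      have sM: "sq_integrable (indicat_real M)"
        by (rule sq_integrable_bounded_support[of _ 1 M]) (use M in \<open>auto simp: indicator_le_1\<close>)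
      have "(LBINT x. indicator M x * wlap T u x \<tau>) - (LBINT x. indicator M x * W x)
        = (LBINT x. indicator M x \<bullet> slc cw u x) - (LBINT x. indicator M x \<bullet> W x)"
        by (simp add: wl)
      also have "\<dots> = (LBINT z. indicator M (fst z) \<bullet> (cw (snd z) *\<^sub>R u z) - indicator M (fst z) \<bullet> (ca (snd z) *\<^sub>R u z))"
        unfolding Wp(4)[OF sM] wp(4)[OF sM] using Wp(3)[OF sM] wp(3)[OF sM]
        by (simp add: Bochner_Integration.integral_diff)
      also have "\<dots> = (LBINT z. indicator M (fst z) \<bullet> (cr (snd z) *\<^sub>R u z))"
        by (intro Bochner_Integration.integral_cong refl) (simp add: cw_def ca_def cr_def a_def algebra_simps)
      also have "\<dots> = (LBINT x. indicator M x * slc cr u x)"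
        unfolding rp(4)[OF sM, symmetric] by simp
      finally have eq: "(LBINT x. indicator M x * wlap T u x \<tau>) - (LBINT x. indicator M x * W x)
        = (LBINT x. indicator M x * slc cr u x)" .
      \<comment> \<open>As weight in Young's inequality, \<open>e\<close> matches
        \<open>sqn (slc cr u)\<close>, which is of order \<open>e\<^sup>2\<close>, so both terms are
        of order \<open>e\<close>.\<close>
      define e where "e = exp (- \<tau> * T1)"
      have e0: "e > 0" by (simp add: e_def)
      have b1: "(LBINT x. indicator M x * slc cr u x) \<le> sqn (slc cr u) / (2 * e) + e * measure lborel M / 2"
        by (rule indicator_integral_le_sqn[OF rp(1) M(1) fin e0])
      have "(LBINT x. indicator M x * - slc cr u x) \<le> sqn (\<lambda>x. - slc cr u x) / (2 * e) + e * measure lborel M / 2"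
        by (rule indicator_integral_le_sqn[OF sq_integrable_uminus[OF rp(1)] M(1) fin e0])
      then have b2: "- (LBINT x. indicator M x * slc cr u x) \<le> sqn (slc cr u) / (2 * e) + e * measure lborel M / 2"
        by simp
      have "sqn (slc cr u) \<le> T * e\<^sup>2 * Iu" using rp(2) by (simp add: e_def Iu_def)
      then have "sqn (slc cr u) / (2 * e) \<le> T * e\<^sup>2 * Iu / (2 * e)" using e0 by (intro divide_right_mono) auto
      also have "\<dots> = (T * Iu / 2) * e" using e0 by (simp add: power2_eq_square)
      finally have "sqn (slc cr u) / (2 * e) + e * measure lborel M / 2 \<le> (T * Iu / 2) * e + e * measure lborel M / 2" by simp
      also have "\<dots> \<le> C * e + C * e * measure lborel M"
      proof (intro add_mono)
        have "T * Iu / 2 \<le> C" using C(3,4) by linarith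
        then show "(T * Iu / 2) * e \<le> C * e" using e0 by (intro mult_right_mono) auto
        have "e * measure lborel M / 2 = 1/2 * (e * measure lborel M)" by simp
        also have "\<dots> \<le> C * (e * measure lborel M)" using C(3) e0 by (intro mult_right_mono) auto
        finally show "e * measure lborel M / 2 \<le> C * e * measure lborel M" by (simp add: mult.assoc)
      qed
      also have "\<dots> = C * (1 + measure lborel M) * e" by (simp add: algebra_simps)
      finally have "sqn (slc cr u) / (2 * e) + e * measure lborel M / 2 \<le> C * (1 + measure lborel M) * e" .
      then show ?thesis unfolding eq e_def[symmetric] using b1 b2 by linarith
    qed
    show "\<exists>W H F. Laplace_sol D T T1 f u C \<tau> W H F"
      unfolding Laplace_sol_def using wg W0 Fp(1) Fb eqn rest by blast
  qed
qed

section \<open>Barriers and the logarithmic asymptotics\<close>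

lemma yuk_indicator_integrable:
  assumes e: "e > 0" and k: "k \<ge> 0" and B: "B \<in> sets borel" "bounded B"
  shows "integrable lborel (\<lambda>z. indicator B z * yuk k e (x - z))" "integrable lborel (\<lambda>z. indicator B z * yuk k e (z - x))"
proof -
  have [measurable]: "yuk k e \<in> borel_measurable borel" "B \<in> sets borel"
    using C1_grad_measurable[OF yuk_C1[OF e]] B by auto
  have *: "\<bar>indicator B z * yuk k e y\<bar> \<le> 1 / e + k / e + 1 / e\<^sup>2" for y z
    using yuk_bounded(1)[OF e k, of y] e k by (auto simp: indicator_def)
  show "integrable lborel (\<lambda>z. indicator B z * yuk k e (x - z))"
    by (rule integrable_bounded_support[OF _ _ B(2), of _ "1 / e + k / e + 1 / e\<^sup>2"]) (use * in auto)
  show "integrable lborel (\<lambda>z. indicator B z * yuk k e (z - x))"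
    by (rule integrable_bounded_support[OF _ _ B(2), of _ "1 / e + k / e + 1 / e\<^sup>2"]) (use * in auto)
qed

lemma indicator_integral_ge:
  fixes g :: "'a::euclidean_space \<Rightarrow> real"
  assumes A: "A \<in> sets borel" "bounded A" "A \<subseteq> B" and i: "integrable lborel (\<lambda>z. indicator B z * g z)"
    and g: "\<And>z. z \<in> B \<Longrightarrow> 0 \<le> g z" "\<And>z. z \<in> A \<Longrightarrow> c \<le> g z"
  shows "measure lborel A * c \<le> (LBINT z. indicator B z * g z)"
proof -
  have iA: "integrable lborel (indicat_real A)" by (rule integrable_indicator_bounded[OF A(1,2)])
  have "measure lborel A * c = (LBINT z. indicator A z * c)" by simp
  also have "\<dots> \<le> (LBINT z. indicator B z * g z)"
    using integrable_mult_left[OF iA, of c] g A(3) by (intro integral_mono i) (auto split: split_indicator)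
  finally show ?thesis .
qed

lemma indicator_integral_le:
  fixes g :: "'a::euclidean_space \<Rightarrow> real"
  assumes B: "B \<in> sets borel" "bounded B" and i: "integrable lborel (\<lambda>z. indicator B z * g z)"
    and g: "\<And>z. z \<in> B \<Longrightarrow> g z \<le> c"
  shows "(LBINT z. indicator B z * g z) \<le> measure lborel B * c"
proof -
  have iB: "integrable lborel (indicat_real B)" by (rule integrable_indicator_bounded[OF B])
  have "(LBINT z. indicator B z * g z) \<le> (LBINT z. indicator B z * c)"
    using integrable_mult_left[OF iB, of c] g by (intro integral_mono i) (auto split: split_indicator)
  then show ?thesis by simp
qed

lemma yuk_at_infinity:
  assumes "e > 0" "k \<ge> 0" shows "((\<lambda>x. yuk k e (x - p)) \<longlongrightarrow> 0) at_infinity"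
  unfolding Lim_at_infinity
proof (intro allI impI)
  fix a :: real assume a: "a > 0"
  show "\<exists>b. \<forall>x. b \<le> norm x \<longrightarrow> dist (yuk k e (x - p)) 0 < a"
  proof (intro exI allI impI)
    fix x :: "real^3" assume x: "norm p + 1 / a + 1 \<le> norm x"
    have n: "1 / a + 1 \<le> norm (x - p)" using x norm_triangle_ineq2[of x p] by linarith
    have "yuk k e (x - p) \<le> exp (- k * 0) / (1 / a + 1)"
      using a n by (intro yuk_le assms) (auto simp: add_pos_pos)
    also have "\<dots> < a" using a by (simp add: field_simps)
    finally show "dist (yuk k e (x - p)) 0 < a" using yuk_pos[OF assms(1), of k "x - p"] by simp
  qed
qed

lemma yconv_nonneg: "e > 0 \<Longrightarrow> 0 \<le> yconv k e B x"
  unfolding yconv_def using yuk_pos[of e k] by (intro mult_nonneg_nonneg integral_nonneg_AE AE_I2) (auto simp: less_imp_le)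

lemma yconv_le:
  assumes e: "e > 0" and k: "k \<ge> 0" and B: "B \<in> sets borel" "bounded B" and c: "\<And>z. z \<in> B \<Longrightarrow> yuk k e (x - z) \<le> c"
  shows "yconv k e B x \<le> measure lborel B * c / (4 * pi)"
  using indicator_integral_le[OF B yuk_indicator_integrable(1)[OF e k B] c]
  by (simp add: yconv_def divide_right_mono)

lemma yconv_ge:
  assumes e: "e > 0" and k: "k \<ge> 0" and B: "B \<in> sets borel" "bounded B"
    and A: "A \<in> sets borel" "A \<subseteq> B" and c: "\<And>z. z \<in> A \<Longrightarrow> c \<le> yuk k e (x - z)"
  shows "measure lborel A * c / (4 * pi) \<le> yconv k e B x"
  using indicator_integral_ge[OF A(1) bounded_subset[OF B(2) A(2)] A(2) yuk_indicator_integrable(1)[OF e k B] less_imp_le[OF yuk_pos[OF e]] c]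
  by (simp add: yconv_def divide_right_mono)

lemma yconv_at_infinity:
  assumes e: "e > 0" and k: "k \<ge> 0" and B: "B \<in> sets borel" "bounded B"
  shows "(yconv k e B \<longlongrightarrow> 0) at_infinity"
  unfolding Lim_at_infinity
proof (intro allI impI)
  fix a :: real assume a: "a > 0"
  obtain R where R: "\<And>z. z \<in> B \<Longrightarrow> norm z \<le> R" using B(2) unfolding bounded_iff by blast
  define v where "v = measure lborel B"
  have v: "v \<ge> 0" by (simp add: v_def)
  show "\<exists>b. \<forall>x. b \<le> norm x \<longrightarrow> dist (yconv k e B x) 0 < a"
  proof (intro exI allI impI)
    fix x :: "real^3" assume x: "R + v / a + 1 \<le> norm x"
    have va: "0 < v / a + 1" using a v by (simp add: add_nonneg_pos)
    have "yconv k e B x \<le> measure lborel B * (exp (- k * 0) / (v / a + 1)) / (4 * pi)"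
    proof (rule yconv_le[OF e k B])
      fix z assume z: "z \<in> B"
      have "v / a + 1 \<le> norm (x - z)" using x R[OF z] norm_triangle_ineq2[of x z] by linarith
      then show "yuk k e (x - z) \<le> exp (- k * 0) / (v / a + 1)" using va by (intro yuk_le e k) auto
    qed
    also have "\<dots> = v / (v / a + 1) / (4 * pi)" by (simp add: v_def)
    also have "\<dots> \<le> v / (v / a + 1) / 1" using v va pi_ge_two by (intro divide_left_mono) auto
    also have "\<dots> < a" using a v va by (simp add: divide_less_eq field_simps)
    finally show "dist (yconv k e B x) 0 < a" using yconv_nonneg[OF e, of k B x] by simp
  qed
qed

text \<open>Decay of a barrier yields the boundedness hypothesis of \<open>weak_comparison\<close>,
  which gives the test function compact support in an unbounded domain.\<close>

lemma at_infinity_bounded: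
  fixes q :: "'a::euclidean_space \<Rightarrow> real"
  assumes "(q \<longlongrightarrow> 0) at_infinity" "a > 0" shows "bounded {x. q x \<le> - a}"
proof -
  obtain b where b: "\<And>x. b \<le> norm x \<Longrightarrow> dist (q x) 0 < a"
    using assms unfolding Lim_at_infinity by blast
  have "norm x \<le> \<bar>b\<bar>" if "q x \<le> - a" for x
    using b[of x] that assms(2) by (cases "b \<le> norm x") auto
  then show ?thesis unfolding bounded_iff by blast
qed

text \<open>With \<open>\<sigma> = 1\<close> a barrier bounds the indicator function from below, with \<open>\<sigma> = -1\<close> from above.\<close>

definition barrier ::
  "(real^3) set \<Rightarrow> (real^3) set \<Rightarrow> real \<Rightarrow> real \<Rightarrow> (real^3 \<Rightarrow> real) \<Rightarrow> (real^3 \<Rightarrow> real^3) \<Rightarrow> bool" where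
  "barrier D B \<tau> \<sigma> g g' \<longleftrightarrow> C1_grad g g' \<and> (g \<longlongrightarrow> 0) at_infinity \<and>
     (\<forall>\<phi> \<phi>'. C1c (- closure D) \<phi> \<phi>' \<longrightarrow> (\<forall>x. 0 \<le> \<phi> x) \<longrightarrow> 0 \<le> (LBINT x. g' x \<bullet> \<phi>' x + \<tau>\<^sup>2 * g x * \<phi> x)) \<and>
     (\<exists>e0>0. \<forall>e x. 0 < e \<longrightarrow> e < e0 \<longrightarrow> x \<in> closure D \<longrightarrow> 0 \<le> \<sigma> * yconv \<tau> e B x + g x)"

text \<open>\<open>\<sigma> * W\<close> is compared with \<open>q = \<sigma> * yconv + g\<close>,
  which is nonnegative on the closure of \<open>D\<close>, where \<open>W\<close> is 0. Regularising
  the free solution makes \<open>q\<close> a C^1 function; its parameter is then sent to 0 with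
  \<open>\<tau>\<close> fixed.\<close>

lemma Ifun_comparison:
  fixes D :: "(real^3) set" and u :: "(real^3) \<times> real \<Rightarrow> real"
  assumes D: "open D" "bounded D" "C2_boundary D"
    and sol: "wave_weak_sol D T (indicator (ball p r)) u" and T: "0 < T1" "T1 < T"
  obtains E where "E > 0" "\<And>\<tau> \<sigma> g g'. \<tau> \<ge> 1 \<Longrightarrow> \<bar>\<sigma>\<bar> = 1 \<Longrightarrow> barrier D (ball p r) \<tau> \<sigma> g g' \<Longrightarrow>
     - \<sigma> * Ifun T u p r p' r' \<tau> \<le> (LBINT x. indicator (ball p' r') x * g x) + E * exp (- \<tau> * T1)"
proof -
  let ?B = "ball p r" and ?B' = "ball p' r'"
  have B: "?B \<in> sets borel" "bounded ?B" and B': "?B' \<in> sets borel" "bounded ?B'" by auto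
  have f: "sq_integrable (indicat_real ?B)"
    by (rule sq_integrable_bounded_support[of _ 1 ?B]) (auto simp: indicator_le_1 borel_measurable_indicator)
  obtain C where C: "C > 0" and ex: "\<And>\<tau>. \<tau> \<ge> 1 \<Longrightarrow> \<exists>W H F. Laplace_sol D T T1 (indicator ?B) u C \<tau> W H F"
    using wave_weak_sol_Laplace[OF sol f T] by blast
  define b where "b = measure lborel ?B'"
  have b: "b \<ge> 0" by (simp add: b_def)
  \<comment> \<open>The three summands come from the free weight \<open>c\<close> on
    \<open>?B'\<close>, from the source error \<open>F\<close>, and from replacing
    \<open>wlap\<close> by \<open>W\<close>.\<close>
  define E where "E = b + 4 * C + C * (1 + b)"
  have E: "E > 0" using C b by (simp add: E_def add_nonneg_pos add_pos_nonneg)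
  show ?thesis
  proof (rule that[OF E])
    fix \<tau> \<sigma> :: real and g :: "real^3 \<Rightarrow> real" and g'
    assume \<tau>: "\<tau> \<ge> 1" and \<sigma>: "\<bar>\<sigma>\<bar> = 1" and bar: "barrier D ?B \<tau> \<sigma> g g'"
    have g: "C1_grad g g'" "(g \<longlongrightarrow> 0) at_infinity"
      and sup: "\<And>\<phi> \<phi>'. C1c (- closure D) \<phi> \<phi>' \<Longrightarrow> (\<And>x. 0 \<le> \<phi> x) \<Longrightarrow> 0 \<le> (LBINT x. g' x \<bullet> \<phi>' x + \<tau>\<^sup>2 * g x * \<phi> x)"
      using bar unfolding barrier_def by blast+
    obtain e0 where e0: "e0 > 0"
      and pos: "\<And>e x. 0 < e \<Longrightarrow> e < e0 \<Longrightarrow> x \<in> closure D \<Longrightarrow> 0 \<le> \<sigma> * yconv \<tau> e ?B x + g x"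
      using bar unfolding barrier_def by blast
    have \<sigma>2: "\<sigma>\<^sup>2 = 1" using \<sigma> by (simp add: abs_square_eq_1)
    have \<tau>0: "\<tau> > 0" "\<tau> \<ge> 0" using \<tau> by auto
    from ex[OF \<tau>] obtain W H F where *: "Laplace_sol D T T1 (indicator ?B) u C \<tau> W H F"
      by (elim exE)
    have W: "weak_grad W H" "\<And>x. x \<in> closure D \<Longrightarrow> W x = 0"
      and F: "sq_integrable F" "sqn F \<le> C * \<tau>\<^sup>2 * exp (- 2 * \<tau> * T1)"
      and eqn: "\<And>\<phi> \<phi>'. C1c (- closure D) \<phi> \<phi>' \<Longrightarrow>
         (LBINT x. H x \<bullet> \<phi>' x + \<tau>\<^sup>2 * W x * \<phi> x) = (LBINT x. (indicator ?B x + F x) * \<phi> x)"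
      and rest: "\<bar>(LBINT x. indicator ?B' x * wlap T u x \<tau>) - (LBINT x. indicator ?B' x * W x)\<bar>
           \<le> C * (1 + b) * exp (- \<tau> * T1)"
      using * B' unfolding Laplace_sol_def b_def by blast+
    have sW: "sq_integrable W" "sq_integrable H" using W(1) by (auto simp: weak_grad_def)
    have apx: "C1c_approx (- closure D) (\<lambda>x. \<sigma> * W x) (\<lambda>x. \<sigma> *\<^sub>R H x)"
    proof (rule weak_grad_C1c_approx[OF D(1,2) C2_boundary_cone[OF D(3)]])
      show "weak_grad (\<lambda>x. \<sigma> * W x) (\<lambda>x. \<sigma> *\<^sub>R H x)"
        using weak_grad_mult[OF W(1) C1_grad_const[of \<sigma>], of 1] \<sigma> by simp
    qed (use W(2) in auto)
    define X where "X n = inverse (real (Suc n))" for n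
    have X: "X \<longlonglongrightarrow> 0" "\<And>n. X n > 0" unfolding X_def by (rule LIMSEQ_inverse_real_of_nat) auto
    define s where "s n = sqn (\<lambda>x. ysrc \<tau> (X n) ?B x - indicator ?B x)" for n
    have slim: "s \<longlonglongrightarrow> 0" and sys: "sq_integrable (ysrc \<tau> (X n) ?B)" for n
      unfolding s_def[abs_def] using ysrc_tendsto[OF \<tau>0(2) B X] by auto
    define J where "J = (LBINT y. indicator ?B y * vsol (indicator ?B') y \<tau>)"
    have Jlim: "(\<lambda>n. LBINT x. indicator ?B' x * yconv \<tau> (X n) ?B x) \<longlonglongrightarrow> J"
      unfolding J_def by (rule integral_yconv_tendsto[OF \<tau>0(1) B' B X])
    have icont: "integrable lborel (\<lambda>x. indicator ?B' x * q x)" if "continuous_on UNIV q" for q :: "real^3 \<Rightarrow> real"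
    proof -
      have "bounded (q ` cball p' r')"
        using that by (intro compact_imp_bounded compact_continuous_image) (auto elim: continuous_on_subset)
      then obtain N where N: "\<And>x. x \<in> cball p' r' \<Longrightarrow> \<bar>q x\<bar> \<le> N" unfolding bounded_iff real_norm_def by blast
      show ?thesis
      proof (rule integrable_bounded_support[of _ "\<bar>N\<bar>" ?B'])
        show "(\<lambda>x. indicator ?B' x * q x) \<in> borel_measurable borel"
          by (intro borel_measurable_times borel_measurable_indicator B' borel_measurable_continuous_onI[OF that])
        fix x show "norm (indicator ?B' x * q x) \<le> \<bar>N\<bar>" using N[of x] by (auto simp: indicator_def)
      qed auto
    qed
    \<comment> \<open>With this weight both error terms of \<open>weak_comparison\<close> are of
      order \<open>c\<close>.\<close>
    define c where "c = exp (- \<tau> * T1)"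
    have c: "c > 0" by (simp add: c_def)
    define IW where "IW = (LBINT x. indicator ?B' x * W x)"
    define Ig where "Ig = (LBINT x. indicator ?B' x * g x)"
    have ev: "\<forall>\<^sub>F n in sequentially. \<sigma> * IW - (\<sigma> * (LBINT x. indicator ?B' x * yconv \<tau> (X n) ?B x) + Ig)
        \<le> c * b + 2 * (2 * sqn F + 2 * s n) / (c * \<tau>^4)"
    proof -
      \<comment> \<open>The boundary inequality of a barrier is available only for regularisation
        parameters below \<open>e0\<close>.\<close>
      have "\<forall>\<^sub>F n in sequentially. X n < e0" using X(1) e0 by (rule order_tendstoD(2))
      then show ?thesis
      proof eventually_elim
        case (elim n)
        let ?v = "yconv \<tau> (X n) ?B" and ?v' = "yconv' \<tau> (X n) ?B"
        have vC: "C1_grad ?v ?v'" by (rule yconv_C1[OF X(2) \<tau>0(2) B])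
        define q where "q x = \<sigma> * ?v x + g x" for x
        define q' where "q' x = \<sigma> *\<^sub>R ?v' x + g' x" for x
        have qC: "C1_grad q q'" unfolding q_def[abs_def] q'_def[abs_def]
          by (rule C1_grad_add[OF C1_grad_cmult[OF vC] g(1)])
        have q0: "(q \<longlongrightarrow> 0) at_infinity"
          using tendsto_add[OF tendsto_mult[OF tendsto_const yconv_at_infinity[OF X(2) \<tau>0(2) B]] g(2), of \<sigma>]
          by (simp add: q_def[abs_def])
        define P where "P x = \<sigma> * (indicator ?B x + F x)" for x
        define Q where "Q x = \<sigma> * ysrc \<tau> (X n) ?B x" for x
        have sP: "sq_integrable P" unfolding P_def[abs_def]
          using sq_integrable_cmult[OF sq_integrable_add[OF f F(1)], of \<sigma>] by simp
        have sQ: "sq_integrable Q" unfolding Q_def[abs_def] using sq_integrable_cmult[OF sys, of \<sigma>] by simp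
        have sW': "sq_integrable (\<lambda>x. \<sigma> * W x)" "sq_integrable (\<lambda>x. \<sigma> *\<^sub>R H x)"
          using sq_integrable_cmult[OF sW(1), of \<sigma>] sq_integrable_cmult[OF sW(2), of \<sigma>] by auto
        have iq: "integrable lborel (\<lambda>x. indicator ?B' x * q x)" "integrable lborel (\<lambda>x. indicator ?B' x * ?v x)"
            "integrable lborel (\<lambda>x. indicator ?B' x * g x)"
          using C1_grad_cont(1)[OF qC] C1_grad_cont(1)[OF vC] C1_grad_cont(1)[OF g(1)] by (auto intro: icont)
        have "(LBINT x. indicator ?B' x * (\<sigma> * W x)) - (LBINT x. indicator ?B' x * q x)
            \<le> c * measure lborel ?B' + 2 * sqn (\<lambda>x. P x - Q x) / (c * \<tau>^4)"
        proof (rule weak_comparison[OF \<tau>0(1) sW' apx sP sQ _ qC _ _ _ B'(1) _ iq(1) c])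
          fix \<phi> \<phi>' assume \<phi>: "C1c (- closure D) \<phi> \<phi>'"
          have "(LBINT x. (\<sigma> *\<^sub>R H x) \<bullet> \<phi>' x + \<tau>\<^sup>2 * (\<sigma> * W x) * \<phi> x) = (LBINT x. \<sigma> * (H x \<bullet> \<phi>' x + \<tau>\<^sup>2 * W x * \<phi> x))"
            by (intro Bochner_Integration.integral_cong refl) (simp add: algebra_simps)
          also have "\<dots> = (LBINT x. \<sigma> * ((indicator ?B x + F x) * \<phi> x))" using eqn[OF \<phi>] by simp
          also have "\<dots> = (LBINT x. P x * \<phi> x)" by (simp add: P_def mult.assoc)
          finally show "(LBINT x. (\<sigma> *\<^sub>R H x) \<bullet> \<phi>' x + \<tau>\<^sup>2 * (\<sigma> * W x) * \<phi> x) = (LBINT x. P x * \<phi> x)" .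
        next
          show "0 \<le> q x" if "x \<notin> - closure D" for x
            using pos[OF X(2) elim, of x] that by (simp add: q_def)
          show "bounded {x. q x \<le> - a}" if "a > 0" for a by (rule at_infinity_bounded[OF q0 that])
          show "emeasure lborel ?B' < \<infinity>" by (rule emeasure_lborel_ball_finite)
        next
          fix \<phi> \<phi>' assume \<phi>: "C1c (- closure D) \<phi> \<phi>'" and \<phi>0: "\<And>x. 0 \<le> \<phi> x"
          obtain S where S: "compact S" "\<And>x. x \<notin> S \<Longrightarrow> \<phi> x = 0" "\<And>x. x \<notin> S \<Longrightarrow> \<phi>' x = 0"
            using C1c_support[OF \<phi>] by metis
          have i1: "integrable lborel (\<lambda>x. ?v' x \<bullet> \<phi>' x + \<tau>\<^sup>2 * ?v x * \<phi> x)"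
            using C1_grad_cont[OF vC] C1_grad_cont[OF C1c_C1[OF \<phi>]] S
            by (intro integrable_continuous_compact_support[of _ S]) (auto intro!: continuous_intros)
          have i2: "integrable lborel (\<lambda>x. g' x \<bullet> \<phi>' x + \<tau>\<^sup>2 * g x * \<phi> x)"
            using C1_grad_cont[OF g(1)] C1_grad_cont[OF C1c_C1[OF \<phi>]] S
            by (intro integrable_continuous_compact_support[of _ S]) (auto intro!: continuous_intros)
          have "(LBINT x. Q x * \<phi> x) = \<sigma> * (LBINT x. ysrc \<tau> (X n) ?B x * \<phi> x)"
            by (simp add: Q_def mult.assoc)
          also have "\<dots> = \<sigma> * (LBINT x. ?v' x \<bullet> \<phi>' x + \<tau>\<^sup>2 * ?v x * \<phi> x)"
            using yconv_weak[OF X(2) \<tau>0(2) B \<phi>] by simp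
          also have "\<dots> \<le> \<sigma> * (LBINT x. ?v' x \<bullet> \<phi>' x + \<tau>\<^sup>2 * ?v x * \<phi> x) + (LBINT x. g' x \<bullet> \<phi>' x + \<tau>\<^sup>2 * g x * \<phi> x)"
            using sup[OF \<phi> \<phi>0] by simp
          also have "\<dots> = (LBINT x. \<sigma> * (?v' x \<bullet> \<phi>' x + \<tau>\<^sup>2 * ?v x * \<phi> x) + (g' x \<bullet> \<phi>' x + \<tau>\<^sup>2 * g x * \<phi> x))"
            using Bochner_Integration.integral_add[OF integrable_mult_right[OF i1, of \<sigma>] i2] by simp
          also have "\<dots> = (LBINT x. q' x \<bullet> \<phi>' x + \<tau>\<^sup>2 * q x * \<phi> x)"
            by (intro Bochner_Integration.integral_cong refl) (simp add: q_def q'_def inner_add_left algebra_simps)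
          finally show "(LBINT x. Q x * \<phi> x) \<le> (LBINT x. q' x \<bullet> \<phi>' x + \<tau>\<^sup>2 * q x * \<phi> x)" .
        qed
        moreover have "(LBINT x. indicator ?B' x * (\<sigma> * W x)) = \<sigma> * IW"
        proof -
          have "(LBINT x. indicator ?B' x * (\<sigma> * W x)) = (LBINT x. \<sigma> * (indicator ?B' x * W x))"
            by (intro Bochner_Integration.integral_cong refl) simp
          then show ?thesis by (simp add: IW_def)
        qed
        moreover have "(LBINT x. indicator ?B' x * q x) = \<sigma> * (LBINT x. indicator ?B' x * ?v x) + Ig"
        proof -
          have "(LBINT x. indicator ?B' x * q x) = (LBINT x. \<sigma> * (indicator ?B' x * ?v x) + indicator ?B' x * g x)"
            by (intro Bochner_Integration.integral_cong refl) (simp add: q_def algebra_simps)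
          then show ?thesis unfolding Ig_def
            using Bochner_Integration.integral_add[OF integrable_mult_right[OF iq(2), of \<sigma>] iq(3)] by simp
        qed
        moreover have "sqn (\<lambda>x. P x - Q x) \<le> 2 * sqn F + 2 * s n"
        proof -
          have "(\<lambda>x. P x - Q x) = (\<lambda>x. \<sigma> *\<^sub>R (F x + (indicator ?B x - ysrc \<tau> (X n) ?B x)))"
            by (simp add: P_def Q_def fun_eq_iff algebra_simps)
          then have "sqn (\<lambda>x. P x - Q x) = sqn (\<lambda>x. F x + (indicator ?B x - ysrc \<tau> (X n) ?B x))"
            using sqn_cmult[of \<sigma> "\<lambda>x. F x + (indicator ?B x - ysrc \<tau> (X n) ?B x)"] \<sigma>2 by simp
          also have "\<dots> \<le> 2 * sqn F + 2 * sqn (\<lambda>x. indicator ?B x - ysrc \<tau> (X n) ?B x)"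
            by (rule sqn_add_le[OF F(1) sq_integrable_diff[OF f sys]])
          finally show ?thesis unfolding s_def by (simp add: sqn_minus_commute[of "indicator ?B"])
        qed
        then have "2 * sqn (\<lambda>x. P x - Q x) / (c * \<tau>^4) \<le> 2 * (2 * sqn F + 2 * s n) / (c * \<tau>^4)"
          using c \<tau>0 by (intro divide_right_mono) auto
        ultimately show ?case unfolding b_def by linarith
      qed
    qed
    have l: "(\<lambda>n. \<sigma> * IW - (\<sigma> * (LBINT x. indicator ?B' x * yconv \<tau> (X n) ?B x) + Ig)) \<longlonglongrightarrow> \<sigma> * IW - (\<sigma> * J + Ig)"
      by (intro tendsto_intros Jlim)
    have r: "(\<lambda>n. c * b + 2 * (2 * sqn F + 2 * s n) / (c * \<tau>^4)) \<longlonglongrightarrow> c * b + 2 * (2 * sqn F + 2 * 0) / (c * \<tau>^4)"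
      by (intro tendsto_intros slim) (use c \<tau>0 in auto)
    have "\<sigma> * IW - (\<sigma> * J + Ig) \<le> c * b + 2 * (2 * sqn F + 2 * 0) / (c * \<tau>^4)"
      by (rule tendsto_le[OF _ r l ev]) simp
    \<comment> \<open>\<open>sqn F\<close> is of order \<open>\<tau>\<^sup>2 * c\<^sup>2\<close>;
      division by \<open>c * \<tau>^4\<close> leaves order \<open>c\<close> because
      \<open>\<tau> \<ge> 1\<close>.\<close>
    also have "2 * (2 * sqn F + 2 * 0) / (c * \<tau>^4) \<le> 4 * C * c"
    proof -
      have c2: "exp (- 2 * \<tau> * T1) = c\<^sup>2" by (simp add: c_def power2_eq_square flip: exp_add)
      have t4: "\<tau>\<^sup>2 \<le> \<tau>^4" using \<tau> by (intro power_increasing) auto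
      have "2 * (2 * sqn F + 2 * 0) / (c * \<tau>^4) \<le> 4 * (C * \<tau>\<^sup>2 * c\<^sup>2) / (c * \<tau>^4)"
        using F(2) c \<tau>0 unfolding c2 by (intro divide_right_mono) auto
      also have "\<dots> \<le> 4 * (C * \<tau>^4 * c\<^sup>2) / (c * \<tau>^4)"
        using t4 C c \<tau>0 by (intro divide_right_mono mult_left_mono mult_right_mono) auto
      also have "\<dots> = 4 * C * c" using c \<tau>0 by (simp add: power2_eq_square)
      finally show ?thesis .
    qed
    finally have k1: "\<sigma> * IW - (\<sigma> * J + Ig) \<le> c * b + 4 * C * c" by simp
    define Iw where "Iw = (LBINT x. indicator ?B' x * wlap T u x \<tau>)"
    have k2: "\<sigma> * Iw - \<sigma> * IW \<le> C * (1 + b) * c"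
    proof -
      have "\<sigma> * Iw - \<sigma> * IW \<le> \<bar>\<sigma> * (Iw - IW)\<bar>" by (simp add: right_diff_distrib)
      also have "\<dots> = \<bar>Iw - IW\<bar>" using \<sigma> by (simp add: abs_mult)
      finally show ?thesis using rest unfolding Iw_def IW_def c_def by simp
    qed
    have Ieq: "Ifun T u p r p' r' \<tau> = J - Iw"
      by (simp add: Ifun_def set_lebesgue_integral_def J_def Iw_def)
    have "- \<sigma> * Ifun T u p r p' r' \<tau> = \<sigma> * Iw - \<sigma> * J" unfolding Ieq by (simp add: algebra_simps)
    also have "\<dots> \<le> Ig + (c * b + 4 * C * c + C * (1 + b) * c)" using k1 k2 by linarith
    also have "\<dots> = Ig + E * c" by (simp add: E_def algebra_simps)
    finally show "- \<sigma> * Ifun T u p r p' r' \<tau> \<le> (LBINT x. indicator ?B' x * g x) + E * exp (- \<tau> * T1)"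
      by (simp add: Ig_def c_def)
  qed
qed

section \<open>Path lengths and the two exponential bounds\<close>

definition path_inf :: "'a::euclidean_space set \<Rightarrow> 'a \<Rightarrow> real \<Rightarrow> 'a \<Rightarrow> real \<Rightarrow> real" where
  "path_inf D p r p' r' =
     Inf {dist y x + dist x y' | x y y'. x \<in> frontier D \<and> y \<in> sphere p r \<and> y' \<in> sphere p' r'}"

text \<open>Extends the bound from the frontier to the whole closure of \<open>D\<close>, since the
  net of the upper barrier has points inside. The segment from \<open>x\<close> to its nearest point
  on the first sphere leaves the closure at some frontier point, and a path over that point is no
  longer than the one over \<open>x\<close>.\<close>

lemma path_inf_le:
  fixes D :: "'a::euclidean_space set"
  assumes "closure (ball p r) \<inter> closure D = {}" "closure (ball p' r') \<inter> closure D = {}" "r > 0" "r' > 0"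
    and x: "x \<in> closure D"
  shows "path_inf D p r p' r' \<le> (norm (x - p) - r) + (norm (x - p') - r')"
proof -
  have cb: "closure (ball p r) = cball p r" "closure (ball p' r') = cball p' r'" using assms by auto
  have np: "r < norm (x - p)" "r' < norm (x - p')"
    using assms(1,2) x unfolding cb by (auto simp: dist_norm norm_minus_commute not_le disjoint_iff)
  define y where "y = p + (r / norm (x - p)) *\<^sub>R (x - p)"
  define y' where "y' = p' + (r' / norm (x - p')) *\<^sub>R (x - p')"
  have y: "y \<in> sphere p r" "y' \<in> sphere p' r'"
    using np assms(3,4) by (auto simp: y_def y'_def dist_norm)
  have d: "norm (x - (p + (r / norm (x - p)) *\<^sub>R (x - p))) = norm (x - p) - r" if "0 < r" "r < norm (x - p)" for p :: 'a and r :: real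
  proof -
    have "x - (p + (r / norm (x - p)) *\<^sub>R (x - p)) = (1 - r / norm (x - p)) *\<^sub>R (x - p)"
      by (simp add: algebra_simps)
    moreover have n0: "0 < norm (x - p)" using that by linarith
    then have "0 \<le> 1 - r / norm (x - p)" using that by (simp add: divide_le_eq_1_pos)
    ultimately have "norm (x - (p + (r / norm (x - p)) *\<^sub>R (x - p))) = (1 - r / norm (x - p)) * norm (x - p)"
      by (metis abs_of_nonneg norm_scaleR)
    also have "\<dots> = norm (x - p) - r" using n0 by (simp add: left_diff_distrib)
    finally show ?thesis .
  qed
  have dy: "dist y x = norm (x - p) - r" "dist x y' = norm (x - p') - r'"
    using d[of r p] d[of r' p'] np assms(3,4) by (auto simp: y_def y'_def dist_norm norm_minus_commute)
  have yD: "y \<notin> closure D" using y(1) assms(1) unfolding cb by auto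
  \<comment> \<open>The crossing point is on the frontier of the closure, which is contained in the
    frontier of \<open>D\<close>.\<close>
  have "closed_segment x y \<inter> frontier (closure D) \<noteq> {}"
  proof (rule connected_Int_frontier)
    show "closed_segment x y \<inter> closure D \<noteq> {}" "closed_segment x y - closure D \<noteq> {}" using x yD by auto
  qed simp
  then obtain z where z: "z \<in> closed_segment x y" "z \<in> frontier D"
    using interior_mono[OF closure_subset[of D]] by (auto simp: frontier_def)
  have xz: "dist x y = dist x z + dist z y" using z(1) between_mem_segment[of x y z] by (simp add: between)
  have bdd: "bdd_below {dist y x + dist x y' | x y y'. x \<in> frontier D \<and> y \<in> sphere p r \<and> y' \<in> sphere p' r'}"
    by (rule bdd_belowI[of _ 0]) auto
  have "path_inf D p r p' r' \<le> dist y z + dist z y'"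
    unfolding path_inf_def by (rule cInf_lower[OF _ bdd]) (use z y in blast)
  also have "\<dots> \<le> dist y z + (dist z x + dist x y')" using dist_triangle[of z y' x] by simp
  also have "\<dots> = dist y x + dist x y'" using xz by (simp add: dist_commute)
  finally show ?thesis using dy by simp
qed

text \<open>With mass exactly \<open>\<tau>\<close>, the smeared source is nonnegative, so any
  positive combination of potentials is a supersolution. Near each net point a single summand
  already dominates the free solution.\<close>

lemma Ifun_upper:
  fixes D :: "(real^3) set" and u :: "(real^3) \<times> real \<Rightarrow> real"
  assumes D: "open D" "bounded D" "C2_boundary D"
    and r: "r > 0" "r' > 0" "closure (ball p r) \<inter> closure D = {}" "closure (ball p' r') \<inter> closure D = {}"
    and sol: "wave_weak_sol D T (indicator (ball p r)) u" and T: "0 < T1" "T1 < T"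
    and \<delta>: "\<delta> > 0"
  obtains C E where "C > 0" "E > 0"
    "\<And>\<tau>. \<tau> \<ge> 1 \<Longrightarrow> Ifun T u p r p' r' \<tau> \<le> C * exp (- \<tau> * (path_inf D p r p' r' - 3 * \<delta>)) + E * exp (- \<tau> * T1)"
proof -
  let ?B = "ball p r" and ?B' = "ball p' r'" and ?m = "path_inf D p r p' r'"
  have B: "?B \<in> sets borel" "bounded ?B" and B': "?B' \<in> sets borel" "bounded ?B'" by auto
  obtain E where E: "E > 0" and comp: "\<And>\<tau> \<sigma> g g'. \<tau> \<ge> 1 \<Longrightarrow> \<bar>\<sigma>\<bar> = 1 \<Longrightarrow> barrier D ?B \<tau> \<sigma> g g' \<Longrightarrow>
     - \<sigma> * Ifun T u p r p' r' \<tau> \<le> (LBINT x. indicator ?B' x * g x) + E * exp (- \<tau> * T1)"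
    by (rule Ifun_comparison[OF D sol T, of p' r']) blast
  have cD: "compact (closure D)" using D(2) by simp
  obtain X where X: "X \<subseteq> closure D" "finite X" "closure D \<subseteq> (\<Union>x\<in>X. ball x \<delta>)"
  proof (rule compactE_image[OF cD])
    show "open (ball x \<delta>)" for x :: "real^3" by simp
    show "closure D \<subseteq> (\<Union>x\<in>closure D. ball x \<delta>)" using \<delta> by force
  qed (use that in blast)
  \<comment> \<open>A uniform gap \<open>d0\<close> bounds the denominator of the kernel on the
    closure of \<open>D\<close>; the exponential rate is handled separately.\<close>
  have "closure D \<inter> closure ?B = {}" using r(3) by auto
  then obtain d0 where d0: "d0 > 0" "\<And>x z. x \<in> closure D \<Longrightarrow> z \<in> closure ?B \<Longrightarrow> d0 \<le> dist x z"
    using separate_compact_closed[OF cD closed_closure, of ?B] by metis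
  define C0 where "C0 = measure lborel ?B / (4 * pi * d0)"
  have C0: "C0 \<ge> 0" using d0 by (simp add: C0_def)
  define C where "C = 1 + real (card X) * (2 * C0 * measure lborel ?B')"
  have C: "C > 0" using C0 by (simp add: C_def add_pos_nonneg)
  show ?thesis
  proof (rule that[OF C E])
    fix \<tau> :: real assume \<tau>: "\<tau> \<ge> 1"
    then have \<tau>0: "\<tau> \<ge> 0" by simp
    \<comment> \<open>Within \<open>\<delta>\<close> of \<open>x\<close> the free solution is at
      most \<open>C0 * exp (- \<tau> * (norm (x - p) - r - \<delta>))\<close>, and the potential
      centred there is at least \<open>exp (- 2 * \<tau> * \<delta>) / (2 * \<delta>)\<close>.
      \<open>A x\<close> is the ratio, whence the loss \<open>3 * \<delta>\<close>.\<close>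
    define A where "A x = 2 * \<delta> * C0 * exp (- \<tau> * (norm (x - p) - r - 3 * \<delta>))" for x
    have A0: "A x \<ge> 0" for x using \<delta> C0 by (simp add: A_def)
    define g where "g x = (\<Sum>i\<in>X. A i * yuk \<tau> \<delta> (x - i))" for x
    define g' where "g' x = (\<Sum>i\<in>X. A i *\<^sub>R yuk' \<tau> \<delta> (x - i))" for x
    have gC: "C1_grad g g'" unfolding g_def[abs_def] g'_def[abs_def]
      by (intro C1_grad_sum C1_grad_cmult C1_grad_shift yuk_C1 \<delta>)
    have "(g \<longlongrightarrow> (\<Sum>i\<in>X. A i * 0)) at_infinity" unfolding g_def[abs_def]
      by (intro tendsto_sum tendsto_mult tendsto_const yuk_at_infinity \<delta> \<tau>0)
    then have g0: "(g \<longlongrightarrow> 0) at_infinity" by simp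
    have sup: "0 \<le> (LBINT x. g' x \<bullet> \<phi>' x + \<tau>\<^sup>2 * g x * \<phi> x)"
      if \<phi>: "C1c (- closure D) \<phi> \<phi>'" and \<phi>0: "\<And>x. 0 \<le> \<phi> x" for \<phi> \<phi>'
    proof -
      obtain S where S: "compact S" "\<And>x. x \<notin> S \<Longrightarrow> \<phi> x = 0" "\<And>x. x \<notin> S \<Longrightarrow> \<phi>' x = 0"
        using C1c_support[OF \<phi>] by metis
      have i: "integrable lborel (\<lambda>x. yuk' \<tau> \<delta> (x - i) \<bullet> \<phi>' x + \<tau>\<^sup>2 * yuk \<tau> \<delta> (x - i) * \<phi> x)" for i
        using C1_grad_cont[OF C1_grad_shift[OF yuk_C1[OF \<delta>]]] C1_grad_cont[OF C1c_C1[OF \<phi>]] S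
        by (intro integrable_continuous_compact_support[of _ S]) (auto intro!: continuous_intros)
      have "(LBINT x. g' x \<bullet> \<phi>' x + \<tau>\<^sup>2 * g x * \<phi> x) =
          (LBINT x. (\<Sum>i\<in>X. A i * (yuk' \<tau> \<delta> (x - i) \<bullet> \<phi>' x + \<tau>\<^sup>2 * yuk \<tau> \<delta> (x - i) * \<phi> x)))"
        by (intro Bochner_Integration.integral_cong refl)
           (simp add: g_def g'_def inner_sum_left sum_distrib_left sum_distrib_right sum.distrib algebra_simps)
      also have "\<dots> = (\<Sum>i\<in>X. A i * (LBINT x. yuk' \<tau> \<delta> (x - i) \<bullet> \<phi>' x + \<tau>\<^sup>2 * yuk \<tau> \<delta> (x - i) * \<phi> x))"
        using i by (subst Bochner_Integration.integral_sum) auto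
      also have "\<dots> = (\<Sum>i\<in>X. A i * (LBINT x. ksrc \<tau> \<delta> (x - i) * \<phi> x))"
        using yuk_weak[OF \<delta> \<phi>] by simp
      also have "\<dots> \<ge> 0"
        using A0 ksrc_nonneg[OF \<delta> \<tau>0] \<phi>0
        by (intro sum_nonneg mult_nonneg_nonneg integral_nonneg_AE AE_I2) auto
      finally show ?thesis .
    qed
    have pos: "0 \<le> -1 * yconv \<tau> e ?B x + g x" if e: "0 < e" and x: "x \<in> closure D" for e x
    proof -
      obtain i where i: "i \<in> X" "x \<in> ball i \<delta>" using X(3) x by blast
      have xi: "norm (x - i) < \<delta>" using i(2) by (simp add: dist_norm norm_minus_commute)
      define d where "d = norm (i - p) - r - \<delta>"
      have "yconv \<tau> e ?B x \<le> measure lborel ?B * (exp (- \<tau> * d) / d0) / (4 * pi)"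
      proof (rule yconv_le[OF e \<tau>0 B])
        fix z assume z: "z \<in> ?B"
        have "norm (z - p) < r" using z by (simp add: dist_norm norm_minus_commute)
        moreover have "norm (i - p) \<le> norm (x - i) + norm (x - z) + norm (z - p)"
          using norm_triangle_ineq[of "i - x" "x - z"] norm_triangle_ineq[of "i - z" "z - p"]
          by (simp add: norm_minus_commute)
        ultimately have "d \<le> norm (x - z)" using xi by (simp add: d_def)
        moreover have "d0 \<le> norm (x - z)" using d0(2)[OF x, of z] z closure_subset[of ?B] by (auto simp: dist_norm)
        ultimately show "yuk \<tau> e (x - z) \<le> exp (- \<tau> * d) / d0" using d0(1) by (intro yuk_le e \<tau>0) auto
      qed
      also have "\<dots> = C0 * exp (- \<tau> * d)" using d0 by (simp add: C0_def)
      also have "\<dots> = A i * (exp (- \<tau> * (2 * \<delta>)) / (2 * \<delta>))"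
      proof -
        have "- \<tau> * d = - \<tau> * (norm (i - p) - r - 3 * \<delta>) + - \<tau> * (2 * \<delta>)" by (simp add: d_def algebra_simps)
        then have "exp (- \<tau> * d) = exp (- \<tau> * (norm (i - p) - r - 3 * \<delta>)) * exp (- \<tau> * (2 * \<delta>))" by (simp only: exp_add)
        then show ?thesis unfolding A_def using \<delta> by simp
      qed
      also have "\<dots> \<le> A i * yuk \<tau> \<delta> (x - i)"
        using xi by (intro mult_left_mono A0 yuk_ge \<delta> \<tau>0) auto
      also have "\<dots> \<le> g x"
        unfolding g_def using i(1) X(2) A0 yuk_pos[OF \<delta>]
        by (intro member_le_sum) (auto simp: less_imp_le)
      finally show ?thesis by simp
    qed
    have "- (-1) * Ifun T u p r p' r' \<tau> \<le> (LBINT x. indicator ?B' x * g x) + E * exp (- \<tau> * T1)"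
    proof (rule comp[OF \<tau>])
      show "barrier D ?B \<tau> (-1) g g'"
        unfolding barrier_def using gC g0 sup pos zero_less_one by blast
    qed simp
    moreover have "(LBINT x. indicator ?B' x * g x) \<le> C * exp (- \<tau> * (?m - 3 * \<delta>))"
    proof -
      have ii: "integrable lborel (\<lambda>x. indicator ?B' x * yuk \<tau> \<delta> (x - i))" for i
        by (rule yuk_indicator_integrable(2)[OF \<delta> \<tau>0 B'])
      have "(LBINT x. indicator ?B' x * g x) = (LBINT x. (\<Sum>i\<in>X. A i * (indicator ?B' x * yuk \<tau> \<delta> (x - i))))"
        by (intro Bochner_Integration.integral_cong refl) (simp add: g_def sum_distrib_left algebra_simps)
      also have "\<dots> = (\<Sum>i\<in>X. A i * (LBINT x. indicator ?B' x * yuk \<tau> \<delta> (x - i)))"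
        using ii by (subst Bochner_Integration.integral_sum) auto
      also have "\<dots> \<le> (\<Sum>i\<in>X. 2 * C0 * measure lborel ?B' * exp (- \<tau> * (?m - 3 * \<delta>)))"
      proof (rule sum_mono)
        fix i assume i: "i \<in> X"
        define d' where "d' = norm (i - p') - r'"
        have "(LBINT x. indicator ?B' x * yuk \<tau> \<delta> (x - i)) \<le> measure lborel ?B' * (exp (- \<tau> * d') / \<delta>)"
        proof (rule indicator_integral_le[OF B' ii])
          fix z assume z: "z \<in> ?B'"
          have "norm (z - p') < r'" using z by (simp add: dist_norm norm_minus_commute)
          then have "d' \<le> norm (z - i)"
            using norm_triangle_ineq[of "i - z" "z - p'"] by (simp add: d'_def norm_minus_commute)
          then show "yuk \<tau> \<delta> (z - i) \<le> exp (- \<tau> * d') / \<delta>" by (intro yuk_le' \<delta> \<tau>0)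
        qed
        then have "A i * (LBINT x. indicator ?B' x * yuk \<tau> \<delta> (x - i)) \<le> A i * (measure lborel ?B' * (exp (- \<tau> * d') / \<delta>))"
          by (intro mult_left_mono A0)
        also have "\<dots> = 2 * C0 * measure lborel ?B' * (exp (- \<tau> * (norm (i - p) - r - 3 * \<delta>)) * exp (- \<tau> * d'))"
          using \<delta> by (simp add: A_def)
        also have "exp (- \<tau> * (norm (i - p) - r - 3 * \<delta>)) * exp (- \<tau> * d') \<le> exp (- \<tau> * (?m - 3 * \<delta>))"
        proof -
          have "?m \<le> (norm (i - p) - r) + (norm (i - p') - r')"
            using i X(1) by (intro path_inf_le r) auto
          then have "\<tau> * (?m - 3 * \<delta>) \<le> \<tau> * ((norm (i - p) - r - 3 * \<delta>) + d')"
            using \<tau>0 by (intro mult_left_mono) (auto simp: d'_def)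
          then show ?thesis by (simp add: distrib_left flip: exp_add)
        qed
        finally show "A i * (LBINT x. indicator ?B' x * yuk \<tau> \<delta> (x - i)) \<le> 2 * C0 * measure lborel ?B' * exp (- \<tau> * (?m - 3 * \<delta>))"
          using C0 by (simp add: mult_left_mono)
      qed
      also have "\<dots> = (real (card X) * (2 * C0 * measure lborel ?B')) * exp (- \<tau> * (?m - 3 * \<delta>))" by simp
      also have "\<dots> \<le> C * exp (- \<tau> * (?m - 3 * \<delta>))" by (intro mult_right_mono) (auto simp: C_def)
      finally show ?thesis .
    qed
    ultimately show "Ifun T u p r p' r' \<tau> \<le> C * exp (- \<tau> * (?m - 3 * \<delta>)) + E * exp (- \<tau> * T1)" by simp
  qed
qed

text \<open>A negative multiple of a potential must be a supersolution off \<open>D\<close>, i.e.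
  the potential itself a subsolution there. Its smeared source has the wrong sign, and the surplus
  \<open>\<kappa>\<^sup>2 - \<tau>\<^sup>2\<close> of the larger mass outweighs it.\<close>

lemma Ifun_lower:
  fixes D :: "(real^3) set" and u :: "(real^3) \<times> real \<Rightarrow> real"
  assumes D: "open D" "bounded D" "C2_boundary D" "D \<noteq> {}"
    and r: "r > 0" "r' > 0"
    and sol: "wave_weak_sol D T (indicator (ball p r)) u" and T: "0 < T1" "T1 < T"
    and \<delta>: "0 < \<delta>" "\<delta> < 1"
  obtains C E where "C > 0" "E > 0"
    "\<And>\<tau>. \<tau> \<ge> 1 \<Longrightarrow> C * exp (- \<tau> * (path_inf D p r p' r' + \<delta> * (path_inf D p r p' r' + 11))) - E * exp (- \<tau> * T1) \<le> Ifun T u p r p' r' \<tau>"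
proof -
  let ?B = "ball p r" and ?B' = "ball p' r'" and ?m = "path_inf D p r p' r'"
  let ?S = "{dist y x + dist x y' | x y y'. x \<in> frontier D \<and> y \<in> sphere p r \<and> y' \<in> sphere p' r'}"
  have B: "?B \<in> sets borel" "bounded ?B" and B': "?B' \<in> sets borel" "bounded ?B'" by auto
  obtain E where E: "E > 0" and comp: "\<And>\<tau> \<sigma> g g'. \<tau> \<ge> 1 \<Longrightarrow> \<bar>\<sigma>\<bar> = 1 \<Longrightarrow> barrier D ?B \<tau> \<sigma> g g' \<Longrightarrow>
     - \<sigma> * Ifun T u p r p' r' \<tau> \<le> (LBINT x. indicator ?B' x * g x) + E * exp (- \<tau> * T1)"
    by (rule Ifun_comparison[OF D(1-3) sol T, of p' r']) blast
  have "frontier D \<noteq> {}"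
    using D(2,4) frontier_not_empty[of D] not_bounded_UNIV by blast
  moreover have "p + r *\<^sub>R axis 1 1 \<in> sphere p r" "p' + r' *\<^sub>R axis 1 1 \<in> sphere p' r'"
    using r by (auto simp: dist_norm norm_axis_1)
  ultimately have ne: "?S \<noteq> {}" by blast
  have m0: "0 \<le> ?m"
    unfolding path_inf_def using ne by (intro cInf_greatest) auto
  have "\<exists>s\<in>?S. s < ?m + \<delta>"
    using ne \<delta> unfolding path_inf_def by (intro cInf_lessD) auto
  then obtain x0 y0 y0' where x0: "x0 \<in> frontier D" and y0: "y0 \<in> sphere p r" "y0' \<in> sphere p' r'"
    and lt: "dist y0 x0 + dist x0 y0' < ?m + \<delta>" by auto
  have "x0 \<in> closure D" using x0 by (simp add: frontier_def)
  \<comment> \<open>The centre is moved from the frontier into \<open>D\<close>, so that the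
    complement of \<open>D\<close> keeps a distance \<open>r0\<close> from the bulk of the smeared
    source.\<close>
  then obtain x1 where x1: "x1 \<in> D" "dist x1 x0 < \<delta>" using \<delta> unfolding closure_approachable by blast
  obtain r0 where r0: "r0 > 0" "ball x1 r0 \<subseteq> D" using D(1) x1(1) openE by blast
  \<comment> \<open>Off \<open>D\<close> and for \<open>\<kappa> \<ge> 1\<close>, the source is at
    most \<open>e1\<^sup>2 * \<kappa>\<^sup>2 * q0\<close> times the potential, and the surplus
    \<open>\<kappa>\<^sup>2 - \<tau>\<^sup>2\<close> equals \<open>\<kappa>\<^sup>2 * w\<close>. So
    \<open>e1\<^sup>2 * q0 \<le> w\<close> suffices, a condition free of
    \<open>\<tau>\<close>.\<close>
  define q0 where "q0 = 1 / r0\<^sup>2 + 3 / r0^3 + 3 / r0^4"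
  have q0: "q0 > 0" using r0 by (simp add: q0_def add_pos_pos)
  define w where "w = 1 - 1 / (1 + \<delta>)\<^sup>2"
  have w: "w > 0" using \<delta> by (simp add: w_def one_less_power)
  define e1 where "e1 = min \<delta> (sqrt (w / q0))"
  have e1: "e1 > 0" "e1 \<le> \<delta>" using \<delta> w q0 by (auto simp: e1_def)
  have e1q: "e1\<^sup>2 * q0 \<le> w"
  proof -
    have "e1\<^sup>2 \<le> (sqrt (w / q0))\<^sup>2" using e1 by (intro power_mono) (auto simp: e1_def)
    then have "e1\<^sup>2 \<le> w / q0" using w q0 by simp
    then show ?thesis using q0 by (simp add: field_simps)
  qed
  \<comment> \<open>Only the part of a ball within \<open>\<delta>\<close> of the chosen boundary
    point is kept. Its volume is positive and affects the constant, not the exponent.\<close>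
  have inter: "0 < measure lborel (ball c s \<inter> ball y \<delta>)" if "y \<in> sphere c s" "s > 0" for c y :: "real^3" and s
  proof -
    have "y \<in> closure (ball c s)" using that by simp
    then obtain z where z: "z \<in> ball c s" "dist z y < \<delta>" using \<delta> unfolding closure_approachable by blast
    have "open (ball c s \<inter> ball y \<delta>)" by auto
    moreover have "z \<in> ball c s \<inter> ball y \<delta>" using z by (auto simp: dist_commute)
    ultimately obtain t where t: "t > 0" "ball z t \<subseteq> ball c s \<inter> ball y \<delta>" using openE by blast
    have "0 < measure lborel (ball z t)" using t by (simp add: content_ball)
    also have "\<dots> \<le> measure lborel (ball c s \<inter> ball y \<delta>)"
    proof (rule measure_mono_fmeasurable[OF t(2)])
      have "bounded (ball c s \<inter> ball y \<delta>)" by (simp add: bounded_Int)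
      then show "ball c s \<inter> ball y \<delta> \<in> fmeasurable lborel"
        by (intro fmeasurableI) (auto intro: emeasure_bounded_finite[unfolded infinity_ennreal_def])
    qed simp
    finally show ?thesis .
  qed
  define A1 where "A1 = ?B \<inter> ball y0 \<delta>"
  define A2 where "A2 = ?B' \<inter> ball y0' \<delta>"
  define \<beta> where "\<beta> = measure lborel A1"
  define \<beta>' where "\<beta>' = measure lborel A2"
  have \<beta>: "\<beta> > 0" "\<beta>' > 0" unfolding \<beta>_def \<beta>'_def A1_def A2_def using inter y0 r by auto
  have A12: "A1 \<in> sets borel" "A1 \<subseteq> ?B" "A2 \<in> sets borel" "A2 \<subseteq> ?B'" "bounded A2" by (auto simp: A1_def A2_def)
  have "bounded (closure D)" using D(2) by (rule bounded_closure)
  then obtain R where R: "\<And>x. x \<in> closure D \<Longrightarrow> norm x \<le> R" unfolding bounded_iff by blast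
  \<comment> \<open>Bounds \<open>norm (x - z) + e\<close> for \<open>x\<close> in the closure of
    \<open>D\<close>, \<open>z\<close> in the source ball and \<open>e < 1\<close>, hence the
    denominator of the kernel from above.\<close>
  define M where "M = \<bar>R\<bar> + norm p + r + 1"
  have M: "M > 0" using r by (simp add: M_def add_nonneg_pos)
  define L where "L = norm (x1 - y0)"
  define L' where "L' = norm (x1 - y0')"
  have LL: "L + L' \<le> ?m + 3 * \<delta>" "L' \<le> ?m + 2"
  proof -
    have "L \<le> dist y0 x0 + \<delta>"
      using x1(2) dist_triangle[of x1 y0 x0] by (simp add: L_def dist_norm[symmetric] dist_commute)
    moreover have *: "L' \<le> dist x0 y0' + \<delta>"
      using x1(2) dist_triangle[of x1 y0' x0] by (simp add: L'_def dist_norm[symmetric])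
    ultimately show "L + L' \<le> ?m + 3 * \<delta>" using lt by simp
    show "L' \<le> ?m + 2" using * lt \<delta> zero_le_dist[of y0 x0] by linarith
  qed
  have L'0: "0 < L' + 2 * \<delta>" using \<delta> by (simp add: L'_def add_nonneg_pos)
  define C where "C = e1 * \<beta> / (4 * pi * M) * (\<beta>' / (L' + 2 * \<delta>))"
  have C: "C > 0" using e1 \<beta> M L'0 by (simp add: C_def)
  show ?thesis
  proof (rule that[OF C E])
    fix \<tau> :: real assume \<tau>: "\<tau> \<ge> 1"
    then have \<tau>0: "\<tau> \<ge> 0" by simp
    define \<kappa> where "\<kappa> = (1 + \<delta>) * \<tau>"
    have "\<delta> * \<tau> \<ge> 0" using \<delta> \<tau>0 by simp
    then have \<kappa>: "\<kappa> \<ge> \<tau>" "\<kappa> \<ge> 1" "\<kappa> \<ge> 0" using \<tau> by (auto simp: \<kappa>_def algebra_simps)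
    \<comment> \<open>Calibrated so that \<open>A * yuk\<close> stays below the free solution on the
      closure of \<open>D\<close>: the direct way from \<open>x\<close> to the source is at most the
      detour over \<open>x1\<close> to \<open>y0\<close>, up to \<open>2 * \<delta>\<close> for the
      piece \<open>A1\<close> and the regularisation.\<close>
    define A where "A = e1 * \<beta> / (4 * pi * M) * exp (- \<tau> * (L + 2 * \<delta>))"
    have A: "A > 0" using e1 \<beta> M by (simp add: A_def)
    define g where "g x = - A * yuk \<kappa> e1 (x - x1)" for x
    define g' where "g' x = (- A) *\<^sub>R yuk' \<kappa> e1 (x - x1)" for x
    have gC: "C1_grad g g'" unfolding g_def[abs_def] g'_def[abs_def]
      by (intro C1_grad_cmult C1_grad_shift yuk_C1 e1)
    have "(g \<longlongrightarrow> - A * 0) at_infinity" unfolding g_def[abs_def]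
      by (intro tendsto_mult tendsto_const yuk_at_infinity e1 \<kappa>)
    then have g0: "(g \<longlongrightarrow> 0) at_infinity" by simp
    have src: "ksrc \<kappa> e1 (x - x1) \<le> (\<kappa>\<^sup>2 - \<tau>\<^sup>2) * yuk \<kappa> e1 (x - x1)" if x: "x \<notin> D" for x
    proof -
      let ?s = "sreg e1 (x - x1)"
      have "r0 \<le> norm (x - x1)" using x r0(2) by (force simp: dist_norm norm_minus_commute)
      then have s: "r0 \<le> ?s" "0 < ?s" using sreg_ge(2)[of "x - x1" e1] r0(1) by auto
      have "ksrc \<kappa> e1 (x - x1) = (e1\<^sup>2 * (\<kappa>\<^sup>2 / ?s\<^sup>2 + 3 * \<kappa> / ?s^3 + 3 / ?s^4)) * yuk \<kappa> e1 (x - x1)"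
        using s(2) by (simp add: ksrc_def yuk_def field_simps eval_nat_numeral)
      also have "\<dots> \<le> (\<kappa>\<^sup>2 - \<tau>\<^sup>2) * yuk \<kappa> e1 (x - x1)"
      proof (intro mult_right_mono)
        have k2: "\<kappa> \<le> \<kappa>\<^sup>2" "1 \<le> \<kappa>\<^sup>2" using \<kappa> self_le_power[of \<kappa> 2] by (auto simp: one_le_power)
        have "\<kappa>\<^sup>2 / ?s\<^sup>2 + 3 * \<kappa> / ?s^3 + 3 / ?s^4 \<le> \<kappa>\<^sup>2 / r0\<^sup>2 + 3 * \<kappa>\<^sup>2 / r0^3 + 3 * \<kappa>\<^sup>2 / r0^4"
          using s r0(1) k2 \<kappa> by (intro add_mono frac_le power_mono) auto
        also have "\<dots> = \<kappa>\<^sup>2 * q0" by (simp add: q0_def algebra_simps)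
        finally have "e1\<^sup>2 * (\<kappa>\<^sup>2 / ?s\<^sup>2 + 3 * \<kappa> / ?s^3 + 3 / ?s^4) \<le> e1\<^sup>2 * (\<kappa>\<^sup>2 * q0)"
          by (intro mult_left_mono) auto
        also have "\<dots> = \<kappa>\<^sup>2 * (e1\<^sup>2 * q0)" by simp
        also have "\<dots> \<le> \<kappa>\<^sup>2 * w" using e1q by (intro mult_left_mono) auto
        also have "\<dots> = \<kappa>\<^sup>2 - \<tau>\<^sup>2" using \<delta> by (simp add: w_def \<kappa>_def right_diff_distrib power_mult_distrib)
        finally show "e1\<^sup>2 * (\<kappa>\<^sup>2 / ?s\<^sup>2 + 3 * \<kappa> / ?s^3 + 3 / ?s^4) \<le> \<kappa>\<^sup>2 - \<tau>\<^sup>2" .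
      qed (use yuk_pos[OF e1(1)] in \<open>auto simp: less_imp_le\<close>)
      finally show ?thesis .
    qed
    have sup: "0 \<le> (LBINT x. g' x \<bullet> \<phi>' x + \<tau>\<^sup>2 * g x * \<phi> x)"
      if \<phi>: "C1c (- closure D) \<phi> \<phi>'" and \<phi>0: "\<And>x. 0 \<le> \<phi> x" for \<phi> \<phi>'
    proof -
      obtain S where S: "compact S" "S \<subseteq> - closure D" "\<And>x. x \<notin> S \<Longrightarrow> \<phi> x = 0" "\<And>x. x \<notin> S \<Longrightarrow> \<phi>' x = 0"
        using C1c_support[OF \<phi>] by metis
      note cont = C1_grad_cont[OF C1_grad_shift[OF yuk_C1[OF e1(1)]]] C1_grad_cont[OF C1c_C1[OF \<phi>]]
      have i: "integrable lborel (\<lambda>x. yuk' \<kappa> e1 (x - x1) \<bullet> \<phi>' x + \<kappa>\<^sup>2 * yuk \<kappa> e1 (x - x1) * \<phi> x)"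
        using cont S by (intro integrable_continuous_compact_support[of _ S]) (auto intro!: continuous_intros)
      have iy: "integrable lborel (\<lambda>x. yuk \<kappa> e1 (x - x1) * \<phi> x)"
        using cont S by (intro integrable_continuous_compact_support[of _ S]) (auto intro!: continuous_intros)
      have sc: "continuous_on UNIV (sreg e1)" by (rule C1_grad_cont(1)[OF sreg_C1[OF e1(1)]])
      have kc: "continuous_on UNIV (ksrc \<kappa> e1)"
        unfolding ksrc_def[abs_def] using sreg_pos[OF e1(1)]
        by (intro continuous_intros sc) (auto simp: less_imp_neq[symmetric])
      have ik: "integrable lborel (\<lambda>x. ksrc \<kappa> e1 (x - x1) * \<phi> x)"
        using cont S by (intro integrable_continuous_compact_support[of _ S])
          (auto intro!: continuous_intros continuous_on_compose2[OF kc])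
      \<comment> \<open>The potential solves its equation with \<open>\<kappa>\<^sup>2\<close> in
        place of \<open>\<tau>\<^sup>2\<close>; the difference is split off to be weighed against
        \<open>ksrc\<close>.\<close>
      have "(LBINT x. g' x \<bullet> \<phi>' x + \<tau>\<^sup>2 * g x * \<phi> x) =
          (LBINT x. (- A) * (yuk' \<kappa> e1 (x - x1) \<bullet> \<phi>' x + \<kappa>\<^sup>2 * yuk \<kappa> e1 (x - x1) * \<phi> x)
            + A * (\<kappa>\<^sup>2 - \<tau>\<^sup>2) * (yuk \<kappa> e1 (x - x1) * \<phi> x))"
        by (intro Bochner_Integration.integral_cong refl) (simp add: g_def g'_def algebra_simps)
      also have "\<dots> = (- A) * (LBINT x. yuk' \<kappa> e1 (x - x1) \<bullet> \<phi>' x + \<kappa>\<^sup>2 * yuk \<kappa> e1 (x - x1) * \<phi> x)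
          + A * (\<kappa>\<^sup>2 - \<tau>\<^sup>2) * (LBINT x. yuk \<kappa> e1 (x - x1) * \<phi> x)"
        using Bochner_Integration.integral_add[OF integrable_mult_right[OF i, of "- A"] integrable_mult_right[OF iy, of "A * (\<kappa>\<^sup>2 - \<tau>\<^sup>2)"]]
        by (simp only: integral_mult_right_zero)
      also have "\<dots> = A * ((\<kappa>\<^sup>2 - \<tau>\<^sup>2) * (LBINT x. yuk \<kappa> e1 (x - x1) * \<phi> x) - (LBINT x. ksrc \<kappa> e1 (x - x1) * \<phi> x))"
        unfolding yuk_weak[OF e1(1) \<phi>] by (simp add: right_diff_distrib mult.assoc)
      also have "\<dots> \<ge> 0"
      proof (intro mult_nonneg_nonneg)
        have "(LBINT x. ksrc \<kappa> e1 (x - x1) * \<phi> x) \<le> (LBINT x. (\<kappa>\<^sup>2 - \<tau>\<^sup>2) * (yuk \<kappa> e1 (x - x1) * \<phi> x))"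
        proof (rule integral_mono[OF ik integrable_mult_right[OF iy]])
          fix x
          show "ksrc \<kappa> e1 (x - x1) * \<phi> x \<le> (\<kappa>\<^sup>2 - \<tau>\<^sup>2) * (yuk \<kappa> e1 (x - x1) * \<phi> x)"
          proof (cases "x \<in> S")
            case True
            then have "x \<notin> D" using S(2) closure_subset[of D] by auto
            from mult_right_mono[OF src[OF this] \<phi>0[of x]] show ?thesis by (simp add: mult.assoc)
          qed (simp add: S(3))
        qed
        then show "0 \<le> (\<kappa>\<^sup>2 - \<tau>\<^sup>2) * (LBINT x. yuk \<kappa> e1 (x - x1) * \<phi> x) - (LBINT x. ksrc \<kappa> e1 (x - x1) * \<phi> x)"
          by simp
      qed (use A in simp)
      finally show ?thesis .
    qed
    have pos: "0 \<le> 1 * yconv \<tau> e ?B x + g x" if e: "0 < e" "e < \<delta>" and x: "x \<in> closure D" for e x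
    proof -
      let ?N = "norm (x - x1)"
      have "A * yuk \<kappa> e1 (x - x1) \<le> A * (exp (- \<kappa> * ?N) / e1)"
        using A by (intro mult_left_mono yuk_le' e1 \<kappa>) auto
      \<comment> \<open>On the obstacle the larger mass helps: it makes the potential
        smaller.\<close>
      also have "\<dots> \<le> A * (exp (- \<tau> * ?N) / e1)"
        using A e1 \<kappa>(1) by (intro mult_left_mono divide_right_mono) (auto intro: mult_right_mono)
      also have "\<dots> = \<beta> * (exp (- \<tau> * (?N + L + 2 * \<delta>)) / M) / (4 * pi)"
      proof -
        have "exp (- \<tau> * (?N + L + 2 * \<delta>)) = exp (- \<tau> * (L + 2 * \<delta>)) * exp (- \<tau> * ?N)"
          by (simp add: algebra_simps flip: exp_add)
        then show ?thesis using e1 M by (simp add: A_def)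
      qed
      also have "\<dots> \<le> yconv \<tau> e ?B x"
        unfolding \<beta>_def
      proof (rule yconv_ge[OF e(1) \<tau>0 B A12(1,2)])
        fix z assume z: "z \<in> A1"
        have z1: "norm (z - p) < r" "norm (z - y0) < \<delta>" using z by (auto simp: A1_def dist_norm norm_minus_commute)
        have "norm (x - z) \<le> norm (x - x1) + norm (x1 - y0) + norm (z - y0)"
          using norm_triangle_ineq[of "x - x1" "x1 - z"] norm_triangle_ineq[of "x1 - y0" "y0 - z"]
          by (simp add: norm_minus_commute)
        then have n1: "norm (x - z) + e \<le> ?N + L + 2 * \<delta>" using z1(2) e by (simp add: L_def)
        have "norm (x - z) \<le> norm x + norm p + norm (z - p)"
          using norm_triangle_ineq4[of x z] norm_triangle_ineq[of p "z - p"] by simp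
        then have n2: "norm (x - z) + e \<le> M" using R[OF x] z1(1) e \<delta> by (simp add: M_def)
        show "exp (- \<tau> * (?N + L + 2 * \<delta>)) / M \<le> yuk \<tau> e (x - z)"
          by (rule yuk_ge[OF e(1) \<tau>0 n1 n2])
      qed
      finally show ?thesis by (simp add: g_def)
    qed
    have "- 1 * Ifun T u p r p' r' \<tau> \<le> (LBINT x. indicator ?B' x * g x) + E * exp (- \<tau> * T1)"
    proof (rule comp[OF \<tau>])
      show "barrier D ?B \<tau> 1 g g'"
        unfolding barrier_def using gC g0 sup pos \<delta>(1) by blast
    qed simp
    moreover have "C * exp (- \<tau> * (?m + \<delta> * (?m + 11))) \<le> - (LBINT x. indicator ?B' x * g x)"
    proof -
      \<comment> \<open>The constant 11 collects \<open>3 * \<delta>\<close> from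
        \<open>L + L'\<close>, \<open>4 * \<delta>\<close> from the two enlargements, and
        \<open>\<delta> * (?m + 4)\<close> from the larger mass on the second leg.\<close>
      have ex: "\<tau> * (L + 2 * \<delta>) + \<kappa> * (L' + 2 * \<delta>) \<le> \<tau> * (?m + \<delta> * (?m + 11))"
      proof -
        have "\<delta> * (L' + 2 * \<delta>) \<le> \<delta> * (?m + 4)" using LL(2) \<delta> by (intro mult_left_mono) auto
        then have "(L + 2 * \<delta>) + (1 + \<delta>) * (L' + 2 * \<delta>) \<le> ?m + \<delta> * (?m + 11)"
          using LL(1) by (simp add: algebra_simps)
        from mult_left_mono[OF this \<tau>0] show ?thesis by (simp add: \<kappa>_def algebra_simps)
      qed
      have "C * exp (- \<tau> * (?m + \<delta> * (?m + 11))) \<le> C * exp (- \<tau> * (L + 2 * \<delta>) + - \<kappa> * (L' + 2 * \<delta>))"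
        using C ex by (intro mult_left_mono) auto
      also have "\<dots> = A * (\<beta>' * (exp (- \<kappa> * (L' + 2 * \<delta>)) / (L' + 2 * \<delta>)))"
        unfolding exp_add by (simp add: C_def A_def)
      also have "\<dots> \<le> A * (LBINT x. indicator ?B' x * yuk \<kappa> e1 (x - x1))"
        unfolding \<beta>'_def
      proof (intro mult_left_mono)
        show "measure lborel A2 * (exp (- \<kappa> * (L' + 2 * \<delta>)) / (L' + 2 * \<delta>)) \<le> (LBINT x. indicator ?B' x * yuk \<kappa> e1 (x - x1))"
        proof (rule indicator_integral_ge[OF A12(3,5,4) yuk_indicator_integrable(2)[OF e1(1) \<kappa>(3) B']])
          show "0 \<le> yuk \<kappa> e1 (z - x1)" for z using yuk_pos[OF e1(1), of \<kappa> "z - x1"] by simp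
          fix z assume "z \<in> A2"
          then have "norm (z - y0') < \<delta>" by (simp add: A2_def dist_norm norm_minus_commute)
          then have n: "norm (z - x1) + e1 \<le> L' + 2 * \<delta>"
            using norm_triangle_ineq[of "z - y0'" "y0' - x1"] e1 by (simp add: L'_def norm_minus_commute)
          show "exp (- \<kappa> * (L' + 2 * \<delta>)) / (L' + 2 * \<delta>) \<le> yuk \<kappa> e1 (z - x1)"
            by (rule yuk_ge[OF e1(1) \<kappa>(3) n n])
        qed
      qed (use A in simp)
      also have "\<dots> = - (LBINT x. indicator ?B' x * g x)"
      proof -
        have "(LBINT x. indicator ?B' x * g x) = (LBINT x. (- A) * (indicator ?B' x * yuk \<kappa> e1 (x - x1)))"
          by (intro Bochner_Integration.integral_cong refl) (simp add: g_def)
        then show ?thesis by simp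
      qed
      finally show ?thesis .
    qed
    ultimately show "C * exp (- \<tau> * (?m + \<delta> * (?m + 11))) - E * exp (- \<tau> * T1) \<le> Ifun T u p r p' r' \<tau>"
      by simp
  qed
qed

section \<open>From exponential bounds to the logarithmic limit\<close>

theorem theorem1p1:
  fixes D :: "(real^3) set" and T :: real
    and p p' :: "real^3" and \<eta> \<eta>' :: real
    and u :: "(real^3) \<times> real \<Rightarrow> real"
  assumes "D \<noteq> {}" and "open D" and "bounded D" and "C2_boundary D"
    and "connected (- closure D)"
    and "T > 0"
    and "\<eta> > 0" and "\<eta>' > 0"
    and "closure (ball p \<eta>) \<inter> closure D = {}"
    and "closure (ball p' \<eta>') \<inter> closure D = {}"
    and "wave_weak_sol D T (indicator (ball p \<eta>)) u"
    and "convex hull (closure (ball p \<eta>) \<union> closure (ball p' \<eta>')) \<inter> frontier D = {}"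
    and "T > Inf {dist y x + dist x y' | x y y'.
                   x \<in> frontier D \<and> y \<in> sphere p \<eta> \<and> y' \<in> sphere p' \<eta>'}"
  shows "(\<exists>\<tau>0>0. \<forall>\<tau>\<ge>\<tau>0. Ifun T u p \<eta> p' \<eta>' \<tau> > 0) \<and>
         ((\<lambda>\<tau>. ln (Ifun T u p \<eta> p' \<eta>' \<tau>) / \<tau>)
          \<longlongrightarrow> - Inf {dist y x + dist x y' | x y y'.
                   x \<in> frontier D \<and> y \<in> sphere p \<eta> \<and> y' \<in> sphere p' \<eta>'}) at_top"
proof -
  define m where "m = path_inf D p \<eta> p' \<eta>'"
  define I where "I = Ifun T u p \<eta> p' \<eta>'"
  have m0: "0 \<le> m"
  proof -
    have "frontier D \<noteq> {}"
      using assms(1,3) frontier_not_empty[of D] not_bounded_UNIV by blast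
    moreover have "p + \<eta> *\<^sub>R axis 1 1 \<in> sphere p \<eta>" "p' + \<eta>' *\<^sub>R axis 1 1 \<in> sphere p' \<eta>'"
      using assms(7,8) by (auto simp: dist_norm norm_axis_1)
    ultimately have "{dist y x + dist x y' | x y y'. x \<in> frontier D \<and> y \<in> sphere p \<eta> \<and> y' \<in> sphere p' \<eta>'} \<noteq> {}"
      by blast
    then show ?thesis unfolding m_def path_inf_def by (intro cInf_greatest) auto
  qed
  have mT: "m < T" using assms(13) by (simp add: m_def path_inf_def)
  \<comment> \<open>Any time strictly between \<open>m\<close> and \<open>T\<close> would do: beyond
    \<open>m\<close> the errors are negligible, before \<open>T\<close> there is room for the
    cutoff.\<close>
  define T1 where "T1 = (m + T) / 2"
  have T1: "0 < T1" "T1 < T" "m < T1" using m0 mT assms(6) by (auto simp: T1_def)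
  have up: "\<forall>\<^sub>F \<tau> in at_top. I \<tau> \<le> exp (- \<tau> * (m - e))" if e: "e > 0" for e
  proof -
    \<comment> \<open>The upper bound loses \<open>3 * (e / 6) = e / 2\<close> in the exponent; the
      other half of \<open>e\<close> absorbs the constants.\<close>
    have e6: "e / 6 > 0" using e by simp
    obtain C E where CE: "C > 0" "E > 0"
      and b: "\<And>\<tau>. \<tau> \<ge> 1 \<Longrightarrow> I \<tau> \<le> C * exp (- \<tau> * (m - 3 * (e / 6))) + E * exp (- \<tau> * T1)"
      unfolding I_def m_def
      by (rule Ifun_upper[OF assms(2-4,7-11) T1(1,2) e6]) blast
    have "\<forall>\<^sub>F \<tau> in at_top. C + E \<le> exp (\<tau> * (e / 2))"
      using e by real_asymp
    then show ?thesis
      using eventually_ge_at_top[of 1]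
    proof eventually_elim
      case (elim \<tau>)
      have "E * exp (- \<tau> * T1) \<le> E * exp (- \<tau> * (m - e / 2))"
        using CE elim T1(3) e by (intro mult_left_mono) auto
      moreover have "C * exp (- \<tau> * (m - 3 * (e / 6))) = C * exp (- \<tau> * (m - e / 2))" by simp
      ultimately have "I \<tau> \<le> C * exp (- \<tau> * (m - e / 2)) + E * exp (- \<tau> * (m - e / 2))"
        using b[OF elim(2)] by linarith
      also have "\<dots> = (C + E) * exp (- \<tau> * (m - e / 2))" by (simp only: distrib_right)
      also have "\<dots> \<le> exp (\<tau> * (e / 2)) * exp (- \<tau> * (m - e / 2))"
        using elim by (intro mult_right_mono) auto
      also have "\<dots> = exp (- \<tau> * (m - e))" by (simp add: algebra_simps flip: exp_add)
      finally show ?case .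
    qed
  qed
  \<comment> \<open>The restriction \<open>m + e \<le> T1\<close> makes the error
    \<open>E * exp (- \<tau> * T1)\<close> at most
    \<open>E * exp (- \<tau> * (m + e))\<close>.\<close>
  have low: "\<forall>\<^sub>F \<tau> in at_top. exp (- \<tau> * (m + e)) \<le> I \<tau>" if e: "e > 0" "m + e \<le> T1" for e
  proof -
    \<comment> \<open>Chosen so that the loss \<open>\<delta> * (m + 11)\<close> of the lower bound
      is at most \<open>e / 2\<close>; the cap 1/2 ensures \<open>\<delta> < 1\<close>.\<close>
    define \<delta> where "\<delta> = min (1/2) (e / (2 * (m + 11)))"
    have \<delta>: "0 < \<delta>" "\<delta> < 1" using e m0 by (auto simp: \<delta>_def)
    have "\<delta> * (m + 11) \<le> e / (2 * (m + 11)) * (m + 11)" using m0 by (intro mult_right_mono) (auto simp: \<delta>_def)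
    also have "\<dots> = e / 2" using m0 by (simp add: field_simps)
    finally have \<delta>e: "\<delta> * (m + 11) \<le> e / 2" .
    obtain C E where CE: "C > 0" "E > 0"
      and b: "\<And>\<tau>. \<tau> \<ge> 1 \<Longrightarrow> C * exp (- \<tau> * (m + \<delta> * (m + 11))) - E * exp (- \<tau> * T1) \<le> I \<tau>"
      unfolding I_def m_def
      by (rule Ifun_lower[OF assms(2-4,1,7,8,11) T1(1,2) \<delta>]) blast
    have "\<forall>\<^sub>F \<tau> in at_top. 1 + E \<le> C * exp (\<tau> * (e / 2))"
      using e CE by real_asymp
    then show ?thesis
      using eventually_ge_at_top[of 1]
    proof eventually_elim
      case (elim \<tau>)
      have "E * exp (- \<tau> * T1) \<le> E * exp (- \<tau> * (m + e))"
        using CE elim e by (intro mult_left_mono) auto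
      moreover have "(1 + E) * exp (- \<tau> * (m + e)) \<le> (C * exp (\<tau> * (e / 2))) * exp (- \<tau> * (m + e))"
        using elim by (intro mult_right_mono) auto
      moreover have "(C * exp (\<tau> * (e / 2))) * exp (- \<tau> * (m + e)) = C * exp (- \<tau> * (m + e / 2))"
        by (simp add: algebra_simps flip: exp_add)
      moreover have "C * exp (- \<tau> * (m + e / 2)) \<le> C * exp (- \<tau> * (m + \<delta> * (m + 11)))"
        using CE elim \<delta>e by (intro mult_left_mono) auto
      ultimately show ?case using b[OF elim(2)] unfolding distrib_right mult_1 by linarith
    qed
  qed
  \<comment> \<open>For positivity a single admissible \<open>e\<close> is enough, and
    \<open>T1 - m\<close> is the largest one.\<close>
  have "\<forall>\<^sub>F \<tau> in at_top. exp (- \<tau> * (m + (T1 - m))) \<le> I \<tau>" using T1 by (intro low) auto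
  then obtain N where N: "\<And>\<tau>. \<tau> \<ge> N \<Longrightarrow> exp (- \<tau> * (m + (T1 - m))) \<le> I \<tau>"
    by (auto simp: eventually_at_top_linorder)
  have "\<forall>\<tau>\<ge>max 1 N. I \<tau> > 0"
    using N by (meson exp_gt_zero less_le_trans max.boundedE)
  then have pos: "\<exists>\<tau>0>0. \<forall>\<tau>\<ge>\<tau>0. I \<tau> > 0" by (intro exI[of _ "max 1 N"]) auto
  have lim: "((\<lambda>\<tau>. ln (I \<tau>) / \<tau>) \<longlongrightarrow> - m) at_top"
  proof (rule tendstoI)
    fix e0 :: real assume e0: "e0 > 0"
    \<comment> \<open>The half makes the final estimate strict; the second entry keeps
      \<open>e\<close> in the range of \<open>low\<close>.\<close>
    define e where "e = min (e0 / 2) (T1 - m)"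
    have e: "e > 0" "m + e \<le> T1" "e < e0" using e0 T1 by (auto simp: e_def)
    show "\<forall>\<^sub>F \<tau> in at_top. dist (ln (I \<tau>) / \<tau>) (- m) < e0"
      using up[OF e(1)] low[OF e(1,2)] eventually_ge_at_top[of 1]
    proof eventually_elim
      case (elim \<tau>)
      have I0: "I \<tau> > 0" using elim(2) by (meson exp_gt_zero less_le_trans)
      have "ln (I \<tau>) \<le> - \<tau> * (m - e)" using ln_le_cancel_iff[OF I0 exp_gt_zero] elim(1) by (metis ln_exp)
      moreover have "- \<tau> * (m + e) \<le> ln (I \<tau>)" using ln_le_cancel_iff[OF exp_gt_zero I0] elim(2) by (metis ln_exp)
      ultimately have "ln (I \<tau>) / \<tau> \<le> - (m - e)" "- (m + e) \<le> ln (I \<tau>) / \<tau>"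
        using elim(3) pos_divide_le_eq[of \<tau> "ln (I \<tau>)" "- (m - e)"] pos_le_divide_eq[of \<tau> "- (m + e)" "ln (I \<tau>)"]
        by (simp_all add: algebra_simps)
      then have "\<bar>ln (I \<tau>) / \<tau> - (- m)\<bar> \<le> e" by linarith
      then show ?case using e(3) by (simp add: dist_real_def)
    qed
  qed
  show ?thesis
    using pos lim unfolding I_def m_def path_inf_def by blast
qed

end
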